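(* Assume that $\sigma:\mathbb R\to\mathbb R$ is bounded and globally Lipschitz continuous with $\sigma(x)\ne0$ for all $x\in\mathbb R$, and that $u_0\in\mathbf C^3(\mathcal O;\mathbb R)$ with $u_0'(0)=u_0'(\pi)=0$. Let $\bar x\in\mathcal O$ be fixed and, for $y\in\mathbb R$ and $n\in\mathbb N^+$, set $$I(y)=\inf\Big\{\tfrac12\|h\|^2_{\mathbf L^2(\mathcal O_T)}:\ h\in\mathbf L^2(\mathcal O_T;\mathbb R),\ \Upsilon(h)(T,\bar x)=y\Big\},\qquad I^n(y)=\inf\Big\{\tfrac12\|h\|^2_{\mathbf L^2(\mathcal O_T)}:\ h\in\mathbf L^2(\mathcal O_T;\mathbb R),\ \Upsilon^n(h)(T,\bar x)=y\Big\}$$ (values in $[0,+\infty]$). Then $$\lim_{n\to+\infty}I^n(y)=I(y)\qquad\text{for every }y\in\mathbb R.$$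
   Context: $T>0$ is fixed, $\mathcal O=[0,\pi]$, $\mathcal O_T=[0,T]\times\mathcal O$, $b(x)=x^3-x$. The infimum of the empty set is $+\infty$. Let $\phi_0=\sqrt{1/\pi}$, $\phi_j(x)=\sqrt{2/\pi}\cos(jx)$ for $j\ge1$, $\lambda_j=-j^2$, $G_t(x,y)=\sum_{j=0}^\infty e^{-\lambda_j^2t}\phi_j(x)\phi_j(y)$ and $\Delta G_t(x,y)=\sum_{j=0}^\infty\lambda_je^{-\lambda_j^2t}\phi_j(x)\phi_j(y)$. For $h\in\mathbf L^2(\mathcal O_T;\mathbb R)$, $\Upsilon(h)=f$ is the unique solution in $\mathbf C(\mathcal O_T;\mathbb R)$ of the skeleton equation $$f(t,x)=\int_{\mathcal O}G_t(x,z)u_0(z)\,dz+\int_0^t\int_{\mathcal O}\Delta G_{t-s}(x,z)b(f(s,z))\,dz\,ds+\int_0^t\int_{\mathcal O}G_{t-s}(x,z)\sigma(f(s,z))h(s,z)\,dz\,ds.$$ For $n\in\mathbb N^+$ let $x_k=\frac{2k-1}{2n}\pi$, $k=1,\dots,n$, and $\kappa_n(x)=(2\lfloor xn/\pi\rfloor+1)\frac{\pi}{2n}$ for $x\in[0,\pi)$, $\kappa_n(\pi)=x_n$. For $w:\mathcal O\to\mathbb R$, $\Pi_n(w)$ is the continuous function equal to $w(x_1)$ on $[0,x_1]$, to $w(x_k)+\frac n\pi(w(x_{k+1})-w(x_k))(x-x_k)$ on $[x_k,x_{k+1}]$ ($1\le k\le n-1$), and to $w(x_n)$ on $[x_n,\pi]$.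 Let $\phi_{j,n}=\Pi_n(\phi_j)$, $\lambda_{j,n}=-\frac{4n^2}{\pi^2}\sin^2\big(\frac{j\pi}{2n}\big)$, $G^n_t(x,y)=\sum_{j=0}^{n-1}e^{-\lambda_{j,n}^2t}\phi_{j,n}(x)\phi_j(\kappa_n(y))$ and $\Delta_{n,y}G^n_t(x,y)=\sum_{j=0}^{n-1}\lambda_{j,n}e^{-\lambda_{j,n}^2t}\phi_{j,n}(x)\phi_j(\kappa_n(y))$. For $h\in\mathbf L^2(\mathcal O_T;\mathbb R)$, $\Upsilon^n(h)=f$ is the unique solution in $\mathbf C(\mathcal O_T;\mathbb R)$ of $$f(t,x)=\int_{\mathcal O}G^n_t(x,y)u_0(\kappa_n(y))\,dy+\int_0^t\int_{\mathcal O}\Delta_{n,y}G^n_{t-s}(x,y)b(f(s,\kappa_n(y)))\,dy\,ds+\int_0^t\int_{\mathcal O}G^n_{t-s}(x,y)\sigma(f(s,\kappa_n(y)))h(s,y)\,dy\,ds.$$ ($I$ and $I^n$ are the one-point large deviations rate functions, as the noise intensity tends to $0$, at $(T,\bar x)$ of the stochastic Cahn--Hilliard equation $\partial_tu^\varepsilon+\Delta^2u^\varepsilon=\Delta b(u^\varepsilon)+\sqrt\varepsilon\sigma(u^\varepsilon)\dot W$ with Neumann boundary conditions and of its spatial finite difference discretization.) *)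

theory Defs
  imports "HOL-Analysis.Analysis"
begin

primrec Ck_on :: "nat \<Rightarrow> real set \<Rightarrow> (real \<Rightarrow> real) \<Rightarrow> bool" where
  "Ck_on 0 S f \<longleftrightarrow> continuous_on S f"
| "Ck_on (Suc k) S f \<longleftrightarrow>
     (\<exists>f'. (\<forall>x\<in>S. (f has_real_derivative f' x) (at x within S)) \<and> Ck_on k S f')"

definition domO :: "real set" where
  "domO = {0..pi}"

definition domOT :: "real \<Rightarrow> (real \<times> real) set" where
  "domOT T = {0..T} \<times> domO"

text \<open>Square integrable functions on the space-time domain, by Borel measurable
  representatives (every class has one); values off the domain are irrelevant.\<close>

definition L2_OT :: "real \<Rightarrow> (real \<times> real \<Rightarrow> real) set" where
  "L2_OT T = {h. set_borel_measurable lborel (domOT T) h \<and>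
                 set_integrable lborel (domOT T) (\<lambda>p. (h p)\<^sup>2)}"

definition L2_norm_OT :: "real \<Rightarrow> (real \<times> real \<Rightarrow> real) \<Rightarrow> real" where
  "L2_norm_OT T h = sqrt (LBINT p:domOT T. (h p)\<^sup>2)"

definition bfun :: "real \<Rightarrow> real" where
  "bfun x = x ^ 3 - x"

definition phi :: "nat \<Rightarrow> real \<Rightarrow> real" where
  "phi j x = (if j = 0 then sqrt (1 / pi) else sqrt (2 / pi) * cos (real j * x))"

definition lam :: "nat \<Rightarrow> real" where
  "lam j = - (real j)\<^sup>2"

definition green :: "real \<Rightarrow> real \<Rightarrow> real \<Rightarrow> real" where
  "green t x y = (\<Sum>j. exp (- (lam j)\<^sup>2 * t) * phi j x * phi j y)"

definition lap_green :: "real \<Rightarrow> real \<Rightarrow> real \<Rightarrow> real" where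
  "lap_green t x y = (\<Sum>j. lam j * exp (- (lam j)\<^sup>2 * t) * phi j x * phi j y)"

text \<open>At time \<open>t = 0\<close> the series for the Green function diverges; the first term of the equation
  is then read as the identity semigroup applied to \<open>u0\<close>, i.e. the initial condition. The
  integrands below are likewise only meaningful for \<open>s < t\<close>, i.e. for almost every \<open>s\<close> in \<open>{0..t}\<close>.\<close>

definition solves_skeleton ::
  "real \<Rightarrow> (real \<Rightarrow> real) \<Rightarrow> (real \<Rightarrow> real) \<Rightarrow> (real \<times> real \<Rightarrow> real) \<Rightarrow> (real \<times> real \<Rightarrow> real) \<Rightarrow> bool"
where
  "solves_skeleton T \<sigma> u0 h f \<longleftrightarrow>
     continuous_on (domOT T) f \<and>
     (\<forall>x\<in>domO. f (0, x) = u0 x) \<and>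
     (\<forall>t\<in>{0<..T}. \<forall>x\<in>domO.
        f (t, x) =
          (LBINT z:domO. green t x z * u0 z)
        + (LBINT s:{0..t}. (LBINT z:domO. lap_green (t - s) x z * bfun (f (s, z))))
        + (LBINT s:{0..t}. (LBINT z:domO. green (t - s) x z * \<sigma> (f (s, z)) * h (s, z))))"

text \<open>Elements of \<open>C(O_T)\<close> are represented by functions that are \<open>undefined\<close> off the domain, so
  that uniqueness on the domain is uniqueness of the HOL function.\<close>

definition Upsilon ::
  "real \<Rightarrow> (real \<Rightarrow> real) \<Rightarrow> (real \<Rightarrow> real) \<Rightarrow> (real \<times> real \<Rightarrow> real) \<Rightarrow> real \<times> real \<Rightarrow> real"
where
  "Upsilon T \<sigma> u0 h = (THE f. f \<in> extensional (domOT T) \<and> solves_skeleton T \<sigma> u0 h f)"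

definition node :: "nat \<Rightarrow> nat \<Rightarrow> real" where
  "node n k = (2 * real k - 1) / (2 * real n) * pi"

definition kappa :: "nat \<Rightarrow> real \<Rightarrow> real" where
  "kappa n x = (if x = pi then node n n
                else (2 * of_int \<lfloor>x * real n / pi\<rfloor> + 1) * (pi / (2 * real n)))"

text \<open>Piecewise linear interpolation; the floor selects the \<open>k\<close> with
  \<open>node n k \<le> x < node n (k + 1)\<close>, cf. lemma \<open>interp_between\<close>.\<close>

definition interp :: "nat \<Rightarrow> (real \<Rightarrow> real) \<Rightarrow> real \<Rightarrow> real" where
  "interp n w x =
     (if x \<le> node n 1 then w (node n 1)
      else if node n n \<le> x then w (node n n)
      else let k = nat \<lfloor>x * real n / pi + 1 / 2\<rfloor>
           in w (node n k) + real n / pi * (w (node n (k + 1)) - w (node n k)) * (x - node n k))"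

lemma interp_between:
  assumes "1 \<le> k" "k < n" "x \<in> {node n k..node n (k + 1)}"
  shows "interp n w x =
    w (node n k) + real n / pi * (w (node n (k + 1)) - w (node n k)) * (x - node n k)"
proof -
  have n: "real n > 0" using assms by simp
  have le: "node n i \<le> node n j \<longleftrightarrow> i \<le> j" for i j
    using n by (simp add: node_def field_simps)
  have step: "real n / pi * (node n (Suc i) - node n i) = 1" for i
    using n by (simp add: node_def field_simps)
  have fl: "nat \<lfloor>x * real n / pi + 1 / 2\<rfloor> = i" if "node n i \<le> x" "x < node n (i + 1)" for i
  proof -
    have "real i \<le> x * real n / pi + 1 / 2" "x * real n / pi + 1 / 2 < real i + 1"
      using that n by (simp_all add: node_def field_simps)
    then have "\<lfloor>x * real n / pi + 1 / 2\<rfloor> = int i" by (intro floor_unique) auto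
    then show ?thesis by simp
  qed
  have end_val: "w (node n k) + real n / pi * (w (node n (k + 1)) - w (node n k))
        * (node n (k + 1) - node n k) = w (node n (k + 1))"
    using step[of k] by (simp add: mult.assoc mult.left_commute[of _ "w _ - w _"]) 
  consider "x = node n k" | "node n k < x" "x < node n (k + 1)" | "x = node n (k + 1)"
    using assms(3) by force
  then show ?thesis
  proof cases
    case 1
    show ?thesis
    proof (cases "k = 1")
      case True then show ?thesis using 1 by (simp add: interp_def)
    next
      case False
      have "x < node n (k + 1)" using 1 le[of "k + 1" k] by simp
      then have "nat \<lfloor>x * real n / pi + 1 / 2\<rfloor> = k" using 1 by (intro fl) auto
      then show ?thesis using False assms 1 le[of k 1] le[of n k]
        by (simp add: interp_def Let_def)
    qed
  next
    case 2
    have "\<not> x \<le> node n 1" "\<not> node n n \<le> x"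
      using 2 le[of 1 k] le[of "k + 1" n] assms by auto
    then show ?thesis using fl[of k] 2 by (simp add: interp_def Let_def)
  next
    case 3
    have "interp n w x = w (node n (k + 1))"
    proof (cases "k + 1 = n")
      case True then show ?thesis using 3 le[of n 1] assms by (auto simp: interp_def)
    next
      case False
      have "x < node n (k + 1 + 1)" using 3 le[of "k + 1 + 1" "k + 1"] by simp
      then have "nat \<lfloor>x * real n / pi + 1 / 2\<rfloor> = k + 1" using 3 by (intro fl) auto
      then show ?thesis using False assms 3 le[of "k + 1" 1] le[of n "k + 1"]
        by (simp add: interp_def Let_def)
    qed
    then show ?thesis using end_val 3 by simp
  qed
qed

definition phi_n :: "nat \<Rightarrow> nat \<Rightarrow> real \<Rightarrow> real" where
  "phi_n n j = interp n (phi j)"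

definition lam_n :: "nat \<Rightarrow> nat \<Rightarrow> real" where
  "lam_n n j = - (4 * (real n)\<^sup>2 / pi\<^sup>2) * (sin (real j * pi / (2 * real n)))\<^sup>2"

definition green_n :: "nat \<Rightarrow> real \<Rightarrow> real \<Rightarrow> real \<Rightarrow> real" where
  "green_n n t x y =
     (\<Sum>j<n. exp (- (lam_n n j)\<^sup>2 * t) * phi_n n j x * phi j (kappa n y))"

definition lap_green_n :: "nat \<Rightarrow> real \<Rightarrow> real \<Rightarrow> real \<Rightarrow> real" where
  "lap_green_n n t x y =
     (\<Sum>j<n. lam_n n j * exp (- (lam_n n j)\<^sup>2 * t) * phi_n n j x * phi j (kappa n y))"

definition solves_skeleton_n ::
  "nat \<Rightarrow> real \<Rightarrow> (real \<Rightarrow> real) \<Rightarrow> (real \<Rightarrow> real) \<Rightarrow> (real \<times> real \<Rightarrow> real) \<Rightarrow> (real \<times> real \<Rightarrow> real) \<Rightarrow> bool"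
where
  "solves_skeleton_n n T \<sigma> u0 h f \<longleftrightarrow>
     continuous_on (domOT T) f \<and>
     (\<forall>t\<in>{0..T}. \<forall>x\<in>domO.
        f (t, x) =
          (LBINT y:domO. green_n n t x y * u0 (kappa n y))
        + (LBINT s:{0..t}. (LBINT y:domO. lap_green_n n (t - s) x y * bfun (f (s, kappa n y))))
        + (LBINT s:{0..t}. (LBINT y:domO.
             green_n n (t - s) x y * \<sigma> (f (s, kappa n y)) * h (s, y))))"

definition Upsilon_n ::
  "nat \<Rightarrow> real \<Rightarrow> (real \<Rightarrow> real) \<Rightarrow> (real \<Rightarrow> real) \<Rightarrow> (real \<times> real \<Rightarrow> real) \<Rightarrow> real \<times> real \<Rightarrow> real"
where
  "Upsilon_n n T \<sigma> u0 h = (THE f. f \<in> extensional (domOT T) \<and> solves_skeleton_n n T \<sigma> u0 h f)"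

text \<open>In \<^typ>\<open>ereal\<close> the infimum of the empty set is \<open>\<infinity>\<close>.\<close>

definition rate ::
  "real \<Rightarrow> (real \<Rightarrow> real) \<Rightarrow> (real \<Rightarrow> real) \<Rightarrow> real \<Rightarrow> real \<Rightarrow> ereal"
where
  "rate T \<sigma> u0 xbar y =
     Inf {ereal (1 / 2 * (L2_norm_OT T h)\<^sup>2) | h. h \<in> L2_OT T \<and> Upsilon T \<sigma> u0 h (T, xbar) = y}"

definition rate_n ::
  "nat \<Rightarrow> real \<Rightarrow> (real \<Rightarrow> real) \<Rightarrow> (real \<Rightarrow> real) \<Rightarrow> real \<Rightarrow> real \<Rightarrow> ereal"
where
  "rate_n n T \<sigma> u0 xbar y =
     Inf {ereal (1 / 2 * (L2_norm_OT T h)\<^sup>2) | h. h \<in> L2_OT T \<and> Upsilon_n n T \<sigma> u0 h (T, xbar) = y}"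

end

theory Submission
  imports Defs
begin

text \<open>Both skeleton equations are written in modes: with \<open>\<mu>\<close> the negative of the eigenvalue, each
  cosine coefficient is driven by the projected source through the factor \<open>exp (- \<mu>\<^sup>2 (t - s))\<close>.
  Since \<open>\<mu>\<close> is at least \<open>j\<^sup>2 / 3\<close>, the \<open>j\<close>-th coefficient is \<open>O(1 / j\<^sup>2)\<close> uniformly in the mesh and in
  controls of bounded norm, so crude termwise bounds suffice: a weight \<open>exp (\<beta> t)\<close> turns the solution
  map of a globally Lipschitz equation into a contraction, and Tannery's theorem gives convergence of
  the discrete solutions, uniformly over bounded sets of controls. Truncation of \<open>b\<close> is removed by
  dissipation of the discrete free energy, which bounds the solutions in sup norm independently of
  the mesh and of the truncation; the bound for the continuum equation is its limit. As \<open>\<sigma>\<close> does not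
  vanish, a control can be modified near the final time, at small cost and uniformly in the mesh, so
  as to move the terminal value by any small amount. Hence almost optimal controls can be
  transferred between the two equations in both directions.\<close>

subsection \<open>Grid, interpolation and discrete frequencies\<close>

text \<open>No weak compactness and no attained minimizer enters: convergence and the correction of
  the terminal value are both uniform over energy balls, so any almost optimal control of one
  equation can be fed into the other. The price is that constants must not depend on
  \<open>n\<close>, which is why one indexed family covers both equations. The obstacle is the sup
  bound. The free energy is differentiated along an ordinary differential equation, on a fixed mesh
  and for a forcing continuous in time, whereas \<open>\<sigma> (f) h\<close> is only square
  integrable. Hence \<sigma> is absorbed into the forcing, whose energy is at most
  \<open>K\<^sup>2 M\<close>; this forcing is approximated by continuous ones, and stability carries
  the bound back. The same absorption makes the terminal value controllable: the additive forcing is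
  perturbed, then divided by \<sigma> along the perturbed solution. The quotient is a control with
  exactly this solution, so no second fixed point problem arises. Energy controls the sup norm
  because \<open>1 / j\<^sup>2\<close> is summable, a one-dimensional fact on which the termwise
  bounds rest as well.\<close>

text \<open>In every indexed family below the index \<open>n = 0\<close> stands for the continuum equation and \<open>n > 0\<close>
  for the discretization with \<open>n\<close> nodes. Frequencies with \<open>j \<ge> n > 0\<close> are dummies: their trial function
  is \<open>0\<close>.\<close>

definition freq :: "nat \<Rightarrow> nat \<Rightarrow> real" where
  "freq n j = (if n = 0 \<or> n \<le> j then (real j)\<^sup>2 else - lam_n n j)"

definition trial :: "nat \<Rightarrow> nat \<Rightarrow> real \<Rightarrow> real" where
  "trial n j x = (if n = 0 then phi j x else if j < n then phi_n n j x else 0)"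

definition samp :: "nat \<Rightarrow> real \<Rightarrow> real" where
  "samp n y = (if n = 0 then y else kappa n y)"

lemma abs_phi_le: "\<bar>phi j x\<bar> \<le> 1"
proof -
  have "sqrt (1 / pi) \<le> 1" "sqrt (2 / pi) \<le> 1" using pi_ge_two by (auto simp: field_simps)
  moreover have "\<bar>sqrt (2 / pi) * cos (real j * x)\<bar> \<le> sqrt (2 / pi) * 1"
    unfolding abs_mult by (intro mult_mono) auto
  ultimately show ?thesis unfolding phi_def by (cases "j = 0") (simp_all add: order.trans)
qed

lemma phi_lipschitz: "\<bar>phi j x - phi j y\<bar> \<le> real j * \<bar>x - y\<bar>"
proof (cases "j = 0")
  case False
  have "sqrt (2 / pi) \<le> 1" using pi_ge_two by (auto simp: field_simps)
  moreover have "\<bar>cos (real j * x) - cos (real j * y)\<bar> \<le> \<bar>real j * x - real j * y\<bar>"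
  proof -
    have "\<bar>cos b - cos a\<bar> \<le> b - a" if "a \<le> b" for a b :: real
    proof (cases "a = b")
      case False
      then have "a < b" using that by simp
      then obtain z where "cos b - cos a = (b - a) * (- sin z)"
        using MVT2[of a b cos "\<lambda>x. - sin x"] DERIV_cos by blast
      then show ?thesis using that by (auto simp: abs_mult intro!: mult_left_le)
    qed auto
    from this[of "real j * x" "real j * y"] this[of "real j * y" "real j * x"] show ?thesis
      by (cases "real j * x \<le> real j * y") auto
  qed
  then have "\<bar>sqrt (2 / pi)\<bar> * \<bar>cos (real j * x) - cos (real j * y)\<bar> \<le> 1 * \<bar>real j * x - real j * y\<bar>"
    using calculation by (intro mult_mono) auto
  moreover have "\<bar>real j * x - real j * y\<bar> = real j * \<bar>x - y\<bar>"
    by (simp add: abs_mult flip: right_diff_distrib)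
  ultimately show ?thesis using False by (simp add: phi_def abs_mult flip: right_diff_distrib)
qed (simp add: phi_def)

lemma continuous_on_phi [continuous_intros]:
  "continuous_on S f \<Longrightarrow> continuous_on S (\<lambda>x. phi j (f x))"
  by (rule continuous_on_compose2[of UNIV "phi j"]) (cases "j = 0"; auto simp: phi_def intro!: continuous_intros)+

lemma measurable_phi [measurable]: "phi j \<in> borel_measurable borel"
  by (intro borel_measurable_continuous_onI continuous_on_phi continuous_on_id)

lemma node_mono: "0 < n \<Longrightarrow> node n i \<le> node n j \<longleftrightarrow> i \<le> j"
  by (simp add: node_def field_simps)

lemma node_Suc: "0 < n \<Longrightarrow> node n (Suc k) = node n k + pi / real n"
  by (simp add: node_def field_simps)

lemma node_in_domO: "1 \<le> k \<Longrightarrow> k \<le> n \<Longrightarrow> node n k \<in> domO"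
  using mult_left_mono[of "real k * 2" "1 + real n * 2" pi]
  by (auto simp: node_def domO_def field_simps)

lemma kappa_cell:
  assumes "1 \<le> k" "k \<le> n" "real (k - 1) * pi / real n \<le> y" "y < real k * pi / real n"
  shows "kappa n y = node n k"
proof -
  have n: "0 < real n" using assms by simp
  have "real k * pi / real n \<le> pi" using assms n by (simp add: field_simps)
  then have "y < pi" using assms by linarith
  moreover have "\<lfloor>y * real n / pi\<rfloor> = int (k - 1)"
    using assms n by (intro floor_unique) (auto simp: field_simps)
  then have "real_of_int \<lfloor>y * real n / pi\<rfloor> = real k - 1" using assms(1) by simp
  ultimately show ?thesis by (simp add: kappa_def node_def)
qed

lemma kappa_exists:
  assumes "0 < n" "y \<in> domO"
  obtains k where "1 \<le> k" "k \<le> n" "kappa n y = node n k" "\<bar>node n k - y\<bar> \<le> pi / real n"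
proof (cases "y = pi")
  \<comment> \<open>At the right end the floor would select cell \<open>n + 1\<close>, which does
    not exist; the separate value of \<open>kappa\<close> there picks the last node.\<close>
  case True
  then show ?thesis using that[of n] assms by (auto simp: kappa_def node_def field_simps)
next
  case False
  define m where "m = nat \<lfloor>y * real n / pi\<rfloor>"
  have y: "0 \<le> y" "y < pi" using False assms by (auto simp: domO_def)
  have m: "real m = of_int \<lfloor>y * real n / pi\<rfloor>" using y by (simp add: m_def)
  have m1: "real m \<le> y * real n / pi" "y * real n / pi < real m + 1" using m by linarith+
  have "y * real n / pi < real n" using y assms by (simp add: field_simps)
  then have mn: "m < n" using m1 by linarith
  have n: "0 < real n" using assms by simp
  have b: "real m * pi / real n \<le> y" "y < (real m + 1) * pi / real n"
    using m1 n by (auto simp: field_simps)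
  have eq: "kappa n y = node n (Suc m)"
    using b mn by (intro kappa_cell) (auto simp: add.commute)
  have "node n (Suc m) = real m * pi / real n + pi / (2 * real n)"
    "node n (Suc m) = (real m + 1) * pi / real n - pi / (2 * real n)"
    using n by (auto simp: node_def field_simps)
  moreover have "pi / (2 * real n) \<le> pi / real n" using n by (simp add: field_simps)
  moreover have "0 < pi / (2 * real n)" using n by simp
  ultimately have "\<bar>node n (Suc m) - y\<bar> \<le> pi / real n" using b by argo
  then show ?thesis using that[of "Suc m"] mn eq by auto
qed

lemma samp_in_domO: "y \<in> domO \<Longrightarrow> samp n y \<in> domO"
  by (cases "n = 0") (auto simp: samp_def node_in_domO elim!: kappa_exists[of n y])

lemma samp_close:
  assumes "0 < n" "y \<in> domO" shows "\<bar>samp n y - y\<bar> \<le> pi / real n"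
  by (rule kappa_exists[OF assms]) (use assms in \<open>simp add: samp_def\<close>)

lemma measurable_samp [measurable]: "samp n \<in> borel_measurable borel"
  unfolding samp_def kappa_def by measurable

text \<open>The weights do not depend on \<open>w\<close>. Hence bounds, approximation errors and
  linearity of interpolation all reduce to the values at two nearby nodes, and the floor need not be
  unfolded again for them.\<close>

lemma interp_convex:
  assumes "0 < n" "x \<in> domO"
  obtains k l s where "1 \<le> k" "k \<le> n" "1 \<le> l" "l \<le> n" "0 \<le> s" "s \<le> (1::real)"
    "\<bar>node n k - x\<bar> \<le> pi / real n" "\<bar>node n l - x\<bar> \<le> pi / real n"
    "\<And>w. interp n w x = (1 - s) * w (node n k) + s * w (node n l)"
proof -
  have n: "0 < real n" using assms by simp
  have n2: "pi / (2 * real n) \<le> pi / real n" "0 < pi / (2 * real n)" using n by (simp_all add: field_simps)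
  have x: "0 \<le> x" "x \<le> pi" using assms by (auto simp: domO_def)
  have n1: "node n 1 = pi / (2 * real n)" and nn: "node n n = pi - pi / (2 * real n)"
    using n by (auto simp: node_def field_simps)
  consider "x \<le> node n 1" | "node n n \<le> x" "\<not> x \<le> node n 1" | "node n 1 < x" "x < node n n" by linarith
  then show ?thesis
  proof cases
    case 1
    then show ?thesis using that[of 1 1 0] assms x n2 n1 by (simp add: interp_def)
  next
    case 2
    then show ?thesis using that[of n n 0] assms x n2 nn by (simp add: interp_def)
  next
    case 3
    define k where "k = nat \<lfloor>x * real n / pi + 1 / 2\<rfloor>"
    have "0 \<le> x * real n / pi" using x n by simp
    then have k: "real k \<le> x * real n / pi + 1/2" "x * real n / pi + 1/2 < real k + 1"
      unfolding k_def by linarith+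
    have xk: "node n k \<le> x" "x < node n (k+1)"
      using k n by (auto simp: node_def field_simps)
    have "1 < k + 1" using node_mono[OF assms(1), of "k+1" 1] xk 3 by linarith
    moreover have "k < n" using node_mono[OF assms(1), of n k] xk 3 by linarith
    ultimately have kn: "1 \<le> k" "k < n" by auto
    have st: "node n (k+1) = node n k + pi / real n" using node_Suc[OF assms(1), of k] by simp
    define s where "s = real n / pi * (x - node n k)"
    have "0 \<le> s" using xk n by (simp add: s_def)
    moreover have "s \<le> real n / pi * (pi / real n)"
      unfolding s_def using xk st n by (intro mult_left_mono) auto
    then have "s \<le> 1" using n by simp
    moreover have "interp n w x = (1 - s) * w (node n k) + s * w (node n (k+1))" for w
    proof -
      have "interp n w x = w (node n k) + (w (node n (k+1)) - w (node n k)) * s"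
        using interp_between[OF kn, of x w] xk by (simp add: s_def)
      then show ?thesis by (simp add: algebra_simps)
    qed
    ultimately show ?thesis using that[of k "k+1" s] kn xk st by auto
  qed
qed

lemma abs_interp_le:
  assumes "0 < n" "x \<in> domO" "\<And>k. 1 \<le> k \<Longrightarrow> k \<le> n \<Longrightarrow> \<bar>w (node n k)\<bar> \<le> B"
  shows "\<bar>interp n w x\<bar> \<le> B"
proof (rule interp_convex[OF assms(1,2)])
  fix k l s
  assume *: "1 \<le> k" "k \<le> n" "1 \<le> l" "l \<le> n" "0 \<le> s" "s \<le> (1::real)"
    and eq: "\<And>w. interp n w x = (1 - s) * w (node n k) + s * w (node n l)"
  have "\<bar>interp n w x\<bar> \<le> (1 - s) * B + s * B"
    unfolding eq using assms(3)[of k] assms(3)[of l] *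
    by (intro order.trans[OF abs_triangle_ineq] add_mono) (auto simp: abs_mult intro: mult_left_mono)
  then show ?thesis by (simp add: algebra_simps)
qed

lemma interp_close:
  assumes "0 < n" "x \<in> domO" "\<And>y. y \<in> domO \<Longrightarrow> \<bar>y - x\<bar> \<le> pi / real n \<Longrightarrow> \<bar>w y - c\<bar> \<le> B"
  shows "\<bar>interp n w x - c\<bar> \<le> B"
proof (rule interp_convex[OF assms(1,2)])
  fix k l s
  assume *: "1 \<le> k" "k \<le> n" "1 \<le> l" "l \<le> n" "0 \<le> s" "s \<le> (1::real)"
    "\<bar>node n k - x\<bar> \<le> pi / real n" "\<bar>node n l - x\<bar> \<le> pi / real n"
    and eq: "\<And>w. interp n w x = (1 - s) * w (node n k) + s * w (node n l)"
  have "interp n w x - c = (1 - s) * (w (node n k) - c) + s * (w (node n l) - c)"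
    unfolding eq by (simp add: algebra_simps)
  also have "\<bar>\<dots>\<bar> \<le> (1 - s) * B + s * B"
    using assms(3)[of "node n k"] assms(3)[of "node n l"] * node_in_domO[of k n] node_in_domO[of l n]
    by (intro order.trans[OF abs_triangle_ineq] add_mono) (auto simp: abs_mult intro: mult_left_mono)
  finally show ?thesis by (simp add: algebra_simps)
qed

lemma continuous_on_interp:
  assumes "0 < n" shows "continuous_on domO (interp n w)"
proof -
  have n: "0 < real n" using assms by simp
  \<comment> \<open>Closed pieces to be glued: index \<open>0\<close> is the constant left end,
    index \<open>n\<close> the constant right end, and the others are the affine cells.\<close>
  define P where "P k = (if k = 0 then {0..node n 1} else if k = n then {node n n..pi}
      else {node n k..node n (k+1)})" for k
  have "continuous_on (P k) (interp n w)" if "k \<le> n" for k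
  proof -
    consider "k = 0" | "k = n" "k \<noteq> 0" | "1 \<le> k" "k < n" using \<open>k \<le> n\<close> by linarith
    then show ?thesis
    proof cases
      case 1
      have "continuous_on (P k) (interp n w) \<longleftrightarrow> continuous_on (P k) (\<lambda>_. w (node n 1))"
        using 1 by (intro continuous_on_cong) (auto simp: P_def interp_def)
      then show ?thesis by simp
    next
      case 2
      have "interp n w x = w (node n n)" if "node n n \<le> x" for x
        using that node_mono[OF assms, of n 1] assms
        by (cases "n = 1") (auto simp: interp_def)
      then have "continuous_on (P k) (interp n w) \<longleftrightarrow> continuous_on (P k) (\<lambda>_. w (node n n))"
        using 2 by (intro continuous_on_cong) (auto simp: P_def)
      then show ?thesis by simp
    next
      case 3
      then have "continuous_on (P k) (interp n w) \<longleftrightarrow> continuous_on (P k) (\<lambda>x. 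
         w (node n k) + real n / pi * (w (node n (k + 1)) - w (node n k)) * (x - node n k))"
        by (intro continuous_on_cong interp_between) (auto simp: P_def)
      then show ?thesis by (auto intro!: continuous_intros)
    qed
  qed
  then have "continuous_on (\<Union>k\<in>{..n}. P k) (interp n w)"
    by (intro continuous_on_closed_Union) (auto simp: P_def)
  moreover have "domO \<subseteq> (\<Union>k\<in>{..n}. P k)"
  proof
    fix x assume "x \<in> domO"
    then have x: "0 \<le> x" "x \<le> pi" by (auto simp: domO_def)
    consider "x \<le> node n 1" | "node n n \<le> x" | "node n 1 < x" "x < node n n" by linarith
    then show "x \<in> (\<Union>k\<in>{..n}. P k)"
    proof cases
      case 1 then show ?thesis using x by (intro UN_I[of 0]) (auto simp: P_def)
    next
      case 2 then show ?thesis using x assms by (intro UN_I[of n]) (auto simp: P_def)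
    next
      case 3
      define k where "k = nat \<lfloor>x * real n / pi + 1 / 2\<rfloor>"
      have "0 \<le> x * real n / pi" using x n by simp
      then have k: "real k \<le> x * real n / pi + 1/2" "x * real n / pi + 1/2 < real k + 1"
        unfolding k_def by linarith+
      have xk: "node n k \<le> x" "x < node n (k+1)"
        using k n by (auto simp: node_def field_simps)
      have "1 < k + 1" using node_mono[OF assms(1), of "k+1" 1] xk 3 by linarith
      moreover have "k < n" using node_mono[OF assms(1), of n k] xk 3 by linarith
      ultimately show ?thesis using xk by (intro UN_I[of k]) (auto simp: P_def)
    qed
  qed
  ultimately show ?thesis by (rule continuous_on_subset)
qed

lemma abs_trial_le: "x \<in> domO \<Longrightarrow> \<bar>trial n j x\<bar> \<le> 1"
  by (auto simp: trial_def phi_n_def abs_phi_le intro!: abs_interp_le)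

lemma continuous_on_trial: "continuous_on domO (trial n j)"
  unfolding trial_def phi_n_def
  by (cases "n = 0"; cases "j < n") (auto intro!: continuous_on_interp continuous_intros)

lemma freq_0 [simp]: "freq n 0 = 0"
  by (simp add: freq_def lam_n_def)

text \<open>Jordan's inequality: by concavity the sine lies above its chord from \<open>0\<close> to
  \<open>pi / 2\<close>.\<close>

lemma sin_ge: assumes "0 \<le> x" "x \<le> pi / 2" shows "2 * x / pi \<le> sin x"
proof -
  have "concave_on {0..pi} sin"
    by (intro f''_le0_imp_concave[where f' = cos and f'' = "\<lambda>x. - sin x"])
      (auto intro!: derivative_eq_intros sin_ge_zero)
  then have "convex_on {0..pi} (\<lambda>x. - sin x)" by (simp add: concave_on_def)
  from convex_onD[OF this, of "2 * x / pi" 0 "pi / 2"] assms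
  show ?thesis by (auto simp: field_simps)
qed

text \<open>Jordan's inequality turns the discrete eigenvalue into at least
  \<open>4 / pi\<^sup>2\<close> times \<open>j\<^sup>2\<close>, and
  \<open>pi\<^sup>2 \<le> 12\<close>. This mesh-independent growth is what makes all later mode sums
  converge uniformly in \<open>n\<close>.\<close>

lemma freq_ge: "(real j)\<^sup>2 / 3 \<le> freq n j"
proof (cases "n = 0 \<or> n \<le> j")
  case False
  then have n: "0 < real n" "real j < real n" by auto
  have "2 * (real j * pi / (2 * real n)) / pi \<le> sin (real j * pi / (2 * real n))"
    using n by (intro sin_ge) (auto simp: field_simps)
  then have "(real j / real n)\<^sup>2 \<le> (sin (real j * pi / (2 * real n)))\<^sup>2"
    using n by (intro power_mono) (auto simp: field_simps)
  then have "(4 * (real n)\<^sup>2 / pi\<^sup>2) * (real j / real n)\<^sup>2 \<le> freq n j"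
    using False unfolding freq_def lam_n_def by (simp add: mult_left_mono divide_right_mono)
  moreover have "(4 * (real n)\<^sup>2 / pi\<^sup>2) * (real j / real n)\<^sup>2 = 4 / pi\<^sup>2 * (real j)\<^sup>2"
    using n by (simp add: field_simps)
  moreover have "1 / 3 \<le> 4 / pi\<^sup>2"
  proof -
    have "pi \<le> 3.2" using pi_approx by simp
    then have "pi\<^sup>2 \<le> 3.2\<^sup>2" by (intro power_mono) auto
    then show ?thesis by (simp add: field_simps power2_eq_square)
  qed
  then have "1 / 3 * (real j)\<^sup>2 \<le> 4 / pi\<^sup>2 * (real j)\<^sup>2" by (rule mult_right_mono) auto
  ultimately show ?thesis by linarith
qed (simp add: freq_def)

lemma freq_le: "freq n j \<le> (real j)\<^sup>2"
proof (cases "n = 0 \<or> n \<le> j")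
  case False
  have "\<bar>sin (real j * pi / (2 * real n))\<bar> \<le> \<bar>real j * pi / (2 * real n)\<bar>" by (rule abs_sin_x_le_abs_x)
  then have "(sin (real j * pi / (2 * real n)))\<^sup>2 \<le> (real j * pi / (2 * real n))\<^sup>2"
    by (rule abs_le_square_iff[THEN iffD1])
  then have "freq n j \<le> (4 * (real n)\<^sup>2 / pi\<^sup>2) * (real j * pi / (2 * real n))\<^sup>2"
    using False unfolding freq_def lam_n_def by (simp add: mult_left_mono divide_right_mono)
  also have "\<dots> = (real j)\<^sup>2" using False by (simp add: field_simps power2_eq_square)
  finally show ?thesis .
qed (simp add: freq_def)

lemma freq_nonneg: "0 \<le> freq n j" using freq_ge[of j n] by (smt (verit) divide_nonneg_nonneg zero_le_power2)

lemma freq_pos: "0 < j \<Longrightarrow> 0 < freq n j"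
  using freq_ge[of j n] by (smt (verit) divide_pos_pos of_nat_0_less_iff zero_less_power)

subsection \<open>Discrete cosine analysis\<close>

text \<open>The half-open cells cover the interval except its right end, hence the exclusion of
  \<open>pi\<close>; a single point does not matter for integrals.\<close>

lemma kappa_indicator_sum:
  assumes "0 < n" "y \<noteq> pi"
  shows "indicator domO y * g (kappa n y) =
    (\<Sum>k\<in>{1..n}. indicator {(real k - 1) * pi / real n ..< real k * pi / real n} y * (g (node n k) :: real))"
proof -
  have n: "0 < real n" using assms by simp
  have cell: "y \<in> {(real k - 1) * pi / real n ..< real k * pi / real n} \<longleftrightarrow> \<lfloor>y * real n / pi\<rfloor> = int k - 1" for k
  proof -
    have "y \<in> {(real k - 1) * pi / real n ..< real k * pi / real n}
       \<longleftrightarrow> real k - 1 \<le> y * real n / pi \<and> y * real n / pi < real k"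
      using n by (auto simp: field_simps)
    also have "\<dots> \<longleftrightarrow> \<lfloor>y * real n / pi\<rfloor> = int k - 1" by (simp add: floor_eq_iff)
    finally show ?thesis .
  qed
  show ?thesis
  proof (cases "y \<in> domO")
    case True
    then have y: "0 \<le> y" "y < pi" using assms by (auto simp: domO_def)
    define m where "m = Suc (nat \<lfloor>y * real n / pi\<rfloor>)"
    have nn: "0 \<le> y * real n / pi" using y by simp
    then have fl: "\<lfloor>y * real n / pi\<rfloor> = int m - 1" by (simp add: m_def)
    have "y * real n / pi < real n" using y n by (simp add: field_simps)
    then have "\<lfloor>y * real n / pi\<rfloor> < int n" by (simp add: floor_less_iff)
    then have "m \<le> n" using fl by linarith
    moreover have "1 \<le> m" by (simp add: m_def)
    ultimately have m: "1 \<le> m" "m \<le> n" by auto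
    have "kappa n y = node n m"
      using fl[THEN cell[THEN iffD2]] m by (intro kappa_cell) (auto simp: of_nat_diff)
    moreover have "indicator {(real k - 1) * pi / real n ..< real k * pi / real n} y * g (node n k)
        = (if k = m then g (node n m) else 0)" for k
      using cell[of k] fl by (auto simp: indicator_def)
    ultimately show ?thesis using True m by simp
  next
    case False
    have "y \<notin> {(real k - 1) * pi / real n ..< real k * pi / real n}" if "k \<in> {1..n}" for k
    proof -
      have "0 \<le> (real k - 1) * pi / real n" "real k * pi / real n \<le> pi"
        using that n by (auto simp: field_simps)
      then show ?thesis using False by (auto simp: domO_def)
    qed
    then show ?thesis using False by simp
  qed
qed

text \<open>Integrating a sampled function is the midpoint rule, exactly. Every space integral of
  the discrete equation thereby becomes a finite sum over nodes.\<close>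

lemma
  assumes "0 < n"
  shows integral_kappa: "(LBINT y:domO. g (kappa n y)) = pi / real n * (\<Sum>k\<in>{1..n}. g (node n k))"
    and integrable_kappa: "set_integrable lborel domO (\<lambda>y. g (kappa n y) :: real)"
proof -
  define S where "S y = (\<Sum>k\<in>{1..n}. indicator {(real k - 1) * pi / real n ..< real k * pi / real n} y * g (node n k))" for y
  have n: "0 < real n" using assms by simp
  have S: "has_bochner_integral lborel S (\<Sum>k\<in>{1..n}. (pi / real n) * g (node n k))"
    unfolding S_def
  proof (intro has_bochner_integral_sum has_bochner_integral_mult_left)
    fix k
    have "(real k - 1) * pi / real n \<le> real k * pi / real n" "real k * pi / real n - (real k - 1) * pi / real n = pi / real n"
      using n by (auto simp: field_simps)
    then show "has_bochner_integral lborel (indicator {(real k - 1) * pi / real n ..< real k * pi / real n}) (pi / real n)"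
      using has_bochner_integral_real_indicator[of "{(real k - 1) * pi / real n ..< real k * pi / real n}" lborel] by simp
  qed
  have ae: "AE y in lborel. S y = indicator domO y *\<^sub>R g (kappa n y)"
    using AE_lborel_singleton[of pi]
    by eventually_elim (simp add: S_def kappa_indicator_sum[OF assms])
  have eq: "indicator domO y *\<^sub>R g (kappa n y) = (if y = pi then g (node n n) else S y)" for y
    using kappa_indicator_sum[OF assms, of y g] by (auto simp: S_def kappa_def domO_def)
  have [measurable]: "S \<in> borel_measurable borel" using S by (auto simp: has_bochner_integral_iff)
  have meas: "(\<lambda>y. indicator domO y *\<^sub>R g (kappa n y)) \<in> borel_measurable lborel"
    unfolding eq by measurable
  show "set_integrable lborel domO (\<lambda>y. g (kappa n y))"
    unfolding set_integrable_def using S ae meas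
    by (subst integrable_cong_AE[of _ _ S]) (auto simp: has_bochner_integral_iff)
  have "(LBINT y:domO. g (kappa n y)) = integral\<^sup>L lborel S"
    unfolding set_lebesgue_integral_def using ae meas by (intro integral_cong_AE) auto
  then show "(LBINT y:domO. g (kappa n y)) = pi / real n * (\<Sum>k\<in>{1..n}. g (node n k))"
    using S by (simp add: has_bochner_integral_iff sum_distrib_left)
qed

text \<open>Sampled cosines are eigenvectors of the second difference, by \<open>cos (a + d) - 2 cos
  a + cos (a - d) = - 4 sin\<^sup>2 (d / 2) cos a\<close>.\<close>

lemma phi_second_difference:
  assumes "j < n" "1 \<le> k"
  shows "phi j (node n (Suc k)) - 2 * phi j (node n k) + phi j (node n (k - 1))
    = - (pi / real n)\<^sup>2 * freq n j * phi j (node n k)"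
proof (cases "j = 0")
  case False
  have n: "0 < real n" using assms by simp
  define a d where "a = real j * node n k" and "d = real j * pi / real n"
  have 1: "real j * node n (Suc k) = a + d" using n by (simp add: a_def d_def node_def field_simps)
  have 2: "real j * node n (k - 1) = a - d" using n assms by (simp add: a_def d_def node_def field_simps)
  have "cos (a + d) - 2 * cos a + cos (a - d) = - 4 * (sin (d / 2))\<^sup>2 * cos a"
  proof -
    have "cos (a + d) - 2 * cos a + cos (a - d) = 2 * cos a * (cos d - 1)"
      by (simp add: cos_add cos_diff algebra_simps)
    also have "cos d - 1 = - 2 * (sin (d / 2))\<^sup>2"
      using cos_double_sin[of "d / 2"] by simp
    finally show ?thesis by simp
  qed
  moreover have "(pi / real n)\<^sup>2 * freq n j = 4 * (sin (d / 2))\<^sup>2"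
    using n assms by (simp add: freq_def lam_n_def d_def field_simps)
  ultimately have "cos (a + d) - 2 * cos a + cos (a - d) = - ((pi / real n)\<^sup>2 * freq n j) * cos a"
    by simp
  then have "sqrt (2 / pi) * (cos (a + d) - 2 * cos a + cos (a - d)) = sqrt (2 / pi) * (- ((pi / real n)\<^sup>2 * freq n j) * cos a)"
    by simp
  then show ?thesis using False unfolding phi_def 1 2 a_def[symmetric] by (simp add: algebra_simps)
qed (simp add: phi_def)

text \<open>Nodes \<open>0\<close> and \<open>n + 1\<close> mirror nodes \<open>1\<close> and
  \<open>n\<close> in the two end points, about which the cosines are even. This is the discrete
  Neumann condition.\<close>

lemma phi_ghost:
  assumes "0 < n"
  shows "phi j (node n 0) = phi j (node n 1)" "phi j (node n (Suc n)) = phi j (node n n)"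
proof -
  have n: "0 < real n" using assms by simp
  have "real j * node n 0 = - (real j * node n 1)" by (simp add: node_def)
  then show "phi j (node n 0) = phi j (node n 1)" by (simp add: phi_def)
  define d where "d = real j * pi / (2 * real n)"
  have "real j * node n (Suc n) = real j * pi + d" "real j * node n n = real j * pi - d"
    using n by (auto simp: node_def d_def field_simps)
  then show "phi j (node n (Suc n)) = phi j (node n n)"
    by (simp add: phi_def cos_add cos_diff)
qed

text \<open>Discrete Green identity: the sum telescopes to its boundary terms.\<close>

lemma sum_by_parts_twice:
  fixes p w :: "nat \<Rightarrow> real"
  shows "(\<Sum>k\<in>{1..n}. (p (Suc k) - 2 * p k + p (k - 1)) * w k - p k * (w (Suc k) - 2 * w k + w (k - 1)))
    = (p (Suc n) * w n - p n * w (Suc n)) - (p 1 * w 0 - p 0 * w 1)"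
  by (induction n) (auto simp: algebra_simps)

text \<open>For two sequences with Neumann ghost values the boundary terms of the Green identity
  cancel, so the discrete Laplacian can be moved from the cosine onto \<open>w\<close>. This
  replaces integration by parts for the initial datum.\<close>

lemma discrete_laplacian_symmetric:
  fixes w :: "nat \<Rightarrow> real"
  assumes "j < n" "w 0 = w 1" "w (Suc n) = w n"
  shows "(pi / real n)\<^sup>2 * freq n j * (\<Sum>k\<in>{1..n}. phi j (node n k) * w k)
    = - (\<Sum>k\<in>{1..n}. phi j (node n k) * (w (Suc k) - 2 * w k + w (k - 1)))"
proof -
  have n: "0 < n" using assms by simp
  define p where "p k = phi j (node n k)" for k
  have "(\<Sum>k\<in>{1..n}. (p (Suc k) - 2 * p k + p (k - 1)) * w k - p k * (w (Suc k) - 2 * w k + w (k - 1))) = 0"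
    unfolding sum_by_parts_twice using phi_ghost[OF n, of j] assms by (simp add: p_def)
  then have "(\<Sum>k\<in>{1..n}. (p (Suc k) - 2 * p k + p (k - 1)) * w k) = (\<Sum>k\<in>{1..n}. p k * (w (Suc k) - 2 * w k + w (k - 1)))"
    by (simp add: sum_subtractf)
  moreover have "(\<Sum>k\<in>{1..n}. (p (Suc k) - 2 * p k + p (k - 1)) * w k)
     = (\<Sum>k\<in>{1..n}. - ((pi / real n)\<^sup>2 * freq n j) * (p k * w k))"
    using phi_second_difference[OF assms(1)] by (intro sum.cong) (auto simp: p_def)
  ultimately show ?thesis by (simp add: p_def sum_negf flip: sum_distrib_left)
qed

lemma sum_phi_node:
  assumes "0 < j" "j < n"
  shows "(\<Sum>k\<in>{1..n}. phi j (node n k)) = 0"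
  using discrete_laplacian_symmetric[of j n "\<lambda>_. 1"] freq_pos[of j n] assms by simp

text \<open>Orthogonality of the higher modes to constants, exact on every mesh. It makes a
  spatially constant forcing act on the mass mode alone, with the same response for all
  \<open>n\<close>.\<close>

lemma integral_phi_samp:
  assumes "0 < j" "n = 0 \<or> j < n"
  shows "(LBINT y:domO. phi j (samp n y)) = 0"
proof (cases "n = 0")
  case False
  then show ?thesis using assms sum_phi_node[of j n] integral_kappa[of n "phi j"] by (simp add: samp_def)
next
  case True
  have "(LBINT y. phi j y * indicator {0..pi} y) = sqrt (2 / pi) / real j * sin (real j * pi) - sqrt (2 / pi) / real j * sin (real j * 0)"
  proof (rule integral_FTC_Icc_real)
    fix x
    show "((\<lambda>y. sqrt (2 / pi) / real j * sin (real j * y)) has_field_derivative phi j x) (at x)"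
      using assms by (auto intro!: derivative_eq_intros simp: phi_def)
    show "isCont (phi j) x" using continuous_on_phi[OF continuous_on_id, of UNIV j]
      by (simp add: continuous_on_eq_continuous_at)
  qed simp
  then show ?thesis using True by (simp add: samp_def set_lebesgue_integral_def domO_def mult.commute sin_npi)
qed

section \<open>Discrete completeness of the sampled cosines\<close>

lemma dirichlet_kernel:
  "2 * sin (x / 2) * (1 / 2 + (\<Sum>j\<in>{1..<n}. cos (real j * x))) = sin ((real n - 1 / 2) * x)" if "0 < n"
  using that
proof (induction n rule: nat_induct_non_zero)
  case (Suc n)
  have "2 * sin (x / 2) * (1 / 2 + (\<Sum>j\<in>{1..<Suc n}. cos (real j * x)))
     = sin ((real n - 1 / 2) * x) + 2 * (cos (real n * x) * sin (x / 2))"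
    using Suc by (simp add: algebra_simps)
  also have "2 * (cos (real n * x) * sin (x / 2)) = sin (real n * x + x / 2) - sin (real n * x - x / 2)"
    by (simp add: sin_add sin_diff)
  finally show ?case by (simp add: algebra_simps)
qed (simp add: field_simps)

text \<open>At \<open>x = m pi / n\<close> the numerator is \<open>sin (m pi - x / 2)\<close>, which
  is the denominator up to a sign given by the parity of \<open>m\<close>. The bounds on
  \<open>m\<close> keep \<open>sin (x / 2)\<close> away from zero.\<close>

lemma dirichlet_kernel_lattice:
  assumes "0 < n" "\<bar>m\<bar> < 2 * int n" "m \<noteq> 0"
  shows "1 / 2 + (\<Sum>j\<in>{1..<n}. cos (real j * (of_int m * pi / real n))) = - (if even m then 1 else -1) / 2"
proof -
  define x where "x = of_int m * pi / real n"
  have n: "0 < real n" using assms by simp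
  have "sin (x / 2) \<noteq> 0"
  proof
    assume "sin (x / 2) = 0"
    then obtain i :: int where "x / 2 = of_int i * pi" by (auto simp: sin_zero_iff_int2)
    then have "real_of_int m = of_int (2 * i * int n)" using n by (simp add: x_def field_simps)
    then have "m = 2 * i * int n" by (simp only: of_int_eq_iff)
    then have m: "\<bar>m\<bar> = \<bar>i\<bar> * (2 * int n)" "i \<noteq> 0" using assms by (auto simp: abs_mult)
    then have "1 * (2 * int n) \<le> \<bar>i\<bar> * (2 * int n)" by (intro mult_right_mono) auto
    then show False using m assms by simp
  qed
  have "(real n - 1 / 2) * x = of_int m * pi - x / 2" using n by (simp add: x_def field_simps)
  then have "sin ((real n - 1 / 2) * x) = - cos (of_int m * pi) * sin (x / 2)"
    by (simp add: sin_diff sin_zero_iff_int2)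
  also have "cos (of_int m * pi) = (if even m then 1 else -1)"
  proof (cases "0 \<le> m")
    case True
    then obtain k where "m = int k" by (auto dest: nonneg_int_cases)
    then show ?thesis by (simp add: cos_npi)
  next
    case False
    then have "m = - int (nat (- m))" by simp
    then obtain k where "m = - int k" by blast
    then show ?thesis by (simp add: cos_npi)
  qed
  finally have *: "2 * sin (x / 2) * (1 / 2 + (\<Sum>j\<in>{1..<n}. cos (real j * x))) = - (if even m then 1 else -1) * sin (x / 2)"
    using dirichlet_kernel[OF assms(1), of x] by simp
  have "c = - e / 2" if "2 * s * c = - e * s" "s \<noteq> 0" for s c e :: real
  proof -
    have "s * (2 * c + e) = 0" using that by (simp add: algebra_simps)
    then show ?thesis using that by simp
  qed
  from this[OF * \<open>sin (x / 2) \<noteq> 0\<close>] show ?thesis unfolding x_def .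
qed

text \<open>The product formula for cosines gives one Dirichlet kernel at the difference
  \<open>a = k - l\<close> and one at \<open>b = k + l - 1\<close>. Off the diagonal
  \<open>a\<close> and \<open>b\<close> have opposite parity and the kernels cancel; on it they
  contribute \<open>n - 1 / 2\<close> and \<open>1 / 2\<close>.\<close>

lemma sum_phi_phi_node:
  assumes "k \<in> {1..n}" "l \<in> {1..n}"
  shows "(\<Sum>j<n. phi j (node n k) * phi j (node n l)) = (if k = l then real n / pi else 0)"
proof -
  have n: "0 < n" using assms by simp
  define a where "a = int k - int l"
  define b where "b = int k + int l - 1"
  have "phi j (node n k) * phi j (node n l) = 1 / pi * (cos (real j * (of_int a * pi / real n)) + cos (real j * (of_int b * pi / real n)))"
    if "j \<noteq> 0" for j
  proof -
    have e: "real j * (of_int a * pi / real n) = real j * node n k - real j * node n l"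
      "real j * (of_int b * pi / real n) = real j * node n k + real j * node n l"
      using n by (auto simp: a_def b_def node_def field_simps)
    have "phi j (node n k) * phi j (node n l) = 2 / pi * (cos (real j * node n k) * cos (real j * node n l))"
    proof -
      define c where "c = sqrt (2 / pi)"
      have "c * c = 2 / pi" by (simp add: c_def)
      moreover have "phi j x = c * cos (real j * x)" for x using that by (simp add: phi_def c_def)
      ultimately show ?thesis by (metis mult.assoc mult.left_commute)
    qed
    then show ?thesis unfolding e by (simp add: cos_add cos_diff)
  qed
  then have "(\<Sum>j\<in>{1..<n}. phi j (node n k) * phi j (node n l))
    = 1 / pi * ((\<Sum>j\<in>{1..<n}. cos (real j * (of_int a * pi / real n))) + (\<Sum>j\<in>{1..<n}. cos (real j * (of_int b * pi / real n))))"
    by (subst sum.distrib[symmetric], subst sum_distrib_left, intro sum.cong) auto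
  moreover have "(\<Sum>j<n. phi j (node n k) * phi j (node n l)) = 1 / pi + (\<Sum>j\<in>{1..<n}. phi j (node n k) * phi j (node n l))"
    using n by (simp add: lessThan_atLeast0 sum.atLeast_Suc_lessThan phi_def)
  ultimately have main: "(\<Sum>j<n. phi j (node n k) * phi j (node n l)) =
     1 / pi * ((1/2 + (\<Sum>j\<in>{1..<n}. cos (real j * (of_int a * pi / real n)))) + (1/2 + (\<Sum>j\<in>{1..<n}. cos (real j * (of_int b * pi / real n)))))"
    by (simp add: field_simps)
  have B: "1 / 2 + (\<Sum>j\<in>{1..<n}. cos (real j * (of_int b * pi / real n))) = - (if even b then 1 else -1) / 2"
    using assms by (intro dirichlet_kernel_lattice n) (auto simp: b_def)
  show ?thesis
  proof (cases "k = l")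
    case True
    then have "odd b" by (simp add: b_def)
    then show ?thesis unfolding main B using True n by (simp add: a_def of_nat_diff field_simps)
  next
    case False
    have A: "1 / 2 + (\<Sum>j\<in>{1..<n}. cos (real j * (of_int a * pi / real n))) = - (if even a then 1 else -1) / 2"
      using assms False by (intro dirichlet_kernel_lattice n) (auto simp: a_def)
    have "b = a + 2 * int l - 1" by (simp add: a_def b_def)
    then have "even a \<longleftrightarrow> odd b" by simp
    then show ?thesis unfolding main A B using False by simp
  qed
qed

text \<open>Completeness makes the discrete cosine expansion exact at the nodes, and both sides
  interpolate node values with the same convex weights.\<close>

lemma interp_eq_sum:
  assumes "0 < n" "x \<in> domO"
  shows "(\<Sum>j<n. trial n j x * (LBINT y:domO. phi j (samp n y) * w (samp n y))) = interp n w x"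
proof -
  have n: "0 < real n" using assms by simp
  have node: "(\<Sum>j<n. phi j (node n k) * (LBINT y:domO. phi j (samp n y) * w (samp n y))) = w (node n k)"
    if "k \<in> {1..n}" for k
  proof -
    have "(\<Sum>j<n. phi j (node n k) * (LBINT y:domO. phi j (samp n y) * w (samp n y)))
      = (\<Sum>j<n. phi j (node n k) * (pi / real n * (\<Sum>l\<in>{1..n}. phi j (node n l) * w (node n l))))"
      using assms integral_kappa[of n "\<lambda>z. phi _ z * w z"] by (simp add: samp_def)
    also have "\<dots> = pi / real n * (\<Sum>l\<in>{1..n}. w (node n l) * (\<Sum>j<n. phi j (node n k) * phi j (node n l)))"
      by (subst sum_distrib_left, subst sum.swap[symmetric])
        (auto simp: sum_distrib_left sum_distrib_right mult_ac intro!: sum.cong)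
    also have "\<dots> = pi / real n * (\<Sum>l\<in>{1..n}. if k = l then w (node n k) * (real n / pi) else 0)"
      using sum_phi_phi_node[OF that] by (intro arg_cong2[where f = "(*)"] sum.cong) auto
    also have "\<dots> = w (node n k)" using that n by simp
    finally show ?thesis .
  qed
  show ?thesis
  proof (rule interp_convex[OF assms])
    fix k l s
    assume *: "1 \<le> k" "k \<le> n" "1 \<le> l" "l \<le> n"
      and eq: "\<And>w. interp n w x = (1 - s) * w (node n k) + s * w (node n l)"
    have "(\<Sum>j<n. trial n j x * (LBINT y:domO. phi j (samp n y) * w (samp n y)))
      = (1 - s) * (\<Sum>j<n. phi j (node n k) * (LBINT y:domO. phi j (samp n y) * w (samp n y)))
        + s * (\<Sum>j<n. phi j (node n l) * (LBINT y:domO. phi j (samp n y) * w (samp n y)))"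
      unfolding sum_distrib_left sum.distrib[symmetric]
      using assms by (intro sum.cong) (auto simp: trial_def phi_n_def eq algebra_simps)
    then show ?thesis using node[of k] node[of l] * by (simp add: eq)
  qed
qed

text \<open>The size of a mode in the norm weighted by \<open>exp (\<beta> t)\<close>: a decay rate
  \<open>\<nu>\<^sup>2 = \<mu>\<^sup>2 + \<beta>\<close> produces the factor
  \<open>1 / \<nu>\<close>, and \<mu> is replaced by its lower bound \<open>j\<^sup>2 / 3\<close>,
  so that one summable sequence serves all meshes.\<close>

definition wt :: "real \<Rightarrow> nat \<Rightarrow> real" where
  "wt \<beta> j = 1 / sqrt (((real j)\<^sup>2 / 3)\<^sup>2 + \<beta>)"

lemma wt_nonneg: "0 \<le> \<beta> \<Longrightarrow> 0 \<le> wt \<beta> j" by (simp add: wt_def)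

lemma wt_mono: "0 < \<beta> \<Longrightarrow> \<beta> \<le> \<gamma> \<Longrightarrow> wt \<gamma> j \<le> wt \<beta> j"
  unfolding wt_def by (intro divide_left_mono mult_pos_pos) (auto simp: add_nonneg_pos)

lemma wt_ge_freq: "0 < \<beta> \<Longrightarrow> 1 / sqrt ((freq n j)\<^sup>2 + \<beta>) \<le> wt \<beta> j"
  unfolding wt_def using freq_ge[of j n]
  by (intro divide_left_mono mult_pos_pos real_sqrt_le_mono add_mono power_mono) (auto simp: add_nonneg_pos)

lemma wt_le: "0 < j \<Longrightarrow> 0 \<le> \<beta> \<Longrightarrow> wt \<beta> j \<le> 3 / (real j)\<^sup>2"
proof -
  assume *: "0 < j" "0 \<le> \<beta>"
  have "sqrt (((real j)\<^sup>2 / 3)\<^sup>2) \<le> sqrt (((real j)\<^sup>2 / 3)\<^sup>2 + \<beta>)" using * by (intro real_sqrt_le_mono) auto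
  then have "(real j)\<^sup>2 / 3 \<le> sqrt (((real j)\<^sup>2 / 3)\<^sup>2 + \<beta>)" by simp
  then have "wt \<beta> j \<le> 1 / ((real j)\<^sup>2 / 3)" unfolding wt_def using *
    by (intro divide_left_mono) (auto intro!: mult_pos_pos simp: add_pos_nonneg)
  then show ?thesis by simp
qed

lemma wt_1_ge: "1 / (2 * (real j)\<^sup>2) \<le> wt 1 j" if "0 < j"
proof -
  have "1 \<le> (real j)\<^sup>2" using that by simp
  moreover have "((real j)\<^sup>2 / 3)\<^sup>2 + 1 \<le> (2 * (real j)\<^sup>2)\<^sup>2"
  proof -
    define a where "a = (real j)\<^sup>2"
    have "1 \<le> a * a" using \<open>1 \<le> (real j)\<^sup>2\<close> mult_mono[of 1 a 1 a] by (simp add: a_def)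
    moreover have "(a / 3)\<^sup>2 = a * a / 9" "(2 * a)\<^sup>2 = 4 * (a * a)" by (simp_all add: power2_eq_square)
    ultimately show ?thesis unfolding a_def[symmetric] by linarith
  qed
  then have "sqrt (((real j)\<^sup>2 / 3)\<^sup>2 + 1) \<le> 2 * (real j)\<^sup>2"
    by (intro real_le_lsqrt) auto
  ultimately show ?thesis using that unfolding wt_def by (intro divide_left_mono mult_pos_pos) (auto simp: add_nonneg_pos)
qed

lemma wt_1_0 [simp]: "wt 1 0 = 1" by (simp add: wt_def)

lemma summable_wt: "0 < \<beta> \<Longrightarrow> summable (wt \<beta>)"
proof (rule summable_comparison_test)
  assume b: "0 < \<beta>"
  show "\<exists>N. \<forall>n\<ge>N. norm (wt \<beta> n) \<le> 3 * inverse (real n ^ 2)"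
    using b wt_le[of _ \<beta>] wt_nonneg[of \<beta>] by (intro exI[of _ 1]) (auto simp: field_simps)
  show "summable (\<lambda>n. 3 * inverse (real n ^ 2))"
    by (intro summable_mult inverse_power_summable) simp
qed

text \<open>Source of all smallness: a large \<beta> turns mode sums into contraction factors.
  Tannery's theorem applies with the weights at \<open>\<beta> = 1\<close> as majorant.\<close>

lemma suminf_wt_tendsto: "((\<lambda>\<beta>. \<Sum>j. wt \<beta> j) \<longlongrightarrow> 0) at_top"
proof -
  have "((\<lambda>\<beta>. wt \<beta> j) \<longlongrightarrow> 0) at_top" for j
    unfolding wt_def
    by (intro tendsto_divide_0[OF tendsto_const] filterlim_at_top_imp_at_infinity
        filterlim_compose[OF sqrt_at_top] filterlim_tendsto_add_at_top[OF tendsto_const filterlim_ident])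
  moreover have "\<forall>\<^sub>F (j, \<beta>) in at_top \<times>\<^sub>F at_top. norm (wt \<beta> j) \<le> wt 1 j"
    unfolding eventually_prod_filter
    by (intro exI[of _ "\<lambda>_. True"] exI[of _ "\<lambda>\<beta>. 1 \<le> \<beta>"])
      (auto simp: wt_nonneg wt_mono eventually_ge_at_top)
  ultimately have "((\<lambda>\<beta>. \<Sum>j. wt \<beta> j) \<longlongrightarrow> (\<Sum>j. 0)) at_top"
    using tannerys_theorem[of "\<lambda>j \<beta>. wt \<beta> j" "\<lambda>_. 0" at_top "wt 1"] summable_wt[of 1] by auto
  then show ?thesis by simp
qed

lemma freq_tendsto: "(\<lambda>n. freq n j) \<longlonglongrightarrow> freq 0 j"
proof (cases "j = 0")
  case False
  have lim: "((\<lambda>h::real. sin h / h) \<longlongrightarrow> 1) (at 0)"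
    using DERIV_sin[of 0] by (simp add: has_field_derivative_iff)
  define h where "h n = real j * pi / (2 * real n)" for n :: nat
  have h0: "h \<longlonglongrightarrow> 0" unfolding h_def
    by (intro tendsto_divide_0[OF tendsto_const] filterlim_at_top_imp_at_infinity
      filterlim_tendsto_pos_mult_at_top[OF tendsto_const _ filterlim_real_sequentially]) auto
  have "\<forall>\<^sub>F n in sequentially. h n \<noteq> 0"
    by (rule eventually_mono[OF eventually_gt_at_top[of 0]]) (use False in \<open>auto simp: h_def\<close>)
  then have "filterlim h (at 0) sequentially" using h0 by (simp add: filterlim_at)
  then have "(\<lambda>n. sin (h n) / h n) \<longlonglongrightarrow> 1" by (rule filterlim_compose[OF lim])
  then have "(\<lambda>n. (real j)\<^sup>2 * (sin (h n) / h n)\<^sup>2) \<longlonglongrightarrow> (real j)\<^sup>2 * 1\<^sup>2" by (intro tendsto_intros)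
  moreover have "\<forall>\<^sub>F n in sequentially. (real j)\<^sup>2 * (sin (h n) / h n)\<^sup>2 = freq n j"
    by (rule eventually_mono[OF eventually_gt_at_top[of j]])
      (use False in \<open>auto simp: h_def freq_def lam_n_def field_simps\<close>)
  ultimately show ?thesis by (simp add: freq_def filterlim_cong[OF refl refl])
qed simp

lemma trial_close:
  assumes "j < n" "x \<in> domO"
  shows "\<bar>trial n j x - phi j x\<bar> \<le> real j * (pi / real n)"
proof -
  have "\<bar>interp n (phi j) x - phi j x\<bar> \<le> real j * (pi / real n)"
    using assms by (intro interp_close order.trans[OF phi_lipschitz] mult_left_mono) auto
  then show ?thesis using assms by (simp add: trial_def phi_n_def)
qed

subsection \<open>Space-time integrals against the modes\<close>

lemma domO_measurable [simp, measurable]: "domO \<in> sets borel"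
  by (simp add: domO_def)

lemma domO_props [simp]: "compact domO" "closed domO" "0 \<in> domO" "pi \<in> domO"
  by (auto simp: domO_def)

lemma compact_domOT [simp]: "compact (domOT T)"
  by (simp add: domOT_def compact_Times)

lemma domOT_measurable [simp, measurable]: "domOT T \<in> sets borel"
  by (intro borel_compact) simp

lemma slab_measurable [simp, measurable]: "{a..b::real} \<times> domO \<in> sets borel"
  by (intro borel_compact compact_Times) auto

lemma slab_subset: "t \<le> T \<Longrightarrow> {0..t} \<times> domO \<subseteq> domOT T"
  by (auto simp: domOT_def)

lemma measurable_fst_snd_borel [measurable]:
  "(\<lambda>z::real\<times>real. fst z) \<in> borel_measurable borel" "(\<lambda>z::real\<times>real. snd z) \<in> borel_measurable borel"
  by (intro borel_measurable_continuous_onI continuous_intros)+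

lemma set_integrable_continuous_compact:
  fixes f :: "'a::euclidean_space \<Rightarrow> real"
  shows "compact S \<Longrightarrow> continuous_on S f \<Longrightarrow> set_integrable lborel S f"
  unfolding set_integrable_def by (rule borel_integrable_compact)

lemma set_integrable_mult_bounded:
  fixes w p :: "'a::euclidean_space \<Rightarrow> real"
  assumes "set_integrable lborel A p" "w \<in> borel_measurable borel" "\<And>z. z \<in> A \<Longrightarrow> \<bar>w z\<bar> \<le> C" "A \<in> sets borel"
  shows "set_integrable lborel A (\<lambda>z. w z * p z)"
  unfolding set_integrable_def
proof (rule Bochner_Integration.integrable_bound)
  show "integrable lborel (\<lambda>z. C *\<^sub>R (indicator A z *\<^sub>R p z))"
    using assms(1) unfolding set_integrable_def by (rule integrable_scaleR_right)
  have "(\<lambda>z. indicator A z *\<^sub>R p z) \<in> borel_measurable lborel"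
    using assms(1) unfolding set_integrable_def by auto
  then have "(\<lambda>z. w z * (indicator A z *\<^sub>R p z)) \<in> borel_measurable lborel"
    using assms(2) by measurable
  then show "(\<lambda>z. indicator A z *\<^sub>R (w z * p z)) \<in> borel_measurable lborel"
    by (simp add: mult_ac)
  show "AE z in lborel. norm (indicator A z *\<^sub>R (w z * p z)) \<le> norm (C *\<^sub>R (indicator A z *\<^sub>R p z))"
  proof (intro AE_I2)
    fix z
    show "norm (indicator A z *\<^sub>R (w z * p z)) \<le> norm (C *\<^sub>R (indicator A z *\<^sub>R p z))"
      using assms(3)[of z] by (cases "z \<in> A") (auto simp: abs_mult intro!: mult_right_mono)
  qed
qed

lemma set_integral_Times:
  fixes g :: "real \<times> real \<Rightarrow> real"
  assumes "set_integrable lborel (A \<times> B) g"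
  shows "(LBINT z:A \<times> B. g z) = (LBINT s:A. LBINT y:B. g (s, y))"
proof -
  let ?f = "\<lambda>z. indicator (A \<times> B) z *\<^sub>R g z"
  have int: "integrable (lborel \<Otimes>\<^sub>M lborel) ?f"
    using assms unfolding set_integrable_def lborel_prod .
  have eq: "indicator (A \<times> B) (s, y) *\<^sub>R g (s, y) = indicator A s *\<^sub>R (indicator B y *\<^sub>R g (s, y))" for s y
    by (auto simp: indicator_def)
  show ?thesis
    using lborel_pair.integral_fst'[OF int] unfolding set_lebesgue_integral_def lborel_prod
    by (simp only: eq integral_scaleR_right)
qed

text \<open>Lets the slice at time \<open>a\<close> be ignored: there kernel series may diverge and
  indicators of time slabs may fail to converge.\<close>

lemma AE_fst_neq: "AE z in (lborel :: (real \<times> real) measure). fst z \<noteq> a"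
proof -
  have "{a} \<times> (UNIV :: real set) \<in> null_sets (lborel \<Otimes>\<^sub>M lborel)"
    by (auto simp: null_sets_def lborel.emeasure_pair_measure_Times)
  then have "AE z in lborel \<Otimes>\<^sub>M (lborel :: real measure). fst z \<noteq> a"
    by (rule AE_I') auto
  then show ?thesis unfolding lborel_prod .
qed

text \<open>A nonintegrable \<open>f\<close> has integral \<open>0\<close> by convention, so
  domination alone suffices.\<close>

lemma abs_set_integral_le:
  fixes f g :: "'a::euclidean_space \<Rightarrow> real"
  assumes "set_integrable lborel A g" "\<And>z. z \<in> A \<Longrightarrow> \<bar>f z\<bar> \<le> g z"
  shows "\<bar>LBINT z:A. f z\<bar> \<le> (LBINT z:A. g z)"
proof (cases "set_integrable lborel A f")
  case True
  have "\<bar>LBINT z:A. f z\<bar> \<le> (LBINT z:A. \<bar>f z\<bar>)"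
    using integral_abs_bound[of lborel "\<lambda>z. indicator A z *\<^sub>R f z"]
    unfolding set_lebesgue_integral_def by (simp add: abs_mult)
  also have "\<dots> \<le> (LBINT z:A. g z)"
    using assms True by (intro set_integral_mono set_integrable_abs) auto
  finally show ?thesis .
next
  case False
  then have "(LBINT z:A. f z) = 0"
    unfolding set_lebesgue_integral_def set_integrable_def by (rule not_integrable_integral_eq)
  moreover have "0 \<le> (LBINT z:A. g z)"
    unfolding set_lebesgue_integral_def using assms(2)
    by (intro integral_nonneg_AE AE_I2) (auto simp: indicator_def intro: order_trans[OF abs_ge_zero])
  ultimately show ?thesis by simp
qed

lemma integral_exp_slab:
  assumes "0 \<le> t" "0 < a"
  shows "(LBINT z:{0..t} \<times> domO. exp (- a * (t - fst z))) \<le> pi / a"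
proof -
  have "set_integrable lborel ({0..t} \<times> domO) (\<lambda>z. exp (- a * (t - fst z)))"
    by (intro set_integrable_continuous_compact compact_Times continuous_intros) auto
  then have "(LBINT z:{0..t} \<times> domO. exp (- a * (t - fst z))) = (LBINT s:{0..t}. LBINT y:domO. exp (- a * (t - s)))"
    by (simp add: set_integral_Times)
  also have "\<dots> = (LBINT s:{0..t}. pi * exp (- a * (t - s)))"
    by (simp add: set_integral_const domO_def)
  also have "\<dots> = pi * (LBINT s:{0..t}. exp (- a * (t - s)))" by simp
  also have "(LBINT s:{0..t}. exp (- a * (t - s))) = (\<integral>s. exp (- a * (t - s)) * indicator {0..t} s \<partial>lborel)"
    by (simp add: set_lebesgue_integral_def mult.commute)
  also have "\<dots> = exp (- a * (t - t)) / a - exp (- a * (t - 0)) / a"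
    using assms by (intro integral_FTC_Icc_real) (auto intro!: derivative_eq_intros continuous_intros)
  also have "\<dots> \<le> 1 / a" using assms by simp
  finally show ?thesis by (simp add: mult_left_mono)
qed

definition energy :: "real \<Rightarrow> (real \<times> real \<Rightarrow> real) \<Rightarrow> real" where
  "energy T h = (LBINT z:domOT T. (h z)\<^sup>2)"

lemma L2_norm_OT_power2: "(L2_norm_OT T h)\<^sup>2 = energy T h"
proof -
  have "0 \<le> (LBINT z:domOT T. (h z)\<^sup>2)"
    unfolding set_lebesgue_integral_def by (intro Bochner_Integration.integral_nonneg) auto
  then show ?thesis by (simp add: L2_norm_OT_def energy_def)
qed

lemma energy_nonneg: "0 \<le> energy T h"
  by (simp flip: L2_norm_OT_power2)

lemma L2_OT_integrable:
  assumes "h \<in> L2_OT T" shows "set_integrable lborel (domOT T) h"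
proof -
  have i: "set_integrable lborel (domOT T) (\<lambda>z. 1 + (h z)\<^sup>2)"
    using assms by (intro set_integral_add(1) set_integrable_continuous_compact[where f = "\<lambda>_. 1"]) (auto simp: L2_OT_def)
  have "norm (h z) \<le> norm (1 + (h z)\<^sup>2)" for z
  proof -
    have "0 \<le> (\<bar>h z\<bar> - 1)\<^sup>2 + \<bar>h z\<bar>" by simp
    then show ?thesis by (simp add: power2_eq_square algebra_simps)
  qed
  then show ?thesis using assms
    by (intro set_integrable_bound[OF i] AE_I2 impI) (simp_all add: L2_OT_def)
qed

lemma L2_OT_I:
  fixes g h :: "real \<times> real \<Rightarrow> real"
  assumes "set_borel_measurable lborel (domOT T) g" "set_integrable lborel (domOT T) k"
    "\<And>z. z \<in> domOT T \<Longrightarrow> (g z)\<^sup>2 \<le> k z"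
  shows "g \<in> L2_OT T"
proof -
  have "(\<lambda>z. (indicator (domOT T) z *\<^sub>R g z)\<^sup>2) \<in> borel_measurable lborel"
    using assms(1) unfolding set_borel_measurable_def by measurable
  then have "set_borel_measurable lborel (domOT T) (\<lambda>z. (g z)\<^sup>2)"
    unfolding set_borel_measurable_def
    by (rule measurable_cong[THEN iffD1, rotated]) (auto simp: indicator_def)
  then have "set_integrable lborel (domOT T) (\<lambda>z. (g z)\<^sup>2)"
    using assms by (intro set_integrable_bound[OF assms(2)]) (auto intro!: AE_I2 order.trans[OF assms(3)])
  then show ?thesis using assms(1) by (simp add: L2_OT_def)
qed

definition mint :: "nat \<Rightarrow> (real \<times> real \<Rightarrow> real) \<Rightarrow> nat \<Rightarrow> real \<Rightarrow> real" where
  "mint n p j t = (LBINT z:{0..t} \<times> domO. exp (- (freq n j)\<^sup>2 * (t - fst z)) * phi j (samp n (snd z)) * p z)"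

lemma mint_integrable:
  assumes "set_integrable lborel (domOT T) p" "t \<le> T"
  shows "set_integrable lborel ({0..t} \<times> domO) (\<lambda>z. exp (- (freq n j)\<^sup>2 * (t - fst z)) * phi j (samp n (snd z)) * p z)"
proof (rule set_integrable_mult_bounded[where C = 1])
  show "set_integrable lborel ({0..t} \<times> domO) p"
    using assms slab_subset by (intro set_integrable_subset[OF assms(1)]) auto
  fix z :: "real \<times> real" assume "z \<in> {0..t} \<times> domO"
  then show "\<bar>exp (- (freq n j)\<^sup>2 * (t - fst z)) * phi j (samp n (snd z))\<bar> \<le> 1"
    using abs_phi_le by (auto simp: abs_mult intro!: mult_le_one)
next
  show "(\<lambda>z. exp (- (freq n j)\<^sup>2 * (t - fst z)) * phi j (samp n (snd z))) \<in> borel_measurable borel"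
    by measurable
qed simp

lemma mint_linear:
  assumes "set_integrable lborel (domOT T) p" "set_integrable lborel (domOT T) q" "t \<le> T"
  shows "mint n (\<lambda>z. a * p z + b * q z) j t = a * mint n p j t + b * mint n q j t"
proof -
  let ?w = "\<lambda>z. exp (- (freq n j)\<^sup>2 * (t - fst z)) * phi j (samp n (snd z))"
  have "mint n (\<lambda>z. a * p z + b * q z) j t = (LBINT z:{0..t} \<times> domO. a * (?w z * p z) + b * (?w z * q z))"
    unfolding mint_def by (intro arg_cong2[where f = "set_lebesgue_integral lborel"] ext) (auto simp: algebra_simps)
  also have "\<dots> = a * mint n p j t + b * mint n q j t"
    unfolding mint_def using mint_integrable[OF assms(1,3)] mint_integrable[OF assms(2,3)]
    by (subst set_integral_add) auto
  finally show ?thesis .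
qed

lemma mint_diff:
  assumes "set_integrable lborel (domOT T) p" "set_integrable lborel (domOT T) q" "t \<le> T"
  shows "mint n p j t - mint n q j t = mint n (\<lambda>z. p z - q z) j t"
  using mint_linear[OF assms, of n 1 "-1" j] by simp

lemma mint_cong:
  "(\<And>z. z \<in> {0..t} \<times> domO \<Longrightarrow> p z = q z) \<Longrightarrow> mint n p j t = mint n q j t"
  unfolding mint_def by (intro set_lebesgue_integral_cong) auto

text \<open>The basic estimate for one mode. The weight merges with the decay to the rate
  \<open>\<nu>\<^sup>2 = \<mu>\<^sup>2 + \<beta>\<close>. The drift carries a factor \<mu>, and
  \<open>\<mu> / \<nu>\<^sup>2 \<le> 1 / \<nu>\<close>; the control is handled by Young's inequality
  balanced at \<nu>. Both parts are thus of order \<open>1 / \<nu>\<close>. Stating it for a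
  dominated \<open>F\<close> makes it apply to signed mode integrals and to absolute values
  alike.\<close>

lemma slab_integral_bound:
  assumes h: "h \<in> L2_OT T" "energy T h \<le> M" and t: "0 \<le> t" "t \<le> T" and "0 < \<beta>" "0 \<le> P"
    and p: "\<And>z. z \<in> {0..t} \<times> domO \<Longrightarrow> \<bar>p z\<bar> \<le> P * exp (\<beta> * fst z) * (freq n j + \<bar>h z\<bar>)"
    and F: "\<And>z. z \<in> {0..t} \<times> domO \<Longrightarrow> \<bar>F z\<bar> \<le> exp (- (freq n j)\<^sup>2 * (t - fst z)) * \<bar>p z\<bar>"
  shows "\<bar>LBINT z:{0..t} \<times> domO. F z\<bar> \<le> P * exp (\<beta> * t) * ((5 + M) * wt \<beta> j)"
proof -
  let ?m = "freq n j" and ?S = "{0..t} \<times> domO"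
  define \<nu> where "\<nu> = sqrt (?m\<^sup>2 + \<beta>)"
  have \<nu>: "0 < \<nu>" "\<nu>\<^sup>2 = ?m\<^sup>2 + \<beta>" "?m \<le> \<nu>"
    using assms freq_nonneg[of n j] by (auto simp: \<nu>_def add_nonneg_pos real_le_rsqrt)
  define g where "g z = P * exp (\<beta> * t) * (?m * exp (- \<nu>\<^sup>2 * (t - fst z)) + ((\<nu> / 2) * exp (- (2 * \<nu>\<^sup>2) * (t - fst z)) + 1 / (2 * \<nu>) * (h z)\<^sup>2))" for z
  have i1: "set_integrable lborel ?S (\<lambda>z. exp (- a * (t - fst z)))" for a
    by (intro set_integrable_continuous_compact compact_Times continuous_intros) auto
  have i2: "set_integrable lborel (domOT T) (\<lambda>z. (h z)\<^sup>2)" using h by (simp add: L2_OT_def)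
  have i3: "set_integrable lborel ?S (\<lambda>z. (h z)\<^sup>2)"
    using t slab_subset by (intro set_integrable_subset[OF i2]) auto
  have ii: "set_integrable lborel ?S (\<lambda>z. (\<nu> / 2) * exp (- (2 * \<nu>\<^sup>2) * (t - fst z)) + 1 / (2 * \<nu>) * (h z)\<^sup>2)"
    by (intro set_integral_add set_integrable_mult_right i1 i3)
  have ig: "set_integrable lborel ?S g"
    unfolding g_def by (intro set_integrable_mult_right set_integral_add(1) ii i1)
  have bound: "\<bar>F z\<bar> \<le> g z" if z: "z \<in> ?S" for z
  proof -
    have e: "exp (- ?m\<^sup>2 * (t - fst z)) * exp (\<beta> * fst z) = exp (\<beta> * t) * exp (- \<nu>\<^sup>2 * (t - fst z))"
      unfolding \<nu>(2) exp_add[symmetric] by (simp add: algebra_simps)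
    define E where "E = exp (- \<nu>\<^sup>2 * (t - fst z))"
    have E2: "E * E = exp (- (2 * \<nu>\<^sup>2) * (t - fst z))"
      unfolding E_def exp_add[symmetric] by (simp add: algebra_simps)
    \<comment> \<open>Young's inequality with parameter \<nu>: after integration the square of the
      exponential gains \<open>1 / \<nu>\<^sup>2\<close>, so both summands end up of order
      \<open>1 / \<nu>\<close>.\<close>
    have am: "E * \<bar>h z\<bar> \<le> (\<nu> / 2) * (E * E) + 1 / (2 * \<nu>) * (h z)\<^sup>2"
    proof -
      have "0 \<le> (\<nu> * E - \<bar>h z\<bar>)\<^sup>2" by simp
      then have "2 * \<nu> * (E * \<bar>h z\<bar>) \<le> \<nu>\<^sup>2 * (E * E) + (h z)\<^sup>2"
        by (simp add: power2_eq_square algebra_simps)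
      then have "(2 * \<nu> * (E * \<bar>h z\<bar>)) / (2 * \<nu>) \<le> (\<nu>\<^sup>2 * (E * E) + (h z)\<^sup>2) / (2 * \<nu>)"
        using \<nu> by (intro divide_right_mono) auto
      then show ?thesis using \<nu>(1) by (simp add: add_divide_distrib power2_eq_square)
    qed
    have "\<bar>F z\<bar> \<le> exp (- ?m\<^sup>2 * (t - fst z)) * \<bar>p z\<bar>" by (rule F[OF z])
    also have "\<dots> \<le> exp (- ?m\<^sup>2 * (t - fst z)) * (P * exp (\<beta> * fst z) * (?m + \<bar>h z\<bar>))"
      by (rule mult_left_mono[OF p[OF z]]) simp
    also have "\<dots> = P * (exp (- ?m\<^sup>2 * (t - fst z)) * exp (\<beta> * fst z)) * (?m + \<bar>h z\<bar>)" by simp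
    also have "\<dots> = P * exp (\<beta> * t) * (?m * E + E * \<bar>h z\<bar>)"
      unfolding e E_def[symmetric] by (simp add: algebra_simps)
    also have "\<dots> \<le> g z"
      unfolding g_def E2[symmetric] E_def[symmetric] using am \<open>0 \<le> P\<close>
      by (intro mult_left_mono add_left_mono) auto
    finally show ?thesis .
  qed
  have "\<bar>LBINT z:?S. F z\<bar> \<le> (LBINT z:?S. g z)"
    by (rule abs_set_integral_le[OF ig bound])
  also have "\<dots> = P * exp (\<beta> * t) * (?m * (LBINT z:?S. exp (- \<nu>\<^sup>2 * (t - fst z)))
     + ((\<nu> / 2) * (LBINT z:?S. exp (- (2 * \<nu>\<^sup>2) * (t - fst z))) + 1 / (2 * \<nu>) * (LBINT z:?S. (h z)\<^sup>2)))"
    unfolding g_def set_integral_mult_right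
    by (subst set_integral_add(2), intro set_integrable_mult_right i1, rule ii,
        subst set_integral_add(2), intro set_integrable_mult_right i1, intro set_integrable_mult_right i3) simp
  also have "\<dots> \<le> P * exp (\<beta> * t) * (?m * (pi / \<nu>\<^sup>2) + ((\<nu> / 2) * (pi / (2 * \<nu>\<^sup>2)) + 1 / (2 * \<nu>) * M))"
  proof -
    have "(LBINT z:?S. (h z)\<^sup>2) \<le> energy T h"
      unfolding energy_def set_lebesgue_integral_def
      using i2 i3 slab_subset[OF t(2)] unfolding set_integrable_def
      by (intro integral_mono) (auto simp: indicator_def)
    then have "(LBINT z:?S. (h z)\<^sup>2) \<le> M" using h by simp
    moreover have "0 < \<nu>\<^sup>2" "0 < 2 * \<nu>\<^sup>2" "0 \<le> \<nu> / 2" "0 \<le> 1 / (2 * \<nu>)" "0 \<le> P * exp (\<beta> * t)"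
      using \<nu>(1) \<open>0 \<le> P\<close> by simp_all
    ultimately show ?thesis
      using integral_exp_slab[OF t(1), of "\<nu>\<^sup>2"] integral_exp_slab[OF t(1), of "2 * \<nu>\<^sup>2"] freq_nonneg[of n j]
      by (intro mult_left_mono[of _ _ "P * exp (\<beta> * t)"] add_mono) (simp_all only: mult_left_mono)
  qed
  \<comment> \<open>The constant \<open>5\<close> absorbs \<open>pi + pi / 4\<close>: the drift
    gives \<open>pi\<close>, the squared exponential \<open>pi / 4\<close>.\<close>
  also have "\<dots> \<le> P * exp (\<beta> * t) * ((5 + M) * (1 / \<nu>))"
  proof -
    have "?m * (pi / \<nu>\<^sup>2) \<le> \<nu> * (pi / \<nu>\<^sup>2)" using \<nu>(3) by (intro mult_right_mono) simp_all
    also have "\<dots> = pi / \<nu>" using \<nu>(1) by (simp add: power2_eq_square)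
    finally have "?m * (pi / \<nu>\<^sup>2) \<le> pi / \<nu>" .
    moreover have "(\<nu> / 2) * (pi / (2 * \<nu>\<^sup>2)) = pi / 4 / \<nu>" using \<nu>(1) by (simp add: power2_eq_square)
    ultimately have "?m * (pi / \<nu>\<^sup>2) + ((\<nu> / 2) * (pi / (2 * \<nu>\<^sup>2)) + 1 / (2 * \<nu>) * M) \<le> (pi + pi / 4 + M / 2) / \<nu>"
      by (simp add: add_divide_distrib)
    also have "\<dots> \<le> (5 + M) / \<nu>"
    proof -
      have "pi \<le> 3.2" using pi_approx by simp
      moreover have "0 \<le> M" using energy_nonneg[of T h] h by simp
      ultimately show ?thesis using \<nu> by (intro divide_right_mono) auto
    qed
    finally show ?thesis using \<open>0 \<le> P\<close> by (intro mult_left_mono) auto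
  qed
  also have "\<dots> \<le> P * exp (\<beta> * t) * ((5 + M) * wt \<beta> j)"
    using wt_ge_freq[OF \<open>0 < \<beta>\<close>, of n j] energy_nonneg[of T h] h \<open>0 \<le> P\<close>
    by (intro mult_left_mono) (auto simp: \<nu>_def)
  finally show ?thesis .
qed

lemma mint_bound:
  assumes "h \<in> L2_OT T" "energy T h \<le> M" "0 \<le> t" "t \<le> T" "0 < \<beta>" "0 \<le> P"
    "\<And>z. z \<in> {0..t} \<times> domO \<Longrightarrow> \<bar>p z\<bar> \<le> P * exp (\<beta> * fst z) * (freq n j + \<bar>h z\<bar>)"
  shows "\<bar>mint n p j t\<bar> \<le> P * exp (\<beta> * t) * ((5 + M) * wt \<beta> j)"
  unfolding mint_def
  by (rule slab_integral_bound[OF assms])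
    (auto simp: abs_mult abs_phi_le intro!: mult_left_le_one_le)

text \<open>Factoring out \<open>exp (- \<mu>\<^sup>2 t)\<close> leaves \<open>t\<close> only in the
  domain of integration, where dominated convergence applies although \<open>p\<close> is merely
  integrable.\<close>

lemma continuous_on_mint:
  assumes p: "set_integrable lborel (domOT T) p"
  shows "continuous_on {0..T} (mint n p j)"
proof -
  let ?q = "\<lambda>z. exp ((freq n j)\<^sup>2 * fst z) * phi j (samp n (snd z)) * p z"
  define I where "I t = (LBINT z:{0..t} \<times> domO. ?q z)" for t
  have eq: "mint n p j t = exp (- (freq n j)\<^sup>2 * t) * I t" for t
  proof -
    have "mint n p j t = (LBINT z:{0..t} \<times> domO. exp (- (freq n j)\<^sup>2 * t) * ?q z)"
      unfolding mint_def
      by (simp add: algebra_simps exp_diff exp_minus divide_inverse)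
    then show ?thesis by (simp add: I_def)
  qed
  have iq: "set_integrable lborel (domOT T) ?q"
  proof (rule set_integrable_mult_bounded[where C = "exp ((freq n j)\<^sup>2 * T)", OF p])
    fix z assume "z \<in> domOT T"
    then have "exp ((freq n j)\<^sup>2 * fst z) * \<bar>phi j (samp n (snd z))\<bar> \<le> exp ((freq n j)\<^sup>2 * T) * 1"
      using abs_phi_le by (intro mult_mono) (auto simp: domOT_def intro!: mult_left_mono)
    then show "\<bar>exp ((freq n j)\<^sup>2 * fst z) * phi j (samp n (snd z))\<bar> \<le> exp ((freq n j)\<^sup>2 * T)"
      by (simp add: abs_mult)
  qed measurable
  have "continuous_on {0..T} I"
    unfolding continuous_on_sequentially
  proof (intro allI ballI impI)
    fix u a assume a: "a \<in> {0..T}" and u: "(\<forall>i. u i \<in> {0..T}) \<and> u \<longlonglongrightarrow> a"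
    have "(\<lambda>i. integral\<^sup>L lborel (\<lambda>z. indicator ({0..u i} \<times> domO) z *\<^sub>R ?q z)) \<longlonglongrightarrow> 
          integral\<^sup>L lborel (\<lambda>z. indicator ({0..a} \<times> domO) z *\<^sub>R ?q z)"
    proof (rule integral_dominated_convergence[where w = "\<lambda>z. \<bar>indicator (domOT T) z *\<^sub>R ?q z\<bar>"])
      show "integrable lborel (\<lambda>z. \<bar>indicator (domOT T) z *\<^sub>R ?q z\<bar>)"
        using iq unfolding set_integrable_def by (rule integrable_abs)
      have m: "(\<lambda>z. indicator ({0..r} \<times> domO) z *\<^sub>R ?q z) \<in> borel_measurable lborel" if "r \<le> T" for r
        using set_integrable_subset[OF iq _ slab_subset[OF that]] unfolding set_integrable_def by auto
      show "(\<lambda>z. indicator ({0..a} \<times> domO) z *\<^sub>R ?q z) \<in> borel_measurable lborel"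
        "\<And>i. (\<lambda>z. indicator ({0..u i} \<times> domO) z *\<^sub>R ?q z) \<in> borel_measurable lborel"
        by (rule m; use a u in auto)+
      have "AE z in (lborel :: (real \<times> real) measure). fst z \<noteq> a" by (rule AE_fst_neq)
      then show "AE z in lborel. (\<lambda>i. indicator ({0..u i} \<times> domO) z *\<^sub>R ?q z) \<longlonglongrightarrow> indicator ({0..a} \<times> domO) z *\<^sub>R ?q z"
      proof eventually_elim
        fix z :: "real \<times> real" assume za: "fst z \<noteq> a"
        have "\<forall>\<^sub>F i in sequentially. indicator ({0..u i} \<times> domO) z = (indicator ({0..a} \<times> domO) z :: real)"
        proof (cases "fst z < a")
          case True
          then have "\<forall>\<^sub>F i in sequentially. fst z < u i" using u by (intro order_tendstoD(1)[of u a]) auto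
          then show ?thesis by eventually_elim (use True in \<open>auto simp: indicator_def mem_Times_iff\<close>)
        next
          case False
          then have "\<forall>\<^sub>F i in sequentially. u i < fst z" using u za by (intro order_tendstoD(2)[of u a]) auto
          then show ?thesis by eventually_elim (use False za in \<open>auto simp: indicator_def mem_Times_iff\<close>)
        qed
        then have "\<forall>\<^sub>F i in sequentially. indicator ({0..u i} \<times> domO) z *\<^sub>R ?q z = indicator ({0..a} \<times> domO) z *\<^sub>R ?q z"
          by eventually_elim simp
        then show "(\<lambda>i. indicator ({0..u i} \<times> domO) z *\<^sub>R ?q z) \<longlonglongrightarrow> indicator ({0..a} \<times> domO) z *\<^sub>R ?q z"
          by (rule tendsto_eventually)
      qed
      show "AE z in lborel. norm (indicator ({0..u i} \<times> domO) z *\<^sub>R ?q z) \<le> \<bar>indicator (domOT T) z *\<^sub>R ?q z\<bar>" for i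
        using u slab_subset[of "u i" T] by (intro AE_I2) (auto simp: indicator_def)
    qed
    then show "(I \<circ> u) \<longlonglongrightarrow> I a" unfolding I_def set_lebesgue_integral_def o_def .
  qed
  then have "continuous_on {0..T} (\<lambda>t. exp (- (freq n j)\<^sup>2 * t) * I t)"
    by (intro continuous_intros)
  then show ?thesis unfolding eq[abs_def] .
qed

subsection \<open>Mild solutions and stability\<close>

definition icoef :: "nat \<Rightarrow> (real \<Rightarrow> real) \<Rightarrow> nat \<Rightarrow> real" where
  "icoef n u0 j = (if n = 0 \<or> j < n then LBINT y:domO. phi j (samp n y) * u0 (samp n y) else 0)"

text \<open>On mode \<open>j\<close> the Laplacian is multiplication by minus the frequency, which
  explains the second term. The nonlinear terms see the sampled point, the control the true one, as
  in the discrete equation.\<close>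

definition source ::
  "nat \<Rightarrow> (real \<Rightarrow> real) \<Rightarrow> (real \<Rightarrow> real) \<Rightarrow> (real \<times> real \<Rightarrow> real) \<Rightarrow> (real \<times> real \<Rightarrow> real) \<Rightarrow> nat \<Rightarrow> real \<times> real \<Rightarrow> real"
where
  "source n b \<sigma> h f j z =
     \<sigma> (f (fst z, samp n (snd z))) * h z - freq n j * b (f (fst z, samp n (snd z)))"

definition modec ::
  "nat \<Rightarrow> (real \<Rightarrow> real) \<Rightarrow> (real \<Rightarrow> real) \<Rightarrow> (real \<Rightarrow> real) \<Rightarrow> (real \<times> real \<Rightarrow> real) \<Rightarrow> (real \<times> real \<Rightarrow> real) \<Rightarrow> nat \<Rightarrow> real \<Rightarrow> real"
where
  "modec n b \<sigma> u0 h f j t = exp (- (freq n j)\<^sup>2 * t) * icoef n u0 j + mint n (source n b \<sigma> h f j) j t"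

definition mild ::
  "nat \<Rightarrow> (real \<Rightarrow> real) \<Rightarrow> (real \<Rightarrow> real) \<Rightarrow> (real \<Rightarrow> real) \<Rightarrow> (real \<times> real \<Rightarrow> real) \<Rightarrow> (real \<times> real \<Rightarrow> real) \<Rightarrow> real \<Rightarrow> real \<Rightarrow> real"
where
  "mild n b \<sigma> u0 h f t x = (\<Sum>j. trial n j x * modec n b \<sigma> u0 h f j t)"

definition sol ::
  "real \<Rightarrow> nat \<Rightarrow> (real \<Rightarrow> real) \<Rightarrow> (real \<Rightarrow> real) \<Rightarrow> (real \<Rightarrow> real) \<Rightarrow> (real \<times> real \<Rightarrow> real) \<Rightarrow> (real \<times> real \<Rightarrow> real) \<Rightarrow> bool"
where
  "sol T n b \<sigma> u0 h f \<longleftrightarrow> continuous_on (domOT T) f \<and>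
     (\<forall>t\<in>{0..T}. \<forall>x\<in>domO. f (t, x) = mild n b \<sigma> u0 h f t x)"

text \<open>The bound is required for all meshes at once; it expresses two derivatives of regularity
  together with the Neumann condition.\<close>

definition decaying :: "(real \<Rightarrow> real) \<Rightarrow> real \<Rightarrow> bool" where
  "decaying u0 V \<longleftrightarrow> (\<forall>n j. \<bar>icoef n u0 j\<bar> \<le> V * wt 1 j)"

definition W :: "real \<Rightarrow> real" where "W \<beta> = (\<Sum>j. wt \<beta> j)"

lemma W_nonneg: "0 < \<beta> \<Longrightarrow> 0 \<le> W \<beta>"
  unfolding W_def by (intro suminf_nonneg summable_wt wt_nonneg) auto

lemma decaying_nonneg: "decaying u0 V \<Longrightarrow> 0 \<le> V"
  unfolding decaying_def by (drule spec[of _ 0], drule spec[of _ 0]) simp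

lemma samp_pair_in_domOT: "z \<in> domOT T \<Longrightarrow> (fst z, samp n (snd z)) \<in> domOT T"
  by (auto simp: domOT_def samp_in_domO)

lemma measurable_compose_samp:
  fixes f :: "real \<times> real \<Rightarrow> real" and g :: "real \<Rightarrow> real"
  assumes "continuous_on (domOT T) f" "continuous_on UNIV g" "0 \<le> T"
  shows "set_borel_measurable lborel (domOT T) (\<lambda>z. g (f (fst z, samp n (snd z))))"
proof -
  \<comment> \<open>Clamping to the rectangle extends \<open>f\<close> continuously to the plane, so
    that composition with the discontinuous sampling map stays Borel.\<close>
  define c where "c z = (max 0 (min T (fst z)), max 0 (min pi (snd z)))" for z :: "real \<times> real"
  have c: "c z \<in> domOT T" for z using assms(3) by (auto simp: c_def domOT_def domO_def)
  have cid: "c z = z" if "z \<in> domOT T" for z using that by (auto simp: c_def domOT_def domO_def)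
  have "continuous_on UNIV c" unfolding c_def by (intro continuous_intros)
  then have "continuous_on UNIV (\<lambda>z. f (c z))"
    using c by (intro continuous_on_compose2[OF assms(1)]) auto
  then have "continuous_on UNIV (\<lambda>z. g (f (c z)))"
    by (intro continuous_on_compose2[OF assms(2)]) auto
  then have [measurable]: "(\<lambda>z. g (f (c z))) \<in> borel_measurable borel"
    by (rule borel_measurable_continuous_onI)
  have [measurable]: "(\<lambda>z. (fst z, samp n (snd z))) \<in> borel_measurable (borel :: (real \<times> real) measure)"
    by measurable
  have "(\<lambda>z. indicator (domOT T) z *\<^sub>R g (f (c (fst z, samp n (snd z))))) \<in> borel_measurable borel"
    by measurable
  moreover have "indicator (domOT T) z *\<^sub>R g (f (c (fst z, samp n (snd z)))) = indicator (domOT T) z *\<^sub>R g (f (fst z, samp n (snd z)))" for z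
    using cid[OF samp_pair_in_domOT, of z n] by (auto simp: indicator_def)
  ultimately show ?thesis unfolding set_borel_measurable_def by (simp only: measurable_lborel2)
qed

lemma source_measurable:
  assumes "continuous_on (domOT T) f" "continuous_on UNIV b" "continuous_on UNIV \<sigma>"
    "set_borel_measurable lborel (domOT T) h" "0 \<le> T"
  shows "set_borel_measurable lborel (domOT T) (source n b \<sigma> h f j)"
proof -
  note * = measurable_compose_samp[OF assms(1,2,5), of n] measurable_compose_samp[OF assms(1,3,5), of n] assms(4)
  have "(\<lambda>z. (indicator (domOT T) z *\<^sub>R \<sigma> (f (fst z, samp n (snd z)))) * (indicator (domOT T) z *\<^sub>R h z)
      - freq n j * (indicator (domOT T) z *\<^sub>R b (f (fst z, samp n (snd z))))) \<in> borel_measurable lborel"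
    using * unfolding set_borel_measurable_def by measurable
  then show ?thesis unfolding set_borel_measurable_def source_def
    by (rule measurable_cong[THEN iffD1, rotated]) (auto simp: indicator_def)
qed

lemma source_abs_le:
  assumes "\<And>z. z \<in> domOT T \<Longrightarrow> \<bar>b (f z)\<bar> \<le> B" "\<And>z. z \<in> domOT T \<Longrightarrow> \<bar>\<sigma> (f z)\<bar> \<le> K" "z \<in> domOT T"
  shows "\<bar>source n b \<sigma> h f j z\<bar> \<le> (B + K) * (freq n j + \<bar>h z\<bar>)"
proof -
  let ?w = "(fst z, samp n (snd z))"
  have w: "\<bar>b (f ?w)\<bar> \<le> B" "\<bar>\<sigma> (f ?w)\<bar> \<le> K" using assms samp_pair_in_domOT[OF assms(3)] by blast+
  then have "0 \<le> B" "0 \<le> K" using abs_ge_zero order_trans by blast+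
  have "\<bar>source n b \<sigma> h f j z\<bar> \<le> \<bar>\<sigma> (f ?w) * h z\<bar> + \<bar>freq n j * b (f ?w)\<bar>"
    unfolding source_def by (rule abs_triangle_ineq4)
  also have "\<dots> \<le> K * \<bar>h z\<bar> + freq n j * B"
    using w freq_nonneg[of n j] unfolding abs_mult by (intro add_mono mult_mono) auto
  also have "\<dots> \<le> (B + K) * (freq n j + \<bar>h z\<bar>)"
    using \<open>0 \<le> B\<close> \<open>0 \<le> K\<close> freq_nonneg[of n j] by (simp add: algebra_simps)
  finally show ?thesis .
qed

lemma compose_bounded:
  fixes f :: "real \<times> real \<Rightarrow> real" and g :: "real \<Rightarrow> real"
  assumes "continuous_on (domOT T) f" "continuous_on UNIV g"
  obtains B where "\<And>z. z \<in> domOT T \<Longrightarrow> \<bar>g (f z)\<bar> \<le> B"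
proof -
  have "continuous_on (domOT T) (\<lambda>z. g (f z))"
    by (rule continuous_on_compose2[OF assms(2,1)]) auto
  then have "compact ((\<lambda>z. g (f z)) ` domOT T)" by (rule compact_continuous_image) simp
  then obtain B where "\<forall>y\<in>(\<lambda>z. g (f z)) ` domOT T. norm y \<le> B"
    by (meson compact_imp_bounded bounded_iff)
  then show ?thesis using that[of B] by auto
qed

lemma source_integrable:
  assumes "continuous_on (domOT T) f" "continuous_on UNIV b" "continuous_on UNIV \<sigma>" "h \<in> L2_OT T" "0 \<le> T"
  shows "set_integrable lborel (domOT T) (source n b \<sigma> h f j)"
proof -
  obtain B where B: "\<And>z. z \<in> domOT T \<Longrightarrow> \<bar>b (f z)\<bar> \<le> B" using compose_bounded[OF assms(1,2)] by blast
  obtain K where K: "\<And>z. z \<in> domOT T \<Longrightarrow> \<bar>\<sigma> (f z)\<bar> \<le> K" using compose_bounded[OF assms(1,3)] by blast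
  have i: "set_integrable lborel (domOT T) (\<lambda>z. (B + K) * (freq n j + \<bar>h z\<bar>))"
    using L2_OT_integrable[OF assms(4)]
    by (intro set_integrable_mult_right set_integral_add(1) set_integrable_abs set_integrable_continuous_compact[where f = "\<lambda>_. freq n j"]) auto
  show ?thesis
  proof (intro set_integrable_bound[OF i] source_measurable AE_I2 impI assms)
    fix z assume "z \<in> domOT T"
    then show "norm (source n b \<sigma> h f j z) \<le> norm ((B + K) * (freq n j + \<bar>h z\<bar>))"
      using source_abs_le[where b = b and f = f and \<sigma> = \<sigma> and B = B and K = K and h = h and n = n and j = j and z = z and T = T, OF B K]
      by simp
  qed (use assms in \<open>simp add: L2_OT_def\<close>)
qed

lemma mint_source_bound:
  assumes "h \<in> L2_OT T" "energy T h \<le> M" "0 \<le> t" "t \<le> T"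
    "\<And>z. z \<in> domOT T \<Longrightarrow> \<bar>b (f z)\<bar> \<le> B" "\<And>z. z \<in> domOT T \<Longrightarrow> \<bar>\<sigma> (f z)\<bar> \<le> K"
  shows "\<bar>mint n (source n b \<sigma> h f j) j t\<bar> \<le> (B + K) * exp T * (5 + M) * wt 1 j"
proof -
  have "(0, 0) \<in> domOT T" using assms by (simp add: domOT_def)
  then have nn: "0 \<le> B" "0 \<le> K" using assms(5,6) abs_ge_zero order_trans by blast+
  have "\<bar>mint n (source n b \<sigma> h f j) j t\<bar> \<le> (B + K) * exp (1 * t) * ((5 + M) * wt 1 j)"
  proof (rule mint_bound[OF assms(1-4)])
    fix z assume z: "z \<in> {0..t} \<times> domO"
    then have "z \<in> domOT T" using slab_subset[OF assms(4)] by blast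
    then have "\<bar>source n b \<sigma> h f j z\<bar> \<le> (B + K) * 1 * (freq n j + \<bar>h z\<bar>)"
      using source_abs_le[where b = b and f = f and \<sigma> = \<sigma> and B = B and K = K and z = z, OF assms(5,6)] by simp
    also have "\<dots> \<le> (B + K) * exp (1 * fst z) * (freq n j + \<bar>h z\<bar>)"
      using z nn freq_nonneg[of n j] by (intro mult_right_mono mult_left_mono) auto
    finally show "\<bar>source n b \<sigma> h f j z\<bar> \<le> (B + K) * exp (1 * fst z) * (freq n j + \<bar>h z\<bar>)" .
  qed (use nn in auto)
  also have "\<dots> \<le> (B + K) * exp T * ((5 + M) * wt 1 j)"
    using nn assms(4) energy_nonneg[of T h] assms(2) wt_nonneg[of 1 j]
    by (intro mult_right_mono mult_left_mono) auto
  finally show ?thesis by (simp add: mult_ac)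
qed

lemma modec_bound:
  assumes "h \<in> L2_OT T" "energy T h \<le> M" "0 \<le> t" "t \<le> T" "decaying u0 V"
    "\<And>z. z \<in> domOT T \<Longrightarrow> \<bar>b (f z)\<bar> \<le> B" "\<And>z. z \<in> domOT T \<Longrightarrow> \<bar>\<sigma> (f z)\<bar> \<le> K"
  shows "\<bar>modec n b \<sigma> u0 h f j t\<bar> \<le> (V + (B + K) * exp T * (5 + M)) * wt 1 j"
proof -
  have "\<bar>exp (- (freq n j)\<^sup>2 * t) * icoef n u0 j\<bar> \<le> 1 * (V * wt 1 j)"
    unfolding abs_mult using assms by (intro mult_mono) (auto simp: decaying_def)
  moreover note mint_source_bound[OF assms(1-4), of b f B \<sigma> K n j] assms(6,7)
  ultimately show ?thesis unfolding modec_def by (simp add: algebra_simps)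
qed

lemma abs_trial_mult_le: "x \<in> domO \<Longrightarrow> \<bar>c\<bar> \<le> d \<Longrightarrow> \<bar>trial n j x * c\<bar> \<le> d"
  using abs_trial_le[of x n j] mult_mono[of "\<bar>trial n j x\<bar>" 1 "\<bar>c\<bar>" d] by (simp add: abs_mult)

lemma abs_suminf_le:
  fixes f g :: "nat \<Rightarrow> real"
  assumes "\<And>j. \<bar>f j\<bar> \<le> g j" "summable g"
  shows "summable f" "\<bar>\<Sum>j. f j\<bar> \<le> (\<Sum>j. g j)"
proof -
  have s: "summable (\<lambda>j. \<bar>f j\<bar>)"
    using assms by (intro summable_comparison_test[OF _ assms(2)]) auto
  then show "summable f" by (rule summable_rabs_cancel)
  have "\<bar>\<Sum>j. f j\<bar> \<le> (\<Sum>j. \<bar>f j\<bar>)" using s by (rule summable_rabs)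
  also have "\<dots> \<le> (\<Sum>j. g j)" using assms s by (intro suminf_le) auto
  finally show "\<bar>\<Sum>j. f j\<bar> \<le> (\<Sum>j. g j)" .
qed

lemma summable_wt_mult: "0 < \<beta> \<Longrightarrow> summable (\<lambda>j. c * wt \<beta> j)"
  and suminf_wt_mult: "0 < \<beta> \<Longrightarrow> (\<Sum>j. c * wt \<beta> j) = c * W \<beta>"
  unfolding W_def by (auto intro: summable_mult summable_wt suminf_mult)

lemma mild_summable:
  assumes "h \<in> L2_OT T" "energy T h \<le> M" "0 \<le> t" "t \<le> T" "decaying u0 V" "x \<in> domO"
    "\<And>z. z \<in> domOT T \<Longrightarrow> \<bar>b (f z)\<bar> \<le> B" "\<And>z. z \<in> domOT T \<Longrightarrow> \<bar>\<sigma> (f z)\<bar> \<le> K"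
  shows "summable (\<lambda>j. trial n j x * modec n b \<sigma> u0 h f j t)"
proof (rule abs_suminf_le(1)[OF _ summable_wt_mult])
  show "\<bar>trial n j x * modec n b \<sigma> u0 h f j t\<bar> \<le> (V + (B + K) * exp T * (5 + M)) * wt 1 j" for j
    by (intro abs_trial_mult_le modec_bound assms) auto
qed simp

lemma continuous_on_suminf:
  fixes g :: "nat \<Rightarrow> 'a::topological_space \<Rightarrow> real"
  assumes "\<And>j. continuous_on S (g j)" "\<And>j z. z \<in> S \<Longrightarrow> \<bar>g j z\<bar> \<le> m j" "summable m"
  shows "continuous_on S (\<lambda>z. \<Sum>j. g j z)"
proof -
  have "uniform_limit S (\<lambda>N z. \<Sum>j<N. g j z) (\<lambda>z. \<Sum>j. g j z) sequentially"
    using assms by (intro Weierstrass_m_test) auto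
  then show ?thesis
    by (rule uniform_limit_theorem[rotated]) (auto intro!: always_eventually continuous_on_sum assms)
qed

lemma continuous_on_mild:
  assumes "continuous_on (domOT T) f" "continuous_on UNIV b" "continuous_on UNIV \<sigma>" "h \<in> L2_OT T" "0 \<le> T" "decaying u0 V"
  shows "continuous_on (domOT T) (\<lambda>z. mild n b \<sigma> u0 h f (fst z) (snd z))"
proof -
  obtain B where B: "\<And>z. z \<in> domOT T \<Longrightarrow> \<bar>b (f z)\<bar> \<le> B" using compose_bounded[OF assms(1,2)] by blast
  obtain K where K: "\<And>z. z \<in> domOT T \<Longrightarrow> \<bar>\<sigma> (f z)\<bar> \<le> K" using compose_bounded[OF assms(1,3)] by blast
  show ?thesis unfolding mild_def
  proof (rule continuous_on_suminf)
    fix j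
    have "continuous_on {0..T} (modec n b \<sigma> u0 h f j)"
      unfolding modec_def by (intro continuous_intros continuous_on_mint source_integrable assms)
    then have "continuous_on (domOT T) (\<lambda>z. modec n b \<sigma> u0 h f j (fst z))"
      by (rule continuous_on_compose2) (auto intro!: continuous_intros simp: domOT_def)
    moreover have "continuous_on (domOT T) (\<lambda>z. trial n j (snd z))"
      by (rule continuous_on_compose2[OF continuous_on_trial]) (auto intro!: continuous_intros simp: domOT_def)
    ultimately show "continuous_on (domOT T) (\<lambda>z. trial n j (snd z) * modec n b \<sigma> u0 h f j (fst z))"
      by (intro continuous_intros)
    fix z assume "z \<in> domOT T"
    then show "\<bar>trial n j (snd z) * modec n b \<sigma> u0 h f j (fst z)\<bar> \<le> (V + (B + K) * exp T * (5 + energy T h)) * wt 1 j"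
      by (intro abs_trial_mult_le modec_bound assms B K) (auto simp: domOT_def)
  qed (intro summable_wt_mult, simp)
qed

text \<open>Lipschitz estimate for the solution map in the weighted norm: the drift difference is
  multiplied by \<mu> and the diffusion difference by \<open>\<bar>h\<bar>\<close>, exactly the two
  shapes allowed in \<open>mint_bound\<close>. The factor \<open>W \<beta>\<close> can be made
  small, and only times up to \<open>t\<close> enter.\<close>

lemma mild_diff_le:
  assumes f: "continuous_on (domOT T) f" and g: "continuous_on (domOT T) g"
    and b: "continuous_on UNIV b" and \<sigma>: "continuous_on UNIV \<sigma>"
    and h: "h \<in> L2_OT T" "energy T h \<le> M" and u0: "decaying u0 V"
    and t: "0 \<le> t" "t \<le> T" and x: "x \<in> domO" and "0 < \<beta>" "0 \<le> P"
    and bd: "\<And>s y. s \<in> {0..t} \<Longrightarrow> y \<in> domO \<Longrightarrow> \<bar>b (f (s, y)) - b (g (s, y))\<bar> \<le> P * exp (\<beta> * s)"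
    and \<sigma>d: "\<And>s y. s \<in> {0..t} \<Longrightarrow> y \<in> domO \<Longrightarrow> \<bar>\<sigma> (f (s, y)) - \<sigma> (g (s, y))\<bar> \<le> P * exp (\<beta> * s)"
  shows "\<bar>mild n b \<sigma> u0 h f t x - mild n b \<sigma> u0 h g t x\<bar> \<le> P * exp (\<beta> * t) * ((5 + M) * W \<beta>)"
proof -
  have T: "0 \<le> T" using t by simp
  obtain B where B: "\<And>z. z \<in> domOT T \<Longrightarrow> \<bar>b (f z)\<bar> \<le> B" using compose_bounded[OF f b] by blast
  obtain K where K: "\<And>z. z \<in> domOT T \<Longrightarrow> \<bar>\<sigma> (f z)\<bar> \<le> K" using compose_bounded[OF f \<sigma>] by blast
  obtain B' where B': "\<And>z. z \<in> domOT T \<Longrightarrow> \<bar>b (g z)\<bar> \<le> B'" using compose_bounded[OF g b] by blast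
  obtain K' where K': "\<And>z. z \<in> domOT T \<Longrightarrow> \<bar>\<sigma> (g z)\<bar> \<le> K'" using compose_bounded[OF g \<sigma>] by blast
  note s1 = mild_summable[where b = b and f = f and \<sigma> = \<sigma> and B = B and K = K and n = n, OF h t u0 x B K]
    and s2 = mild_summable[where b = b and f = g and \<sigma> = \<sigma> and B = B' and K = K' and n = n, OF h t u0 x B' K']
  have "\<bar>trial n j x * modec n b \<sigma> u0 h f j t - trial n j x * modec n b \<sigma> u0 h g j t\<bar> \<le> P * exp (\<beta> * t) * (5 + M) * wt \<beta> j" for j
  proof -
    have "\<bar>mint n (\<lambda>z. source n b \<sigma> h f j z - source n b \<sigma> h g j z) j t\<bar> \<le> P * exp (\<beta> * t) * ((5 + M) * wt \<beta> j)"
    proof (rule mint_bound[OF h t \<open>0 < \<beta>\<close> \<open>0 \<le> P\<close>])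
      fix z assume z: "z \<in> {0..t} \<times> domO"
      let ?w = "(fst z, samp n (snd z))"
      have "source n b \<sigma> h f j z - source n b \<sigma> h g j z = (\<sigma> (f ?w) - \<sigma> (g ?w)) * h z - freq n j * (b (f ?w) - b (g ?w))"
        by (simp add: source_def algebra_simps)
      also have "\<bar>\<dots>\<bar> \<le> \<bar>\<sigma> (f ?w) - \<sigma> (g ?w)\<bar> * \<bar>h z\<bar> + freq n j * \<bar>b (f ?w) - b (g ?w)\<bar>"
        using freq_nonneg[of n j] by (intro order.trans[OF abs_triangle_ineq4]) (simp add: abs_mult)
      also have "\<dots> \<le> P * exp (\<beta> * fst z) * \<bar>h z\<bar> + freq n j * (P * exp (\<beta> * fst z))"
        using z samp_in_domO[of "snd z" n] freq_nonneg[of n j]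
        by (intro add_mono mult_right_mono mult_left_mono bd \<sigma>d) auto
      finally show "\<bar>source n b \<sigma> h f j z - source n b \<sigma> h g j z\<bar> \<le> P * exp (\<beta> * fst z) * (freq n j + \<bar>h z\<bar>)"
        by (simp add: algebra_simps)
    qed
    then have "\<bar>mint n (source n b \<sigma> h f j) j t - mint n (source n b \<sigma> h g j) j t\<bar> \<le> P * exp (\<beta> * t) * ((5 + M) * wt \<beta> j)"
      using mint_diff[OF source_integrable[OF f b \<sigma> h(1) T] source_integrable[OF g b \<sigma> h(1) T] t(2)] by simp
    then have "\<bar>trial n j x * (modec n b \<sigma> u0 h f j t - modec n b \<sigma> u0 h g j t)\<bar> \<le> P * exp (\<beta> * t) * ((5 + M) * wt \<beta> j)"
      by (intro abs_trial_mult_le x) (simp add: modec_def)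
    then show ?thesis by (simp add: algebra_simps)
  qed
  from abs_suminf_le(2)[OF this summable_wt_mult[OF \<open>0 < \<beta>\<close>]]
  have "\<bar>\<Sum>j. trial n j x * modec n b \<sigma> u0 h f j t - trial n j x * modec n b \<sigma> u0 h g j t\<bar> \<le> P * exp (\<beta> * t) * ((5 + M) * W \<beta>)"
    unfolding suminf_wt_mult[OF \<open>0 < \<beta>\<close>] by (simp only: mult.assoc)
  also have "(\<Sum>j. trial n j x * modec n b \<sigma> u0 h f j t - trial n j x * modec n b \<sigma> u0 h g j t)
      = mild n b \<sigma> u0 h f t x - mild n b \<sigma> u0 h g t x"
    unfolding mild_def by (rule suminf_diff[OF s1 s2, symmetric])
  finally show ?thesis .
qed

text \<open>Instead of a Gronwall inequality: the weighted difference attains its maximum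
  \<open>D\<close> on the compact slab, and the hypothesis at the maximum point absorbs half of
  \<open>D\<close> into the left side.\<close>

lemma stability:
  fixes f g :: "real \<times> real \<Rightarrow> real"
  assumes f: "continuous_on (domOT T) f" and g: "continuous_on (domOT T) g" and "0 < \<beta>"
    and \<tau>: "0 \<le> \<tau>" "\<tau> \<le> T" and "0 \<le> a" "0 \<le> q" "q \<le> 1 / 2"
    and step: "\<And>t x D. t \<in> {0..\<tau>} \<Longrightarrow> x \<in> domO \<Longrightarrow> 0 \<le> D \<Longrightarrow>
       (\<And>s y. s \<in> {0..t} \<Longrightarrow> y \<in> domO \<Longrightarrow> \<bar>f (s, y) - g (s, y)\<bar> \<le> D * exp (\<beta> * s)) \<Longrightarrow>
       \<bar>f (t, x) - g (t, x)\<bar> \<le> a + q * (D * exp (\<beta> * t))"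
    and tx: "t \<in> {0..\<tau>}" "x \<in> domO"
  shows "\<bar>f (t, x) - g (t, x)\<bar> \<le> 2 * a * exp (\<beta> * \<tau>)"
proof -
  let ?S = "{0..\<tau>} \<times> domO"
  let ?d = "\<lambda>z. \<bar>f z - g z\<bar> * exp (- \<beta> * fst z)"
  have "continuous_on ?S ?d"
    using f g slab_subset[OF \<tau>(2)] by (intro continuous_intros) (auto elim: continuous_on_subset)
  moreover have "compact ?S" by (intro compact_Times) auto
  moreover have "?S \<noteq> {}" using tx by auto
  ultimately obtain z0 where z0: "z0 \<in> ?S" "\<forall>z\<in>?S. ?d z \<le> ?d z0"
    using continuous_attains_sup[of ?S ?d] by blast
  define D where "D = ?d z0"
  have D0: "0 \<le> D" by (simp add: D_def)
  have Dle: "\<bar>f (s, y) - g (s, y)\<bar> \<le> D * exp (\<beta> * s)" if "s \<in> {0..\<tau>}" "y \<in> domO" for s y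
  proof -
    have "?d (s, y) \<le> D" using z0(2) that unfolding D_def by blast
    then have "?d (s, y) * exp (\<beta> * s) \<le> D * exp (\<beta> * s)" by (rule mult_right_mono) simp
    moreover have "exp (- \<beta> * s) * exp (\<beta> * s) = 1" by (simp flip: exp_add)
    ultimately show ?thesis by (simp only: mult.assoc fst_conv mult_1_right)
  qed
  obtain t0 x0 where z0': "z0 = (t0, x0)" "t0 \<in> {0..\<tau>}" "x0 \<in> domO" using z0(1) by auto
  have "\<bar>f (t0, x0) - g (t0, x0)\<bar> \<le> a + q * (D * exp (\<beta> * t0))"
    by (rule step) (use z0' D0 Dle in auto)
  also have "\<dots> \<le> a + 1 / 2 * (D * exp (\<beta> * t0))"
    using assms D0 by (intro add_left_mono mult_right_mono) auto
  also have "D * exp (\<beta> * t0) = \<bar>f (t0, x0) - g (t0, x0)\<bar>"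
    unfolding D_def z0'(1) by (simp add: mult.assoc flip: exp_add)
  finally have "\<bar>f (t0, x0) - g (t0, x0)\<bar> \<le> 2 * a" by simp
  moreover have "exp (- \<beta> * t0) \<le> 1" using z0' \<open>0 < \<beta>\<close> by simp
  ultimately have "D \<le> 2 * a * 1" unfolding D_def z0'(1) fst_conv by (intro mult_mono) auto
  have "\<bar>f (t, x) - g (t, x)\<bar> \<le> D * exp (\<beta> * t)" by (rule Dle) (use tx in auto)
  also have "\<dots> \<le> 2 * a * exp (\<beta> * \<tau>)"
    using \<open>D \<le> 2 * a * 1\<close> D0 tx \<open>0 < \<beta>\<close> by (intro mult_mono) auto
  finally show ?thesis .
qed

lemma exists_weight:
  assumes "0 \<le> L" shows "\<exists>\<beta>>0. L * W \<beta> \<le> 1 / 2"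
proof -
  have "((\<lambda>\<beta>. L * W \<beta>) \<longlongrightarrow> L * 0) at_top"
    unfolding W_def by (intro tendsto_mult tendsto_const suminf_wt_tendsto)
  then have "\<forall>\<^sub>F \<beta> in at_top. L * W \<beta> < 1 / 2" by (rule order_tendstoD) simp
  then have "\<forall>\<^sub>F \<beta> in at_top. 0 < \<beta> \<and> L * W \<beta> \<le> 1 / 2"
    using eventually_gt_at_top[of 0] by eventually_elim simp
  then have "\<exists>\<beta>. 0 < \<beta> \<and> L * W \<beta> \<le> 1 / 2" by (rule eventually_happens'[rotated]) simp
  then show ?thesis by blast
qed

text \<open>The number \<open>a\<close> is the residual with which \<open>f\<close> and
  \<open>g\<close> solve the same equation. Lipschitz bounds are asked only along the values of
  \<open>f\<close> and \<open>g\<close>, so the statement also serves the cubic nonlinearity once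
  both functions are bounded.\<close>

lemma mild_stability:
  assumes f: "continuous_on (domOT T) f" and g: "continuous_on (domOT T) g"
    and b: "continuous_on UNIV b" and \<sigma>: "continuous_on UNIV \<sigma>"
    and h: "h \<in> L2_OT T" "energy T h \<le> M" and u0: "decaying u0 V"
    and \<tau>: "0 \<le> \<tau>" "\<tau> \<le> T" and "0 < \<beta>" "0 \<le> L" "L * (5 + M) * W \<beta> \<le> 1 / 2" "0 \<le> a"
    and bd: "\<And>z. z \<in> domOT T \<Longrightarrow> \<bar>b (f z) - b (g z)\<bar> \<le> L * \<bar>f z - g z\<bar>"
    and \<sigma>d: "\<And>z. z \<in> domOT T \<Longrightarrow> \<bar>\<sigma> (f z) - \<sigma> (g z)\<bar> \<le> L * \<bar>f z - g z\<bar>"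
    and err: "\<And>t x. t \<in> {0..\<tau>} \<Longrightarrow> x \<in> domO \<Longrightarrow>
      \<bar>f (t, x) - g (t, x)\<bar> \<le> a + \<bar>mild n b \<sigma> u0 h f t x - mild n b \<sigma> u0 h g t x\<bar>"
    and tx: "t \<in> {0..\<tau>}" "x \<in> domO"
  shows "\<bar>f (t, x) - g (t, x)\<bar> \<le> 2 * a * exp (\<beta> * \<tau>)"
proof (rule stability[OF f g \<open>0 < \<beta>\<close> \<tau> \<open>0 \<le> a\<close> _ \<open>L * (5 + M) * W \<beta> \<le> 1 / 2\<close> _ tx])
  have M: "0 \<le> M" using energy_nonneg[of T h] h by simp
  then show "0 \<le> L * (5 + M) * W \<beta>" using assms W_nonneg[of \<beta>] by auto
  fix t x D
  assume t: "t \<in> {0..\<tau>}" and x: "x \<in> domO" and "0 \<le> D"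
    and D: "\<And>s y. s \<in> {0..t} \<Longrightarrow> y \<in> domO \<Longrightarrow> \<bar>f (s, y) - g (s, y)\<bar> \<le> D * exp (\<beta> * s)"
  have in_dom: "(s, y) \<in> domOT T" if "s \<in> {0..t}" "y \<in> domO" for s y
    using that t \<tau> by (auto simp: domOT_def)
  have "L * \<bar>f (s, y) - g (s, y)\<bar> \<le> (L * D) * exp (\<beta> * s)" if "s \<in> {0..t}" "y \<in> domO" for s y
    using mult_left_mono[OF D[OF that] \<open>0 \<le> L\<close>] by simp
  then have "\<bar>mild n b \<sigma> u0 h f t x - mild n b \<sigma> u0 h g t x\<bar> \<le> (L * D) * exp (\<beta> * t) * ((5 + M) * W \<beta>)"
    using t \<tau> \<open>0 \<le> L\<close> \<open>0 \<le> D\<close>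
    by (intro mild_diff_le[OF f g b \<sigma> h u0 _ _ x \<open>0 < \<beta>\<close>] order.trans[OF bd[OF in_dom]] order.trans[OF \<sigma>d[OF in_dom]]) auto
  then show "\<bar>f (t, x) - g (t, x)\<bar> \<le> a + L * (5 + M) * W \<beta> * (D * exp (\<beta> * t))"
    using err[OF t x] by (simp add: mult_ac)
qed

text \<open>Banach's fixed point theorem in the bounded continuous functions on the plane. The
  unknown is \<open>exp (- \<beta> t) f\<close>, which makes the plain sup metric the weighted one,
  and the clamp \<open>c\<close> turns functions on the rectangle into functions on the
  plane.\<close>

lemma exists_sol_lipschitz:
  assumes "0 \<le> T" and b: "\<And>x y. \<bar>b x - b y\<bar> \<le> L * \<bar>x - y\<bar>" and \<sigma>: "\<And>x y. \<bar>\<sigma> x - \<sigma> y\<bar> \<le> L * \<bar>x - y\<bar>"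
    and "0 \<le> L" and h: "h \<in> L2_OT T" and u0: "decaying u0 V"
  shows "\<exists>f. sol T n b \<sigma> u0 h f"
proof -
  have lip: "continuous_on UNIV g" if "\<And>x y. \<bar>g x - g y\<bar> \<le> L * \<bar>x - y\<bar>" for g :: "real \<Rightarrow> real"
    using that \<open>0 \<le> L\<close> by (intro lipschitz_on_continuous_on[of L]) (auto simp: lipschitz_on_def dist_real_def)
  note bc = lip[OF b] and \<sigma>c = lip[OF \<sigma>]
  define M where "M = energy T h"
  have "0 \<le> L * (5 + M)" using \<open>0 \<le> L\<close> energy_nonneg[of T h] by (simp add: M_def)
  then obtain \<beta> where \<beta>: "0 < \<beta>" "L * (5 + M) * W \<beta> \<le> 1 / 2" using exists_weight by blast
  define c where "c z = (max 0 (min T (fst z)), max 0 (min pi (snd z)))" for z :: "real \<times> real"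
  have c: "c z \<in> domOT T" for z using \<open>0 \<le> T\<close> by (auto simp: c_def domOT_def domO_def)
  have cid: "c z = z" if "z \<in> domOT T" for z using that by (auto simp: c_def domOT_def domO_def)
  have cc: "continuous_on UNIV c" unfolding c_def by (intro continuous_intros)
  define E where "E g z = exp (\<beta> * fst z) * g z" for g :: "real \<times> real \<Rightarrow> real" and z
  have E: "continuous_on (domOT T) (E (apply_bcontfun g))" for g
    unfolding E_def by (intro continuous_intros) auto
  define F where "F g z = exp (- \<beta> * fst (c z)) * mild n b \<sigma> u0 h (E (apply_bcontfun g)) (fst (c z)) (snd (c z))" for g z
  have F: "F g \<in> bcontfun" for g
  proof -
    have cont: "continuous_on (domOT T) (\<lambda>z. exp (- \<beta> * fst z) * mild n b \<sigma> u0 h (E (apply_bcontfun g)) (fst z) (snd z))"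
      by (intro continuous_intros continuous_on_mild[OF E bc \<sigma>c h \<open>0 \<le> T\<close> u0])
    have "continuous_on UNIV (F g)"
      unfolding F_def using continuous_on_compose2[OF cont cc] c by (simp add: image_subset_iff)
    moreover have "bounded ((\<lambda>z. exp (- \<beta> * fst z) * mild n b \<sigma> u0 h (E (apply_bcontfun g)) (fst z) (snd z)) ` domOT T)"
      by (intro compact_imp_bounded compact_continuous_image cont) simp
    then have "bounded (range (F g))"
      by (rule bounded_subset) (use c in \<open>force simp: F_def\<close>)
    ultimately show ?thesis by (simp add: bcontfun_def)
  qed
  define \<Phi> where "\<Phi> g = Bcontfun (F g)" for g
  have ap: "apply_bcontfun (\<Phi> g) = F g" for g
    unfolding \<Phi>_def using F by (rule Bcontfun_inverse)
  have "dist (\<Phi> g) (\<Phi> g') \<le> 1 / 2 * dist g g'" for g g'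
  proof (rule dist_bound)
    fix z
    obtain t x where tx: "c z = (t, x)" by fastforce
    then have t: "0 \<le> t" "t \<le> T" "x \<in> domO" using c[of z] by (auto simp: domOT_def)
    have Ed: "\<bar>E g (s, y) - E g' (s, y)\<bar> \<le> dist g g' * exp (\<beta> * s)" for s y
      using dist_bounded[of g "(s, y)" g'] by (simp add: E_def dist_real_def abs_mult mult_right_mono mult.commute flip: right_diff_distrib)
    have LE: "L * \<bar>E g (s, y) - E g' (s, y)\<bar> \<le> (L * dist g g') * exp (\<beta> * s)" for s y
      using mult_left_mono[OF Ed \<open>0 \<le> L\<close>] by (simp only: mult.assoc)
    have "\<bar>mild n b \<sigma> u0 h (E g) t x - mild n b \<sigma> u0 h (E g') t x\<bar> \<le> (L * dist g g') * exp (\<beta> * t) * ((5 + M) * W \<beta>)"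
      using \<open>0 \<le> L\<close> t
      by (intro mild_diff_le[OF E E bc \<sigma>c h _ u0 _ _ _ \<beta>(1)] order.trans[OF b LE] order.trans[OF \<sigma> LE]) (auto simp: M_def)
    then have "exp (- \<beta> * t) * \<bar>mild n b \<sigma> u0 h (E g) t x - mild n b \<sigma> u0 h (E g') t x\<bar>
        \<le> exp (- \<beta> * t) * ((L * dist g g') * exp (\<beta> * t) * ((5 + M) * W \<beta>))"
      by (rule mult_left_mono) simp
    also have "\<dots> = (exp (- \<beta> * t) * exp (\<beta> * t)) * (L * (5 + M) * W \<beta>) * dist g g'" by (simp only: mult_ac)
    also have "exp (- \<beta> * t) * exp (\<beta> * t) = 1" by (simp flip: exp_add)
    also have "1 * (L * (5 + M) * W \<beta>) * dist g g' \<le> 1 / 2 * dist g g'"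
      using \<beta>(2) by (intro mult_right_mono) auto
    finally show "dist (apply_bcontfun (\<Phi> g) z) (apply_bcontfun (\<Phi> g') z) \<le> 1 / 2 * dist g g'"
      unfolding ap F_def tx by (simp add: dist_real_def abs_mult flip: right_diff_distrib)
  qed
  then have "\<exists>!g. \<Phi> g = g" by (intro banach_fix_type[of "1/2"]) auto
  then obtain g where g: "\<Phi> g = g" by blast
  have "sol T n b \<sigma> u0 h (E g)"
    unfolding sol_def
  proof (intro conjI ballI E)
    fix t x assume "t \<in> {0..T}" "x \<in> domO"
    then have "c (t, x) = (t, x)" by (intro cid) (simp add: domOT_def)
    then have "E g (t, x) = exp (\<beta> * t) * (exp (- \<beta> * t) * mild n b \<sigma> u0 h (E g) t x)"
      using ap[of g] unfolding g by (simp add: E_def F_def)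
    then show "E g (t, x) = mild n b \<sigma> u0 h (E g) t x"
      by (simp add: mult.assoc[symmetric] flip: exp_add)
  qed
  then show ?thesis by blast
qed

subsection \<open>Approximation of the forcing\<close>

text \<open>Indicators are approximated by a Urysohn function between a closed set inside and an
  open set outside; sums and dominated limits follow from the induction for integrable
  functions.\<close>

lemma approx_integrable_continuous:
  fixes f :: "'a::euclidean_space \<Rightarrow> real"
  assumes "integrable lborel f"
  shows "\<forall>\<epsilon>>0. \<exists>G. continuous_on UNIV G \<and> integrable lborel G \<and> (LBINT x. \<bar>f x - G x\<bar>) < \<epsilon>"
  using assms
proof (induction f rule: integrable_induct)
  case (base A c)
  show ?case
  proof (intro allI impI)
    fix \<epsilon> :: real assume "0 < \<epsilon>"
    \<comment> \<open>The summand \<open>1\<close> keeps the quotient meaningful for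
      \<open>c = 0\<close>; the factor \<open>2\<close> pays for the inner and the outer
      error.\<close>
    define e where "e = \<epsilon> / (2 * (\<bar>c\<bar> + 1))"
    have "0 < e" using \<open>0 < \<epsilon>\<close> by (simp add: e_def)
    have A: "A \<in> sets lebesgue" "A \<in> sets borel" using base by auto
    obtain C where C: "closed C" "C \<subseteq> A" "A - C \<in> lmeasurable" "emeasure lebesgue (A - C) < ennreal e"
      using sets_lebesgue_inner_closed[OF A(1) \<open>0 < e\<close>] .
    obtain U where U: "open U" "A \<subseteq> U" "U - A \<in> lmeasurable" "emeasure lebesgue (U - A) < ennreal e"
      using sets_lebesgue_outer_open[OF A(1) \<open>0 < e\<close>] .
    have cl: "closed (- U)" "- U \<inter> C = {}" using C U by auto
    obtain \<phi> :: "'a \<Rightarrow> real" where \<phi>: "continuous_on UNIV \<phi>" "\<And>x. \<phi> x \<in> closed_segment 0 1"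
        "\<And>x. x \<in> - U \<Longrightarrow> \<phi> x = 0" "\<And>x. x \<in> C \<Longrightarrow> \<phi> x = 1"
      by (rule Urysohn[OF cl(1) C(1) cl(2), where a = "0 :: real" and b = 1]) (rule that)
    have \<phi>01: "0 \<le> \<phi> x" "\<phi> x \<le> 1" for x using \<phi>(2)[of x] by (auto simp: closed_segment_eq_real_ivl)
    have m: "measure lborel (A - C) < e" "measure lborel (U - A) < e" "emeasure lborel (A - C) < \<infinity>" "emeasure lborel (U - A) < \<infinity>"
    proof -
      have "A - C \<in> sets borel" "U - A \<in> sets borel" using A C U by auto
      then have *: "emeasure lborel (A - C) < ennreal e" "emeasure lborel (U - A) < ennreal e"
        using C U by simp_all
      then show "emeasure lborel (A - C) < \<infinity>" "emeasure lborel (U - A) < \<infinity>"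
        by (auto intro: less_trans)
      show "measure lborel (A - C) < e" "measure lborel (U - A) < e"
        using * \<open>0 < e\<close> by (simp_all add: measure_def enn2real_less_iff less_trans[OF _ ennreal_less_top])
    qed
    let ?J = "\<lambda>x. indicator (A - C) x + indicator (U - A) x :: real"
    have iJ: "integrable lborel ?J"
      using m A C U by (intro Bochner_Integration.integrable_add integrable_real_indicator) auto
    have le: "\<bar>indicator A x - \<phi> x\<bar> \<le> ?J x" for x
      using \<phi>01[of x] \<phi>(3)[of x] \<phi>(4)[of x] C(2) U(2) by (auto simp: indicator_def)
    have [measurable]: "\<phi> \<in> borel_measurable borel" using \<phi>(1) by (rule borel_measurable_continuous_onI)
    have iA: "integrable lborel (indicator A :: 'a \<Rightarrow> real)" using base by (intro integrable_real_indicator) auto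
    have id: "integrable lborel (\<lambda>x. indicator A x - \<phi> x)"
      using A le by (intro Bochner_Integration.integrable_bound[OF iJ]) (auto intro!: AE_I2 order.trans[OF le])
    have "integrable lborel (\<lambda>x. indicator A x - (indicator A x - \<phi> x))"
      by (intro Bochner_Integration.integrable_diff iA id)
    then have "integrable lborel \<phi>" by simp
    then have "integrable lborel (\<lambda>x. \<phi> x * c)" by simp
    moreover have "continuous_on UNIV (\<lambda>x. \<phi> x * c)" by (intro continuous_intros \<phi>(1))
    moreover have "(LBINT x. \<bar>indicator A x *\<^sub>R c - \<phi> x * c\<bar>) < \<epsilon>"
    proof -
      have "(LBINT x. \<bar>indicator A x *\<^sub>R c - \<phi> x * c\<bar>) = (LBINT x. \<bar>c\<bar> * \<bar>indicator A x - \<phi> x\<bar>)"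
        by (intro Bochner_Integration.integral_cong) (auto simp: abs_mult simp flip: left_diff_distrib)
      also have "\<dots> = \<bar>c\<bar> * (LBINT x. \<bar>indicator A x - \<phi> x\<bar>)" by simp
      also have "\<dots> \<le> \<bar>c\<bar> * (LBINT x. ?J x)"
        using id le by (intro mult_left_mono integral_mono integrable_abs iJ) auto
      also have "(LBINT x. ?J x) = measure lborel (A - C) + measure lborel (U - A)"
        using m A C U by (subst Bochner_Integration.integral_add) auto
      also have "\<bar>c\<bar> * (measure lborel (A - C) + measure lborel (U - A)) \<le> \<bar>c\<bar> * (2 * e)"
        using m by (intro mult_left_mono) auto
      also have "\<dots> < (\<bar>c\<bar> + 1) * (2 * e)" using \<open>0 < e\<close> by simp
      also have "\<dots> = \<epsilon>"
      proof -
        have "\<bar>c\<bar> + 1 \<noteq> 0" by linarith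
        then show ?thesis by (simp add: e_def field_simps)
      qed
      finally show ?thesis .
    qed
    ultimately show "\<exists>G. continuous_on UNIV G \<and> integrable lborel G \<and> (LBINT x. \<bar>indicator A x *\<^sub>R c - G x\<bar>) < \<epsilon>"
      by blast
  qed
next
  case (add f g)
  show ?case
  proof (intro allI impI)
    fix \<epsilon> :: real assume "0 < \<epsilon>"
    then have e: "0 < \<epsilon> / 2" by simp
    obtain F where F: "continuous_on UNIV F" "integrable lborel F" "(LBINT x. \<bar>f x - F x\<bar>) < \<epsilon> / 2"
      using add e by blast
    obtain G where G: "continuous_on UNIV G" "integrable lborel G" "(LBINT x. \<bar>g x - G x\<bar>) < \<epsilon> / 2"
      using add e by blast
    have "(LBINT x. \<bar>(f x + g x) - (F x + G x)\<bar>) \<le> (LBINT x. \<bar>f x - F x\<bar> + \<bar>g x - G x\<bar>)"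
      using add F G by (intro integral_mono) auto
    also have "\<dots> = (LBINT x. \<bar>f x - F x\<bar>) + (LBINT x. \<bar>g x - G x\<bar>)"
      using add F G by (intro Bochner_Integration.integral_add) auto
    also have "\<dots> < \<epsilon>" using F G by simp
    finally have "(LBINT x. \<bar>(f x + g x) - (F x + G x)\<bar>) < \<epsilon>" .
    then show "\<exists>G. continuous_on UNIV G \<and> integrable lborel G \<and> (LBINT x. \<bar>f x + g x - G x\<bar>) < \<epsilon>"
      using F G by (intro exI[of _ "\<lambda>x. F x + G x"]) (auto intro!: continuous_intros)
  qed
next
  case (lim f s)
  show ?case
  proof (intro allI impI)
    fix \<epsilon> :: real assume "0 < \<epsilon>"
    then have e: "0 < \<epsilon> / 2" by simp
    have "(\<lambda>i. LBINT x. \<bar>f x - s i x\<bar>) \<longlonglongrightarrow> integral\<^sup>L lborel (\<lambda>x::'a. 0 :: real)"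
    proof (rule integral_dominated_convergence[where w = "\<lambda>x. 3 * \<bar>f x\<bar>"])
      show "AE x in lborel. (\<lambda>i. \<bar>f x - s i x\<bar>) \<longlonglongrightarrow> (0::real)"
      proof (intro AE_I2)
        fix x :: 'a
        have "(\<lambda>i. \<bar>f x - s i x\<bar>) \<longlonglongrightarrow> \<bar>f x - f x\<bar>" using lim.hyps(2)[of x] by (intro tendsto_intros) auto
        then show "(\<lambda>i. \<bar>f x - s i x\<bar>) \<longlonglongrightarrow> 0" by simp
      qed
      show "AE x in lborel. norm \<bar>f x - s i x\<bar> \<le> 3 * \<bar>f x\<bar>" for i
      proof (intro AE_I2)
        fix x
        have "\<bar>s i x\<bar> \<le> 2 * \<bar>f x\<bar>" using lim.hyps(3)[of x i] by simp
        then show "norm \<bar>f x - s i x\<bar> \<le> 3 * \<bar>f x\<bar>" by simp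
      qed
    qed (use lim in auto)
    then have "\<forall>\<^sub>F i in sequentially. (LBINT x. \<bar>f x - s i x\<bar>) < \<epsilon> / 2"
      using e by (intro order_tendstoD) auto
    then obtain i where i: "(LBINT x. \<bar>f x - s i x\<bar>) < \<epsilon> / 2" by (auto simp: eventually_sequentially)
    obtain G where G: "continuous_on UNIV G" "integrable lborel G" "(LBINT x. \<bar>s i x - G x\<bar>) < \<epsilon> / 2"
      using lim.IH[of i] e by blast
    have "(LBINT x. \<bar>f x - G x\<bar>) \<le> (LBINT x. \<bar>f x - s i x\<bar> + \<bar>s i x - G x\<bar>)"
      using lim G by (intro integral_mono) auto
    also have "\<dots> = (LBINT x. \<bar>f x - s i x\<bar>) + (LBINT x. \<bar>s i x - G x\<bar>)"
      using lim G by (intro Bochner_Integration.integral_add) auto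
    also have "\<dots> < \<epsilon>" using i G by simp
    finally show "\<exists>G. continuous_on UNIV G \<and> integrable lborel G \<and> (LBINT x. \<bar>f x - G x\<bar>) < \<epsilon>"
      using G by blast
  qed
qed

text \<open>Approximating \<open>q \<bar>q\<bar>\<close> in \<open>L\<^sup>1\<close> and taking signed square roots approximates \<open>q\<close> in
  \<open>L\<^sup>2\<close>.\<close>

lemma signed_sqrt_diff_le: "(x - sgn c * sqrt \<bar>c\<bar>)\<^sup>2 \<le> 2 * \<bar>x * \<bar>x\<bar> - c\<bar>" for x c :: real
proof -
  define y where "y = sgn c * sqrt \<bar>c\<bar>"
  have "\<bar>y\<bar> = sqrt \<bar>c\<bar>" by (auto simp: y_def abs_mult sgn_if)
  then have c: "c = y * \<bar>y\<bar>" by (auto simp: y_def sgn_if)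
  have "(x - y)\<^sup>2 \<le> 2 * \<bar>x * \<bar>x\<bar> - y * \<bar>y\<bar>\<bar>"
  \<comment> \<open>For equal signs the right side contains
    \<open>\<bar>x\<^sup>2 - y\<^sup>2\<bar>\<close>, which factors; for opposite signs it contains
    the full sum of squares.\<close>
  proof (cases "0 \<le> x * y")
    case True
    then have *: "\<bar>x * \<bar>x\<bar> - y * \<bar>y\<bar>\<bar> = \<bar>x - y\<bar> * \<bar>x + y\<bar>"
    proof -
      have "\<bar>x * \<bar>x\<bar> - y * \<bar>y\<bar>\<bar> = \<bar>x * x - y * y\<bar>"
        using True by (cases "0 \<le> x"; cases "0 \<le> y") (auto simp: zero_le_mult_iff)
      also have "x * x - y * y = (x - y) * (x + y)" by (simp add: algebra_simps)
      finally show ?thesis by (simp add: abs_mult)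
    qed
    have "\<bar>x - y\<bar> \<le> \<bar>x + y\<bar>" using True by (auto simp: zero_le_mult_iff)
    then have "\<bar>x - y\<bar> * \<bar>x - y\<bar> \<le> \<bar>x - y\<bar> * \<bar>x + y\<bar>" by (intro mult_left_mono) auto
    then have "(x - y)\<^sup>2 \<le> \<bar>x - y\<bar> * \<bar>x + y\<bar>" by (simp add: power2_eq_square)
    also have "\<dots> \<le> 2 * (\<bar>x - y\<bar> * \<bar>x + y\<bar>)" by simp
    finally show ?thesis unfolding * .
  next
    case False
    then have "\<bar>x * \<bar>x\<bar> - y * \<bar>y\<bar>\<bar> = x\<^sup>2 + y\<^sup>2"
      by (cases "0 \<le> x"; cases "0 \<le> y") (auto simp: zero_le_mult_iff power2_eq_square)
    moreover have "0 \<le> (x + y)\<^sup>2" by simp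
    ultimately show ?thesis by (simp add: power2_eq_square algebra_simps)
  qed
  then show ?thesis by (simp add: y_def[symmetric] flip: c)
qed

lemma approx_L2_continuous:
  assumes q: "q \<in> L2_OT T" and "0 < \<epsilon>"
  obtains g where "continuous_on UNIV g" "(\<lambda>z. q z - g z) \<in> L2_OT T"
    "energy T (\<lambda>z. q z - g z) \<le> \<epsilon>" "energy T g \<le> energy T q + \<epsilon>"
proof -
  let ?f = "\<lambda>z. indicator (domOT T) z *\<^sub>R (q z * \<bar>q z\<bar>)"
  have qi: "set_integrable lborel (domOT T) (\<lambda>z. (q z)\<^sup>2)" and
    qm: "(\<lambda>z. indicator (domOT T) z *\<^sub>R q z) \<in> borel_measurable lborel"
    using q by (auto simp: L2_OT_def set_borel_measurable_def)
  have fm: "?f \<in> borel_measurable lborel"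
  proof -
    have "(\<lambda>z. (indicator (domOT T) z *\<^sub>R q z) * \<bar>indicator (domOT T) z *\<^sub>R q z\<bar>) \<in> borel_measurable lborel"
      using qm by measurable
    then show ?thesis by (rule measurable_cong[THEN iffD1, rotated]) (auto simp: indicator_def)
  qed
  have fi: "integrable lborel ?f"
    using qi fm unfolding set_integrable_def
    by (rule Bochner_Integration.integrable_bound) (auto simp: indicator_def abs_mult power2_eq_square)
  from approx_integrable_continuous[OF this] \<open>0 < \<epsilon>\<close>
  have "\<exists>G. continuous_on UNIV G \<and> integrable lborel G \<and> (LBINT z. \<bar>?f z - G z\<bar>) < \<epsilon> / 2"
    using half_gt_zero by blast
  then obtain G where G: "continuous_on UNIV G" "integrable lborel G" "(LBINT z. \<bar>?f z - G z\<bar>) < \<epsilon> / 2"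
    by blast
  define g where "g z = sgn (G z) * sqrt \<bar>G z\<bar>" for z
  have g2: "(g z)\<^sup>2 = \<bar>G z\<bar>" for z by (auto simp: g_def power_mult_distrib sgn_if)
  have "continuous_on UNIV g"
  proof -
    have "g = (\<lambda>z. sqrt (max (G z) 0) - sqrt (max (- G z) 0))"
      by (auto simp: g_def fun_eq_iff sgn_if max_def)
    then show ?thesis using G(1) by (auto intro!: continuous_intros)
  qed
  have int: "integrable lborel (\<lambda>z. 2 * \<bar>?f z - G z\<bar>)"
    using fi G by auto
  have intS: "set_integrable lborel (domOT T) (\<lambda>z. 2 * \<bar>?f z - G z\<bar>)"
    unfolding set_integrable_def by (rule integrable_mult_indicator[OF _ int]) simp
  have le: "(q z - g z)\<^sup>2 \<le> 2 * \<bar>?f z - G z\<bar>" if "z \<in> domOT T" for z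
    using signed_sqrt_diff_le[of "q z" "G z"] that by (simp add: g_def)
  have gm: "g \<in> borel_measurable borel" using \<open>continuous_on UNIV g\<close> by (rule borel_measurable_continuous_onI)
  have dm: "set_borel_measurable lborel (domOT T) (\<lambda>z. q z - g z)"
  proof -
    have "(\<lambda>z. indicator (domOT T) z *\<^sub>R q z - indicator (domOT T) z *\<^sub>R g z) \<in> borel_measurable lborel"
      using qm gm by measurable
    then show ?thesis unfolding set_borel_measurable_def by (simp add: algebra_simps)
  qed
  have d: "(\<lambda>z. q z - g z) \<in> L2_OT T" by (rule L2_OT_I[OF dm intS le])
  have "energy T (\<lambda>z. q z - g z) \<le> (LBINT z:domOT T. 2 * \<bar>?f z - G z\<bar>)"
    unfolding energy_def using d intS le by (intro set_integral_mono) (auto simp: L2_OT_def)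
  also have "\<dots> \<le> (LBINT z. 2 * \<bar>?f z - G z\<bar>)"
    unfolding set_lebesgue_integral_def using intS int unfolding set_integrable_def
    by (intro integral_mono) (auto simp: indicator_def)
  also have "\<dots> \<le> \<epsilon>" using G(3) by simp
  finally have e1: "energy T (\<lambda>z. q z - g z) \<le> \<epsilon>" .
  \<comment> \<open>Since the square of \<open>g\<close> is \<open>\<bar>G\<bar>\<close>, the
    first-power approximation bounds the energy of \<open>g\<close> by that of \<open>q\<close> plus
    an error, without a multiplicative constant.\<close>
  have "energy T g = (LBINT z:domOT T. \<bar>G z\<bar>)" by (simp add: energy_def g2)
  also have "\<dots> \<le> (LBINT z. \<bar>?f z\<bar> + \<bar>?f z - G z\<bar>)"
    unfolding set_lebesgue_integral_def using G(2) fi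
    by (intro integral_mono integrable_mult_indicator) (auto simp: indicator_def)
  also have "\<dots> = (LBINT z. \<bar>?f z\<bar>) + (LBINT z. \<bar>?f z - G z\<bar>)"
    using G(2) fi by (intro Bochner_Integration.integral_add) auto
  also have "(LBINT z. \<bar>?f z\<bar>) = energy T q"
    unfolding energy_def set_lebesgue_integral_def
    by (intro Bochner_Integration.integral_cong) (auto simp: abs_mult power2_eq_square)
  finally have "energy T g \<le> energy T q + \<epsilon>" using G(3) \<open>0 < \<epsilon>\<close> by simp
  then show ?thesis using that d e1 \<open>continuous_on UNIV g\<close> by blast
qed

lemma continuous_in_L2_OT:
  assumes "continuous_on (domOT T) g" shows "g \<in> L2_OT T"
  unfolding L2_OT_def set_borel_measurable_def
proof (intro CollectI conjI)
  show "(\<lambda>z. indicator (domOT T) z *\<^sub>R g z) \<in> borel_measurable lborel"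
    using set_integrable_continuous_compact[OF compact_domOT assms] unfolding set_integrable_def by auto
  show "set_integrable lborel (domOT T) (\<lambda>z. (g z)\<^sup>2)"
    by (intro set_integrable_continuous_compact continuous_intros assms) simp
qed

lemma L2_OT_scale: "h \<in> L2_OT T \<Longrightarrow> (\<lambda>z. c * h z) \<in> L2_OT T"
  and energy_scale: "energy T (\<lambda>z. c * h z) = c\<^sup>2 * energy T h"
proof -
  assume h: "h \<in> L2_OT T"
  then have "(\<lambda>z. c * (indicator (domOT T) z *\<^sub>R h z)) \<in> borel_measurable lborel"
    unfolding L2_OT_def set_borel_measurable_def by (auto intro!: borel_measurable_times)
  then show "(\<lambda>z. c * h z) \<in> L2_OT T"
    using h unfolding L2_OT_def set_borel_measurable_def by (auto simp: power_mult_distrib mult_ac)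
qed (simp add: energy_def power_mult_distrib)

section \<open>Absorbing the diffusion coefficient into the forcing\<close>

lemma forcing_L2:
  fixes \<sigma> :: "real \<Rightarrow> real" and f h :: "real \<times> real \<Rightarrow> real"
  assumes "continuous_on (domOT T) f" "continuous_on UNIV \<sigma>" "h \<in> L2_OT T" "0 \<le> T"
    "\<And>z. z \<in> domOT T \<Longrightarrow> \<bar>\<sigma> (f z)\<bar> \<le> K"
  shows "(\<lambda>z. \<sigma> (f (fst z, samp n (snd z))) * h z) \<in> L2_OT T"
    and "energy T (\<lambda>z. \<sigma> (f (fst z, samp n (snd z))) * h z) \<le> K\<^sup>2 * energy T h"
proof -
  let ?q = "\<lambda>z. \<sigma> (f (fst z, samp n (snd z))) * h z"
  have "set_borel_measurable lborel (domOT T) (source n (\<lambda>_. 0) \<sigma> h f 0)"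
    using assms by (intro source_measurable) (auto simp: L2_OT_def)
  then have m: "set_borel_measurable lborel (domOT T) ?q"
    by (simp add: source_def[abs_def])
  have i: "set_integrable lborel (domOT T) (\<lambda>z. K\<^sup>2 * (h z)\<^sup>2)"
    using assms by (auto simp: L2_OT_def)
  have le: "(?q z)\<^sup>2 \<le> K\<^sup>2 * (h z)\<^sup>2" if "z \<in> domOT T" for z
    unfolding power_mult_distrib using assms(5)[OF samp_pair_in_domOT[OF that]]
    by (intro mult_right_mono abs_le_square_iff[THEN iffD1] order.trans[OF _ abs_ge_self]) auto
  show L: "?q \<in> L2_OT T" by (rule L2_OT_I[OF m i le])
  have "energy T ?q \<le> (LBINT z:domOT T. K\<^sup>2 * (h z)\<^sup>2)"
    unfolding energy_def using L i le by (intro set_integral_mono) (auto simp: L2_OT_def)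
  then show "energy T ?q \<le> K\<^sup>2 * energy T h" by (simp add: energy_def)
qed

lemma mint_source_forcing:
  "mint n (source n b \<sigma> h f j) j t = mint n (source n b (\<lambda>_. 1) (\<lambda>z. \<sigma> (f (fst z, samp n (snd z))) * h z) f j) j t"
  by (simp add: source_def[abs_def])

lemma mild_forcing: "mild n b \<sigma> u0 h f t x = mild n b (\<lambda>_. 1) u0 (\<lambda>z. \<sigma> (f (fst z, samp n (snd z))) * h z) f t x"
  unfolding mild_def modec_def mint_source_forcing[of n b \<sigma>] ..

text \<open>Once \<open>f\<close> is given, \<open>\<sigma> (f) h\<close> is just another square
  integrable function. Read from left to right this removes \<sigma> for the energy estimate; read
  backwards it produces controls by dividing a forcing by \<open>\<sigma> (f)\<close>.\<close>

lemma sol_forcing: "sol T n b \<sigma> u0 h f \<longleftrightarrow> sol T n b (\<lambda>_. 1) u0 (\<lambda>z. \<sigma> (f (fst z, samp n (snd z))) * h z) f"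
  unfolding sol_def mild_forcing[of n b \<sigma>] ..

lemma L2_add:
  assumes "f \<in> L2_OT T" "g \<in> L2_OT T" shows "(\<lambda>z. f z + g z) \<in> L2_OT T"
proof (rule L2_OT_I)
  have "(\<lambda>z. indicator (domOT T) z *\<^sub>R f z + indicator (domOT T) z *\<^sub>R g z) \<in> borel_measurable lborel"
    using assms unfolding L2_OT_def set_borel_measurable_def by (intro borel_measurable_add) auto
  then show "set_borel_measurable lborel (domOT T) (\<lambda>z. f z + g z)"
    unfolding set_borel_measurable_def by (simp add: algebra_simps)
  show "set_integrable lborel (domOT T) (\<lambda>z. 2 * (f z)\<^sup>2 + 2 * (g z)\<^sup>2)"
    using assms by (intro set_integral_add(1)) (auto simp: L2_OT_def)
  show "(f z + g z)\<^sup>2 \<le> 2 * (f z)\<^sup>2 + 2 * (g z)\<^sup>2" for z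
    using zero_le_power2[of "f z - g z"] by (simp add: power2_eq_square algebra_simps)
qed

text \<open>With \<open>f\<close> held fixed the map is affine in the forcing, so a perturbation
  appears as a separate linear response.\<close>

lemma mild_forcing_add:
  assumes f: "continuous_on (domOT T) f" and b: "continuous_on UNIV b" and q: "q \<in> L2_OT T" "d \<in> L2_OT T"
    and u0: "decaying u0 V" and t: "0 \<le> t" "t \<le> T" and x: "x \<in> domO"
  shows "mild n b (\<lambda>_. 1) u0 (\<lambda>z. q z + d z) f t x = mild n b (\<lambda>_. 1) u0 q f t x + (\<Sum>j. trial n j x * mint n d j t)"
    and "summable (\<lambda>j. trial n j x * mint n d j t)"
proof -
  have T: "0 \<le> T" using t by simp
  obtain B where B: "\<And>z. z \<in> domOT T \<Longrightarrow> \<bar>b (f z)\<bar> \<le> B" using compose_bounded[OF f b] by blast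
  have eq: "modec n b (\<lambda>_. 1) u0 (\<lambda>z. q z + d z) f j t = modec n b (\<lambda>_. 1) u0 q f j t + mint n d j t" for j
  proof -
    have "source n b (\<lambda>_. 1) (\<lambda>z. q z + d z) f j = (\<lambda>z. 1 * source n b (\<lambda>_. 1) q f j z + 1 * d z)"
      by (auto simp: source_def fun_eq_iff)
    then show ?thesis unfolding modec_def
      using mint_linear[OF source_integrable[OF f b _ q(1) T] L2_OT_integrable[OF q(2)] t(2), where n = n and a = 1 and b = 1 and j = j]
      by simp
  qed
  have s1: "summable (\<lambda>j. trial n j x * modec n b (\<lambda>_. 1) u0 q f j t)"
    using mild_summable[where b = b and f = f and \<sigma> = "\<lambda>_. 1" and K = 1 and M = "energy T q", OF q(1) _ t u0 x B] by simp
  have s2: "summable (\<lambda>j. trial n j x * modec n b (\<lambda>_. 1) u0 (\<lambda>z. q z + d z) f j t)"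
    using mild_summable[where b = b and f = f and \<sigma> = "\<lambda>_. 1" and K = 1 and M = "energy T (\<lambda>z. q z + d z)", OF L2_add[OF q] _ t u0 x B] by simp
  have "summable (\<lambda>j. trial n j x * modec n b (\<lambda>_. 1) u0 (\<lambda>z. q z + d z) f j t - trial n j x * modec n b (\<lambda>_. 1) u0 q f j t)"
    by (rule summable_diff[OF s2 s1])
  then show s3: "summable (\<lambda>j. trial n j x * mint n d j t)"
    unfolding eq by (simp add: algebra_simps)
  show "mild n b (\<lambda>_. 1) u0 (\<lambda>z. q z + d z) f t x = mild n b (\<lambda>_. 1) u0 q f t x + (\<Sum>j. trial n j x * mint n d j t)"
    unfolding mild_def eq distrib_left by (rule suminf_add[OF s1 s3, symmetric])
qed

text \<open>Applying the mode bound to \<open>d / \<epsilon>\<close>, of energy at most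
  \<open>1\<close>, gives linear dependence on \<epsilon>; hence \<open>6 = 5 + 1\<close>.\<close>

lemma forcing_small:
  assumes d: "d \<in> L2_OT T" "energy T d \<le> \<epsilon>\<^sup>2" "0 < \<epsilon>" and t: "0 \<le> t" "t \<le> T" and x: "x \<in> domO"
  shows "\<bar>\<Sum>j. trial n j x * mint n d j t\<bar> \<le> 6 * \<epsilon> * exp T * W 1"
proof -
  let ?h = "\<lambda>z. (1 / \<epsilon>) * d z"
  have h: "?h \<in> L2_OT T" "energy T ?h \<le> 1"
    using d L2_OT_scale[OF d(1), of "1 / \<epsilon>"] energy_scale[of T "1 / \<epsilon>" d]
    by (simp_all add: power_divide divide_le_eq)
  have "\<bar>trial n j x * mint n d j t\<bar> \<le> 6 * \<epsilon> * exp T * wt 1 j" for j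
  proof (intro abs_trial_mult_le x)
    have "\<bar>mint n d j t\<bar> \<le> \<epsilon> * exp (1 * t) * ((5 + 1) * wt 1 j)"
    proof (rule mint_bound[OF h t])
      fix z assume "z \<in> {0..t} \<times> domO"
      then have "1 \<le> exp (1 * fst z)" by auto
      then have "1 * \<bar>d z\<bar> \<le> exp (1 * fst z) * (\<epsilon> * freq n j + \<bar>d z\<bar>)"
        using freq_nonneg[of n j] \<open>0 < \<epsilon>\<close> by (intro mult_mono) auto
      also have "\<dots> = \<epsilon> * exp (1 * fst z) * (freq n j + \<bar>(1 / \<epsilon>) * d z\<bar>)"
        using \<open>0 < \<epsilon>\<close> by (simp add: abs_mult field_simps)
      finally show "\<bar>d z\<bar> \<le> \<epsilon> * exp (1 * fst z) * (freq n j + \<bar>(1 / \<epsilon>) * d z\<bar>)" by simp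
    qed (use d in auto)
    also have "\<dots> \<le> \<epsilon> * exp T * ((5 + 1) * wt 1 j)"
      using t d wt_nonneg[of 1 j] by (intro mult_right_mono mult_left_mono) auto
    finally show "\<bar>mint n d j t\<bar> \<le> 6 * \<epsilon> * exp T * wt 1 j" by simp
  qed
  from abs_suminf_le(2)[OF this summable_wt_mult] show ?thesis by (simp add: suminf_wt_mult)
qed

subsection \<open>Free energy estimate\<close>

definition clip :: "real \<Rightarrow> real \<Rightarrow> real" where "clip R x = max (- R) (min R x)"

definition trunc :: "real \<Rightarrow> real \<Rightarrow> real" where "trunc R x = bfun (clip R x)"

text \<open>The antiderivative of the truncated nonlinearity, i.e. the double well \<open>(u\<^sup>2 - 1)\<^sup>2 / 4\<close>
  continued affinely.\<close>

definition potential :: "real \<Rightarrow> real \<Rightarrow> real" where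
  "potential R u = ((clip R u)\<^sup>2 - 1)\<^sup>2 / 4 + bfun (clip R u) * (u - clip R u)"

lemma bfun_lipschitz:
  assumes "\<bar>x\<bar> \<le> R" "\<bar>y\<bar> \<le> R" shows "\<bar>bfun x - bfun y\<bar> \<le> (3 * R\<^sup>2 + 1) * \<bar>x - y\<bar>"
proof -
  have "x * x \<le> R * R" "y * y \<le> R * R" "\<bar>x * y\<bar> \<le> R * R"
    using assms by (auto simp: abs_mult intro!: mult_mono abs_le_square_iff[THEN iffD1, unfolded power2_eq_square])
  moreover have "0 \<le> x * x" "0 \<le> y * y" by auto
  ultimately have "\<bar>x * x + x * y + y * y - 1\<bar> \<le> 3 * R\<^sup>2 + 1" unfolding power2_eq_square by linarith
  then have "\<bar>x - y\<bar> * \<bar>x * x + x * y + y * y - 1\<bar> \<le> \<bar>x - y\<bar> * (3 * R\<^sup>2 + 1)" by (rule mult_left_mono) simp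
  moreover have "bfun x - bfun y = (x - y) * (x * x + x * y + y * y - 1)"
    by (simp add: bfun_def power3_eq_cube algebra_simps)
  ultimately show ?thesis by (simp add: abs_mult mult.commute)
qed

lemma trunc_lipschitz:
  assumes "0 \<le> R" shows "\<bar>trunc R x - trunc R y\<bar> \<le> (3 * R\<^sup>2 + 1) * \<bar>x - y\<bar>"
proof -
  have "\<bar>trunc R x - trunc R y\<bar> \<le> (3 * R\<^sup>2 + 1) * \<bar>clip R x - clip R y\<bar>"
    unfolding trunc_def using assms by (intro bfun_lipschitz) (auto simp: clip_def)
  also have "\<dots> \<le> (3 * R\<^sup>2 + 1) * \<bar>x - y\<bar>"
    by (intro mult_left_mono) (auto simp: clip_def)
  finally show ?thesis .
qed

lemma trunc_eq: "\<bar>x\<bar> \<le> R \<Longrightarrow> trunc R x = bfun x" by (simp add: trunc_def clip_def)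

lemma continuous_on_lipschitz_real:
  fixes g :: "real \<Rightarrow> real"
  assumes "\<And>x y. \<bar>g x - g y\<bar> \<le> L * \<bar>x - y\<bar>" "0 \<le> L"
  shows "continuous_on UNIV g"
  using assms by (intro lipschitz_on_continuous_on[of L]) (auto simp: lipschitz_on_def dist_real_def)

lemma continuous_on_trunc: "0 \<le> R \<Longrightarrow> continuous_on UNIV (trunc R)"
  by (rule continuous_on_lipschitz_real[OF trunc_lipschitz]) auto

lemma continuous_on_bfun: "continuous_on UNIV bfun"
  unfolding bfun_def by (intro continuous_intros)

text \<open>For \<open>R \<ge> 1\<close> the cubic points outwards at \<open>R\<close> and
  \<open>- R\<close>, so the affine continuation of the potential only adds a nonnegative term. This
  is why truncation radii are at least \<open>1\<close>.\<close>

lemma bfun_clip_sign: "1 \<le> R \<Longrightarrow> 0 \<le> bfun (clip R u) * (u - clip R u)"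
proof -
  assume R: "1 \<le> R"
  have "0 \<le> bfun R" using mult_mono[of 1 R 1 R] R
    by (auto simp: bfun_def power3_eq_cube mult_left_mono[of 1 "R * R" R, simplified] mult.assoc)
  moreover have "bfun (- R) = - bfun R" by (simp add: bfun_def power3_eq_cube)
  ultimately show ?thesis using R
    by (auto simp: clip_def max_def min_def mult_nonneg_nonneg mult_nonneg_nonpos)
qed

lemma potential_nonneg: "1 \<le> R \<Longrightarrow> 0 \<le> potential R u"
  unfolding potential_def using bfun_clip_sign[of R u] by (intro add_nonneg_nonneg) auto

text \<open>The nonlinearity is dominated by the potential with constants independent of
  \<open>R\<close>. This is what controls the mean of the chemical potential, on which there is no
  dissipation.\<close>

lemma abs_trunc_le: "1 \<le> R \<Longrightarrow> \<bar>trunc R u\<bar> \<le> 1 + 4 * potential R u"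
proof -
  assume R: "1 \<le> R"
  define c where "c = clip R u"
  \<comment> \<open>With this \<open>s\<close> one has \<open>\<bar>c\<bar> \<le> 1 + s / 2\<close>,
    so the cubic is at most \<open>s + s\<^sup>2 / 2 \<le> 1 + s\<^sup>2\<close>, and
    \<open>s\<^sup>2\<close> is four times the double well.\<close>
  define s where "s = \<bar>c\<^sup>2 - 1\<bar>"
  have "c\<^sup>2 \<le> 1 + s" "0 \<le> s" by (auto simp: s_def)
  then have "\<bar>c\<bar>\<^sup>2 \<le> (1 + s / 2)\<^sup>2" by (simp add: power2_eq_square field_simps add_increasing)
  then have c: "\<bar>c\<bar> \<le> 1 + s / 2" by (rule power2_le_imp_le) (use \<open>0 \<le> s\<close> in simp)
  have "bfun c = c * (c\<^sup>2 - 1)" by (simp add: bfun_def power2_eq_square power3_eq_cube algebra_simps)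
  then have "\<bar>bfun c\<bar> = \<bar>c\<bar> * s" by (simp add: abs_mult s_def)
  also have "\<dots> \<le> (1 + s / 2) * s" using c \<open>0 \<le> s\<close> by (intro mult_right_mono)
  also have "\<dots> \<le> 1 + s\<^sup>2" using zero_le_power2[of "s - 1"] by (simp add: power2_eq_square algebra_simps)
  finally have "\<bar>bfun c\<bar> \<le> 1 + s\<^sup>2" .
  moreover have "s\<^sup>2 = (c\<^sup>2 - 1)\<^sup>2" by (simp add: s_def)
  ultimately show ?thesis
    using bfun_clip_sign[OF R, of u] by (simp add: potential_def trunc_def c_def)
qed

text \<open>The formulas match in value and slope at \<open>R\<close> and \<open>- R\<close>;
  proving left and right derivatives separately avoids a case for the joints.\<close>

lemma potential_DERIV:
  assumes "0 < R" shows "(potential R has_real_derivative trunc R u) (at u)"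
proof -
  let ?q = "\<lambda>u::real. (u\<^sup>2 - 1)\<^sup>2 / 4" and ?l = "\<lambda>c u::real. (c\<^sup>2 - 1)\<^sup>2 / 4 + bfun c * (u - c)"
  have dq: "(?q has_real_derivative bfun v) (at v within S)" for v S
  proof -
    have "(?q has_real_derivative 2 * (v\<^sup>2 - 1) * (2 * v) / 4) (at v within S)"
      by (auto intro!: derivative_eq_intros)
    also have "2 * (v\<^sup>2 - 1) * (2 * v) / 4 = bfun v"
      by (simp add: bfun_def power2_eq_square power3_eq_cube right_diff_distrib left_diff_distrib)
    finally show ?thesis .
  qed
  have dl: "(?l c has_real_derivative bfun c) (at v within S)" for c v S
    by (auto intro!: derivative_eq_intros)
  have un: "(potential R has_real_derivative d) (at v)"
    if "(potential R has_real_derivative d) (at v within {..v})" "(potential R has_real_derivative d) (at v within {v..})" for d v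
  proof -
    have "{..v} \<union> {v..} = UNIV" by auto
    then show ?thesis using that unfolding has_field_derivative_iff by (metis Lim_within_Un)
  qed
  have left: "(potential R has_real_derivative trunc R v) (at v within {..v})" for v
  proof (cases "v \<le> - R")
    case True
    then show ?thesis using assms
      by (intro has_field_derivative_transform_within[OF dl[of "- R"], of 1 v, THEN DERIV_cong])
        (auto simp: potential_def clip_def trunc_def)
  next
    case False
    show ?thesis
    proof (cases "v \<le> R")
      case True
      then show ?thesis using False assms
        by (intro has_field_derivative_transform_within[OF dq, of "v + R" v, THEN DERIV_cong])
          (auto simp: potential_def clip_def trunc_def dist_real_def)
    next
      case F2: False
      then show ?thesis using False assms
        by (intro has_field_derivative_transform_within[OF dl[of R], of "v - R" v, THEN DERIV_cong])
          (auto simp: potential_def clip_def trunc_def dist_real_def)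
    qed
  qed
  have right: "(potential R has_real_derivative trunc R v) (at v within {v..})" for v
  proof (cases "R \<le> v")
    case True
    then show ?thesis using assms
      by (intro has_field_derivative_transform_within[OF dl[of R], of 1 v, THEN DERIV_cong])
        (auto simp: potential_def clip_def trunc_def)
  next
    case False
    show ?thesis
    proof (cases "- R \<le> v")
      case True
      then show ?thesis using False assms
        by (intro has_field_derivative_transform_within[OF dq, of "R - v" v, THEN DERIV_cong])
          (auto simp: potential_def clip_def trunc_def dist_real_def)
    next
      case F2: False
      then show ?thesis using False assms
        by (intro has_field_derivative_transform_within[OF dl[of "- R"], of "- R - v" v, THEN DERIV_cong])
          (auto simp: potential_def clip_def trunc_def dist_real_def)
    qed
  qed
  show ?thesis by (rule un[OF left right])
qed

section \<open>Mode coefficients as solutions of ordinary differential equations\<close>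

lemma interp_node:
  assumes "1 \<le> k" "k \<le> n" shows "interp n w (node n k) = w (node n k)"
proof (cases "k = n")
  case True
  then show ?thesis using assms node_mono[of n n 1] by (cases "n = 1") (auto simp: interp_def)
next
  case False
  then show ?thesis using assms node_mono[of n k "k + 1"] by (subst interp_between[of k]) auto
qed

lemma trial_node: "1 \<le> k \<Longrightarrow> k \<le> n \<Longrightarrow> j < n \<Longrightarrow> trial n j (node n k) = phi j (node n k)"
  by (simp add: trial_def phi_n_def interp_node)

lemma continuous_on_space_integral:
  assumes g: "continuous_on (domOT T) g" and w: "w \<in> borel_measurable borel" "\<And>y. \<bar>w y\<bar> \<le> 1"
  shows "continuous_on {0..T} (\<lambda>s. LBINT y:domO. w y * g (s, y) :: real)"
    and "\<And>s. s \<in> {0..T} \<Longrightarrow> set_integrable lborel domO (\<lambda>y. w y * g (s, y))"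
proof -
  have gc: "continuous_on domO (\<lambda>y. g (s, y))" if "s \<in> {0..T}" for s
    by (rule continuous_on_compose2[OF g]) (use that in \<open>auto simp: domOT_def intro!: continuous_intros\<close>)
  show int: "set_integrable lborel domO (\<lambda>y. w y * g (s, y))" if "s \<in> {0..T}" for s
    by (rule set_integrable_mult_bounded[OF set_integrable_continuous_compact[OF _ gc[OF that]] w]) auto
  obtain B where B: "\<And>z. z \<in> domOT T \<Longrightarrow> \<bar>id (g z)\<bar> \<le> B" using compose_bounded[OF g, of id] by auto
  show "continuous_on {0..T} (\<lambda>s. LBINT y:domO. w y * g (s, y))"
    unfolding continuous_on_sequentially
  proof (intro allI ballI impI)
    fix u a assume a: "a \<in> {0..T}" and u: "(\<forall>i. u i \<in> {0..T}) \<and> u \<longlonglongrightarrow> a"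
    have "(\<lambda>i. integral\<^sup>L lborel (\<lambda>y. indicator domO y *\<^sub>R (w y * g (u i, y)))) \<longlonglongrightarrow>
      integral\<^sup>L lborel (\<lambda>y. indicator domO y *\<^sub>R (w y * g (a, y)))"
    proof (rule integral_dominated_convergence[where w = "\<lambda>y. indicator domO y *\<^sub>R B"])
      show "integrable lborel (\<lambda>y. indicator domO y *\<^sub>R B)"
        using set_integrable_continuous_compact[of domO "\<lambda>_. B"] unfolding set_integrable_def by simp
      show "(\<lambda>y. indicator domO y *\<^sub>R (w y * g (a, y))) \<in> borel_measurable lborel"
        using int[OF a] unfolding set_integrable_def by (rule borel_measurable_integrable)
      show "(\<lambda>y. indicator domO y *\<^sub>R (w y * g (u i, y))) \<in> borel_measurable lborel" for i
        using int[of "u i"] u unfolding set_integrable_def by (intro borel_measurable_integrable) auto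
      show "AE y in lborel. (\<lambda>i. indicator domO y *\<^sub>R (w y * g (u i, y))) \<longlonglongrightarrow> indicator domO y *\<^sub>R (w y * g (a, y))"
      proof (intro AE_I2)
        fix y
        show "(\<lambda>i. indicator domO y *\<^sub>R (w y * g (u i, y))) \<longlonglongrightarrow> indicator domO y *\<^sub>R (w y * g (a, y))"
        proof (cases "y \<in> domO")
          case True
          have "(\<lambda>i. g (u i, y)) \<longlonglongrightarrow> g (a, y)"
            by (rule continuous_on_tendsto_compose[OF g])
              (use u a True in \<open>auto simp: domOT_def intro!: tendsto_intros always_eventually\<close>)
          then show ?thesis by (intro tendsto_intros)
        qed simp
      qed
      show "AE y in lborel. norm (indicator domO y *\<^sub>R (w y * g (u i, y))) \<le> indicator domO y *\<^sub>R B" for i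
      proof (intro AE_I2)
        fix y
        have "\<bar>w y\<bar> * \<bar>g (u i, y)\<bar> \<le> 1 * B" if "y \<in> domO"
          using B[of "(u i, y)"] w(2)[of y] that u by (intro mult_mono) (auto simp: domOT_def)
        then show "norm (indicator domO y *\<^sub>R (w y * g (u i, y))) \<le> indicator domO y *\<^sub>R B"
          by (auto simp: indicator_def abs_mult)
      qed
    qed
    then show "((\<lambda>s. LBINT y:domO. w y * g (s, y)) \<circ> u) \<longlonglongrightarrow> (LBINT y:domO. w y * g (a, y))"
      unfolding set_lebesgue_integral_def o_def .
  qed
qed

lemma measurable_phi_samp: "(\<lambda>y. phi j (samp n y)) \<in> borel_measurable borel"
  by measurable

definition load :: "nat \<Rightarrow> (real \<times> real \<Rightarrow> real) \<Rightarrow> nat \<Rightarrow> real \<Rightarrow> real" where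
  "load n q j s = (LBINT y:domO. phi j (samp n y) * q (s, y))"

definition reaction :: "nat \<Rightarrow> (real \<Rightarrow> real) \<Rightarrow> (real \<times> real \<Rightarrow> real) \<Rightarrow> nat \<Rightarrow> real \<Rightarrow> real" where
  "reaction n b f j s = pi / real n * (\<Sum>k\<in>{1..n}. phi j (node n k) * b (f (s, node n k)))"

text \<open>For continuous \<open>q\<close> the projected source is continuous in time, so the
  variation of constants formula is differentiable by the fundamental theorem. The derivative is
  grouped so that the chemical potential appears in the inner bracket.\<close>

lemma
  assumes "0 < n" "0 \<le> T" and q: "continuous_on (domOT T) q" and f: "continuous_on (domOT T) f"
    and b: "continuous_on UNIV b" and t: "t \<in> {0..T}"
  shows modec_DERIV: "(modec n b (\<lambda>_. 1) u0 q f j has_real_derivative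
      load n q j t - freq n j * (freq n j * modec n b (\<lambda>_. 1) u0 q f j t + reaction n b f j t)) (at t within {0..T})"
    and modec_0: "modec n b (\<lambda>_. 1) u0 q f j 0 = icoef n u0 j"
proof -
  let ?m = "freq n j"
  define P where "P s = load n q j s - ?m * reaction n b f j s" for s
  have fb: "continuous_on {0..T} (\<lambda>s. b (f (s, node n k)))" if "k \<in> {1..n}" for k
    by (rule continuous_on_compose2[OF b], rule continuous_on_compose2[OF f])
      (use that node_in_domO[of k n] in \<open>auto simp: domOT_def intro!: continuous_intros\<close>)
  have loadc: "continuous_on {0..T} (load n q j)"
    unfolding load_def by (rule continuous_on_space_integral(1)[OF q measurable_phi_samp abs_phi_le])
  have Pc: "continuous_on {0..T} P"
    unfolding P_def reaction_def by (intro continuous_intros loadc fb)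
  have inner: "(LBINT y:domO. exp (- ?m\<^sup>2 * (s' - fst (s, y))) * phi j (samp n (snd (s, y))) * source n b (\<lambda>_. 1) q f j (s, y))
      = exp (- ?m\<^sup>2 * s') * (exp (?m\<^sup>2 * s) * P s)" if "s \<in> {0..T}" for s s'
  proof -
    have i1: "set_integrable lborel domO (\<lambda>y. phi j (samp n y) * q (s, y))"
      by (rule continuous_on_space_integral(2)[OF q measurable_phi_samp abs_phi_le that])
    have i2: "set_integrable lborel domO (\<lambda>y. phi j (samp n y) * b (f (s, samp n y)))"
      using integrable_kappa[OF \<open>0 < n\<close>, of "\<lambda>y. phi j y * b (f (s, y))"] \<open>0 < n\<close> by (simp add: samp_def)
    have r: "reaction n b f j s = (LBINT y:domO. phi j (samp n y) * b (f (s, samp n y)))"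
      using integral_kappa[OF \<open>0 < n\<close>, of "\<lambda>y. phi j y * b (f (s, y))"] \<open>0 < n\<close> by (simp add: samp_def reaction_def)
    have "P s = (LBINT y:domO. phi j (samp n y) * q (s, y) - ?m * (phi j (samp n y) * b (f (s, samp n y))))"
      unfolding P_def load_def r using i1 i2 by (subst set_integral_diff) auto
    then have "exp (- ?m\<^sup>2 * (s' - s)) * P s = (LBINT y:domO. exp (- ?m\<^sup>2 * (s' - s)) * (phi j (samp n y) * q (s, y) - ?m * (phi j (samp n y) * b (f (s, samp n y)))))"
      by simp
    also have "\<dots> = (LBINT y:domO. exp (- ?m\<^sup>2 * (s' - fst (s, y))) * phi j (samp n (snd (s, y))) * source n b (\<lambda>_. 1) q f j (s, y))"
      by (simp add: source_def algebra_simps)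
    finally have "(LBINT y:domO. exp (- ?m\<^sup>2 * (s' - fst (s, y))) * phi j (samp n (snd (s, y))) * source n b (\<lambda>_. 1) q f j (s, y))
        = exp (- ?m\<^sup>2 * (s' - s)) * P s" ..
    also have "exp (- ?m\<^sup>2 * (s' - s)) = exp (- ?m\<^sup>2 * s') * exp (?m\<^sup>2 * s)"
      by (simp add: algebra_simps flip: exp_add)
    finally show ?thesis by simp
  qed
  have gc: "continuous_on {0..T} (\<lambda>s. exp (?m\<^sup>2 * s) * P s)" by (intro continuous_intros Pc)
  have mint_eq: "mint n (source n b (\<lambda>_. 1) q f j) j t = exp (- ?m\<^sup>2 * t) * integral {0..t} (\<lambda>s. exp (?m\<^sup>2 * s) * P s)"
    if t: "t \<in> {0..T}" for t
  proof -
    have "set_integrable lborel (domOT T) (source n b (\<lambda>_. 1) q f j)"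
      using assms continuous_in_L2_OT[OF q] by (intro source_integrable) auto
    then have "set_integrable lborel ({0..t} \<times> domO) (\<lambda>z. exp (- ?m\<^sup>2 * (t - fst z)) * phi j (samp n (snd z)) * source n b (\<lambda>_. 1) q f j z)"
      using t by (intro mint_integrable) auto
    then have "mint n (source n b (\<lambda>_. 1) q f j) j t
      = (LBINT s:{0..t}. LBINT y:domO. exp (- ?m\<^sup>2 * (t - fst (s, y))) * phi j (samp n (snd (s, y))) * source n b (\<lambda>_. 1) q f j (s, y))"
      unfolding mint_def by (rule set_integral_Times)
    also have "\<dots> = (LBINT s:{0..t}. exp (- ?m\<^sup>2 * t) * (exp (?m\<^sup>2 * s) * P s))"
      using t by (intro set_lebesgue_integral_cong allI impI inner) auto
    also have "\<dots> = exp (- ?m\<^sup>2 * t) * (LBINT s:{0..t}. exp (?m\<^sup>2 * s) * P s)" by simp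
    also have "(LBINT s:{0..t}. exp (?m\<^sup>2 * s) * P s) = integral {0..t} (\<lambda>s. exp (?m\<^sup>2 * s) * P s)"
      using t by (intro set_borel_integral_eq_integral(2) set_integrable_continuous_compact continuous_on_subset[OF gc]) auto
    finally show ?thesis .
  qed
  have eq: "modec n b (\<lambda>_. 1) u0 q f j t = exp (- ?m\<^sup>2 * t) * (icoef n u0 j + integral {0..t} (\<lambda>s. exp (?m\<^sup>2 * s) * P s))"
    if "t \<in> {0..T}" for t
    using mint_eq[OF that] by (simp add: modec_def algebra_simps)
  show "modec n b (\<lambda>_. 1) u0 q f j 0 = icoef n u0 j" using eq[of 0] \<open>0 \<le> T\<close> by simp
  have "((\<lambda>t. exp (- ?m\<^sup>2 * t) * (icoef n u0 j + integral {0..t} (\<lambda>s. exp (?m\<^sup>2 * s) * P s)))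
     has_real_derivative (exp (- ?m\<^sup>2 * t) * (exp (?m\<^sup>2 * t) * P t) - ?m\<^sup>2 * modec n b (\<lambda>_. 1) u0 q f j t)) (at t within {0..T})"
    unfolding eq[OF t]
    by (rule derivative_eq_intros integral_has_real_derivative[OF gc t] refl | simp)+
  moreover have "exp (- ?m\<^sup>2 * t) * (exp (?m\<^sup>2 * t) * P t) - ?m\<^sup>2 * modec n b (\<lambda>_. 1) u0 q f j t
    = load n q j t - ?m * (?m * modec n b (\<lambda>_. 1) u0 q f j t + reaction n b f j t)"
    by (simp add: mult.assoc[symmetric] flip: exp_add) (simp add: P_def power2_eq_square algebra_simps)
  ultimately show "(modec n b (\<lambda>_. 1) u0 q f j has_real_derivative
      load n q j t - ?m * (?m * modec n b (\<lambda>_. 1) u0 q f j t + reaction n b f j t)) (at t within {0..T})"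
    using t by (auto intro: has_field_derivative_transform_within[of _ _ _ _ 1] simp: eq)
qed

text \<open>Cauchy-Schwarz, obtained from the nonnegativity of the integral of
  \<open>(\<bar>q\<bar> - a / pi)\<^sup>2\<close>, where \<open>a / pi\<close> is the mean of
  \<open>\<bar>q\<bar>\<close>.\<close>

lemma load_bound:
  assumes q: "continuous_on (domOT T) q" and s: "s \<in> {0..T}"
  shows "(load n q j s)\<^sup>2 \<le> pi * (LBINT y:domO. (q (s, y))\<^sup>2)"
proof -
  define a where "a = (LBINT y:domO. \<bar>q (s, y)\<bar>)"
  have gc: "continuous_on domO (\<lambda>y. q (s, y))"
    by (rule continuous_on_compose2[OF q]) (use s in \<open>auto simp: domOT_def intro!: continuous_intros\<close>)
  have ia: "set_integrable lborel domO (\<lambda>y. \<bar>q (s, y)\<bar>)" and i2: "set_integrable lborel domO (\<lambda>y. (q (s, y))\<^sup>2)"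
    and ic: "set_integrable lborel domO (\<lambda>y. c)" for c :: real
    using gc set_integrable_continuous_compact[of domO "\<lambda>_. c"]
    by (auto intro: set_integrable_continuous_compact continuous_intros)
  have "\<bar>load n q j s\<bar> \<le> a"
    unfolding load_def a_def using abs_phi_le
    by (intro abs_set_integral_le ia) (auto simp: abs_mult intro!: mult_left_le_one_le)
  then have "(load n q j s)\<^sup>2 \<le> a\<^sup>2" by (metis abs_ge_zero abs_le_square_iff abs_of_nonneg order_trans)
  moreover have "0 \<le> (LBINT y:domO. (\<bar>q (s, y)\<bar> - a / pi)\<^sup>2)"
    unfolding set_lebesgue_integral_def by (intro Bochner_Integration.integral_nonneg) auto
  moreover have "(LBINT y:domO. (\<bar>q (s, y)\<bar> - a / pi)\<^sup>2)
    = (LBINT y:domO. ((q (s, y))\<^sup>2 - (2 * a / pi) * \<bar>q (s, y)\<bar>) + (a / pi)\<^sup>2)"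
    by (intro set_lebesgue_integral_cong) (auto simp: power2_eq_square algebra_simps)
  moreover have "\<dots> = (LBINT y:domO. (q (s, y))\<^sup>2) - (2 * a / pi) * a + pi * (a / pi)\<^sup>2"
    by (subst set_integral_add(2)[OF set_integral_diff(1)[OF i2 set_integrable_mult_right[OF ia]] ic],
        subst set_integral_diff(2)[OF i2 set_integrable_mult_right[OF ia]])
      (simp add: a_def set_integral_const domO_def)
  ultimately have "(2 * a / pi) * a - pi * (a / pi)\<^sup>2 \<le> (LBINT y:domO. (q (s, y))\<^sup>2)" by simp
  moreover have "(2 * a / pi) * a - pi * (a / pi)\<^sup>2 = a\<^sup>2 / pi" by (simp add: power2_eq_square field_simps)
  ultimately have "a\<^sup>2 / pi \<le> (LBINT y:domO. (q (s, y))\<^sup>2)" by linarith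
  then have "a\<^sup>2 \<le> pi * (LBINT y:domO. (q (s, y))\<^sup>2)" by (simp add: divide_le_eq mult.commute)
  with \<open>(load n q j s)\<^sup>2 \<le> a\<^sup>2\<close> show ?thesis by simp
qed


lemma inverse_freq_le: "0 < j \<Longrightarrow> 1 / freq n j \<le> 6 * wt 1 j"
proof -
  assume j: "0 < j"
  have "1 / freq n j \<le> 1 / ((real j)\<^sup>2 / 3)"
    using freq_ge[of j n] freq_pos[OF j, of n] j by (intro divide_left_mono mult_pos_pos) auto
  also have "\<dots> = 6 * (1 / (2 * (real j)\<^sup>2))" by simp
  also have "\<dots> \<le> 6 * wt 1 j" using wt_1_ge[OF j] by simp
  finally show ?thesis .
qed

lemma sum_wt_le: "0 \<le> c \<Longrightarrow> (\<Sum>j<n. c * wt 1 j) \<le> c * W 1"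
  using sum_le_suminf[OF summable_wt_mult[of 1 c], of "{..<n}"] wt_nonneg[of 1]
  by (simp add: suminf_wt_mult)

text \<open>The first two summands bound the mass mode, \<open>3 * W 1\<close> comes from Young's
  inequality on the other modes, and the last term is one plus the initial free energy, amplified by
  Gronwall's inequality. Neither the mesh nor the truncation radius occurs.\<close>

definition supbound :: "real \<Rightarrow> real \<Rightarrow> real \<Rightarrow> real" where
  "supbound T V E = V + exp T * (5 + E) + 3 * W 1 +
     (1 + 3 * V\<^sup>2 * W 1 + 4 * (1 + (V * W 1)\<^sup>2)\<^sup>2) * exp ((8 + 5 * W 1) * (T + E))"

text \<open>The Cahn-Hilliard energy: the Dirichlet form, diagonal in the modes, plus the double
  well integrated by the midpoint rule.\<close>

definition free_energy :: "nat \<Rightarrow> real \<Rightarrow> (nat \<Rightarrow> real) \<Rightarrow> real" where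
  "free_energy n R c = 1 / 2 * (\<Sum>j<n. freq n j * (c j)\<^sup>2)
     + pi / real n * (\<Sum>k\<in>{1..n}. potential R (\<Sum>j<n. phi j (node n k) * c j))"

lemma free_energy_nonneg:
  assumes "1 \<le> R"
  shows "0 \<le> 1 / 2 * (\<Sum>j<n. freq n j * (c j)\<^sup>2)" "0 \<le> pi / real n * (\<Sum>k\<in>{1..n}. potential R (\<Sum>j<n. phi j (node n k) * c j))"
  using freq_nonneg potential_nonneg[OF assms]
  by (auto intro!: sum_nonneg mult_nonneg_nonneg divide_nonneg_nonneg)

text \<open>With the chemical potential \<open>w = \<mu> C + \<beta>\<close> in mode coordinates the equation reads
  \<open>C' = - \<mu> w + q\<close>, so the free energy has derivative \<open>\<langle>w, C'\<rangle>\<close>; only the mass mode of \<open>w\<close>, on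
  which \<open>\<mu>\<close> vanishes, must be controlled by the free energy itself.\<close>

lemma free_energy_dissipation:
  assumes n: "0 < n" and R: "1 \<le> R" and w: "\<And>j. w j = freq n j * c j + pi / real n * (\<Sum>k\<in>{1..n}. phi j (node n k) * trunc R (\<Sum>j<n. phi j (node n k) * c j))"
    and q: "\<And>j. (q j)\<^sup>2 \<le> pi * Q"
  shows "(\<Sum>j<n. w j * (q j - freq n j * w j)) \<le> (8 + 5 * W 1) * ((1 + free_energy n R c) * (1 + Q))"
proof -
  let ?F = "free_energy n R c" and ?u = "\<lambda>k. \<Sum>j<n. phi j (node n k) * c j"
  have "0 \<le> pi * Q" using q[of 0] zero_le_power2 order_trans by blast
  then have Q: "0 \<le> Q" using pi_gt_zero mult_pos_neg[of pi Q] by linarith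
  have F0: "0 \<le> ?F" unfolding free_energy_def using free_energy_nonneg[OF R] by (intro add_nonneg_nonneg)
  have pi4: "pi \<le> 4" using pi_less_4 by simp
  \<comment> \<open>The mean of the chemical potential is the mean of the nonlinearity, which the
    potential part of the free energy dominates.\<close>
  have w0: "\<bar>w 0\<bar> \<le> 4 * (1 + ?F)"
  proof -
    have "\<bar>w 0\<bar> \<le> pi / real n * (\<Sum>k\<in>{1..n}. \<bar>phi 0 (node n k) * trunc R (?u k)\<bar>)"
      unfolding w freq_0 mult_zero_left add_0 abs_mult[of "pi / real n"]
      by (simp only: abs_of_nonneg[OF divide_nonneg_nonneg[OF pi_ge_zero of_nat_0_le_iff]])
        (intro mult_left_mono sum_abs, simp)
    also have "\<dots> \<le> pi / real n * (\<Sum>k\<in>{1..n}. 1 + 4 * potential R (?u k))"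
    proof (intro mult_left_mono sum_mono)
      fix k
      have "\<bar>phi 0 (node n k)\<bar> * \<bar>trunc R (?u k)\<bar> \<le> 1 * (1 + 4 * potential R (?u k))"
        using abs_phi_le abs_trunc_le[OF R] by (intro mult_mono) auto
      then show "\<bar>phi 0 (node n k) * trunc R (?u k)\<bar> \<le> 1 + 4 * potential R (?u k)" by (simp add: abs_mult)
    qed simp
    also have "\<dots> = pi + 4 * (pi / real n * (\<Sum>k\<in>{1..n}. potential R (?u k)))"
      using n by (simp add: sum.distrib sum_distrib_left[symmetric] field_simps)
    also have "\<dots> \<le> 4 + 4 * ?F"
      using free_energy_nonneg(1)[OF R, of n c] pi4 by (intro add_mono mult_left_mono) (auto simp: free_energy_def)
    finally show ?thesis by simp
  qed
  have q0: "\<bar>q 0\<bar> \<le> 2 * (1 + Q)"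
  proof -
    have "2 * \<bar>q 0\<bar> \<le> 1 + (q 0)\<^sup>2" using zero_le_power2[of "\<bar>q 0\<bar> - 1"] by (simp add: power2_eq_square algebra_simps)
    also have "\<dots> \<le> 1 + 4 * Q" using q[of 0] mult_right_mono[OF pi4 Q] by linarith
    finally have "2 * \<bar>q 0\<bar> \<le> 1 + 4 * Q" .
    moreover have "a \<le> 2 * (1 + Q)" if "2 * a \<le> 1 + 4 * Q" for a using that Q by simp
    ultimately show ?thesis by blast
  qed
  \<comment> \<open>The constant \<open>8\<close> is the product of the factors \<open>4\<close> and
    \<open>2\<close> just found for \<open>w 0\<close> and \<open>q 0\<close>; \<open>5\<close>
    exceeds \<open>(pi / 4) * 6\<close>, with \<open>6\<close> from
    \<open>inverse_freq_le\<close>.\<close>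
  have each: "w j * (q j - freq n j * w j) \<le> (if j = 0 then 8 * ((1 + ?F) * (1 + Q)) else 0) + 5 * Q * wt 1 j" for j
  proof (cases "j = 0")
    case True
    have "w 0 * q 0 \<le> \<bar>w 0\<bar> * \<bar>q 0\<bar>" by (simp flip: abs_mult)
    also have "\<dots> \<le> (4 * (1 + ?F)) * (2 * (1 + Q))" using w0 q0 F0 by (intro mult_mono) auto
    also have "\<dots> = 8 * ((1 + ?F) * (1 + Q))" by (simp add: algebra_simps)
    finally have "w 0 * q 0 \<le> 8 * ((1 + ?F) * (1 + Q))" .
    then show ?thesis using True Q by simp
  next
    case False
    then have m: "0 < freq n j" by (intro freq_pos) simp
    \<comment> \<open>Completing the square in \<open>w j\<close>: the dissipation absorbs the
      forcing at the cost of the inverse frequency, which is summable over the modes.\<close>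
    have "w j * (q j - freq n j * w j) \<le> (q j)\<^sup>2 / (4 * freq n j)"
    proof -
      have "0 \<le> (q j - 2 * freq n j * w j)\<^sup>2" by simp
      then have "4 * freq n j * (w j * (q j - freq n j * w j)) \<le> (q j)\<^sup>2"
        by (simp add: power2_eq_square algebra_simps)
      then show ?thesis using m by (simp add: field_simps)
    qed
    also have "\<dots> \<le> (pi * Q) / (4 * freq n j)" using q m by (intro divide_right_mono) auto
    also have "\<dots> = (pi / 4 * Q) * (1 / freq n j)" by simp
    also have "\<dots> \<le> (pi / 4 * Q) * (6 * wt 1 j)"
      using inverse_freq_le[of j n] False Q by (intro mult_left_mono) auto
    also have "\<dots> = (pi * 3 / 2) * (Q * wt 1 j)" by simp
    also have "\<dots> \<le> 5 * (Q * wt 1 j)"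
      using pi_approx Q wt_nonneg[of 1 j] by (intro mult_right_mono) auto
    finally show ?thesis using False by simp
  qed
  have "(\<Sum>j<n. w j * (q j - freq n j * w j)) \<le> (\<Sum>j<n. (if j = 0 then 8 * ((1 + ?F) * (1 + Q)) else 0) + 5 * Q * wt 1 j)"
    by (intro sum_mono each)
  also have "\<dots> = 8 * ((1 + ?F) * (1 + Q)) + (\<Sum>j<n. 5 * Q * wt 1 j)"
    using n by (simp add: sum.distrib)
  also have "\<dots> \<le> 8 * ((1 + ?F) * (1 + Q)) + 5 * Q * W 1"
    using Q sum_wt_le[of "5 * Q" n] by simp
  also have "5 * Q * W 1 \<le> 5 * W 1 * ((1 + ?F) * (1 + Q))"
  proof -
    have "1 * Q \<le> (1 + ?F) * (1 + Q)" using F0 Q by (intro mult_mono) auto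
    then have "5 * W 1 * (1 * Q) \<le> 5 * W 1 * ((1 + ?F) * (1 + Q))"
      using W_nonneg[of 1] by (intro mult_left_mono) auto
    then show ?thesis by (simp add: mult_ac)
  qed
  finally show ?thesis by (simp add: algebra_simps)
qed

lemma free_energy_DERIV:
  assumes "1 \<le> R" "\<And>j. j < n \<Longrightarrow> (c j has_real_derivative d j) (at t within S)"
  shows "((\<lambda>t. free_energy n R (\<lambda>j. c j t)) has_real_derivative
    (\<Sum>j<n. (freq n j * c j t + pi / real n * (\<Sum>k\<in>{1..n}. phi j (node n k) * trunc R (\<Sum>j<n. phi j (node n k) * c j t))) * d j))
    (at t within S)"
proof -
  let ?u = "\<lambda>k t. \<Sum>j<n. phi j (node n k) * c j t"
  have 1: "((\<lambda>t. 1 / 2 * (\<Sum>j<n. freq n j * (c j t)\<^sup>2)) has_real_derivative (\<Sum>j<n. freq n j * c j t * d j)) (at t within S)"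
  proof -
    have "((\<lambda>t. 1 / 2 * (\<Sum>j<n. freq n j * (c j t)\<^sup>2)) has_real_derivative 1 / 2 * (\<Sum>j<n. freq n j * (2 * c j t * d j))) (at t within S)"
      by (intro DERIV_cmult DERIV_sum) (auto intro!: derivative_eq_intros assms(2))
    then show ?thesis by (simp add: sum_distrib_left mult_ac)
  qed
  have u: "(?u k has_real_derivative (\<Sum>j<n. phi j (node n k) * d j)) (at t within S)" for k
    by (intro DERIV_sum DERIV_cmult assms(2)) auto
  have "((\<lambda>t. pi / real n * (\<Sum>k\<in>{1..n}. potential R (?u k t))) has_real_derivative
      pi / real n * (\<Sum>k\<in>{1..n}. trunc R (?u k t) * (\<Sum>j<n. phi j (node n k) * d j))) (at t within S)"
    using assms(1) by (intro DERIV_cmult DERIV_sum DERIV_chain2[OF potential_DERIV u]) auto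
  from DERIV_add[OF 1 this] show ?thesis
    unfolding free_energy_def
  proof (rule DERIV_cong)
    have "(\<Sum>k\<in>{1..n}. trunc R (?u k t) * (\<Sum>j<n. phi j (node n k) * d j)) = (\<Sum>j<n. (\<Sum>k\<in>{1..n}. phi j (node n k) * trunc R (?u k t)) * d j)"
      unfolding sum_distrib_left sum_distrib_right by (subst sum.swap) (simp add: mult_ac)
    moreover define X where "X j = (\<Sum>k\<in>{1..n}. phi j (node n k) * trunc R (?u k t))" for j
    ultimately show "(\<Sum>j<n. freq n j * c j t * d j) + pi / real n * (\<Sum>k\<in>{1..n}. trunc R (?u k t) * (\<Sum>j<n. phi j (node n k) * d j))
       = (\<Sum>j<n. (freq n j * c j t + pi / real n * (\<Sum>k\<in>{1..n}. phi j (node n k) * trunc R (?u k t))) * d j)"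
      unfolding X_def[symmetric]
      by (simp only: distrib_right sum.distrib sum_distrib_left[of "pi / real n"] mult.assoc)
  qed
qed

text \<open>The rate varies in time because it contains the instantaneous energy of the forcing, of
  which only the time integral is bounded.\<close>

lemma gronwall_product:
  fixes F :: "real \<Rightarrow> real"
  assumes "0 \<le> T" "\<And>t. t \<in> {0..T} \<Longrightarrow> (F has_real_derivative F' t) (at t within {0..T})"
    and "\<And>t. t \<in> {0..T} \<Longrightarrow> F' t \<le> a t * F t" "continuous_on {0..T} a" "t \<in> {0..T}"
  shows "F t \<le> F 0 * exp (integral {0..t} a)"
proof -
  define A where "A t = integral {0..t} a" for t
  define G where "G t = F t * exp (- A t)" for t
  have dA: "(A has_real_derivative a t) (at t within {0..T})" if "t \<in> {0..T}" for t
    unfolding A_def by (rule integral_has_real_derivative[OF assms(4) that])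
  have dG: "(G has_real_derivative (F' t - a t * F t) * exp (- A t)) (at t within {0..T})" if "t \<in> {0..T}" for t
    unfolding G_def by (rule derivative_eq_intros assms(2)[OF that] dA[OF that] refl)+ (simp add: algebra_simps)
  have "\<exists>s\<in>{0..t}. G t - G 0 = (\<lambda>s x. x * ((F' s - a s * F s) * exp (- A s))) s (t - 0)"
  proof (rule mvt_very_simple)
    fix s assume "0 \<le> s" "s \<le> t"
    then show "(G has_derivative (\<lambda>x. x * ((F' s - a s * F s) * exp (- A s)))) (at s within {0..t})"
      using dG[of s] assms(5) unfolding has_field_derivative_def
      by (intro has_derivative_subset[of G _ s "{0..T}" "{0..t}"]) (auto simp: mult_commute_abs)
  qed (use assms in auto)
  then obtain s where s: "s \<in> {0..t}" "G t - G 0 = t * ((F' s - a s * F s) * exp (- A s))" by auto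
  have "t * ((F' s - a s * F s) * exp (- A s)) \<le> 0"
    using assms(3)[of s] s(1) assms(5) by (intro mult_nonneg_nonpos mult_nonpos_nonneg) auto
  then have "G t \<le> F 0" using s(2) by (simp add: G_def A_def)
  then have "G t * exp (A t) \<le> F 0 * exp (A t)" by (rule mult_right_mono) simp
  moreover have "G t * exp (A t) = F t" by (simp add: G_def mult.assoc flip: exp_add)
  ultimately show ?thesis unfolding A_def by simp
qed

lemma mild_discrete:
  "0 < n \<Longrightarrow> mild n b \<sigma> u0 h f t x = (\<Sum>j<n. trial n j x * modec n b \<sigma> u0 h f j t)"
  unfolding mild_def by (rule suminf_finite) (auto simp: trial_def)

text \<open>The condition \<open>V * W 1 \<le> R\<close> places the initial node values below the
  truncation, so that the bound does not depend on \<open>R\<close>. The Dirichlet part converges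
  since the squared coefficients decay like \<open>1 / j\<^sup>4\<close> against frequencies of
  order \<open>j\<^sup>2\<close>.\<close>

lemma initial_free_energy:
  assumes n: "0 < n" and R: "1 \<le> R" "V * W 1 \<le> R" and V: "decaying u0 V"
  shows "free_energy n R (icoef n u0) \<le> 3 * V\<^sup>2 * W 1 + 4 * (1 + (V * W 1)\<^sup>2)\<^sup>2"
proof -
  have ic: "\<bar>icoef n u0 j\<bar> \<le> V * wt 1 j" for j using V by (auto simp: decaying_def)
  have V0: "0 \<le> V" using decaying_nonneg[OF V] .
  have "freq n j * (icoef n u0 j)\<^sup>2 \<le> 3 * V\<^sup>2 * wt 1 j" for j
  proof (cases "j = 0")
    case False
    have "(icoef n u0 j)\<^sup>2 \<le> (V * wt 1 j)\<^sup>2" using ic[of j] by (intro abs_le_square_iff[THEN iffD1]) auto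
    then have "freq n j * (icoef n u0 j)\<^sup>2 \<le> (real j)\<^sup>2 * (V * wt 1 j)\<^sup>2"
      using freq_le[of n j] freq_nonneg[of n j] by (intro mult_mono) auto
    also have "\<dots> = V\<^sup>2 * wt 1 j * ((real j)\<^sup>2 * wt 1 j)" by (simp add: power2_eq_square)
    also have "\<dots> \<le> V\<^sup>2 * wt 1 j * 3"
    proof (intro mult_left_mono)
      show "(real j)\<^sup>2 * wt 1 j \<le> 3" using wt_le[of j 1] False by (simp add: field_simps)
    qed (simp add: wt_nonneg)
    finally show ?thesis by simp
  qed (simp add: V0 wt_nonneg)
  then have "(\<Sum>j<n. freq n j * (icoef n u0 j)\<^sup>2) \<le> (\<Sum>j<n. 3 * V\<^sup>2 * wt 1 j)" by (rule sum_mono)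
  also have "\<dots> \<le> 3 * V\<^sup>2 * W 1" by (rule sum_wt_le) simp
  finally have 1: "(\<Sum>j<n. freq n j * (icoef n u0 j)\<^sup>2) \<le> 3 * V\<^sup>2 * W 1" .
  have "potential R (\<Sum>j<n. phi j (node n k) * icoef n u0 j) \<le> (1 + (V * W 1)\<^sup>2)\<^sup>2" for k
  proof -
    let ?u = "\<Sum>j<n. phi j (node n k) * icoef n u0 j"
    have "\<bar>?u\<bar> \<le> (\<Sum>j<n. \<bar>phi j (node n k)\<bar> * \<bar>icoef n u0 j\<bar>)" by (simp add: sum_abs flip: abs_mult)
    also have "\<dots> \<le> (\<Sum>j<n. 1 * (V * wt 1 j))" using abs_phi_le ic by (intro sum_mono mult_mono) auto
    also have "\<dots> \<le> V * W 1" using sum_wt_le[OF V0, of n] by simp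
    finally have u: "\<bar>?u\<bar> \<le> V * W 1" .
    then have "clip R ?u = ?u" using R by (auto simp: clip_def)
    then have "potential R ?u = (?u\<^sup>2 - 1)\<^sup>2 / 4" by (simp add: potential_def)
    moreover have "\<bar>?u\<^sup>2 - 1\<bar> \<le> 1 + (V * W 1)\<^sup>2"
    proof -
      have "?u\<^sup>2 \<le> (V * W 1)\<^sup>2" using u by (intro abs_le_square_iff[THEN iffD1]) auto
      then show ?thesis using zero_le_power2[of ?u] by linarith
    qed
    then have "(?u\<^sup>2 - 1)\<^sup>2 \<le> (1 + (V * W 1)\<^sup>2)\<^sup>2" by (intro abs_le_square_iff[THEN iffD1]) auto
    ultimately show ?thesis using zero_le_power2[of "1 + (V * W 1)\<^sup>2"] by linarith
  qed
  then have "(\<Sum>k\<in>{1..n}. potential R (\<Sum>j<n. phi j (node n k) * icoef n u0 j)) \<le> (\<Sum>k\<in>{1..n}. (1 + (V * W 1)\<^sup>2)\<^sup>2)"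
    by (rule sum_mono)
  then have "pi / real n * (\<Sum>k\<in>{1..n}. potential R (\<Sum>j<n. phi j (node n k) * icoef n u0 j)) \<le> pi / real n * (\<Sum>k\<in>{1..n}. (1 + (V * W 1)\<^sup>2)\<^sup>2)"
    by (rule mult_left_mono) simp
  also have "\<dots> = pi * (1 + (V * W 1)\<^sup>2)\<^sup>2" using n by simp
  also have "\<dots> \<le> 4 * (1 + (V * W 1)\<^sup>2)\<^sup>2" using pi_less_4 by (intro mult_right_mono) auto
  finally have "pi / real n * (\<Sum>k\<in>{1..n}. potential R (\<Sum>j<n. phi j (node n k) * icoef n u0 j)) \<le> 4 * (1 + (V * W 1)\<^sup>2)\<^sup>2" .
  moreover have "0 \<le> 3 * V\<^sup>2 * W 1" using W_nonneg[of 1] by simp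
  ultimately show ?thesis using 1 unfolding free_energy_def by linarith
qed

text \<open>Dissipation bounds the free energy by Gronwall's inequality, and the embedding of the
  energy space into the bounded functions is done by hand on the modes.\<close>

lemma sup_bound_continuous_forcing:
  assumes n: "0 < n" and T: "0 \<le> T" and q: "continuous_on (domOT T) q" "energy T q \<le> E"
    and f: "sol T n (trunc R) (\<lambda>_. 1) u0 q f" and R: "1 \<le> R" "V * W 1 \<le> R" and V: "decaying u0 V"
    and z: "z \<in> domOT T"
  shows "\<bar>f z\<bar> \<le> supbound T V E"
proof -
  have fc: "continuous_on (domOT T) f" and feq: "\<And>t x. t \<in> {0..T} \<Longrightarrow> x \<in> domO \<Longrightarrow> f (t, x) = mild n (trunc R) (\<lambda>_. 1) u0 q f t x"
    using f by (auto simp: sol_def)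
  have tc: "continuous_on UNIV (trunc R)" using R by (intro continuous_on_trunc) auto
  define C where "C = modec n (trunc R) (\<lambda>_. 1) u0 q f"
  have node: "f (t, node n k) = (\<Sum>j<n. phi j (node n k) * C j t)" if "t \<in> {0..T}" "k \<in> {1..n}" for t k
    using that node_in_domO[of k n] by (simp add: feq mild_discrete[OF n] trial_node C_def)
  define F where "F t = free_energy n R (\<lambda>j. C j t)" for t
  define Q where "Q t = (LBINT y:domO. (q (t, y))\<^sup>2)" for t
  define w where "w j t = freq n j * C j t + pi / real n * (\<Sum>k\<in>{1..n}. phi j (node n k) * trunc R (\<Sum>j<n. phi j (node n k) * C j t))" for j t
  define A where "A = 8 + 5 * W 1"
  have A0: "0 \<le> A" using W_nonneg[of 1] by (simp add: A_def)
  have dC: "(C j has_real_derivative load n q j t - freq n j * w j t) (at t within {0..T})" if "t \<in> {0..T}" for j t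
  proof -
    have "reaction n (trunc R) f j t = pi / real n * (\<Sum>k\<in>{1..n}. phi j (node n k) * trunc R (\<Sum>j<n. phi j (node n k) * C j t))"
      unfolding reaction_def using node[OF that] by simp
    then show ?thesis using modec_DERIV[OF n T q(1) fc tc that, of u0 j] by (simp add: C_def w_def)
  qed
  have dF: "((\<lambda>t. 1 + F t) has_real_derivative (\<Sum>j<n. w j t * (load n q j t - freq n j * w j t))) (at t within {0..T})" if "t \<in> {0..T}" for t
    unfolding F_def w_def[symmetric]
    using free_energy_DERIV[OF R(1), of n C, OF dC[OF that]] by (auto intro!: derivative_eq_intros simp: w_def)
  have F': "(\<Sum>j<n. w j t * (load n q j t - freq n j * w j t)) \<le> (A * (1 + Q t)) * (1 + F t)" if "t \<in> {0..T}" for t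
    using free_energy_dissipation[OF n R(1), of "\<lambda>j. w j t" "\<lambda>j. C j t" "\<lambda>j. load n q j t" "Q t"] load_bound[OF q(1) that]
    unfolding F_def A_def w_def Q_def by (simp only: mult_ac refl simp_thms)
  have q2: "continuous_on (domOT T) (\<lambda>z. (q z)\<^sup>2)" by (intro continuous_intros q)
  have Qc: "continuous_on {0..T} Q"
    using continuous_on_space_integral(1)[OF q2, of "\<lambda>_. 1"] by (simp add: Q_def[abs_def])
  have Q0: "0 \<le> Q t" for t
    unfolding Q_def set_lebesgue_integral_def by (intro Bochner_Integration.integral_nonneg) auto
  have "energy T q = integral {0..T} Q"
  proof -
    have "set_integrable lborel (domOT T) (\<lambda>z. (q z)\<^sup>2)" by (intro set_integrable_continuous_compact q2) simp
    then have "energy T q = (LBINT t:{0..T}. Q t)"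
      unfolding energy_def Q_def domOT_def by (rule set_integral_Times)
    then show ?thesis using set_borel_integral_eq_integral(2)[OF set_integrable_continuous_compact[OF _ Qc]] by simp
  qed
  have F_le: "1 + F t \<le> (1 + 3 * V\<^sup>2 * W 1 + 4 * (1 + (V * W 1)\<^sup>2)\<^sup>2) * exp (A * (T + E))" if t: "t \<in> {0..T}" for t
  proof -
    have ac: "continuous_on {0..T} (\<lambda>t. A * (1 + Q t))" by (intro continuous_intros Qc)
    have "1 + F t \<le> (1 + F 0) * exp (integral {0..t} (\<lambda>t. A * (1 + Q t)))"
      by (rule gronwall_product[OF T dF F' ac t])
    also have "\<dots> \<le> (1 + 3 * V\<^sup>2 * W 1 + 4 * (1 + (V * W 1)\<^sup>2)\<^sup>2) * exp (A * (T + E))"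
    proof (intro mult_mono)
      have "F 0 = free_energy n R (icoef n u0)"
        unfolding F_def C_def using modec_0[OF n T q(1) fc tc, of 0 u0] T by simp
      then show "1 + F 0 \<le> 1 + 3 * V\<^sup>2 * W 1 + 4 * (1 + (V * W 1)\<^sup>2)\<^sup>2"
        using initial_free_energy[OF n R V] by simp
      have i: "(\<lambda>t. A * (1 + Q t)) integrable_on {0..T}" "(\<lambda>t. A * (1 + Q t)) integrable_on {0..t}"
        using ac t by (auto intro!: integrable_continuous_real elim: continuous_on_subset)
      have "integral {0..t} (\<lambda>t. A * (1 + Q t)) \<le> integral {0..T} (\<lambda>t. A * (1 + Q t))"
        using t A0 Q0 by (intro integral_subset_le i) auto
      also have "\<dots> = A * (T + integral {0..T} Q)"
        using T Qc by (simp add: integral_add integrable_continuous_real)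
      also have "\<dots> \<le> A * (T + E)" using A0 q(2) \<open>energy T q = integral {0..T} Q\<close> by (intro mult_left_mono) auto
      finally show "exp (integral {0..t} (\<lambda>t. A * (1 + Q t))) \<le> exp (A * (T + E))" by simp
      show "0 \<le> 1 + 3 * V\<^sup>2 * W 1 + 4 * (1 + (V * W 1)\<^sup>2)\<^sup>2" using W_nonneg[of 1] by (intro add_nonneg_nonneg) auto
    qed simp
    finally show ?thesis .
  qed
  obtain t x where tx: "z = (t, x)" "t \<in> {0..T}" "x \<in> domO" using z by (auto simp: domOT_def)
  \<comment> \<open>The Dirichlet form does not see the mass mode. There the frequency vanishes, so
    the nonlinearity drops out and forcing and initial mass give the bound.\<close>
  have C0: "\<bar>C 0 t\<bar> \<le> V + exp T * (5 + E)"
  proof -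
    have "\<bar>mint n (source n (trunc R) (\<lambda>_. 1) q f 0) 0 t\<bar> \<le> 1 * exp (1 * t) * ((5 + E) * wt 1 0)"
    proof (rule mint_bound[OF continuous_in_L2_OT[OF q(1)] q(2)])
      fix z assume "z \<in> {0..t} \<times> domO"
      then have "1 \<le> exp (1 * fst z)" by auto
      then have "1 * \<bar>q z\<bar> \<le> exp (1 * fst z) * \<bar>q z\<bar>" by (intro mult_right_mono) auto
      then show "\<bar>source n (trunc R) (\<lambda>_. 1) q f 0 z\<bar> \<le> 1 * exp (1 * fst z) * (freq n 0 + \<bar>q z\<bar>)"
        by (simp add: source_def)
    qed (use tx in auto)
    also have "\<dots> \<le> exp T * (5 + E)"
      using tx energy_nonneg[of T q] q(2) by (simp add: mult_right_mono)
    finally have "\<bar>mint n (source n (trunc R) (\<lambda>_. 1) q f 0) 0 t\<bar> \<le> exp T * (5 + E)" .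
    moreover have "\<bar>icoef n u0 0\<bar> \<le> V" using V[unfolded decaying_def, rule_format, of n 0] by simp
    ultimately show ?thesis unfolding C_def modec_def by simp
  qed
  \<comment> \<open>Young's inequality
    \<open>\<bar>C\<bar> \<le> \<mu> C\<^sup>2 / 2 + 1 / (2 \<mu>)\<close>: the first terms sum to
    the Dirichlet energy, the second ones to a multiple of \<open>W 1\<close>.\<close>
  have Cj: "\<bar>C j t\<bar> \<le> (if j = 0 then V + exp T * (5 + E) else 0) + (1 / 2 * (freq n j * (C j t)\<^sup>2) + 3 * wt 1 j)" for j
  proof (cases "j = 0")
    case False
    then have m: "0 < freq n j" by (intro freq_pos) simp
    have "0 \<le> (freq n j * \<bar>C j t\<bar> - 1)\<^sup>2" by simp
    then have "2 * (freq n j * \<bar>C j t\<bar>) \<le> freq n j * (freq n j * (C j t)\<^sup>2) + 1"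
      by (simp add: power2_eq_square algebra_simps)
    then have "\<bar>C j t\<bar> \<le> 1 / 2 * (freq n j * (C j t)\<^sup>2) + 1 / 2 * (1 / freq n j)"
      using m by (simp add: field_simps)
    also have "\<dots> \<le> 1 / 2 * (freq n j * (C j t)\<^sup>2) + 1 / 2 * (6 * wt 1 j)"
      using inverse_freq_le[of j n] False by (intro add_left_mono mult_left_mono) auto
    finally show ?thesis using False by simp
  qed (use C0 in simp)
  have "\<bar>f z\<bar> = \<bar>\<Sum>j<n. trial n j x * C j t\<bar>" using tx by (simp add: feq mild_discrete[OF n] C_def)
  also have "\<dots> \<le> (\<Sum>j<n. \<bar>trial n j x * C j t\<bar>)" by (rule sum_abs)
  also have "\<dots> \<le> (\<Sum>j<n. (if j = 0 then V + exp T * (5 + E) else 0) + (1 / 2 * (freq n j * (C j t)\<^sup>2) + 3 * wt 1 j))"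
    by (intro sum_mono abs_trial_mult_le Cj tx)
  also have "\<dots> = V + exp T * (5 + E) + (1 / 2 * (\<Sum>j<n. freq n j * (C j t)\<^sup>2) + (\<Sum>j<n. 3 * wt 1 j))"
    using n by (simp add: sum.distrib sum_distrib_left)
  also have "\<dots> \<le> V + exp T * (5 + E) + ((1 + F t) + 3 * W 1)"
    using free_energy_nonneg(2)[OF R(1), of n "\<lambda>j. C j t"] sum_wt_le[of 3 n] unfolding F_def free_energy_def by linarith
  also have "\<dots> \<le> supbound T V E" using F_le[OF tx(2)] unfolding supbound_def A_def by linarith
  finally show ?thesis .
qed

subsection \<open>Consistency of the discretization\<close>

lemma le_if_le_add_small:
  fixes a b c :: real
  assumes "\<And>\<epsilon>. 0 < \<epsilon> \<Longrightarrow> \<epsilon> \<le> 1 \<Longrightarrow> a \<le> b + c * \<epsilon>" "0 \<le> c"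
  shows "a \<le> b"
proof (rule field_le_epsilon)
  fix e :: real assume "0 < e"
  define \<epsilon> where "\<epsilon> = min 1 (e / (c + 1))"
  have "0 < \<epsilon>" "\<epsilon> \<le> 1" using \<open>0 < e\<close> assms(2) by (auto simp: \<epsilon>_def)
  moreover have "c * \<epsilon> \<le> e"
  proof -
    have "c * \<epsilon> \<le> (c + 1) * (e / (c + 1))" using assms(2) \<open>0 < e\<close> by (intro mult_mono) (auto simp: \<epsilon>_def)
    then show ?thesis using assms(2) by simp
  qed
  ultimately show "a \<le> b + e" using assms(1)[of \<epsilon>] by linarith
qed

text \<open>\<open>K\<^sup>2 * M\<close> bounds the energy of the forcing
  \<open>\<sigma> (f) h\<close>, and the extra \<open>1\<close> leaves room for its approximation by
  continuous forcings.\<close>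

definition aprio :: "real \<Rightarrow> real \<Rightarrow> real \<Rightarrow> real \<Rightarrow> real" where
  "aprio T V K M = supbound T V (K\<^sup>2 * M + 1)"

text \<open>Density of the continuous forcings together with stability. The stability constant
  depends on the truncation radius, but it only multiplies the approximation error, which tends to
  zero with everything else fixed.\<close>

lemma sup_bound_discrete:
  assumes n: "0 < n" and T: "0 \<le> T" and h: "h \<in> L2_OT T" "energy T h \<le> M"
    and \<sigma>: "continuous_on UNIV \<sigma>" "\<And>x. \<bar>\<sigma> x\<bar> \<le> K"
    and f: "sol T n (trunc R) \<sigma> u0 h f" and R: "1 \<le> R" "V * W 1 \<le> R" and V: "decaying u0 V"
    and z: "z \<in> domOT T"
  shows "\<bar>f z\<bar> \<le> aprio T V K M"
proof -
  have fc: "continuous_on (domOT T) f" using f by (simp add: sol_def)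
  have tc: "continuous_on UNIV (trunc R)" using R by (intro continuous_on_trunc) auto
  define q where "q = (\<lambda>z. \<sigma> (f (fst z, samp n (snd z))) * h z)"
  have q: "q \<in> L2_OT T" "energy T q \<le> K\<^sup>2 * M"
  proof -
    show "q \<in> L2_OT T" unfolding q_def by (rule forcing_L2(1)[OF fc \<sigma>(1) h(1) T \<sigma>(2)])
    have "energy T q \<le> K\<^sup>2 * energy T h" unfolding q_def by (rule forcing_L2(2)[OF fc \<sigma>(1) h(1) T \<sigma>(2)])
    also have "\<dots> \<le> K\<^sup>2 * M" using h by (intro mult_left_mono) auto
    finally show "energy T q \<le> K\<^sup>2 * M" .
  qed
  have fq: "sol T n (trunc R) (\<lambda>_. 1) u0 q f" using f unfolding q_def sol_forcing[of T n _ \<sigma>] .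
  define L where "L = 3 * R\<^sup>2 + 1"
  have L0: "0 \<le> L" by (simp add: L_def)
  have "0 \<le> L * (5 + energy T q)" using L0 energy_nonneg[of T q] by simp
  then obtain \<beta> where \<beta>: "0 < \<beta>" "L * (5 + energy T q) * W \<beta> \<le> 1 / 2" using exists_weight by blast
  have "\<bar>f z\<bar> \<le> supbound T V (K\<^sup>2 * M + 1) + (12 * exp T * W 1 * exp (\<beta> * T)) * \<epsilon>" if \<epsilon>: "0 < \<epsilon>" "\<epsilon> \<le> 1" for \<epsilon>
  proof -
    have "0 < \<epsilon>\<^sup>2" using \<epsilon> by simp
    then obtain g where g: "continuous_on UNIV g" "(\<lambda>z. q z - g z) \<in> L2_OT T"
      "energy T (\<lambda>z. q z - g z) \<le> \<epsilon>\<^sup>2" "energy T g \<le> energy T q + \<epsilon>\<^sup>2"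
      using approx_L2_continuous[OF q(1)] by blast
    have gc: "continuous_on (domOT T) g" using g(1) continuous_on_subset by blast
    have eg: "energy T g \<le> K\<^sup>2 * M + 1"
      using g(4) q(2) power_le_one[of \<epsilon> 2] \<epsilon> by simp
    have "\<exists>f'. sol T n (trunc R) (\<lambda>_. 1) u0 g f'"
      using R L0 by (intro exists_sol_lipschitz[OF T _ _ L0 continuous_in_L2_OT[OF gc] V]) (auto simp: L_def intro!: trunc_lipschitz)
    then obtain f' where f': "sol T n (trunc R) (\<lambda>_. 1) u0 g f'" by blast
    have fc': "continuous_on (domOT T) f'" using f' by (simp add: sol_def)
    obtain t x where tx: "z = (t, x)" "t \<in> {0..T}" "x \<in> domO" using z by (auto simp: domOT_def)
    have "\<bar>f (t, x) - f' (t, x)\<bar> \<le> 2 * (6 * \<epsilon> * exp T * W 1) * exp (\<beta> * T)"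
    proof (rule mild_stability[OF fc fc' tc, where \<sigma> = "\<lambda>_. 1" and h = q and M = "energy T q" and n = n and \<tau> = T])
      fix s y assume sy: "s \<in> {0..T}" "y \<in> domO"
      have "mild n (trunc R) (\<lambda>_. 1) u0 q f' s y = mild n (trunc R) (\<lambda>_. 1) u0 g f' s y + (\<Sum>j. trial n j y * mint n (\<lambda>z. q z - g z) j s)"
        using mild_forcing_add(1)[OF fc' tc continuous_in_L2_OT[OF gc] g(2) V, of s y n] sy by simp
      then have "f (s, y) - f' (s, y) = (\<Sum>j. trial n j y * mint n (\<lambda>z. q z - g z) j s)
         + (mild n (trunc R) (\<lambda>_. 1) u0 q f s y - mild n (trunc R) (\<lambda>_. 1) u0 q f' s y)"
        using fq f' sy by (simp add: sol_def)
      then show "\<bar>f (s, y) - f' (s, y)\<bar> \<le> 6 * \<epsilon> * exp T * W 1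
         + \<bar>mild n (trunc R) (\<lambda>_. 1) u0 q f s y - mild n (trunc R) (\<lambda>_. 1) u0 q f' s y\<bar>"
        using forcing_small[OF g(2,3) \<epsilon>(1), of s y n] sy by auto
    next
      show "\<bar>trunc R (f z) - trunc R (f' z)\<bar> \<le> L * \<bar>f z - f' z\<bar>" for z
        unfolding L_def using R by (intro trunc_lipschitz) auto
    qed (use V q \<beta> L0 T tx \<epsilon> W_nonneg[of 1] in auto)
    moreover have "\<bar>f' (t, x)\<bar> \<le> supbound T V (K\<^sup>2 * M + 1)"
      using sup_bound_continuous_forcing[OF n T gc eg f' R V z] tx by simp
    ultimately show ?thesis using tx by (simp add: mult_ac)
  qed
  then show ?thesis unfolding aprio_def
    by (rule le_if_le_add_small) (use W_nonneg[of 1] in auto)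
qed

section \<open>Residual of the continuum solution in the discrete equation\<close>

lemma exp_minus_lipschitz: "0 \<le> a \<Longrightarrow> 0 \<le> b \<Longrightarrow> \<bar>exp (- a) - exp (- b)\<bar> \<le> \<bar>a - b\<bar>" for a b :: real
proof (induction a b rule: linorder_wlog)
  case (le a b)
  have "exp (- a) - exp (- b) = exp (- a) * (1 - exp (- (b - a)))"
    by (simp add: algebra_simps flip: exp_add)
  also have "\<dots> \<le> 1 * (b - a)"
  proof (intro mult_mono)
    show "1 - exp (- (b - a)) \<le> b - a" using exp_ge_add_one_self[of "- (b - a)"] by linarith
  qed (use le in auto)
  finally show ?case using le by simp
qed (simp add: abs_minus_commute)

lemma abs_product3_diff_le:
  fixes e e' p p' s s' :: real
  assumes "\<bar>e - e'\<bar> \<le> a" "\<bar>e'\<bar> \<le> 1" "\<bar>p - p'\<bar> \<le> c" "\<bar>p\<bar> \<le> 1" "\<bar>p'\<bar> \<le> 1" "\<bar>s\<bar> \<le> S" "\<bar>s - s'\<bar> \<le> d"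
  shows "\<bar>e * p * s - e' * p' * s'\<bar> \<le> a * S + c * S + d"
proof -
  have "\<bar>(e - e') * (p * s)\<bar> \<le> a * (1 * S)" "\<bar>e' * ((p - p') * s)\<bar> \<le> 1 * (c * S)" "\<bar>e' * (p' * (s - s'))\<bar> \<le> 1 * (1 * d)"
    unfolding abs_mult using assms by (intro mult_mono order_refl; simp)+
  moreover have "e * p * s - e' * p' * s' = (e - e') * (p * s) + e' * ((p - p') * s) + e' * (p' * (s - s'))"
    by (simp add: algebra_simps)
  ultimately show ?thesis by (simp add: abs_le_iff)
qed

text \<open>Common modulus of continuity of cosine series with coefficients of size
  \<open>wt 1 j\<close>. The cap \<open>2\<close>, from the boundedness of the cosines, is
  essential: \<open>j * wt 1 j\<close> behaves like \<open>1 / j\<close> and is not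
  summable.\<close>

definition modulus :: "nat \<Rightarrow> real" where
  "modulus n = (\<Sum>j. wt 1 j * min 2 (real j * (pi / real n)))"

lemma modulus_summable: "summable (\<lambda>j. wt 1 j * min 2 (real j * (pi / real n)))"
proof (rule abs_suminf_le(1)[OF _ summable_wt_mult[of 1 2]])
  fix j
  show "\<bar>wt 1 j * min 2 (real j * (pi / real n))\<bar> \<le> 2 * wt 1 j"
    using mult_left_mono[of "min 2 (real j * (pi / real n))" 2 "wt 1 j"] wt_nonneg[of 1 j]
    by (simp add: abs_mult)
qed simp

lemma Tannery_null:
  fixes D :: "nat \<Rightarrow> nat \<Rightarrow> real"
  assumes "\<And>j. (\<lambda>n. D j n) \<longlonglongrightarrow> 0" "\<And>j n. \<bar>D j n\<bar> \<le> c * wt 1 j"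
  shows "(\<lambda>n. \<Sum>j. D j n) \<longlonglongrightarrow> 0"
proof -
  have "\<forall>\<^sub>F (j, n) in at_top \<times>\<^sub>F sequentially. norm (D j n) \<le> c * wt 1 j"
    using assms(2) by (intro always_eventually) auto
  with tannerys_theorem[of D "\<lambda>_. 0" sequentially "\<lambda>j. c * wt 1 j"] assms(1) summable_wt_mult[of 1 c]
  show ?thesis by simp
qed

lemma pi_div_tendsto: "(\<lambda>n. c * (pi / real n)) \<longlonglongrightarrow> 0"
proof -
  have "(\<lambda>n. (c * pi) / real n) \<longlonglongrightarrow> 0" by (rule lim_const_over_n)
  then show ?thesis by simp
qed

lemma modulus_tendsto: "modulus \<longlonglongrightarrow> 0"
  unfolding modulus_def
proof (rule Tannery_null[where c = 2])
  fix j
  have "(\<lambda>n. wt 1 j * min 2 (real j * (pi / real n))) \<longlonglongrightarrow> wt 1 j * min 2 0"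
    by (intro tendsto_intros pi_div_tendsto)
  then show "(\<lambda>n. wt 1 j * min 2 (real j * (pi / real n))) \<longlonglongrightarrow> 0" by simp
  show "\<bar>wt 1 j * min 2 (real j * (pi / real n))\<bar> \<le> 2 * wt 1 j" for n
    using mult_left_mono[of "min 2 (real j * (pi / real n))" 2 "wt 1 j"] wt_nonneg[of 1 j]
    by (simp add: abs_mult)
qed

lemma modulus_nonneg: "0 \<le> modulus n"
  unfolding modulus_def by (intro suminf_nonneg modulus_summable) (auto simp: wt_nonneg)

context
  fixes T V K B L M :: real and b \<sigma> u0 :: "real \<Rightarrow> real"
  assumes T: "0 \<le> T" and V: "decaying u0 V"
    and b: "\<And>x y. \<bar>b x - b y\<bar> \<le> L * \<bar>x - y\<bar>" "\<And>x. \<bar>b x\<bar> \<le> B"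
    and \<sigma>: "\<And>x y. \<bar>\<sigma> x - \<sigma> y\<bar> \<le> L * \<bar>x - y\<bar>" "\<And>x. \<bar>\<sigma> x\<bar> \<le> K"
    and L: "0 \<le> L" and M: "0 \<le> M"
    and u0: "\<And>j. (\<lambda>n. icoef n u0 j) \<longlonglongrightarrow> icoef 0 u0 j"
begin

private definition "C = V + (B + K) * exp T * (5 + M)"

private lemma BK: "0 \<le> B" "0 \<le> K"
  using b(2)[of 0] \<sigma>(2)[of 0] abs_ge_zero order_trans by blast+

private lemma C_nonneg: "0 \<le> C"
  unfolding C_def using decaying_nonneg[OF V] BK M by (intro add_nonneg_nonneg mult_nonneg_nonneg) auto

private lemma cont: "continuous_on UNIV b" "continuous_on UNIV \<sigma>"
  using continuous_on_lipschitz_real[OF b(1) L] continuous_on_lipschitz_real[OF \<sigma>(1) L] by auto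

private lemma modec_le:
  assumes "h \<in> L2_OT T" "energy T h \<le> M" "0 \<le> t" "t \<le> T"
  shows "\<bar>modec n b \<sigma> u0 h f j t\<bar> \<le> C * wt 1 j"
  unfolding C_def by (rule modec_bound[OF assms V]) (use b \<sigma> in auto)

text \<open>Solutions inherit the modulus from their coefficients, which are bounded uniformly over
  the energy ball; hence the sampling error in the nonlinear terms is uniform in the
  control.\<close>

private lemma sol_samp_close:
  assumes f: "sol T 0 b \<sigma> u0 h f" and h: "h \<in> L2_OT T" "energy T h \<le> M"
    and "0 < n" "s \<in> {0..T}" "y \<in> domO"
  shows "\<bar>f (s, samp n y) - f (s, y)\<bar> \<le> C * modulus n"
proof -
  have sy: "samp n y \<in> domO" using assms samp_in_domO by blast
  have eq: "f (s, x) = (\<Sum>j. phi j x * modec 0 b \<sigma> u0 h f j s)" "summable (\<lambda>j. phi j x * modec 0 b \<sigma> u0 h f j s)"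
    if "x \<in> domO" for x
    using f assms that mild_summable[OF h _ _ V that, of s b f B \<sigma> K 0] b \<sigma>
    by (auto simp: sol_def mild_def trial_def)
  have "\<bar>phi j (samp n y) * modec 0 b \<sigma> u0 h f j s - phi j y * modec 0 b \<sigma> u0 h f j s\<bar>
      \<le> C * (wt 1 j * min 2 (real j * (pi / real n)))" for j
  proof -
    have "\<bar>phi j (samp n y) - phi j y\<bar> \<le> real j * \<bar>samp n y - y\<bar>" by (rule phi_lipschitz)
    also have "\<dots> \<le> real j * (pi / real n)" using samp_close[OF \<open>0 < n\<close> \<open>y \<in> domO\<close>] by (intro mult_left_mono) auto
    finally have "\<bar>phi j (samp n y) - phi j y\<bar> \<le> min 2 (real j * (pi / real n))"
      using abs_phi_le[of j "samp n y"] abs_phi_le[of j y] by auto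
    then have "\<bar>phi j (samp n y) - phi j y\<bar> * \<bar>modec 0 b \<sigma> u0 h f j s\<bar> \<le> min 2 (real j * (pi / real n)) * (C * wt 1 j)"
      using modec_le[OF h, of s 0 f j] assms by (intro mult_mono) auto
    then show ?thesis by (simp add: mult_ac flip: abs_mult left_diff_distrib)
  qed
  from abs_suminf_le(2)[OF this summable_mult[OF modulus_summable]]
  show ?thesis unfolding eq(1)[OF sy] eq(1)[OF assms(6)] suminf_diff[OF eq(2)[OF sy] eq(2)[OF assms(6)]]
    modulus_def suminf_mult[OF modulus_summable] .
qed

text \<open>Error of the integrand of one mode, in this order: decay factor and test function,
  sampling inside the two coefficients, frequency in front of the drift. The control does not
  occur.\<close>

private definition "\<rho> j n = (\<bar>(freq n j)\<^sup>2 - (freq 0 j)\<^sup>2\<bar> * T + real j * (pi / real n)) * (B + K)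
   + L * (C * modulus n) + \<bar>freq n j - freq 0 j\<bar> * B"

text \<open>Total error of one term of the series: trial function, initial coefficient, time
  integral. It grows with \<open>j\<close> and is used only for its limit at fixed
  \<open>j\<close>.\<close>

private definition "\<delta> j n = real j * (pi / real n) * (C * wt 1 j)
   + (\<bar>(freq n j)\<^sup>2 - (freq 0 j)\<^sup>2\<bar> * T * (V * wt 1 j) + \<bar>icoef n u0 j - icoef 0 u0 j\<bar>
     + \<rho> j n * (T * pi * (2 + (real j)\<^sup>2) + M))"

private lemma \<delta>_tendsto: "(\<lambda>n. \<delta> j n) \<longlonglongrightarrow> 0"
proof -
  have f2: "(\<lambda>n. \<bar>(freq n j)\<^sup>2 - (freq 0 j)\<^sup>2\<bar>) \<longlonglongrightarrow> \<bar>(freq 0 j)\<^sup>2 - (freq 0 j)\<^sup>2\<bar>"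
    and f1: "(\<lambda>n. \<bar>freq n j - freq 0 j\<bar>) \<longlonglongrightarrow> \<bar>freq 0 j - freq 0 j\<bar>"
    and ic: "(\<lambda>n. \<bar>icoef n u0 j - icoef 0 u0 j\<bar>) \<longlonglongrightarrow> \<bar>icoef 0 u0 j - icoef 0 u0 j\<bar>"
    by (intro tendsto_intros freq_tendsto u0)+
  have "(\<lambda>n. \<rho> j n) \<longlonglongrightarrow> (\<bar>(freq 0 j)\<^sup>2 - (freq 0 j)\<^sup>2\<bar> * T + 0) * (B + K) + L * (C * 0) + \<bar>freq 0 j - freq 0 j\<bar> * B"
    unfolding \<rho>_def by (intro tendsto_add tendsto_mult tendsto_const f1 f2 pi_div_tendsto modulus_tendsto)
  then have r: "(\<lambda>n. \<rho> j n) \<longlonglongrightarrow> 0" by simp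
  have "(\<lambda>n. \<delta> j n) \<longlonglongrightarrow> 0 * (C * wt 1 j)
   + (\<bar>(freq 0 j)\<^sup>2 - (freq 0 j)\<^sup>2\<bar> * T * (V * wt 1 j) + \<bar>icoef 0 u0 j - icoef 0 u0 j\<bar>
     + 0 * (T * pi * (2 + (real j)\<^sup>2) + M))"
    unfolding \<delta>_def by (intro tendsto_add tendsto_mult[OF pi_div_tendsto tendsto_const]
      tendsto_mult[OF tendsto_mult[OF f2 tendsto_const] tendsto_const] tendsto_mult[OF r tendsto_const] ic)
  then show ?thesis by simp
qed

private lemma \<rho>_nonneg: "0 \<le> \<rho> j n"
  unfolding \<rho>_def using T BK L C_nonneg modulus_nonneg[of n]
  by (intro add_nonneg_nonneg mult_nonneg_nonneg) auto

private lemma mode_consistent: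
  assumes f: "sol T 0 b \<sigma> u0 h f" and h: "h \<in> L2_OT T" "energy T h \<le> M"
    and j: "j < n" and t: "t \<in> {0..T}" and x: "x \<in> domO"
  shows "\<bar>trial n j x * modec n b \<sigma> u0 h f j t - trial 0 j x * modec 0 b \<sigma> u0 h f j t\<bar> \<le> \<delta> j n"
proof -
  have n: "0 < n" using j by simp
  have fc: "continuous_on (domOT T) f" using f by (simp add: sol_def)
  have V0: "0 \<le> V" using decaying_nonneg[OF V] .
  have expd: "\<bar>exp (- (freq n j)\<^sup>2 * r) - exp (- (freq 0 j)\<^sup>2 * r)\<bar> \<le> \<bar>(freq n j)\<^sup>2 - (freq 0 j)\<^sup>2\<bar> * T" if "r \<in> {0..T}" for r
  proof -
    have "\<bar>exp (- ((freq n j)\<^sup>2 * r)) - exp (- ((freq 0 j)\<^sup>2 * r))\<bar> \<le> \<bar>(freq n j)\<^sup>2 * r - (freq 0 j)\<^sup>2 * r\<bar>"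
      using that by (intro exp_minus_lipschitz) auto
    also have "\<dots> = \<bar>(freq n j)\<^sup>2 - (freq 0 j)\<^sup>2\<bar> * r" using that by (simp add: abs_mult flip: left_diff_distrib)
    also have "\<dots> \<le> \<bar>(freq n j)\<^sup>2 - (freq 0 j)\<^sup>2\<bar> * T" using that by (intro mult_left_mono) auto
    finally show ?thesis by simp
  qed
  have initial: "\<bar>exp (- (freq n j)\<^sup>2 * t) * icoef n u0 j - exp (- (freq 0 j)\<^sup>2 * t) * icoef 0 u0 j\<bar>
      \<le> \<bar>(freq n j)\<^sup>2 - (freq 0 j)\<^sup>2\<bar> * T * (V * wt 1 j) + \<bar>icoef n u0 j - icoef 0 u0 j\<bar>"
  proof -
    have "exp (- (freq n j)\<^sup>2 * t) * icoef n u0 j - exp (- (freq 0 j)\<^sup>2 * t) * icoef 0 u0 j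
      = (exp (- (freq n j)\<^sup>2 * t) - exp (- (freq 0 j)\<^sup>2 * t)) * icoef n u0 j + exp (- (freq 0 j)\<^sup>2 * t) * (icoef n u0 j - icoef 0 u0 j)"
      by (simp add: algebra_simps)
    also have "\<bar>\<dots>\<bar> \<le> \<bar>(freq n j)\<^sup>2 - (freq 0 j)\<^sup>2\<bar> * T * (V * wt 1 j) + 1 * \<bar>icoef n u0 j - icoef 0 u0 j\<bar>"
      using expd[OF t] V T t unfolding decaying_def
      by (intro order.trans[OF abs_triangle_ineq] add_mono; unfold abs_mult; intro mult_mono) auto
    finally show ?thesis by simp
  qed
  let ?I = "\<lambda>n z. exp (- (freq n j)\<^sup>2 * (t - fst z)) * phi j (samp n (snd z)) * source n b \<sigma> h f j z"
  let ?S = "{0..t} \<times> domO"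
  have int: "set_integrable lborel ?S (?I n)" for n
    using t by (intro mint_integrable[of T] source_integrable fc cont h T) auto
  have i2: "set_integrable lborel (domOT T) (\<lambda>z. (2 + (real j)\<^sup>2) + (h z)\<^sup>2)"
    using h by (intro set_integral_add(1)[OF set_integrable_continuous_compact[of "domOT T" "\<lambda>_. 2 + (real j)\<^sup>2"]]) (auto simp: L2_OT_def)
  have i3: "set_integrable lborel ?S (\<lambda>z. (2 + (real j)\<^sup>2) + (h z)\<^sup>2)"
    using t slab_subset by (intro set_integrable_subset[OF i2]) auto
  \<comment> \<open>The product of three factors is telescoped. All dependence on the control goes
    into the majorant, using \<open>\<bar>h\<bar> \<le> 1 + h\<^sup>2\<close>, whose integral is
    bounded over the energy ball.\<close>
  have pw: "\<bar>?I n z - ?I 0 z\<bar> \<le> \<rho> j n * ((2 + (real j)\<^sup>2) + (h z)\<^sup>2)" if z: "z \<in> ?S" for z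
  proof -
    let ?E = "\<lambda>n. exp (- (freq n j)\<^sup>2 * (t - fst z))" and ?p = "\<lambda>n. phi j (samp n (snd z))" and ?s = "\<lambda>n. source n b \<sigma> h f j z"
    have zT: "z \<in> domOT T" using z slab_subset[of t T] t by auto
    have E: "\<bar>?E n - ?E 0\<bar> \<le> \<bar>(freq n j)\<^sup>2 - (freq 0 j)\<^sup>2\<bar> * T" using expd[of "t - fst z"] z t by auto
    have E1: "\<bar>?E 0\<bar> \<le> 1" using z by auto
    have p: "\<bar>?p n - ?p 0\<bar> \<le> real j * (pi / real n)"
    proof -
      have "\<bar>?p n - ?p 0\<bar> \<le> real j * \<bar>samp n (snd z) - snd z\<bar>"
        using phi_lipschitz by (simp add: samp_def[of 0])
      also have "\<dots> \<le> real j * (pi / real n)" using samp_close[OF n] z by (intro mult_left_mono) auto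
      finally show ?thesis .
    qed
    have sn: "\<bar>?s n\<bar> \<le> (B + K) * ((real j)\<^sup>2 + \<bar>h z\<bar>)"
    proof -
      have "\<bar>?s n\<bar> \<le> (B + K) * (freq n j + \<bar>h z\<bar>)"
        by (rule source_abs_le[OF _ _ zT]) (use b \<sigma> in auto)
      also have "\<dots> \<le> (B + K) * ((real j)\<^sup>2 + \<bar>h z\<bar>)" using freq_le[of n j] BK by (intro mult_left_mono) auto
      finally show ?thesis .
    qed
    have sd: "\<bar>?s n - ?s 0\<bar> \<le> L * (C * modulus n) * ((real j)\<^sup>2 + \<bar>h z\<bar>) + \<bar>freq n j - freq 0 j\<bar> * B"
    proof -
      let ?w = "f (fst z, samp n (snd z))" and ?v = "f (fst z, snd z)"
      have wv: "\<bar>?w - ?v\<bar> \<le> C * modulus n" by (rule sol_samp_close[OF f h n]) (use zT in \<open>auto simp: domOT_def\<close>)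
      have "?s n - ?s 0 = (\<sigma> ?w - \<sigma> ?v) * h z - freq n j * (b ?w - b ?v) - (freq n j - freq 0 j) * b ?v"
        by (simp add: source_def samp_def[of 0] algebra_simps)
      also have "\<bar>\<dots>\<bar> \<le> \<bar>\<sigma> ?w - \<sigma> ?v\<bar> * \<bar>h z\<bar> + freq n j * \<bar>b ?w - b ?v\<bar> + \<bar>freq n j - freq 0 j\<bar> * \<bar>b ?v\<bar>"
      proof -
        have "\<bar>u - v - w\<bar> \<le> \<bar>u\<bar> + \<bar>v\<bar> + \<bar>w\<bar>" for u v w :: real by linarith
        from this[of "(\<sigma> ?w - \<sigma> ?v) * h z" "freq n j * (b ?w - b ?v)" "(freq n j - freq 0 j) * b ?v"]
        show ?thesis using freq_nonneg[of n j] by (simp only: abs_mult abs_of_nonneg)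
      qed
      also have "\<dots> \<le> L * (C * modulus n) * \<bar>h z\<bar> + (real j)\<^sup>2 * (L * (C * modulus n)) + \<bar>freq n j - freq 0 j\<bar> * B"
      proof (intro add_mono mult_mono abs_ge_zero freq_le order_refl b(2) zero_le_power2)
        show "\<bar>\<sigma> ?w - \<sigma> ?v\<bar> \<le> L * (C * modulus n)" by (rule order.trans[OF \<sigma>(1) mult_left_mono[OF wv L]])
        show "\<bar>b ?w - b ?v\<bar> \<le> L * (C * modulus n)" by (rule order.trans[OF b(1) mult_left_mono[OF wv L]])
        show "0 \<le> L * (C * modulus n)" using L C_nonneg modulus_nonneg[of n] by simp
      qed
      finally show ?thesis by (simp add: algebra_simps)
    qed
    let ?a = "1 + (real j)\<^sup>2 + \<bar>h z\<bar>"
    have s1: "\<bar>?s n\<bar> \<le> (B + K) * ?a" using sn BK mult_left_mono[of "(real j)\<^sup>2 + \<bar>h z\<bar>" ?a "B + K"] by simp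
    have s2: "\<bar>?s n - ?s 0\<bar> \<le> (L * (C * modulus n) + \<bar>freq n j - freq 0 j\<bar> * B) * ?a"
    proof -
      have "0 \<le> L * (C * modulus n)" "0 \<le> \<bar>freq n j - freq 0 j\<bar> * B"
        using L C_nonneg modulus_nonneg[of n] BK by auto
      then have "L * (C * modulus n) * ((real j)\<^sup>2 + \<bar>h z\<bar>) \<le> L * (C * modulus n) * ?a"
        "\<bar>freq n j - freq 0 j\<bar> * B * 1 \<le> \<bar>freq n j - freq 0 j\<bar> * B * ?a"
        by (intro mult_left_mono; simp)+
      then show ?thesis using sd unfolding distrib_right by linarith
    qed
    have "\<bar>?I n z - ?I 0 z\<bar> \<le> (\<bar>(freq n j)\<^sup>2 - (freq 0 j)\<^sup>2\<bar> * T) * ((B + K) * ?a) + (real j * (pi / real n)) * ((B + K) * ?a)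
       + (L * (C * modulus n) + \<bar>freq n j - freq 0 j\<bar> * B) * ?a"
      by (rule abs_product3_diff_le[OF E E1 p abs_phi_le abs_phi_le s1 s2])
    also have "\<dots> = \<rho> j n * ?a"
    proof -
      have "r * (c * a) + r' * (c * a) + (d + d') * a = ((r + r') * c + d + d') * a" for r r' a c d d' :: real
        by (simp add: algebra_simps)
      then show ?thesis unfolding \<rho>_def .
    qed
    also have "\<dots> \<le> \<rho> j n * ((2 + (real j)\<^sup>2) + (h z)\<^sup>2)"
    proof (intro mult_left_mono \<rho>_nonneg)
      have "0 \<le> (\<bar>h z\<bar> - 1)\<^sup>2 + \<bar>h z\<bar>" by simp
      then show "?a \<le> (2 + (real j)\<^sup>2) + (h z)\<^sup>2" by (simp add: power2_eq_square algebra_simps)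
    qed
    finally show ?thesis .
  qed
  have mintd: "\<bar>mint n (source n b \<sigma> h f j) j t - mint 0 (source 0 b \<sigma> h f j) j t\<bar> \<le> \<rho> j n * (T * pi * (2 + (real j)\<^sup>2) + M)"
  proof -
    have diff: "mint n (source n b \<sigma> h f j) j t - mint 0 (source 0 b \<sigma> h f j) j t = (LBINT z:?S. ?I n z - ?I 0 z)"
      unfolding mint_def by (rule set_integral_diff(2)[symmetric]) (rule int)+
    have "\<bar>mint n (source n b \<sigma> h f j) j t - mint 0 (source 0 b \<sigma> h f j) j t\<bar> \<le> (LBINT z:?S. \<rho> j n * ((2 + (real j)\<^sup>2) + (h z)\<^sup>2))"
      unfolding diff
    proof (rule abs_set_integral_le)
      show "set_integrable lborel ?S (\<lambda>z. \<rho> j n * ((2 + (real j)\<^sup>2) + (h z)\<^sup>2))"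
        by (intro set_integrable_mult_right i3)
    qed (rule pw)
    also have "\<dots> = \<rho> j n * (LBINT z:?S. (2 + (real j)\<^sup>2) + (h z)\<^sup>2)" by (rule set_integral_mult_right)
    finally have le: "\<bar>mint n (source n b \<sigma> h f j) j t - mint 0 (source 0 b \<sigma> h f j) j t\<bar> \<le> \<rho> j n * (LBINT z:?S. (2 + (real j)\<^sup>2) + (h z)\<^sup>2)" .
    have "(LBINT z:?S. (2 + (real j)\<^sup>2) + (h z)\<^sup>2) \<le> (LBINT z:domOT T. (2 + (real j)\<^sup>2) + (h z)\<^sup>2)"
      unfolding set_lebesgue_integral_def using i2 i3 slab_subset[of t T] t unfolding set_integrable_def
      by (intro integral_mono) (auto simp: indicator_def)
    also have "\<dots> = (LBINT z:domOT T. 2 + (real j)\<^sup>2) + energy T h"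
      unfolding energy_def
      using h by (intro set_integral_add(2)[OF set_integrable_continuous_compact[of "domOT T" "\<lambda>_. 2 + (real j)\<^sup>2"]]) (auto simp: L2_OT_def)
    also have "(LBINT z:domOT T. 2 + (real j)\<^sup>2) = T * pi * (2 + (real j)\<^sup>2)"
    proof -
      have "(LBINT z:domOT T. 2 + (real j)\<^sup>2) = (LBINT s:{0..T}. LBINT y:domO. 2 + (real j)\<^sup>2)"
        unfolding domOT_def
        by (intro set_integral_Times set_integrable_continuous_compact compact_Times continuous_intros) auto
      then show ?thesis using T by (simp add: set_integral_const domO_def)
    qed
    finally have "(LBINT z:?S. (2 + (real j)\<^sup>2) + (h z)\<^sup>2) \<le> T * pi * (2 + (real j)\<^sup>2) + M" using h(2) by linarith
    then show ?thesis using le mult_left_mono[OF _ \<rho>_nonneg[of j n]] order.trans by blast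
  qed
  have mdiff: "modec n b \<sigma> u0 h f j t - modec 0 b \<sigma> u0 h f j t =
      (exp (- (freq n j)\<^sup>2 * t) * icoef n u0 j - exp (- (freq 0 j)\<^sup>2 * t) * icoef 0 u0 j)
      + (mint n (source n b \<sigma> h f j) j t - mint 0 (source 0 b \<sigma> h f j) j t)"
    unfolding modec_def by (rule add_diff_add)
  have md: "\<bar>modec n b \<sigma> u0 h f j t - modec 0 b \<sigma> u0 h f j t\<bar>
      \<le> \<bar>(freq n j)\<^sup>2 - (freq 0 j)\<^sup>2\<bar> * T * (V * wt 1 j) + \<bar>icoef n u0 j - icoef 0 u0 j\<bar> + \<rho> j n * (T * pi * (2 + (real j)\<^sup>2) + M)"
    unfolding mdiff by (rule order.trans[OF abs_triangle_ineq add_mono[OF initial mintd]])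
  have td: "\<bar>(trial n j x - phi j x) * modec n b \<sigma> u0 h f j t\<bar> \<le> real j * (pi / real n) * (C * wt 1 j)"
    unfolding abs_mult using trial_close[OF j x] modec_le[OF h, of t n f j] t by (intro mult_mono) auto
  have eq: "trial n j x * modec n b \<sigma> u0 h f j t - trial 0 j x * modec 0 b \<sigma> u0 h f j t
    = (trial n j x - phi j x) * modec n b \<sigma> u0 h f j t + trial 0 j x * (modec n b \<sigma> u0 h f j t - modec 0 b \<sigma> u0 h f j t)"
    by (simp add: trial_def[of 0] algebra_simps)
  show ?thesis unfolding eq \<delta>_def
    by (rule order.trans[OF abs_triangle_ineq add_mono[OF td abs_trial_mult_le[OF x md]]])
qed

text \<open>The continuum solution is inserted into the discrete map. Each term converges at a rate
  independent of the control, and the tails are dominated by the weights, so Tannery's theorem gives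
  uniformity over the ball.\<close>

lemma mild_consistent:
  assumes "0 < \<epsilon>"
  shows "\<exists>N. \<forall>n\<ge>N. \<forall>h f. h \<in> L2_OT T \<longrightarrow> energy T h \<le> M \<longrightarrow> sol T 0 b \<sigma> u0 h f \<longrightarrow>
    (\<forall>t\<in>{0..T}. \<forall>x\<in>domO. \<bar>mild n b \<sigma> u0 h f t x - f (t, x)\<bar> \<le> \<epsilon>)"
proof -
  \<comment> \<open>The termwise error is capped by the crude bound on two terms, which supplies the
    summable majorant; for \<open>j \<ge> n\<close>, where the discrete term is a dummy, the crude
    bound is all there is.\<close>
  define D where "D j n = (if j < n then min (2 * C * wt 1 j) (\<bar>\<delta> j n\<bar>) else 2 * C * wt 1 j)" for j n
  have Db: "\<bar>D j n\<bar> \<le> 2 * C * wt 1 j" for j n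
    using C_nonneg wt_nonneg[of 1 j] by (auto simp: D_def min_def)
  have D0: "(\<lambda>n. D j n) \<longlonglongrightarrow> 0" for j
  proof -
    have "(\<lambda>n. min (2 * C * wt 1 j) \<bar>\<delta> j n\<bar>) \<longlonglongrightarrow> min (2 * C * wt 1 j) \<bar>0\<bar>"
      by (intro tendsto_intros \<delta>_tendsto)
    then have "(\<lambda>n. min (2 * C * wt 1 j) \<bar>\<delta> j n\<bar>) \<longlonglongrightarrow> 0"
      using C_nonneg wt_nonneg[of 1 j] by (simp add: min_absorb2 del: min_less_iff_conj)
    then show ?thesis
      by (rule Lim_transform_eventually) (auto simp: D_def eventually_gt_at_top intro!: eventually_mono[OF eventually_gt_at_top[of j]])
  qed
  have "(\<lambda>n. \<Sum>j. D j n) \<longlonglongrightarrow> 0" by (rule Tannery_null[OF D0 Db])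
  then have "\<forall>\<^sub>F n in sequentially. (\<Sum>j. D j n) < \<epsilon>" using assms by (intro order_tendstoD)
  then obtain N where N: "\<And>n. N \<le> n \<Longrightarrow> (\<Sum>j. D j n) < \<epsilon>" by (auto simp: eventually_sequentially)
  have "\<bar>mild n b \<sigma> u0 h f t x - f (t, x)\<bar> \<le> \<epsilon>"
    if "N \<le> n" and h: "h \<in> L2_OT T" "energy T h \<le> M" and f: "sol T 0 b \<sigma> u0 h f" and t: "t \<in> {0..T}" and x: "x \<in> domO"
    for n h f t x
  proof -
    have s: "summable (\<lambda>j. trial n j x * modec n b \<sigma> u0 h f j t)" for n
      by (rule mild_summable[OF h _ _ V x, of t b f B \<sigma> K]) (use t b \<sigma> in auto)
    have "\<bar>trial n j x * modec n b \<sigma> u0 h f j t - trial 0 j x * modec 0 b \<sigma> u0 h f j t\<bar> \<le> D j n" for j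
    proof -
      have m: "\<bar>trial n j x * modec n b \<sigma> u0 h f j t\<bar> \<le> C * wt 1 j" for n
        by (intro abs_trial_mult_le x modec_le h) (use t in auto)
      have "\<bar>trial n j x * modec n b \<sigma> u0 h f j t - trial 0 j x * modec 0 b \<sigma> u0 h f j t\<bar> \<le> 2 * C * wt 1 j"
        using m[of n] m[of 0] by linarith
      moreover have "\<bar>trial n j x * modec n b \<sigma> u0 h f j t - trial 0 j x * modec 0 b \<sigma> u0 h f j t\<bar> \<le> \<bar>\<delta> j n\<bar>" if "j < n"
        by (rule order.trans[OF mode_consistent[OF f h that t x] abs_ge_self])
      ultimately show ?thesis unfolding D_def by (simp only: min_def split: if_split) blast
    qed
    moreover have "summable (\<lambda>j. D j n)" by (rule abs_suminf_le(1)[OF Db summable_wt_mult]) simp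
    ultimately have "\<bar>\<Sum>j. trial n j x * modec n b \<sigma> u0 h f j t - trial 0 j x * modec 0 b \<sigma> u0 h f j t\<bar> \<le> (\<Sum>j. D j n)"
      by (rule abs_suminf_le(2))
    also have "(\<Sum>j. trial n j x * modec n b \<sigma> u0 h f j t - trial 0 j x * modec 0 b \<sigma> u0 h f j t) = mild n b \<sigma> u0 h f t x - f (t, x)"
      using suminf_diff[OF s[of n] s[of 0]] f t x by (simp add: sol_def mild_def)
    finally show ?thesis using N[OF \<open>N \<le> n\<close>] by simp
  qed
  then show ?thesis by blast
qed

text \<open>Consistency plus stability. The weight \<beta> depends on the Lipschitz constant and the
  energy bound only, so stability is uniform in the mesh.\<close>

lemma sol_convergence_lipschitz:
  assumes "0 < \<epsilon>"
  shows "\<exists>N. \<forall>n\<ge>N. \<forall>h f g. h \<in> L2_OT T \<longrightarrow> energy T h \<le> M \<longrightarrow> sol T 0 b \<sigma> u0 h f \<longrightarrow> sol T n b \<sigma> u0 h g \<longrightarrow>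
    (\<forall>z\<in>domOT T. \<bar>g z - f z\<bar> \<le> \<epsilon>)"
proof -
  have "0 \<le> L * (5 + M)" using L M by simp
  then obtain \<beta> where \<beta>: "0 < \<beta>" "L * (5 + M) * W \<beta> \<le> 1 / 2" using exists_weight by blast
  define e where "e = \<epsilon> / (2 * exp (\<beta> * T))"
  have e: "0 < e" "2 * e * exp (\<beta> * T) = \<epsilon>" using assms by (auto simp: e_def)
  obtain N where N: "\<And>n h f t x. N \<le> n \<Longrightarrow> h \<in> L2_OT T \<Longrightarrow> energy T h \<le> M \<Longrightarrow> sol T 0 b \<sigma> u0 h f \<Longrightarrow>
    t \<in> {0..T} \<Longrightarrow> x \<in> domO \<Longrightarrow> \<bar>mild n b \<sigma> u0 h f t x - f (t, x)\<bar> \<le> e"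
    using mild_consistent[OF e(1)] by blast
  have "\<bar>g z - f z\<bar> \<le> \<epsilon>" if "N \<le> n" and h: "h \<in> L2_OT T" "energy T h \<le> M" and f: "sol T 0 b \<sigma> u0 h f" and g: "sol T n b \<sigma> u0 h g"
    and z: "z \<in> domOT T" for n h f g z
  proof -
    obtain t x where tx: "z = (t, x)" "t \<in> {0..T}" "x \<in> domO" using z by (auto simp: domOT_def)
    have fc: "continuous_on (domOT T) f" and gc: "continuous_on (domOT T) g" using f g by (auto simp: sol_def)
    have "\<bar>g (t, x) - f (t, x)\<bar> \<le> 2 * e * exp (\<beta> * T)"
    proof (rule mild_stability[OF gc fc cont h V T order_refl \<beta>(1) L \<beta>(2) _ b(1) \<sigma>(1) _ tx(2,3), where n = n])
      fix s y assume sy: "s \<in> {0..T}" "y \<in> domO"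
      show "\<bar>g (s, y) - f (s, y)\<bar> \<le> e + \<bar>mild n b \<sigma> u0 h g s y - mild n b \<sigma> u0 h f s y\<bar>"
        using N[OF \<open>N \<le> n\<close> h f sy] g sy by (auto simp: sol_def)
    qed (use e in auto)
    then show ?thesis using tx e by simp
  qed
  then show ?thesis by blast
qed

end

subsection \<open>Well-posedness with the cubic nonlinearity\<close>

definition coefficient :: "(real \<Rightarrow> real) \<Rightarrow> real \<Rightarrow> real \<Rightarrow> bool" where
  "coefficient \<sigma> K L \<longleftrightarrow> 0 \<le> L \<and> (\<forall>x y. \<bar>\<sigma> x - \<sigma> y\<bar> \<le> L * \<bar>x - y\<bar>) \<and> (\<forall>x. \<bar>\<sigma> x\<bar> \<le> K)"

definition initial_datum :: "(real \<Rightarrow> real) \<Rightarrow> real \<Rightarrow> bool" where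
  "initial_datum u0 V \<longleftrightarrow> decaying u0 V \<and> (\<forall>j. (\<lambda>n. icoef n u0 j) \<longlonglongrightarrow> icoef 0 u0 j)"

lemma coefficient_continuous: "coefficient \<sigma> K L \<Longrightarrow> continuous_on UNIV \<sigma>"
  by (rule continuous_on_lipschitz_real[of _ L]) (auto simp: coefficient_def)

lemma coefficient_one: "coefficient (\<lambda>_. 1) 1 0" by (simp add: coefficient_def)

lemma mild_cong:
  assumes "\<And>z. z \<in> domOT T \<Longrightarrow> b (f z) = b' (f' z)" "\<And>z. z \<in> domOT T \<Longrightarrow> \<sigma> (f z) = \<sigma>' (f' z)"
    "\<And>z. z \<in> domOT T \<Longrightarrow> h z = h' z" "t \<le> T"
  shows "mild n b \<sigma> u0 h f t x = mild n b' \<sigma>' u0 h' f' t x"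
proof -
  have "mint n (source n b \<sigma> h f j) j t = mint n (source n b' \<sigma>' h' f' j) j t" for j
  proof (rule mint_cong)
    fix z assume "z \<in> {0..t} \<times> domO"
    then have "z \<in> domOT T" using slab_subset[OF assms(4)] by blast
    then show "source n b \<sigma> h f j z = source n b' \<sigma>' h' f' j z"
      using assms(1-3) samp_pair_in_domOT[of z T n] by (simp add: source_def)
  qed
  then show ?thesis by (simp add: mild_def modec_def)
qed

lemma sol_cong:
  assumes "\<And>z. z \<in> domOT T \<Longrightarrow> b (f z) = b' (f' z)" "\<And>z. z \<in> domOT T \<Longrightarrow> \<sigma> (f z) = \<sigma>' (f' z)"
    "\<And>z. z \<in> domOT T \<Longrightarrow> h z = h' z" "\<And>z. z \<in> domOT T \<Longrightarrow> f z = f' z"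
  shows "sol T n b \<sigma> u0 h f \<longleftrightarrow> sol T n b' \<sigma>' u0 h' f'"
proof -
  have "continuous_on (domOT T) f \<longleftrightarrow> continuous_on (domOT T) f'"
    using assms(4) by (intro continuous_on_cong) auto
  moreover have "mild n b \<sigma> u0 h f t x = mild n b' \<sigma>' u0 h' f' t x" if "t \<in> {0..T}" for t x
    by (rule mild_cong[where T = T]) (use that assms in auto)
  moreover have "f (t, x) = f' (t, x)" if "t \<in> {0..T}" "x \<in> domO" for t x
    using assms(4)[of "(t, x)"] that by (simp add: domOT_def)
  ultimately show ?thesis unfolding sol_def by simp
qed

lemma sol_trunc:
  assumes "\<And>z. z \<in> domOT T \<Longrightarrow> \<bar>f z\<bar> \<le> R"
  shows "sol T n (trunc R) \<sigma> u0 h f \<longleftrightarrow> sol T n bfun \<sigma> u0 h f"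
  by (rule sol_cong) (auto simp: trunc_eq assms)

lemma continuous_bounded:
  assumes "continuous_on (domOT T) (f :: real \<times> real \<Rightarrow> real)"
  obtains R where "\<And>z. z \<in> domOT T \<Longrightarrow> \<bar>f z\<bar> \<le> R"
  using compose_bounded[OF assms, of "\<lambda>x. x"] by auto

text \<open>Both solutions are continuous on a compact set, hence bounded, and the cubic is
  Lipschitz on their common range; stability with zero residual finishes.\<close>

lemma sol_unique:
  assumes T: "0 \<le> T" and \<sigma>: "coefficient \<sigma> K L" and u0: "decaying u0 V" and h: "h \<in> L2_OT T"
    and f: "sol T n bfun \<sigma> u0 h f" and g: "sol T n bfun \<sigma> u0 h g" and z: "z \<in> domOT T"
  shows "f z = g z"
proof -
  have fc: "continuous_on (domOT T) f" and gc: "continuous_on (domOT T) g" using f g by (auto simp: sol_def)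
  obtain R where R: "\<And>z. z \<in> domOT T \<Longrightarrow> \<bar>f z\<bar> \<le> R" using continuous_bounded[OF fc] by blast
  obtain R' where R': "\<And>z. z \<in> domOT T \<Longrightarrow> \<bar>g z\<bar> \<le> R'" using continuous_bounded[OF gc] by blast
  define S where "S = max R R'"
  define Q where "Q = max (3 * S\<^sup>2 + 1) L"
  have Q: "0 \<le> Q" "3 * S\<^sup>2 + 1 \<le> Q" "L \<le> Q" by (auto simp: Q_def le_max_iff_disj)
  have "0 \<le> Q * (5 + energy T h)" using Q energy_nonneg[of T h] by simp
  then obtain \<beta> where \<beta>: "0 < \<beta>" "Q * (5 + energy T h) * W \<beta> \<le> 1 / 2" using exists_weight by blast
  obtain t x where tx: "z = (t, x)" "t \<in> {0..T}" "x \<in> domO" using z by (auto simp: domOT_def)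
  have "\<bar>f (t, x) - g (t, x)\<bar> \<le> 2 * 0 * exp (\<beta> * T)"
  proof (rule mild_stability[OF fc gc continuous_on_bfun coefficient_continuous[OF \<sigma>] h order_refl u0 T order_refl \<beta>(1) Q(1) \<beta>(2) order_refl _ _ _ tx(2,3)])
    fix z assume z: "z \<in> domOT T"
    have "\<bar>bfun (f z) - bfun (g z)\<bar> \<le> (3 * S\<^sup>2 + 1) * \<bar>f z - g z\<bar>"
      by (rule bfun_lipschitz) (use R[OF z] R'[OF z] in \<open>auto simp: S_def\<close>)
    also have "\<dots> \<le> Q * \<bar>f z - g z\<bar>" using Q by (intro mult_right_mono) auto
    finally show "\<bar>bfun (f z) - bfun (g z)\<bar> \<le> Q * \<bar>f z - g z\<bar>" .
    have "\<bar>\<sigma> (f z) - \<sigma> (g z)\<bar> \<le> L * \<bar>f z - g z\<bar>" using \<sigma> by (simp add: coefficient_def)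
    also have "\<dots> \<le> Q * \<bar>f z - g z\<bar>" using Q by (intro mult_right_mono) auto
    finally show "\<bar>\<sigma> (f z) - \<sigma> (g z)\<bar> \<le> Q * \<bar>f z - g z\<bar>" .
  next
    fix s y assume "s \<in> {0..T}" "y \<in> domO"
    then show "\<bar>f (s, y) - g (s, y)\<bar> \<le> 0 + \<bar>mild n bfun \<sigma> u0 h f s y - mild n bfun \<sigma> u0 h g s y\<bar>"
      using f g by (auto simp: sol_def)
  qed
  then show ?thesis using tx by simp
qed

lemma abs_trunc_bounded: "0 \<le> R \<Longrightarrow> \<bar>trunc R x\<bar> \<le> (3 * R\<^sup>2 + 1) * R"
proof -
  assume R: "0 \<le> R"
  have c: "\<bar>clip R x\<bar> \<le> R" using R by (auto simp: clip_def)
  have "\<bar>bfun (clip R x) - bfun 0\<bar> \<le> (3 * R\<^sup>2 + 1) * \<bar>clip R x - 0\<bar>"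
    using R c by (intro bfun_lipschitz) auto
  also have "\<dots> \<le> (3 * R\<^sup>2 + 1) * R" using c by (intro mult_left_mono) auto
  finally show ?thesis by (simp add: trunc_def bfun_def)
qed

text \<open>Three demands on the truncation: at least \<open>1\<close> for the sign of the affine
  continuation, above the initial node values, and above the a priori bound so that truncation is
  never active.\<close>

definition radius :: "real \<Rightarrow> real \<Rightarrow> real \<Rightarrow> real \<Rightarrow> real" where
  "radius T V K M = max 1 (max (V * W 1) (aprio T V K M))"

lemma radius: "1 \<le> radius T V K M" "V * W 1 \<le> radius T V K M" "aprio T V K M \<le> radius T V K M" "0 \<le> radius T V K M"
  by (auto simp: radius_def le_max_iff_disj)

lemma exists_sol_trunc:
  assumes "0 \<le> T" "coefficient \<sigma> K L" "decaying u0 V" "h \<in> L2_OT T" "0 \<le> R"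
  shows "\<exists>f. sol T n (trunc R) \<sigma> u0 h f"
proof (rule exists_sol_lipschitz[OF assms(1)])
  show "0 \<le> max (3 * R\<^sup>2 + 1) L" by (simp add: le_max_iff_disj)
  show "\<bar>trunc R x - trunc R y\<bar> \<le> max (3 * R\<^sup>2 + 1) L * \<bar>x - y\<bar>" for x y
    by (rule order.trans[OF trunc_lipschitz[OF assms(5)]], rule mult_right_mono) auto
  have "\<bar>\<sigma> x - \<sigma> y\<bar> \<le> L * \<bar>x - y\<bar>" for x y using assms(2) by (simp add: coefficient_def)
  then show "\<bar>\<sigma> x - \<sigma> y\<bar> \<le> max (3 * R\<^sup>2 + 1) L * \<bar>x - y\<bar>" for x y
    by (rule order.trans, intro mult_right_mono) auto
qed (use assms in auto)

lemma trunc_convergence: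
  assumes "0 \<le> T" "coefficient \<sigma> K L" "initial_datum u0 V" "0 \<le> R" "0 \<le> M" "0 < \<epsilon>"
  shows "\<exists>N. \<forall>n\<ge>N. \<forall>h f g. h \<in> L2_OT T \<longrightarrow> energy T h \<le> M \<longrightarrow> sol T 0 (trunc R) \<sigma> u0 h f \<longrightarrow> sol T n (trunc R) \<sigma> u0 h g \<longrightarrow>
    (\<forall>z\<in>domOT T. \<bar>g z - f z\<bar> \<le> \<epsilon>)"
proof (rule sol_convergence_lipschitz[where V = V and L = "max (3 * R\<^sup>2 + 1) L" and K = K and B = "(3 * R\<^sup>2 + 1) * R"])
  show "\<bar>trunc R x - trunc R y\<bar> \<le> max (3 * R\<^sup>2 + 1) L * \<bar>x - y\<bar>" for x y
    by (rule order.trans[OF trunc_lipschitz[OF assms(4)]], rule mult_right_mono) auto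
  have "\<bar>\<sigma> x - \<sigma> y\<bar> \<le> L * \<bar>x - y\<bar>" for x y using assms(2) by (simp add: coefficient_def)
  then show "\<bar>\<sigma> x - \<sigma> y\<bar> \<le> max (3 * R\<^sup>2 + 1) L * \<bar>x - y\<bar>" for x y
    by (rule order.trans, intro mult_right_mono) auto
  show "\<bar>trunc R x\<bar> \<le> (3 * R\<^sup>2 + 1) * R" for x by (rule abs_trunc_bounded[OF assms(4)])
qed (use assms in \<open>auto simp: coefficient_def initial_datum_def le_max_iff_disj\<close>)

text \<open>For the continuum equation the bound passes to the limit: at this fixed truncation the
  discrete solutions converge, and each of them obeys the mesh-independent estimate.\<close>

lemma sol_trunc_bound:
  assumes T: "0 \<le> T" and \<sigma>: "coefficient \<sigma> K L" and u0: "initial_datum u0 V" and h: "h \<in> L2_OT T" "energy T h \<le> M"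
    and f: "sol T n (trunc (radius T V K M)) \<sigma> u0 h f" and z: "z \<in> domOT T"
  shows "\<bar>f z\<bar> \<le> aprio T V K M"
proof -
  let ?R = "radius T V K M"
  have d: "decaying u0 V" using u0 by (simp add: initial_datum_def)
  have M: "0 \<le> M" using h energy_nonneg[of T h] by simp
  have K: "\<And>x. \<bar>\<sigma> x\<bar> \<le> K" using \<sigma> by (simp add: coefficient_def)
  have bound: "\<bar>g z\<bar> \<le> aprio T V K M" if "0 < n" "sol T n (trunc ?R) \<sigma> u0 h g" for g n
    by (rule sup_bound_discrete[OF that(1) T h coefficient_continuous[OF \<sigma>] K that(2) radius(1,2) d z])
  show ?thesis
  proof (cases "n = 0")
    case True
    show ?thesis
    proof (rule field_le_epsilon)
      fix e :: real assume "0 < e"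
      obtain N where N: "\<And>n f g z. N \<le> n \<Longrightarrow> sol T 0 (trunc ?R) \<sigma> u0 h f \<Longrightarrow> sol T n (trunc ?R) \<sigma> u0 h g \<Longrightarrow>
          z \<in> domOT T \<Longrightarrow> \<bar>g z - f z\<bar> \<le> e"
        using trunc_convergence[OF T \<sigma> u0 radius(4) M \<open>0 < e\<close>] h by blast
      obtain g where g: "sol T (Suc N) (trunc ?R) \<sigma> u0 h g"
        using exists_sol_trunc[OF T \<sigma> d h(1) radius(4)] by blast
      have "\<bar>g z - f z\<bar> \<le> e" by (rule N[of "Suc N"]) (use f g z True in auto)
      then show "\<bar>f z\<bar> \<le> aprio T V K M + e" using bound[OF _ g] by simp
    qed
  qed (use bound f in auto)
qed

text \<open>The a priori bound lies below the truncation radius, so the truncated solution solves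
  the cubic equation, and by uniqueness every cubic solution is this one.\<close>

lemma wellposed:
  assumes T: "0 \<le> T" and \<sigma>: "coefficient \<sigma> K L" and u0: "initial_datum u0 V" and h: "h \<in> L2_OT T" "energy T h \<le> M"
  shows "\<exists>f. sol T n bfun \<sigma> u0 h f"
    and "sol T n bfun \<sigma> u0 h f \<Longrightarrow> z \<in> domOT T \<Longrightarrow> \<bar>f z\<bar> \<le> aprio T V K M"
    and "sol T n bfun \<sigma> u0 h f \<Longrightarrow> sol T n (trunc (radius T V K M)) \<sigma> u0 h f"
proof -
  let ?R = "radius T V K M"
  have d: "decaying u0 V" using u0 by (simp add: initial_datum_def)
  obtain g where g: "sol T n (trunc ?R) \<sigma> u0 h g"
    using exists_sol_trunc[OF T \<sigma> d h(1) radius(4)] by blast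
  have gb: "\<bar>g z\<bar> \<le> aprio T V K M" if "z \<in> domOT T" for z by (rule sol_trunc_bound[OF T \<sigma> u0 h g that])
  then have gR: "\<bar>g z\<bar> \<le> ?R" if "z \<in> domOT T" for z using radius(3) that order.trans by blast
  have g': "sol T n bfun \<sigma> u0 h g" using sol_trunc[of T g ?R] gR g by blast
  then show "\<exists>f. sol T n bfun \<sigma> u0 h f" by blast
  assume f: "sol T n bfun \<sigma> u0 h f"
  have eq: "f z = g z" if "z \<in> domOT T" for z by (rule sol_unique[OF T \<sigma> d h(1) f g' that])
  show "\<bar>f z\<bar> \<le> aprio T V K M" if "z \<in> domOT T" using gb eq that by simp
  show "sol T n (trunc ?R) \<sigma> u0 h f" using sol_trunc[of T f ?R] gR eq f by simp
qed

lemma sol_convergence: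
  assumes T: "0 \<le> T" and \<sigma>: "coefficient \<sigma> K L" and u0: "initial_datum u0 V" and "0 \<le> M" "0 < \<epsilon>"
  shows "\<exists>N. \<forall>n\<ge>N. \<forall>h f g. h \<in> L2_OT T \<longrightarrow> energy T h \<le> M \<longrightarrow> sol T 0 bfun \<sigma> u0 h f \<longrightarrow> sol T n bfun \<sigma> u0 h g \<longrightarrow>
    (\<forall>z\<in>domOT T. \<bar>g z - f z\<bar> \<le> \<epsilon>)"
  using trunc_convergence[OF T \<sigma> u0 radius(4)[of T V K M] assms(4,5)] wellposed(3)[OF T \<sigma> u0] by meson

section \<open>Response to a spatially constant forcing switched on late\<close>

definition late :: "real \<Rightarrow> real \<times> real \<Rightarrow> real" where "late a z = (if a \<le> fst z then 1 else 0)"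

lemma late_L2: "late a \<in> L2_OT T" and energy_late: "0 \<le> T \<Longrightarrow> energy T (late a) \<le> pi * T"
proof -
  have m: "late a \<in> borel_measurable borel" unfolding late_def by measurable
  have i: "set_integrable lborel (domOT T) (\<lambda>_. 1 :: real)" by (intro set_integrable_continuous_compact) auto
  show L: "late a \<in> L2_OT T"
  proof (rule L2_OT_I[OF _ i])
    show "set_borel_measurable lborel (domOT T) (late a)"
      unfolding set_borel_measurable_def using m by measurable
  qed (simp add: late_def)
  assume T: "0 \<le> T"
  have "energy T (late a) \<le> (LBINT z:domOT T. 1)"
    unfolding energy_def using L i by (intro set_integral_mono) (auto simp: L2_OT_def late_def)
  also have "\<dots> = (LBINT s:{0..T}. LBINT y:domO. 1)"
    using i unfolding domOT_def by (rule set_integral_Times)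
  also have "\<dots> = pi * T" using T by (simp add: set_integral_const domO_def)
  finally show "energy T (late a) \<le> pi * T" .
qed

text \<open>A spatially constant forcing acts on the mass mode only.\<close>

lemma late_response:
  assumes a: "0 \<le> a" and t: "0 \<le> t" "t \<le> T" and x: "x \<in> domO"
  shows "(\<Sum>j. trial n j x * mint n (late a) j t) = max 0 (t - a)"
proof -
  have zero: "trial n j x * mint n (late a) j t = 0" if "j \<noteq> 0" for j
  proof (cases "n = 0 \<or> j < n")
    case True
    have "mint n (late a) j t = (LBINT s:{0..t}. LBINT y:domO. exp (- (freq n j)\<^sup>2 * (t - fst (s, y))) * phi j (samp n (snd (s, y))) * late a (s, y))"
      unfolding mint_def by (intro set_integral_Times mint_integrable[OF L2_OT_integrable[OF late_L2] t(2)])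
    also have "\<dots> = (LBINT s:{0..t}. (exp (- (freq n j)\<^sup>2 * (t - s)) * late a (s, 0)) * (LBINT y:domO. phi j (samp n y)))"
    proof -
      have "(LBINT y:domO. exp (- (freq n j)\<^sup>2 * (t - fst (s, y))) * phi j (samp n (snd (s, y))) * late a (s, y))
        = (exp (- (freq n j)\<^sup>2 * (t - s)) * late a (s, 0)) * (LBINT y:domO. phi j (samp n y))" for s
        unfolding set_integral_mult_right[symmetric] by (simp add: late_def mult_ac)
      then show ?thesis by simp
    qed
    also have "\<dots> = 0" using integral_phi_samp[of j n] True that by simp
    finally show ?thesis by simp
  qed (auto simp: trial_def)
  have "(\<Sum>j. trial n j x * mint n (late a) j t) = trial n 0 x * mint n (late a) 0 t"
    using suminf_finite[of "{0}" "\<lambda>j. trial n j x * mint n (late a) j t"] zero by simp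
  also have "trial n 0 x = sqrt (1 / pi)"
  proof (cases "n = 0")
    case False
    then have "trial n 0 x = interp n (phi 0) x" by (simp add: trial_def phi_n_def)
    also have "\<dots> = sqrt (1 / pi)"
      using interp_close[of n x "phi 0" "sqrt (1 / pi)" 0] False x by (simp add: phi_def)
    finally show ?thesis .
  qed (simp add: trial_def phi_def)
  also have "mint n (late a) 0 t = sqrt (1 / pi) * (pi * max 0 (t - a))"
  proof -
    have "mint n (late a) 0 t = (LBINT s:{0..t}. LBINT y:domO. exp (- (freq n 0)\<^sup>2 * (t - fst (s, y))) * phi 0 (samp n (snd (s, y))) * late a (s, y))"
      unfolding mint_def by (intro set_integral_Times mint_integrable[OF L2_OT_integrable[OF late_L2] t(2)])
    also have "\<dots> = (LBINT s:{0..t}. sqrt (1 / pi) * (pi * (if a \<le> s then 1 else 0)))"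
      by (simp add: phi_def late_def set_integral_const domO_def mult_ac)
    also have "\<dots> = sqrt (1 / pi) * (pi * (LBINT s:{0..t}. (if a \<le> s then 1 else 0)))"
      by (simp only: set_integral_mult_right)
    also have "(LBINT s:{0..t}. (if a \<le> s then 1 else 0) :: real) = (LBINT s:{a..t}. 1)"
      unfolding set_lebesgue_integral_def using a
      by (intro Bochner_Integration.integral_cong) (auto simp: indicator_def)
    also have "\<dots> = max 0 (t - a)" by (cases "a \<le> t") (simp_all add: set_integral_const)
    finally show ?thesis .
  qed
  also have "sqrt (1 / pi) * (sqrt (1 / pi) * (pi * max 0 (t - a))) = max 0 (t - a)"
    by (simp add: mult.assoc[symmetric])
  finally show ?thesis .
qed

lemma energy_add_le:
  assumes "f \<in> L2_OT T" "g \<in> L2_OT T"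
  shows "energy T (\<lambda>z. f z + g z) \<le> 2 * energy T f + 2 * energy T g"
proof -
  have "energy T (\<lambda>z. f z + g z) \<le> (LBINT z:domOT T. 2 * (f z)\<^sup>2 + 2 * (g z)\<^sup>2)"
    unfolding energy_def
  proof (rule set_integral_mono)
    show "set_integrable lborel (domOT T) (\<lambda>z. (f z + g z)\<^sup>2)" using L2_add[OF assms] by (simp add: L2_OT_def)
    show "set_integrable lborel (domOT T) (\<lambda>z. 2 * (f z)\<^sup>2 + 2 * (g z)\<^sup>2)"
      using assms by (intro set_integral_add(1)) (auto simp: L2_OT_def)
    show "(f z + g z)\<^sup>2 \<le> 2 * (f z)\<^sup>2 + 2 * (g z)\<^sup>2" for z
      using zero_le_power2[of "f z - g z"] by (simp add: power2_eq_square algebra_simps)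
  qed
  also have "\<dots> = 2 * energy T f + 2 * energy T g"
    unfolding energy_def using assms by (subst set_integral_add(2)) (auto simp: L2_OT_def)
  finally show ?thesis .
qed

subsection \<open>Control of the terminal value\<close>

text \<open>Moving the terminal value: the forcing is changed by \<open>\<theta>\<close> on a short final time interval, on
  which the response \<open>\<theta> (t - a)\<close> of the mass mode dominates the feedback of the nonlinearity; by
  continuity in \<open>\<theta>\<close> every nearby value is attained.\<close>

lemma late_perturbation:
  assumes T: "0 < T" and u0: "initial_datum u0 V" and M: "0 \<le> M"
  obtains \<eta> where "0 < \<eta>" "\<eta> \<le> T"
    "\<And>n q \<theta> f g z. q \<in> L2_OT T \<Longrightarrow> energy T q \<le> M \<Longrightarrow> \<bar>\<theta>\<bar> \<le> 1 \<Longrightarrow>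
       sol T n bfun (\<lambda>_. 1) u0 q g \<Longrightarrow> sol T n bfun (\<lambda>_. 1) u0 (\<lambda>z. q z + \<theta> * late (T - \<eta>) z) f \<Longrightarrow> z \<in> domOT T \<Longrightarrow>
       \<bar>f z - g z\<bar> \<le> 4 / 3 * \<eta> * \<bar>\<theta>\<bar> \<and> (fst z = T \<longrightarrow> \<bar>f z - g z - \<theta> * \<eta>\<bar> \<le> 1 / 3 * \<eta> * \<bar>\<theta>\<bar>)"
    "\<exists>Q. \<forall>n q \<theta> \<theta>' f g z. q \<in> L2_OT T \<longrightarrow> energy T q \<le> M \<longrightarrow> \<bar>\<theta>\<bar> \<le> 1 \<longrightarrow> \<bar>\<theta>'\<bar> \<le> 1 \<longrightarrow>
       sol T n bfun (\<lambda>_. 1) u0 (\<lambda>z. q z + \<theta> * late (T - \<eta>) z) f \<longrightarrow>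
       sol T n bfun (\<lambda>_. 1) u0 (\<lambda>z. q z + \<theta>' * late (T - \<eta>) z) g \<longrightarrow> z \<in> domOT T \<longrightarrow>
       \<bar>f z - g z\<bar> \<le> Q * \<bar>\<theta> - \<theta>'\<bar>"
proof -
  note \<sigma> = coefficient_one
  have T0: "0 \<le> T" using T by simp
  have d: "decaying u0 V" using u0 by (simp add: initial_datum_def)
  \<comment> \<open>Bounds the energy of every perturbed forcing with
    \<open>\<bar>\<theta>\<bar> \<le> 1\<close>; \<open>pi * T\<close> is the area of the
    domain.\<close>
  define M2 where "M2 = 2 * M + 2 * (pi * T)"
  have M2: "0 \<le> M2" "M \<le> M2" using M T by (auto simp: M2_def)
  define R where "R = radius T V 1 M2"
  define Lb where "Lb = 3 * R\<^sup>2 + 1"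
  have Lb: "0 \<le> Lb" by (simp add: Lb_def)
  \<comment> \<open>The factor \<open>6\<close> makes the contraction constant
    \<open>1 / 12\<close>, so that even after growth by \<open>3\<close> the feedback is at most a
    quarter of the difference.\<close>
  have "0 \<le> 6 * Lb * (5 + M2)" using Lb M2 by simp
  then obtain \<beta> where \<beta>: "0 < \<beta>" "6 * Lb * (5 + M2) * W \<beta> \<le> 1 / 2" using exists_weight by blast
  have \<beta>12: "Lb * (5 + M2) * W \<beta> \<le> 1 / 12" using \<beta>(2) by simp
  have \<beta>2: "Lb * (5 + M2) * W \<beta> \<le> 1 / 2" using \<beta>12 by simp
  \<comment> \<open>On an interval of length at most \<open>1 / \<beta>\<close> the weight grows by
    at most \<open>exp 1 \<le> 3\<close>.\<close>
  define \<eta> where "\<eta> = min T (1 / \<beta>)"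
  have \<eta>: "0 < \<eta>" "\<eta> \<le> T" using T \<beta> by (auto simp: \<eta>_def)
  have "\<beta> * \<eta> \<le> \<beta> * (1 / \<beta>)" using \<beta> by (intro mult_left_mono) (auto simp: \<eta>_def)
  then have "\<beta> * \<eta> \<le> 1" using \<beta> by simp
  then have "exp (\<beta> * \<eta>) \<le> exp 1" by simp
  then have e3: "exp (\<beta> * \<eta>) \<le> 3" using exp_le by linarith
  let ?l = "late (T - \<eta>)"
  let ?q = "\<lambda>q \<theta> z. q z + \<theta> * ?l z"
  have qL: "?q q \<theta> \<in> L2_OT T" if "q \<in> L2_OT T" for q \<theta>
    by (rule L2_add[OF that L2_OT_scale[OF late_L2]])
  have qE: "energy T (?q q \<theta>) \<le> M2" if q: "q \<in> L2_OT T" "energy T q \<le> M" and "\<bar>\<theta>\<bar> \<le> 1" for q \<theta>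
  proof -
    have "energy T (?q q \<theta>) \<le> 2 * energy T q + 2 * energy T (\<lambda>z. \<theta> * ?l z)"
      by (rule energy_add_le[OF q(1) L2_OT_scale[OF late_L2]])
    also have "energy T (\<lambda>z. \<theta> * ?l z) = \<theta>\<^sup>2 * energy T ?l" by (rule energy_scale)
    also have "\<theta>\<^sup>2 * energy T ?l \<le> 1 * (pi * T)"
      using \<open>\<bar>\<theta>\<bar> \<le> 1\<close> energy_late[OF T0] energy_nonneg by (intro mult_mono) (auto simp: abs_square_le_1)
    finally show ?thesis using q(2) by (simp add: M2_def)
  qed
  have bound: "\<bar>f z\<bar> \<le> R" if "q \<in> L2_OT T" "energy T q \<le> M2" "sol T n bfun (\<lambda>_. 1) u0 q f" "z \<in> domOT T" for n q f z
    using wellposed(2)[OF T0 \<sigma> u0 that] radius(3)[of T V 1 M2] by (simp add: R_def)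
  have lip: "\<bar>bfun (f z) - bfun (g z)\<bar> \<le> Lb * \<bar>f z - g z\<bar>" if "\<bar>f z\<bar> \<le> R" "\<bar>g z\<bar> \<le> R" for f g :: "real \<times> real \<Rightarrow> real" and z
    unfolding Lb_def using that by (rule bfun_lipschitz)
  \<comment> \<open>The explicit response of the mass mode splits off, and what remains is the
    effect of the nonlinearity on two functions under the same forcing.\<close>
  have diff: "f (t, x) - g (t, x) - (\<theta> - \<theta>') * max 0 (t - (T - \<eta>)) =
      mild n bfun (\<lambda>_. 1) u0 (?q q \<theta>) f t x - mild n bfun (\<lambda>_. 1) u0 (?q q \<theta>) g t x"
    if q: "q \<in> L2_OT T" and f: "sol T n bfun (\<lambda>_. 1) u0 (?q q \<theta>) f" and g: "sol T n bfun (\<lambda>_. 1) u0 (?q q \<theta>') g"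
      and t: "t \<in> {0..T}" and x: "x \<in> domO" for n q \<theta> \<theta>' f g t x
  proof -
    have gc: "continuous_on (domOT T) g" using g by (simp add: sol_def)
    have t': "0 \<le> t" "t \<le> T" using t by auto
    have "mild n bfun (\<lambda>_. 1) u0 (\<lambda>z. ?q q \<theta>' z + (\<theta> - \<theta>') * ?l z) g t x
      = mild n bfun (\<lambda>_. 1) u0 (?q q \<theta>') g t x + (\<Sum>j. trial n j x * mint n (\<lambda>z. (\<theta> - \<theta>') * ?l z) j t)"
      by (rule mild_forcing_add(1)[OF gc continuous_on_bfun qL[OF q] L2_OT_scale[OF late_L2] d t' x])
    also have "(\<lambda>z. ?q q \<theta>' z + (\<theta> - \<theta>') * ?l z) = ?q q \<theta>" by (auto simp: algebra_simps)
    also have "(\<Sum>j. trial n j x * mint n (\<lambda>z. (\<theta> - \<theta>') * ?l z) j t) = (\<theta> - \<theta>') * max 0 (t - (T - \<eta>))"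
    proof -
      have li: "set_integrable lborel (domOT T) ?l" by (rule L2_OT_integrable[OF late_L2])
      have "mint n (\<lambda>z. (\<theta> - \<theta>') * ?l z) j t = (\<theta> - \<theta>') * mint n ?l j t" for j
        using mint_linear[OF li li t'(2), of n "\<theta> - \<theta>'" 0 j] by simp
      then have "(\<Sum>j. trial n j x * mint n (\<lambda>z. (\<theta> - \<theta>') * ?l z) j t) = (\<Sum>j. (\<theta> - \<theta>') * (trial n j x * mint n ?l j t))"
        by (simp add: mult_ac)
      also have "\<dots> = (\<theta> - \<theta>') * (\<Sum>j. trial n j x * mint n ?l j t)"
        by (rule suminf_mult[OF mild_forcing_add(2)[OF gc continuous_on_bfun q late_L2 d t' x]])
      also have "(\<Sum>j. trial n j x * mint n ?l j t) = max 0 (t - (T - \<eta>))"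
        by (rule late_response[OF _ t' x]) (use \<eta> in simp)
      finally show ?thesis .
    qed
    finally show ?thesis using f g t x by (simp add: sol_def)
  qed
  have ramp: "0 \<le> max 0 (t - (T - \<eta>))" "max 0 (t - (T - \<eta>)) \<le> \<eta>" if "t \<in> {0..T}" for t
    using that \<eta> by auto
  show ?thesis
  proof (rule that[OF \<eta>])
    fix n q \<theta> f g z
    assume q: "q \<in> L2_OT T" "energy T q \<le> M" and \<theta>: "\<bar>\<theta>\<bar> \<le> 1" and g: "sol T n bfun (\<lambda>_. 1) u0 q g"
      and f: "sol T n bfun (\<lambda>_. 1) u0 (?q q \<theta>) f" and z: "z \<in> domOT T"
    have g0: "sol T n bfun (\<lambda>_. 1) u0 (?q q 0) g" using g by simp
    have fc: "continuous_on (domOT T) f" and gc: "continuous_on (domOT T) g" using f g by (auto simp: sol_def)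
    note E = qE[OF q \<theta>]
    have fR: "\<bar>f z\<bar> \<le> R" if "z \<in> domOT T" for z by (rule bound[OF qL[OF q(1)] E f that])
    have gR: "\<bar>g z\<bar> \<le> R" if "z \<in> domOT T" for z using bound[OF q(1) _ g that] q(2) M2 by simp
    have df: "f (t, x) - g (t, x) - \<theta> * max 0 (t - (T - \<eta>)) =
      mild n bfun (\<lambda>_. 1) u0 (?q q \<theta>) f t x - mild n bfun (\<lambda>_. 1) u0 (?q q \<theta>) g t x"
      if "t \<in> {0..T}" "x \<in> domO" for t x
      using diff[OF q(1) f g0 that] by (simp only: diff_0_right)
    \<comment> \<open>Before the switching time the perturbation has not acted, so the residual is
      zero.\<close>
    have early: "\<bar>f (t, x) - g (t, x)\<bar> \<le> 2 * 0 * exp (\<beta> * (T - \<eta>))" if "t \<in> {0..T - \<eta>}" "x \<in> domO" for t x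
    proof (rule mild_stability[OF fc gc continuous_on_bfun continuous_on_const qL[OF q(1)] E d _ _ \<beta>(1) Lb \<beta>2 order_refl _ _ _ that, where n = n])
      fix s y assume s: "s \<in> {0..T - \<eta>}" "y \<in> domO"
      then have "max 0 (s - (T - \<eta>)) = 0" by simp
      then show "\<bar>f (s, y) - g (s, y)\<bar> \<le> 0 + \<bar>mild n bfun (\<lambda>_. 1) u0 (?q q \<theta>) f s y - mild n bfun (\<lambda>_. 1) u0 (?q q \<theta>) g s y\<bar>"
        using df[of s y] s \<eta> by auto
    qed (use \<eta> lip fR gR Lb in auto)
    have "continuous_on (domOT T) (\<lambda>z. \<bar>f z - g z\<bar>)" by (intro continuous_intros fc gc)
    moreover have "domOT T \<noteq> {}" using z by auto
    ultimately obtain z0 where z0: "z0 \<in> domOT T" "\<And>z. z \<in> domOT T \<Longrightarrow> \<bar>f z - g z\<bar> \<le> \<bar>f z0 - g z0\<bar>"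
      using continuous_attains_sup[OF compact_domOT] by blast
    define D where "D = \<bar>f z0 - g z0\<bar>"
    have D: "0 \<le> D" "\<And>z. z \<in> domOT T \<Longrightarrow> \<bar>f z - g z\<bar> \<le> D" using z0 by (auto simp: D_def)
    have quarter: "\<bar>f (t, x) - g (t, x) - \<theta> * max 0 (t - (T - \<eta>))\<bar> \<le> D / 4" if t: "t \<in> {0..T}" and x: "x \<in> domO" for t x
    proof -
      \<comment> \<open>The weight is normalized at the switching time, which is legitimate because
        the difference vanishes earlier; only growth over the short interval is paid for.\<close>
      let ?P = "Lb * D * exp (- (\<beta> * (T - \<eta>)))"
      have P: "\<bar>bfun (f (s, y)) - bfun (g (s, y))\<bar> \<le> ?P * exp (\<beta> * s)" if s: "s \<in> {0..t}" and y: "y \<in> domO" for s y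
      proof -
        have in_dom: "(s, y) \<in> domOT T" using s y t by (auto simp: domOT_def)
        have "\<bar>bfun (f (s, y)) - bfun (g (s, y))\<bar> \<le> Lb * \<bar>f (s, y) - g (s, y)\<bar>"
          using lip fR[OF in_dom] gR[OF in_dom] by blast
        also have "\<dots> \<le> Lb * (D * exp (\<beta> * (s - (T - \<eta>))))"
        proof (intro mult_left_mono Lb)
          show "\<bar>f (s, y) - g (s, y)\<bar> \<le> D * exp (\<beta> * (s - (T - \<eta>)))"
          proof (cases "s \<le> T - \<eta>")
            case True
            then have "\<bar>f (s, y) - g (s, y)\<bar> \<le> 0" using early[of s y] s y by auto
            then show ?thesis using D by (meson mult_nonneg_nonneg exp_ge_zero order_trans)
          next
            case False
            then have "1 \<le> exp (\<beta> * (s - (T - \<eta>)))" using \<beta> by simp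
            then have "D * 1 \<le> D * exp (\<beta> * (s - (T - \<eta>)))" using D by (intro mult_left_mono) auto
            then show ?thesis using D(2)[OF in_dom] by simp
          qed
        qed
        also have "exp (\<beta> * (s - (T - \<eta>))) = exp (- (\<beta> * (T - \<eta>))) * exp (\<beta> * s)"
          by (simp add: algebra_simps flip: exp_add)
        finally show ?thesis by (simp only: mult.assoc)
      qed
      have "\<bar>mild n bfun (\<lambda>_. 1) u0 (?q q \<theta>) f t x - mild n bfun (\<lambda>_. 1) u0 (?q q \<theta>) g t x\<bar> \<le> ?P * exp (\<beta> * t) * ((5 + M2) * W \<beta>)"
        by (rule mild_diff_le[OF fc gc continuous_on_bfun continuous_on_const qL[OF q(1)] E d _ _ x \<beta>(1) _ P])
          (use t D Lb in auto)
      also have "\<dots> = D * (exp (- (\<beta> * (T - \<eta>))) * exp (\<beta> * t)) * (Lb * (5 + M2) * W \<beta>)" by (simp only: mult_ac)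
      also have "\<dots> \<le> D * 3 * (1 / 12)"
      proof (intro mult_mono mult_nonneg_nonneg \<beta>12 D order_refl)
        have "exp (- (\<beta> * (T - \<eta>))) * exp (\<beta> * t) = exp (\<beta> * (t - (T - \<eta>)))" by (simp add: algebra_simps flip: exp_add)
        also have "\<dots> \<le> exp (\<beta> * \<eta>)" using t \<beta> by simp
        finally show "exp (- (\<beta> * (T - \<eta>))) * exp (\<beta> * t) \<le> 3" using e3 by linarith
      qed (use Lb M2 W_nonneg[OF \<beta>(1)] in auto)
      finally show ?thesis using df[OF t x] by simp
    qed
    \<comment> \<open>At the maximum point
      \<open>D \<le> D / 4 + \<bar>\<theta>\<bar> \<eta>\<close>, whence the constant
      \<open>4 / 3\<close>; a quarter of it is the deviation \<open>1 / 3\<close> from the linear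
      response.\<close>
    have sup: "D \<le> 4 / 3 * \<eta> * \<bar>\<theta>\<bar>"
    proof -
      obtain t x where tx: "z0 = (t, x)" "t \<in> {0..T}" "x \<in> domO" using z0(1) by (auto simp: domOT_def)
      have "\<bar>\<theta> * max 0 (t - (T - \<eta>))\<bar> \<le> \<bar>\<theta>\<bar> * \<eta>"
        unfolding abs_mult using ramp[OF tx(2)] by (intro mult_left_mono) auto
      then have "D \<le> D / 4 + \<bar>\<theta>\<bar> * \<eta>" using quarter[OF tx(2,3)] unfolding D_def tx(1) by linarith
      moreover have "4 / 3 * \<eta> * \<bar>\<theta>\<bar> = 4 / 3 * (\<bar>\<theta>\<bar> * \<eta>)" by simp
      ultimately show ?thesis by linarith
    qed
    obtain t x where tx: "z = (t, x)" "t \<in> {0..T}" "x \<in> domO" using z by (auto simp: domOT_def)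
    have "\<bar>f z - g z - \<theta> * \<eta>\<bar> \<le> 1 / 3 * \<eta> * \<bar>\<theta>\<bar>" if "fst z = T"
    proof -
      have "max 0 (t - (T - \<eta>)) = \<eta>" using that tx \<eta> by simp
      then have "\<bar>f z - g z - \<theta> * \<eta>\<bar> \<le> D / 4" using quarter[OF tx(2,3)] tx(1) by simp
      then show ?thesis using sup by simp
    qed
    then show "\<bar>f z - g z\<bar> \<le> 4 / 3 * \<eta> * \<bar>\<theta>\<bar> \<and> (fst z = T \<longrightarrow> \<bar>f z - g z - \<theta> * \<eta>\<bar> \<le> 1 / 3 * \<eta> * \<bar>\<theta>\<bar>)"
      using D(2)[OF z] sup by linarith
  next
    \<comment> \<open>This constant may be large: it only provides continuity in \<theta>.\<close>
    have "\<bar>f z - g z\<bar> \<le> 2 * \<eta> * exp (\<beta> * T) * \<bar>\<theta> - \<theta>'\<bar>"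
      if q: "q \<in> L2_OT T" "energy T q \<le> M" and \<theta>: "\<bar>\<theta>\<bar> \<le> 1" "\<bar>\<theta>'\<bar> \<le> 1"
        and f: "sol T n bfun (\<lambda>_. 1) u0 (?q q \<theta>) f" and g: "sol T n bfun (\<lambda>_. 1) u0 (?q q \<theta>') g" and z: "z \<in> domOT T"
      for n q \<theta> \<theta>' f g z
    proof -
      have fc: "continuous_on (domOT T) f" and gc: "continuous_on (domOT T) g" using f g by (auto simp: sol_def)
      have fR: "\<bar>f z\<bar> \<le> R" if "z \<in> domOT T" for z by (rule bound[OF qL[OF q(1)] qE[OF q \<theta>(1)] f that])
      have gR: "\<bar>g z\<bar> \<le> R" if "z \<in> domOT T" for z by (rule bound[OF qL[OF q(1)] qE[OF q \<theta>(2)] g that])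
      obtain t x where tx: "z = (t, x)" "t \<in> {0..T}" "x \<in> domO" using z by (auto simp: domOT_def)
      have "\<bar>f (t, x) - g (t, x)\<bar> \<le> 2 * (\<bar>\<theta> - \<theta>'\<bar> * \<eta>) * exp (\<beta> * T)"
      proof (rule mild_stability[OF fc gc continuous_on_bfun continuous_on_const qL[OF q(1)] qE[OF q \<theta>(1)] d T0 order_refl \<beta>(1) Lb \<beta>2 _ _ _ _ tx(2,3), where n = n])
        fix s y assume s: "s \<in> {0..T}" "y \<in> domO"
        have "\<bar>(\<theta> - \<theta>') * max 0 (s - (T - \<eta>))\<bar> \<le> \<bar>\<theta> - \<theta>'\<bar> * \<eta>"
          unfolding abs_mult using ramp[OF s(1)] by (intro mult_left_mono) auto
        then show "\<bar>f (s, y) - g (s, y)\<bar> \<le> \<bar>\<theta> - \<theta>'\<bar> * \<eta> + \<bar>mild n bfun (\<lambda>_. 1) u0 (?q q \<theta>) f s y - mild n bfun (\<lambda>_. 1) u0 (?q q \<theta>) g s y\<bar>"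
          using diff[OF q(1) f g s] by linarith
      qed (use \<eta> lip fR gR Lb in auto)
      then show ?thesis using tx by (simp add: mult_ac)
    qed
    then show "\<exists>Q. \<forall>n q \<theta> \<theta>' f g z. q \<in> L2_OT T \<longrightarrow> energy T q \<le> M \<longrightarrow> \<bar>\<theta>\<bar> \<le> 1 \<longrightarrow> \<bar>\<theta>'\<bar> \<le> 1 \<longrightarrow>
       sol T n bfun (\<lambda>_. 1) u0 (?q q \<theta>) f \<longrightarrow> sol T n bfun (\<lambda>_. 1) u0 (?q q \<theta>') g \<longrightarrow> z \<in> domOT T \<longrightarrow>
       \<bar>f z - g z\<bar> \<le> Q * \<bar>\<theta> - \<theta>'\<bar>"
      by blast
  qed
qed

lemma square_le_of_abs_le:
  fixes h k r :: real
  assumes "\<bar>k\<bar> \<le> (1 + r) * \<bar>h\<bar> + r" "0 \<le> r" "r \<le> 1"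
  shows "k\<^sup>2 \<le> h\<^sup>2 + r * (5 * h\<^sup>2 + 3)"
proof -
  have "k\<^sup>2 \<le> ((1 + r) * \<bar>h\<bar> + r)\<^sup>2"
    using assms by (intro abs_le_square_iff[THEN iffD1]) auto
  also have "\<dots> = h\<^sup>2 + r * ((2 + r) * h\<^sup>2 + 2 * (1 + r) * \<bar>h\<bar> + r)"
    by (simp add: power2_eq_square algebra_simps)
  also have "\<dots> \<le> h\<^sup>2 + r * (5 * h\<^sup>2 + 3)"
  proof (intro add_left_mono mult_left_mono assms)
    have "0 \<le> (\<bar>h\<bar> - 1)\<^sup>2" by simp
    then have "2 * \<bar>h\<bar> \<le> h\<^sup>2 + 1" by (simp add: power2_eq_square algebra_simps)
    then have 1: "2 * (1 + r) * \<bar>h\<bar> \<le> 2 * (h\<^sup>2 + 1)"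
      using mult_mono[of "1 + r" 2 "2 * \<bar>h\<bar>" "h\<^sup>2 + 1"] assms by (simp add: algebra_simps)
    have "(2 + r) * h\<^sup>2 \<le> 3 * h\<^sup>2" using assms by (intro mult_right_mono) auto
    from add_mono[OF add_mono[OF this 1] assms(3)]
    show "(2 + r) * h\<^sup>2 + 2 * (1 + r) * \<bar>h\<bar> + r \<le> 5 * h\<^sup>2 + 3" by simp
  qed
  finally show ?thesis .
qed

text \<open>In forcing form the terminal value depends continuously on \<theta> and nearly linearly,
  so the intermediate value theorem hits the target. Dividing the perturbed forcing by \<sigma>
  along the new solution gives the control, and it stays close to \<open>h\<close> because the two
  solutions are close and \<sigma> is bounded away from zero on their common range.\<close>

lemma control:
  assumes T: "0 < T" and \<sigma>: "coefficient \<sigma> K L" and \<sigma>0: "\<And>x. \<sigma> x \<noteq> 0" and u0: "initial_datum u0 V"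
    and M: "0 \<le> M" and \<epsilon>: "0 < \<epsilon>" and x: "x \<in> domO"
  shows "\<exists>\<delta>0>0. \<forall>n h g \<delta>. h \<in> L2_OT T \<longrightarrow> energy T h \<le> M \<longrightarrow> sol T n bfun \<sigma> u0 h g \<longrightarrow> \<bar>\<delta>\<bar> \<le> \<delta>0 \<longrightarrow>
    (\<exists>k f. k \<in> L2_OT T \<and> energy T k \<le> energy T h + \<epsilon> \<and> sol T n bfun \<sigma> u0 k f \<and> f (T, x) = g (T, x) + \<delta>)"
proof -
  have T0: "0 \<le> T" using T by simp
  have d: "decaying u0 V" using u0 by (simp add: initial_datum_def)
  have \<sigma>c: "continuous_on UNIV \<sigma>" by (rule coefficient_continuous[OF \<sigma>])
  have \<sigma>K: "\<bar>\<sigma> x\<bar> \<le> K" for x using \<sigma> by (simp add: coefficient_def)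
  have \<sigma>L: "0 \<le> L" "\<bar>\<sigma> x - \<sigma> y\<bar> \<le> L * \<bar>x - y\<bar>" for x y using \<sigma> by (auto simp: coefficient_def)
  define M1 where "M1 = K\<^sup>2 * M"
  have M1: "0 \<le> M1" using M by (simp add: M1_def)
  obtain \<eta> where \<eta>: "0 < \<eta>" "\<eta> \<le> T"
    and pert: "\<And>n q \<theta> f g z. q \<in> L2_OT T \<Longrightarrow> energy T q \<le> M1 \<Longrightarrow> \<bar>\<theta>\<bar> \<le> 1 \<Longrightarrow>
       sol T n bfun (\<lambda>_. 1) u0 q g \<Longrightarrow> sol T n bfun (\<lambda>_. 1) u0 (\<lambda>z. q z + \<theta> * late (T - \<eta>) z) f \<Longrightarrow> z \<in> domOT T \<Longrightarrow>
       \<bar>f z - g z\<bar> \<le> 4 / 3 * \<eta> * \<bar>\<theta>\<bar> \<and> (fst z = T \<longrightarrow> \<bar>f z - g z - \<theta> * \<eta>\<bar> \<le> 1 / 3 * \<eta> * \<bar>\<theta>\<bar>)"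
    and exQ: "\<exists>Q. \<forall>n q \<theta> \<theta>' f g z. q \<in> L2_OT T \<longrightarrow> energy T q \<le> M1 \<longrightarrow> \<bar>\<theta>\<bar> \<le> 1 \<longrightarrow> \<bar>\<theta>'\<bar> \<le> 1 \<longrightarrow>
       sol T n bfun (\<lambda>_. 1) u0 (\<lambda>z. q z + \<theta> * late (T - \<eta>) z) f \<longrightarrow>
       sol T n bfun (\<lambda>_. 1) u0 (\<lambda>z. q z + \<theta>' * late (T - \<eta>) z) g \<longrightarrow> z \<in> domOT T \<longrightarrow>
       \<bar>f z - g z\<bar> \<le> Q * \<bar>\<theta> - \<theta>'\<bar>"
    by (rule late_perturbation[OF T u0 M1]) (rule that)
  from exQ obtain Q where Q: "\<forall>n q \<theta> \<theta>' f g z. q \<in> L2_OT T \<longrightarrow> energy T q \<le> M1 \<longrightarrow> \<bar>\<theta>\<bar> \<le> 1 \<longrightarrow> \<bar>\<theta>'\<bar> \<le> 1 \<longrightarrow>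
       sol T n bfun (\<lambda>_. 1) u0 (\<lambda>z. q z + \<theta> * late (T - \<eta>) z) f \<longrightarrow>
       sol T n bfun (\<lambda>_. 1) u0 (\<lambda>z. q z + \<theta>' * late (T - \<eta>) z) g \<longrightarrow> z \<in> domOT T \<longrightarrow>
       \<bar>f z - g z\<bar> \<le> Q * \<bar>\<theta> - \<theta>'\<bar>" ..
  let ?l = "late (T - \<eta>)"
  \<comment> \<open>Range of the perturbed solutions: the a priori bound plus their distance, at
    most \<open>4 / 3 * \<eta> * \<bar>\<theta>\<bar> \<le> 2 * T\<close>.\<close>
  define R where "R = aprio T V K M + 2 * T"
  have "continuous_on {-R..R} (\<lambda>x. inverse \<bar>\<sigma> x\<bar>)"
    by (intro continuous_intros continuous_on_subset[OF \<sigma>c]) (auto simp: \<sigma>0)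
  then have "compact ((\<lambda>x. inverse \<bar>\<sigma> x\<bar>) ` {-R..R})" by (intro compact_continuous_image) auto
  then obtain c0 where "\<forall>y\<in>(\<lambda>x. inverse \<bar>\<sigma> x\<bar>) ` {-R..R}. norm y \<le> c0"
    by (meson compact_imp_bounded bounded_iff)
  then have c0: "inverse \<bar>\<sigma> x\<bar> \<le> c0" if "\<bar>x\<bar> \<le> R" for x using that by (auto simp: abs_le_iff)
  define c where "c = max c0 0"
  have c: "0 \<le> c" "\<And>x. \<bar>x\<bar> \<le> R \<Longrightarrow> inverse \<bar>\<sigma> x\<bar> \<le> c" using c0 by (auto simp: c_def le_max_iff_disj)
  \<comment> \<open>Collects the relative error of replacing \<open>\<sigma> (f)\<close> by
    \<open>\<sigma> (g)\<close> and the size of the added forcing, both divided by \<sigma>; the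
    final \<open>1\<close> makes the division below harmless.\<close>
  define \<kappa> where "\<kappa> = c * (2 * T * L + 1) + 1"
  have \<kappa>: "1 \<le> \<kappa>" using c \<sigma>L T by (simp add: \<kappa>_def)
  \<comment> \<open>Chosen so that the energy increment
    \<open>r * (5 * energy T h + 3 * pi * T)\<close>, coming from
    \<open>square_le_of_abs_le\<close>, stays below \<epsilon>.\<close>
  define r where "r = min 1 (\<epsilon> / (5 * M + 3 * (pi * T) + 1))"
  have den: "0 < 5 * M + 3 * (pi * T) + 1" using M T by (simp add: add_nonneg_pos)
  have r: "0 < r" "r \<le> 1" "r * (5 * M + 3 * (pi * T)) \<le> \<epsilon>"
  proof -
    show "0 < r" "r \<le> 1" using \<epsilon> den by (auto simp: r_def)
    have "r * (5 * M + 3 * (pi * T)) \<le> r * (5 * M + 3 * (pi * T) + 1)"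
      using \<open>0 < r\<close> by (intro mult_left_mono) auto
    also have "\<dots> \<le> \<epsilon> / (5 * M + 3 * (pi * T) + 1) * (5 * M + 3 * (pi * T) + 1)"
      using den by (intro mult_right_mono) (auto simp: r_def)
    also have "\<dots> = \<epsilon>" using den by simp
    finally show "r * (5 * M + 3 * (pi * T)) \<le> \<epsilon>" .
  qed
  define \<theta>0 where "\<theta>0 = r / \<kappa>"
  have \<theta>0: "0 < \<theta>0" "\<theta>0 \<le> 1" "\<kappa> * \<theta>0 = r" using r \<kappa> by (auto simp: \<theta>0_def divide_le_eq)
  \<comment> \<open>At the extreme parameters the terminal value moves by at least
    \<open>\<eta> * \<theta>0\<close> minus a third of it.\<close>
  define \<delta>0 where "\<delta>0 = 2 / 3 * \<eta> * \<theta>0"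
  have main: "\<exists>k f. k \<in> L2_OT T \<and> energy T k \<le> energy T h + \<epsilon> \<and> sol T n bfun \<sigma> u0 k f \<and> f (T, x) = g (T, x) + \<delta>"
    if h: "h \<in> L2_OT T" "energy T h \<le> M" and g: "sol T n bfun \<sigma> u0 h g" and \<delta>: "\<bar>\<delta>\<bar> \<le> \<delta>0" for n h g \<delta>
  proof -
    have gc: "continuous_on (domOT T) g" using g by (simp add: sol_def)
    define q where "q = (\<lambda>z. \<sigma> (g (fst z, samp n (snd z))) * h z)"
    have q: "q \<in> L2_OT T" "energy T q \<le> M1"
    proof -
      show "q \<in> L2_OT T" unfolding q_def by (rule forcing_L2(1)[OF gc \<sigma>c h(1) T0 \<sigma>K])
      have "energy T q \<le> K\<^sup>2 * energy T h" unfolding q_def by (rule forcing_L2(2)[OF gc \<sigma>c h(1) T0 \<sigma>K])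
      also have "\<dots> \<le> M1" unfolding M1_def using h by (intro mult_left_mono) auto
      finally show "energy T q \<le> M1" .
    qed
    have gq: "sol T n bfun (\<lambda>_. 1) u0 q g" using g unfolding q_def sol_forcing[of T n _ \<sigma>] .
    have qL: "(\<lambda>z. q z + \<theta> * ?l z) \<in> L2_OT T" for \<theta> by (rule L2_add[OF q(1) L2_OT_scale[OF late_L2]])
    have "\<exists>f. sol T n bfun (\<lambda>_. 1) u0 (\<lambda>z. q z + \<theta> * ?l z) f" for \<theta>
      by (rule wellposed(1)[OF T0 coefficient_one u0 qL order_refl])
    then obtain F where F: "\<And>\<theta>. sol T n bfun (\<lambda>_. 1) u0 (\<lambda>z. q z + \<theta> * ?l z) (F \<theta>)" by metis
    have Tx: "(T, x) \<in> domOT T" using T x by (auto simp: domOT_def)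
    have "\<exists>\<theta>. - \<theta>0 \<le> \<theta> \<and> \<theta> \<le> \<theta>0 \<and> F \<theta> (T, x) = g (T, x) + \<delta>"
    proof (rule IVT')
      have low: "\<bar>F \<theta> (T, x) - g (T, x) - \<theta> * \<eta>\<bar> \<le> 1 / 3 * \<eta> * \<bar>\<theta>\<bar>" if "\<bar>\<theta>\<bar> \<le> 1" for \<theta>
        using pert[OF q that gq F Tx] by simp
      show "F (- \<theta>0) (T, x) \<le> g (T, x) + \<delta>"
      proof -
        have "3 * \<bar>F (- \<theta>0) (T, x) - g (T, x) + \<eta> * \<theta>0\<bar> \<le> \<eta> * \<theta>0"
          using low[of "- \<theta>0"] \<theta>0 by (simp add: mult.commute)
        moreover have "3 * \<bar>\<delta>\<bar> \<le> 2 * (\<eta> * \<theta>0)" using \<delta> by (simp add: \<delta>0_def)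
        ultimately show ?thesis
          using abs_ge_self[of "F (- \<theta>0) (T, x) - g (T, x) + \<eta> * \<theta>0"] abs_ge_minus_self[of \<delta>] by argo
      qed
      show "g (T, x) + \<delta> \<le> F \<theta>0 (T, x)"
      proof -
        have "3 * \<bar>F \<theta>0 (T, x) - g (T, x) - \<eta> * \<theta>0\<bar> \<le> \<eta> * \<theta>0"
          using low[of \<theta>0] \<theta>0 by (simp add: mult.commute)
        moreover have "3 * \<bar>\<delta>\<bar> \<le> 2 * (\<eta> * \<theta>0)" using \<delta> by (simp add: \<delta>0_def)
        ultimately show ?thesis
          using abs_ge_minus_self[of "F \<theta>0 (T, x) - g (T, x) - \<eta> * \<theta>0"] abs_ge_self[of \<delta>] by argo
      qed
      show "- \<theta>0 \<le> \<theta>0" using \<theta>0 by simp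
      show "continuous_on {- \<theta>0..\<theta>0} (\<lambda>\<theta>. F \<theta> (T, x))"
      proof (rule lipschitz_on_continuous_on[of "max Q 0"], rule lipschitz_onI)
        fix a b assume "a \<in> {- \<theta>0..\<theta>0}" "b \<in> {- \<theta>0..\<theta>0}"
        then have "\<bar>a\<bar> \<le> 1" "\<bar>b\<bar> \<le> 1" using \<theta>0 by auto
        then have "\<bar>F a (T, x) - F b (T, x)\<bar> \<le> Q * \<bar>a - b\<bar>" by (intro Q[rule_format, OF q _ _ F F Tx])
        also have "\<dots> \<le> max Q 0 * \<bar>a - b\<bar>" by (intro mult_right_mono) auto
        finally show "dist (F a (T, x)) (F b (T, x)) \<le> max Q 0 * dist a b" by (simp add: dist_real_def)
      qed simp
    qed
    then obtain \<theta> where \<theta>: "\<bar>\<theta>\<bar> \<le> \<theta>0" "F \<theta> (T, x) = g (T, x) + \<delta>" by (force simp: abs_le_iff)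
    have \<theta>1: "\<bar>\<theta>\<bar> \<le> 1" using \<theta> \<theta>0 by simp
    define f where "f = F \<theta>"
    have f: "sol T n bfun (\<lambda>_. 1) u0 (\<lambda>z. q z + \<theta> * ?l z) f" unfolding f_def by (rule F)
    have fc: "continuous_on (domOT T) f" using f by (simp add: sol_def)
    have fg: "\<bar>f z - g z\<bar> \<le> 2 * T * \<bar>\<theta>\<bar>" if "z \<in> domOT T" for z
    proof -
      have "\<bar>f z - g z\<bar> \<le> 4 / 3 * \<eta> * \<bar>\<theta>\<bar>" using pert[OF q \<theta>1 gq f that] by simp
      also have "\<dots> \<le> 2 * T * \<bar>\<theta>\<bar>" using \<eta> by (intro mult_right_mono mult_mono) auto
      finally show ?thesis .
    qed
    have gR: "\<bar>g z\<bar> \<le> aprio T V K M" if "z \<in> domOT T" for z by (rule wellposed(2)[OF T0 \<sigma> u0 h g that])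
    have fR: "\<bar>f z\<bar> \<le> R" if "z \<in> domOT T" for z
    proof -
      have "2 * T * \<bar>\<theta>\<bar> \<le> 2 * T * 1" using \<theta>1 T by (intro mult_left_mono) auto
      then show ?thesis using fg[OF that] gR[OF that] unfolding R_def by linarith
    qed
    have ic: "continuous_on UNIV (\<lambda>y. inverse (\<sigma> y))" by (intro continuous_intros \<sigma>c) (simp add: \<sigma>0)
    \<comment> \<open>With this control the forcing along \<open>f\<close> is exactly the perturbed
      one, so \<open>f\<close> itself is the solution.\<close>
    define k where "k = (\<lambda>z. inverse (\<sigma> (f (fst z, samp n (snd z)))) * (q z + \<theta> * ?l z))"
    have kL: "k \<in> L2_OT T" unfolding k_def
      by (rule forcing_L2(1)[OF fc ic qL T0, of c]) (use c fR in \<open>simp add: abs_inverse\<close>)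
    have "sol T n bfun (\<lambda>_. 1) u0 (\<lambda>z. \<sigma> (f (fst z, samp n (snd z))) * k z) f"
      using f by (simp add: k_def \<sigma>0 mult.assoc[symmetric])
    then have kf: "sol T n bfun \<sigma> u0 k f" unfolding sol_forcing[of T n _ \<sigma>] .
    have r\<theta>: "\<kappa> * \<bar>\<theta>\<bar> \<le> r" using \<theta>(1) \<theta>0 \<kappa> by (metis mult_left_mono order_trans zero_le_one)
    have kb: "(k z)\<^sup>2 \<le> (h z)\<^sup>2 + r * (5 * (h z)\<^sup>2 + 3)" if z: "z \<in> domOT T" for z
    proof (rule square_le_of_abs_le)
      let ?w = "(fst z, samp n (snd z))"
      have w: "?w \<in> domOT T" by (rule samp_pair_in_domOT[OF z])
      define i where "i = inverse (\<sigma> (f ?w))"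
      have i: "\<bar>i\<bar> \<le> c" using c(2)[OF fR[OF w]] by (simp add: i_def abs_inverse)
      have i1: "i * \<sigma> (f ?w) = 1" by (simp add: i_def \<sigma>0)
      have "k z = i * (\<sigma> (g ?w) * h z + \<theta> * ?l z)" by (simp add: k_def q_def i_def)
      also have "\<dots> = (i * \<sigma> (f ?w)) * h z + i * ((\<sigma> (g ?w) - \<sigma> (f ?w)) * h z) + i * (\<theta> * ?l z)"
        by (simp add: algebra_simps)
      finally have "k z = h z + i * ((\<sigma> (g ?w) - \<sigma> (f ?w)) * h z) + i * (\<theta> * ?l z)" unfolding i1 by simp
      moreover have "\<bar>i * ((\<sigma> (g ?w) - \<sigma> (f ?w)) * h z)\<bar> \<le> r * \<bar>h z\<bar>"
      proof -
        have "\<bar>\<sigma> (g ?w) - \<sigma> (f ?w)\<bar> \<le> L * (2 * T * \<bar>\<theta>\<bar>)"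
          using \<sigma>L fg[OF w] by (intro order.trans[OF \<sigma>L(2)] mult_left_mono) (auto simp: abs_minus_commute)
        then have "\<bar>i\<bar> * (\<bar>\<sigma> (g ?w) - \<sigma> (f ?w)\<bar> * \<bar>h z\<bar>) \<le> c * (L * (2 * T * \<bar>\<theta>\<bar>) * \<bar>h z\<bar>)"
          using i c by (intro mult_mono) auto
        also have "\<dots> = (c * (2 * T * L)) * \<bar>\<theta>\<bar> * \<bar>h z\<bar>" by simp
        also have "\<dots> \<le> \<kappa> * \<bar>\<theta>\<bar> * \<bar>h z\<bar>" using c by (intro mult_right_mono) (auto simp: \<kappa>_def algebra_simps)
        also have "\<dots> \<le> r * \<bar>h z\<bar>" using r\<theta> by (intro mult_right_mono) auto
        finally show ?thesis by (simp add: abs_mult)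
      qed
      moreover have "\<bar>i * (\<theta> * ?l z)\<bar> \<le> r"
      proof -
        have "\<bar>i\<bar> * (\<bar>\<theta>\<bar> * \<bar>?l z\<bar>) \<le> c * (\<bar>\<theta>\<bar> * 1)"
          using i c by (intro mult_mono) (auto simp: late_def)
        also have "\<dots> \<le> \<kappa> * \<bar>\<theta>\<bar>" using c \<sigma>L T by (simp add: \<kappa>_def mult_right_mono algebra_simps)
        also have "\<dots> \<le> r" by (rule r\<theta>)
        finally show ?thesis by (simp add: abs_mult)
      qed
      ultimately have "\<bar>k z\<bar> \<le> \<bar>h z\<bar> + r * \<bar>h z\<bar> + r" by linarith
      then show "\<bar>k z\<bar> \<le> (1 + r) * \<bar>h z\<bar> + r" by (simp add: algebra_simps)
    qed (use r in auto)
    have "energy T k \<le> (LBINT z:domOT T. (1 + 5 * r) * (h z)\<^sup>2 + 3 * r)"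
      unfolding energy_def
    proof (rule set_integral_mono)
      show "set_integrable lborel (domOT T) (\<lambda>z. (k z)\<^sup>2)" using kL by (simp add: L2_OT_def)
      show "set_integrable lborel (domOT T) (\<lambda>z. (1 + 5 * r) * (h z)\<^sup>2 + 3 * r)"
        using h by (intro set_integral_add(1) set_integrable_continuous_compact[where f = "\<lambda>_. 3 * r"]) (auto simp: L2_OT_def)
      show "(k z)\<^sup>2 \<le> (1 + 5 * r) * (h z)\<^sup>2 + 3 * r" if "z \<in> domOT T" for z
        using kb[OF that] by (simp add: algebra_simps)
    qed
    also have "\<dots> = (1 + 5 * r) * energy T h + (LBINT z:domOT T. 3 * r)"
      unfolding energy_def using h
      by (subst set_integral_add(2)) (auto simp: L2_OT_def intro: set_integrable_continuous_compact)
    also have "(LBINT z:domOT T. 3 * r) = (LBINT s:{0..T}. LBINT y:domO. 3 * r)"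
      unfolding domOT_def by (intro set_integral_Times set_integrable_continuous_compact compact_Times) auto
    also have "\<dots> = 3 * r * (pi * T)" using T by (simp add: set_integral_const domO_def)
    also have "(1 + 5 * r) * energy T h + 3 * r * (pi * T) = energy T h + r * (5 * energy T h + 3 * (pi * T))"
      by (simp add: algebra_simps)
    also have "\<dots> \<le> energy T h + r * (5 * M + 3 * (pi * T))"
      using h r by (intro add_left_mono mult_left_mono) auto
    also have "\<dots> \<le> energy T h + \<epsilon>" using r by simp
    finally have "energy T k \<le> energy T h + \<epsilon>" .
    then show ?thesis using kL kf \<theta>(2) by (auto simp: f_def)
  qed
  have "0 < \<delta>0" using \<eta> \<theta>0 by (simp add: \<delta>0_def)
  then show ?thesis using main by blast
qed

subsection \<open>Initial data\<close>

context
  fixes u u' :: "real \<Rightarrow> real" and K U :: real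
  assumes du: "\<And>x. x \<in> domO \<Longrightarrow> (u has_real_derivative u' x) (at x within domO)"
    and lip: "\<And>x y. x \<in> domO \<Longrightarrow> y \<in> domO \<Longrightarrow> \<bar>u' x - u' y\<bar> \<le> K * \<bar>x - y\<bar>"
    and bc: "u' 0 = 0" "u' pi = 0"
    and U: "\<And>x. x \<in> domO \<Longrightarrow> \<bar>u x\<bar> \<le> U"
begin

private lemma K_nonneg: "0 \<le> K"
proof (rule ccontr)
  assume "\<not> 0 \<le> K"
  then have "K * \<bar>pi - 0\<bar> < 0" by (simp add: mult_neg_pos)
  then show False using order.trans[OF abs_ge_zero lip[of pi 0]] by simp
qed

private lemma taylor:
  assumes "x \<in> domO" "y \<in> domO" shows "\<bar>u y - u x - u' x * (y - x)\<bar> \<le> K * (y - x)\<^sup>2"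
proof -
  let ?S = "closed_segment x y" and ?g = "\<lambda>s. u s - u' x * s"
  have S: "?S \<subseteq> domO" using assms by (auto simp: domO_def closed_segment_eq_real_ivl split: if_splits)
  have "norm (?g y - ?g x) \<le> (K * \<bar>y - x\<bar>) * norm (y - x)"
  proof (rule field_differentiable_bound[of ?S ?g "\<lambda>s. u' s - u' x"])
    fix s assume s: "s \<in> ?S"
    have "(u has_real_derivative u' s) (at s within ?S)"
      by (rule has_field_derivative_subset[OF du S]) (use s S in auto)
    then show "(?g has_real_derivative u' s - u' x) (at s within ?S)"
      by (auto intro!: derivative_eq_intros)
    have "\<bar>s - x\<bar> \<le> \<bar>y - x\<bar>" using s by (auto simp: closed_segment_eq_real_ivl split: if_splits)
    then have "K * \<bar>s - x\<bar> \<le> K * \<bar>y - x\<bar>" using K_nonneg by (rule mult_left_mono)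
    moreover have "\<bar>u' s - u' x\<bar> \<le> K * \<bar>s - x\<bar>" using s S assms by (intro lip) auto
    ultimately show "norm (u' s - u' x) \<le> K * \<bar>y - x\<bar>" by simp
  qed auto
  then show ?thesis by (simp add: power2_eq_square algebra_simps)
qed

private lemma u_lipschitz:
  assumes "x \<in> domO" "y \<in> domO" shows "\<bar>u x - u y\<bar> \<le> K * pi * \<bar>x - y\<bar>"
proof -
  have "norm (u x - u y) \<le> (K * pi) * norm (x - y)"
  proof (rule field_differentiable_bound[of domO u u'])
    fix s assume s: "s \<in> domO"
    then have "\<bar>u' s - u' 0\<bar> \<le> K * \<bar>s - 0\<bar>" by (intro lip) auto
    also have "\<dots> \<le> K * pi" using s K_nonneg by (intro mult_left_mono) (auto simp: domO_def)
    finally show "norm (u' s) \<le> K * pi" using bc by simp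
  qed (use assms du in \<open>auto simp: domO_def\<close>)
  then show ?thesis by simp
qed

private lemma cont_u: "continuous_on domO u"
  by (rule DERIV_continuous_on[OF du])

text \<open>Clamping the index produces the Neumann ghost values. Inside, two Taylor expansions
  cancel their linear terms; at the ends one expansion is missing and the boundary condition makes
  its linear term small.\<close>

private lemma second_difference:
  fixes n k :: nat
  defines "w \<equiv> \<lambda>k. u (node n (max 1 (min n k)))"
  assumes "1 \<le> k" "k \<le> n"
  shows "\<bar>w (Suc k) - 2 * w k + w (k - 1)\<bar> \<le> 2 * K * (pi / real n)\<^sup>2"
proof -
  define e where "e = pi / real n"
  have n: "0 < n" "0 < real n" using assms by auto
  have e: "0 \<le> e" by (simp add: e_def)
  have Ke: "0 \<le> K * e\<^sup>2" using K_nonneg by simp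
  define x where "x = node n k"
  have x: "x \<in> domO" unfolding x_def using assms by (intro node_in_domO)
  have wk: "w k = u x" using assms by (simp add: w_def x_def max_def min_def)
  have right: "k < n \<Longrightarrow> \<bar>w (Suc k) - w k - u' x * e\<bar> \<le> K * e\<^sup>2"
  proof -
    assume "k < n"
    then have "w (Suc k) = u (x + e)" "x + e \<in> domO"
      using node_in_domO[of "Suc k" n] node_Suc[OF n(1), of k] by (auto simp: w_def x_def e_def)
    then show ?thesis using taylor[OF x, of "x + e"] wk by simp
  qed
  have left: "1 < k \<Longrightarrow> \<bar>w (k - 1) - w k + u' x * e\<bar> \<le> K * e\<^sup>2"
  proof -
    assume k: "1 < k"
    then have "node n (k - 1) = x - e" using node_Suc[OF n(1), of "k - 1"] by (simp add: x_def e_def)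
    moreover have "node n (k - 1) \<in> domO" using k assms by (intro node_in_domO) auto
    moreover have "max 1 (min n (k - 1)) = k - 1" using k assms by auto
    ultimately have "w (k - 1) = u (x - e)" "x - e \<in> domO" by (auto simp: w_def)
    then show ?thesis using taylor[OF x, of "x - e"] wk by simp
  qed
  have half: "K * (e / 2) * e = K * e\<^sup>2 / 2" by (simp add: power2_eq_square)
  \<comment> \<open>The first node is half a mesh width from the boundary, where the derivative
    vanishes, so the derivative there is at most \<open>K * e / 2\<close>.\<close>
  have first: "\<bar>u' x * e\<bar> \<le> K * e\<^sup>2" if "k = 1"
  proof -
    have "\<bar>x - 0\<bar> = e / 2" using that n e by (simp add: x_def e_def node_def)
    then have "\<bar>u' x\<bar> \<le> K * (e / 2)" using lip[OF x, of 0] bc by (simp only: domO_props diff_0_right)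
    then have "\<bar>u' x\<bar> * e \<le> K * (e / 2) * e" using e by (rule mult_right_mono)
    then have "\<bar>u' x * e\<bar> \<le> K * e\<^sup>2 / 2" using e unfolding half by (simp add: abs_mult)
    then show ?thesis using Ke by linarith
  qed
  have last: "\<bar>u' x * e\<bar> \<le> K * e\<^sup>2" if "k = n"
  proof -
    have "x - pi = - (e / 2)" using that n by (simp add: x_def e_def node_def field_simps)
    then have "\<bar>x - pi\<bar> = e / 2" using e by simp
    then have "\<bar>u' x\<bar> \<le> K * (e / 2)" using lip[OF x, of pi] bc by (simp only: domO_props diff_0_right)
    then have "\<bar>u' x\<bar> * e \<le> K * (e / 2) * e" using e by (rule mult_right_mono)
    then have "\<bar>u' x * e\<bar> \<le> K * e\<^sup>2 / 2" using e unfolding half by (simp add: abs_mult)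
    then show ?thesis using Ke by linarith
  qed
  have w0: "w (k - 1) = w k" if "k = 1" using that by (simp add: w_def)
  have wn: "w (Suc k) = w k" if "k = n" using that n by (simp add: w_def)
  have "\<bar>w (Suc k) - 2 * w k + w (k - 1)\<bar> \<le> 2 * (K * e\<^sup>2)"
  proof (cases "k = 1")
    case k1: True
    show ?thesis
    proof (cases "k = n")
      case True then show ?thesis using w0 wn k1 Ke by simp
    next
      case False then show ?thesis using right first w0 k1 assms by linarith
    qed
  next
    case k1: False
    show ?thesis
    proof (cases "k = n")
      case True then show ?thesis using left last wn k1 assms by linarith
    next
      case False then show ?thesis using left right k1 assms by linarith
    qed
  qed
  then show ?thesis by (simp add: e_def)
qed

text \<open>Summation by parts transfers the discrete Laplacian to the datum, whose second
  differences are of the order of the squared mesh width.\<close>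

private lemma icoef_decay_discrete:
  assumes "j < n" shows "freq n j * \<bar>icoef n u j\<bar> \<le> 2 * K * pi"
proof -
  have n: "0 < n" "0 < real n" using assms by auto
  define w where "w k = u (node n (max 1 (min n k)))" for k
  define S where "S = (\<Sum>k\<in>{1..n}. phi j (node n k) * w k)"
  have ic: "icoef n u j = pi / real n * S"
  proof -
    have "S = (\<Sum>k\<in>{1..n}. phi j (node n k) * u (node n k))"
      unfolding S_def by (intro sum.cong) (auto simp: w_def min_absorb2 max_absorb2)
    then show ?thesis
      using integral_kappa[OF n(1), of "\<lambda>y. phi j y * u y"] assms by (simp add: icoef_def samp_def)
  qed
  have "(pi / real n)\<^sup>2 * freq n j * S = - (\<Sum>k\<in>{1..n}. phi j (node n k) * (w (Suc k) - 2 * w k + w (k - 1)))"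
    unfolding S_def by (rule discrete_laplacian_symmetric[OF assms]) (use n in \<open>auto simp: w_def\<close>)
  moreover have "c * \<bar>s\<bar> = \<bar>r\<bar>" if "c * s = - r" "0 \<le> c" for c s r :: real
    using that(2) arg_cong[OF that(1), of abs] by (simp add: abs_mult)
  ultimately have "(pi / real n)\<^sup>2 * freq n j * \<bar>S\<bar> = \<bar>\<Sum>k\<in>{1..n}. phi j (node n k) * (w (Suc k) - 2 * w k + w (k - 1))\<bar>"
    using freq_nonneg[of n j] by simp
  also have "\<dots> \<le> (\<Sum>k\<in>{1..n}. 1 * (2 * K * (pi / real n)\<^sup>2))"
    unfolding w_def using abs_phi_le second_difference[of _ n]
    by (intro order.trans[OF sum_abs] sum_mono) (simp only: abs_mult, intro mult_mono, auto)
  also have "\<dots> = (pi / real n)\<^sup>2 * (2 * K * real n)" by simp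
  finally have "freq n j * \<bar>S\<bar> \<le> 2 * K * real n" using n by (simp add: mult.assoc)
  then have "pi / real n * (freq n j * \<bar>S\<bar>) \<le> pi / real n * (2 * K * real n)" by (rule mult_left_mono) simp
  then show ?thesis using n by (simp add: ic abs_mult mult_ac)
qed

private lemma icoef_close:
  assumes "j < n" shows "\<bar>icoef n u j - icoef 0 u j\<bar> \<le> pi * ((real j * U + K * pi) * (pi / real n))"
proof -
  have n: "0 < n" using assms by simp
  have i1: "set_integrable lborel domO (\<lambda>y. phi j (samp n y) * u (samp n y))"
    using integrable_kappa[OF n, of "\<lambda>y. phi j y * u y"] n by (simp add: samp_def)
  have i2: "set_integrable lborel domO (\<lambda>y. phi j y * u y)"
    by (intro set_integrable_continuous_compact continuous_intros cont_u) simp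
  have i3: "set_integrable lborel domO (\<lambda>y. (real j * U + K * pi) * (pi / real n))"
    by (intro set_integrable_continuous_compact) auto
  have "icoef n u j - icoef 0 u j = (LBINT y:domO. phi j (samp n y) * u (samp n y) - phi j y * u y)"
    using assms by (simp add: icoef_def samp_def[of 0] set_integral_diff(2)[OF i1 i2])
  moreover have "\<bar>LBINT y:domO. phi j (samp n y) * u (samp n y) - phi j y * u y\<bar> \<le> (LBINT y:domO. (real j * U + K * pi) * (pi / real n))"
  proof (rule abs_set_integral_le[OF i3])
    fix y assume y: "y \<in> domO"
    have sy: "samp n y \<in> domO" by (rule samp_in_domO[OF y])
    have c: "\<bar>samp n y - y\<bar> \<le> pi / real n" by (rule samp_close[OF n y])
    have "\<bar>phi j (samp n y) - phi j y\<bar> \<le> real j * (pi / real n)"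
      by (rule order.trans[OF phi_lipschitz mult_left_mono[OF c]]) simp
    then have "\<bar>phi j (samp n y) - phi j y\<bar> * \<bar>u (samp n y)\<bar> \<le> (real j * (pi / real n)) * U"
      using U[OF sy] by (intro mult_mono) auto
    moreover have "\<bar>phi j y\<bar> * \<bar>u (samp n y) - u y\<bar> \<le> 1 * (K * pi * (pi / real n))"
      using K_nonneg by (intro mult_mono abs_phi_le order.trans[OF u_lipschitz[OF sy y]] mult_left_mono c) auto
    moreover have "phi j (samp n y) * u (samp n y) - phi j y * u y = (phi j (samp n y) - phi j y) * u (samp n y) + phi j y * (u (samp n y) - u y)"
      by (simp add: algebra_simps)
    ultimately have "\<bar>phi j (samp n y) * u (samp n y) - phi j y * u y\<bar> \<le> (real j * (pi / real n)) * U + 1 * (K * pi * (pi / real n))"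
      using abs_triangle_ineq[of "(phi j (samp n y) - phi j y) * u (samp n y)" "phi j y * (u (samp n y) - u y)"]
      unfolding abs_mult by simp
    then show "\<bar>phi j (samp n y) * u (samp n y) - phi j y * u y\<bar> \<le> (real j * U + K * pi) * (pi / real n)"
      by (simp add: algebra_simps)
  qed
  moreover have "(LBINT y:domO. (real j * U + K * pi) * (pi / real n)) = pi * ((real j * U + K * pi) * (pi / real n))"
    by (simp add: set_integral_const domO_def)
  ultimately show ?thesis by (simp only:)
qed

private lemma icoef_tendsto: "(\<lambda>n. icoef n u j) \<longlonglongrightarrow> icoef 0 u j"
proof -
  have "(\<lambda>n. pi * ((real j * U + K * pi) * (pi / real n))) \<longlonglongrightarrow> pi * 0"
    by (intro tendsto_mult[OF tendsto_const] pi_div_tendsto)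
  then have "(\<lambda>n. pi * ((real j * U + K * pi) * (pi / real n))) \<longlonglongrightarrow> 0" by simp
  then have "(\<lambda>n. icoef n u j - icoef 0 u j) \<longlonglongrightarrow> 0"
    by (rule Lim_null_comparison[rotated], intro eventually_mono[OF eventually_gt_at_top[of j]])
      (simp only: real_norm_def icoef_close)
  then show ?thesis by (simp add: LIM_zero_iff)
qed

text \<open>The continuum case is the limit of the discrete estimate, which replaces integration by
  parts on the interval.\<close>

private lemma icoef_decay: "freq n j * \<bar>icoef n u j\<bar> \<le> 2 * K * pi"
proof -
  have "freq 0 j * \<bar>icoef 0 u j\<bar> \<le> 2 * K * pi"
  proof (rule LIMSEQ_le_const2)
    show "(\<lambda>n. freq n j * \<bar>icoef n u j\<bar>) \<longlonglongrightarrow> freq 0 j * \<bar>icoef 0 u j\<bar>"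
      by (intro tendsto_intros freq_tendsto icoef_tendsto)
    show "\<exists>N. \<forall>n\<ge>N. freq n j * \<bar>icoef n u j\<bar> \<le> 2 * K * pi"
      using icoef_decay_discrete[of j] by (intro exI[of _ "Suc j"]) auto
  qed
  then show ?thesis
    using icoef_decay_discrete[of j n] K_nonneg by (cases "n = 0"; cases "j < n") (auto simp: icoef_def)
qed

text \<open>In the constant, \<open>12\<close> is \<open>2\<close> from the decay estimate times
  \<open>6\<close> from \<open>inverse_freq_le\<close>; \<open>pi * U\<close> covers the
  mean.\<close>

lemma initial_datum_smooth: "initial_datum u (12 * K * pi + pi * U)"
  unfolding initial_datum_def decaying_def
proof (intro conjI allI icoef_tendsto)
  fix n j
  have U0: "0 \<le> U" using U[of 0] by (simp add: order.trans[OF abs_ge_zero])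
  show "\<bar>icoef n u j\<bar> \<le> (12 * K * pi + pi * U) * wt 1 j"
  proof (cases "j = 0")
    case True
    have "\<bar>LBINT y:domO. phi 0 (samp n y) * u (samp n y)\<bar> \<le> (LBINT y:domO. U)"
    proof (rule abs_set_integral_le)
      fix y assume "y \<in> domO"
      then have "\<bar>u (samp n y)\<bar> \<le> U" using samp_in_domO U by blast
      then have "\<bar>phi 0 (samp n y)\<bar> * \<bar>u (samp n y)\<bar> \<le> 1 * U" by (intro mult_mono abs_phi_le) auto
      then show "\<bar>phi 0 (samp n y) * u (samp n y)\<bar> \<le> U" by (simp add: abs_mult)
    qed (intro set_integrable_continuous_compact, auto)
    also have "\<dots> = pi * U" by (simp add: set_integral_const domO_def)
    finally have "\<bar>icoef n u 0\<bar> \<le> pi * U" using U0 by (simp add: icoef_def)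
    moreover have "0 \<le> 12 * K * pi" using K_nonneg by simp
    ultimately show ?thesis using True by simp
  next
    case False
    then have m: "0 < freq n j" by (intro freq_pos) simp
    have "\<bar>icoef n u j\<bar> \<le> (2 * K * pi) * (1 / freq n j)"
      using icoef_decay[of n j] m by (simp add: field_simps)
    also have "\<dots> \<le> (2 * K * pi) * (6 * wt 1 j)"
      using inverse_freq_le[of j n] False K_nonneg by (intro mult_left_mono) auto
    also have "\<dots> \<le> (12 * K * pi + pi * U) * wt 1 j"
      using U0 wt_nonneg[of 1 j] by (simp add: algebra_simps)
    finally show ?thesis .
  qed
qed

text \<open>Pointwise convergence of the cosine series is inherited from its discrete counterpart, where
  the expansion is exact at the nodes.\<close>

lemma cosine_series:
  assumes x: "x \<in> domO" shows "(\<Sum>j. phi j x * icoef 0 u j) = u x"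
proof -
  let ?V = "12 * K * pi + pi * U"
  have d: "\<bar>icoef n u j\<bar> \<le> ?V * wt 1 j" for n j
    using initial_datum_smooth by (auto simp: initial_datum_def decaying_def)
  have "(\<lambda>n. \<Sum>j. trial n j x * icoef n u j) \<longlonglongrightarrow> (\<Sum>j. phi j x * icoef 0 u j)"
  proof -
    have "(\<lambda>n. trial n j x) \<longlonglongrightarrow> phi j x" for j
    proof -
      have "(\<lambda>n. trial n j x - phi j x) \<longlonglongrightarrow> 0"
        by (rule Lim_null_comparison[OF _ pi_div_tendsto[of "real j"]])
          (use trial_close[OF _ x] in \<open>auto intro!: eventually_mono[OF eventually_gt_at_top[of j]]\<close>)
      then show ?thesis by (simp add: LIM_zero_iff)
    qed
    then have lim: "(\<lambda>n. trial n j x * icoef n u j) \<longlonglongrightarrow> phi j x * icoef 0 u j" for j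
      by (intro tendsto_mult icoef_tendsto)
    have "\<forall>\<^sub>F (j, n) in at_top \<times>\<^sub>F sequentially. norm (trial n j x * icoef n u j) \<le> ?V * wt 1 j"
      using abs_trial_mult_le[OF x d] by (intro always_eventually) auto
    with tannerys_theorem[of "\<lambda>j n. trial n j x * icoef n u j", OF lim] summable_wt_mult[of 1 ?V]
    show ?thesis by simp
  qed
  moreover have "(\<lambda>n. \<Sum>j. trial n j x * icoef n u j) \<longlonglongrightarrow> u x"
  proof -
    have "(\<lambda>n. interp n u x - u x) \<longlonglongrightarrow> 0"
    proof (rule Lim_null_comparison[OF _ pi_div_tendsto[of "K * pi"]])
      have "\<bar>interp n u x - u x\<bar> \<le> K * pi * (pi / real n)" if "0 < n" for n
        using that x K_nonneg by (intro interp_close order.trans[OF u_lipschitz] mult_left_mono) auto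
      then show "\<forall>\<^sub>F n in sequentially. norm (interp n u x - u x) \<le> K * pi * (pi / real n)"
        by (auto intro!: eventually_mono[OF eventually_gt_at_top[of 0]])
    qed
    then have "(\<lambda>n. interp n u x) \<longlonglongrightarrow> u x" by (simp add: LIM_zero_iff)
    moreover have "\<forall>\<^sub>F n in sequentially. interp n u x = (\<Sum>j. trial n j x * icoef n u j)"
    proof (rule eventually_mono[OF eventually_gt_at_top[of 0]])
      fix n :: nat assume n: "0 < n"
      have "(\<Sum>j. trial n j x * icoef n u j) = (\<Sum>j<n. trial n j x * icoef n u j)"
        using n by (intro suminf_finite) (auto simp: trial_def)
      also have "\<dots> = (\<Sum>j<n. trial n j x * (LBINT y:domO. phi j (samp n y) * u (samp n y)))"
        by (intro sum.cong) (auto simp: icoef_def)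
      also have "\<dots> = interp n u x" by (rule interp_eq_sum[OF n x])
      finally show "interp n u x = (\<Sum>j. trial n j x * icoef n u j)" ..
    qed
    ultimately show ?thesis by (rule Lim_transform_eventually)
  qed
  ultimately show ?thesis by (rule LIMSEQ_unique)
qed

end

lemma datum_of_hypotheses:
  assumes "Ck_on 3 domO u0" "(u0 has_real_derivative 0) (at 0 within domO)" "(u0 has_real_derivative 0) (at pi within domO)"
  shows "\<exists>V. initial_datum u0 V" "\<And>x. x \<in> domO \<Longrightarrow> (\<Sum>j. phi j x * icoef 0 u0 j) = u0 x" "continuous_on domO u0"
proof -
  have "\<exists>u1 u2 u3. (\<forall>x\<in>domO. (u0 has_real_derivative u1 x) (at x within domO)) \<and>
    (\<forall>x\<in>domO. (u1 has_real_derivative u2 x) (at x within domO)) \<and> (\<forall>x\<in>domO. (u2 has_real_derivative u3 x) (at x within domO))"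
    using assms(1) by (auto simp: eval_nat_numeral)
  then obtain u1 u2 u3 where d: "\<And>x. x \<in> domO \<Longrightarrow> (u0 has_real_derivative u1 x) (at x within domO)"
    "\<And>x. x \<in> domO \<Longrightarrow> (u1 has_real_derivative u2 x) (at x within domO)"
    "\<And>x. x \<in> domO \<Longrightarrow> (u2 has_real_derivative u3 x) (at x within domO)"
    by blast
  \<comment> \<open>One-sided derivatives at the end points are unique, so the first derivative
    provided by \<open>Ck_on\<close> is the one that vanishes there by hypothesis.\<close>
  have nb: "at x within domO \<noteq> bot" if "x \<in> domO" for x
    using that by (simp add: domO_def trivial_limit_within)
  have "u1 p = 0" if "p \<in> domO" "(u0 has_real_derivative 0) (at p within domO)" for p
    using vector_derivative_unique_within[OF nb[OF that(1)], of u0 "u1 p" 0] d(1)[OF that(1)] that(2)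
    by (simp add: has_real_derivative_iff_has_vector_derivative)
  then have bc: "u1 0 = 0" "u1 pi = 0" using assms(2,3) by simp_all
  show c0: "continuous_on domO u0" by (rule DERIV_continuous_on[OF d(1)])
  have "continuous_on domO u2" by (rule DERIV_continuous_on[OF d(3)])
  then have "bounded (u2 ` domO)" "bounded (u0 ` domO)"
    using c0 by (intro compact_imp_bounded compact_continuous_image; simp)+
  then obtain K U where "\<forall>y\<in>u2 ` domO. norm y \<le> K" "\<forall>y\<in>u0 ` domO. norm y \<le> U"
    unfolding bounded_iff by blast
  then have K: "norm (u2 x) \<le> K" and U: "norm (u0 x) \<le> U" if "x \<in> domO" for x
    using that by blast+
  have lip: "\<bar>u1 x - u1 y\<bar> \<le> K * \<bar>x - y\<bar>" if "x \<in> domO" "y \<in> domO" for x y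
    using field_differentiable_bound[OF _ d(2) K that] by (simp add: domO_def)
  have U': "\<bar>u0 x\<bar> \<le> U" if "x \<in> domO" for x using U[OF that] by simp
  show "\<exists>V. initial_datum u0 V" using initial_datum_smooth[OF d(1) lip bc U'] by blast
  show "(\<Sum>j. phi j x * icoef 0 u0 j) = u0 x" if "x \<in> domO" for x
    by (rule cosine_series[OF d(1) lip bc U' that])
qed

subsection \<open>Skeleton equations and rate functions\<close>

text \<open>One series for all four kernels: \<open>c = 1\<close> gives the Green functions,
  \<open>c = - \<mu>\<close> their Laplacians.\<close>

definition kern :: "nat \<Rightarrow> (nat \<Rightarrow> real) \<Rightarrow> real \<Rightarrow> real \<Rightarrow> real \<Rightarrow> real" where
  "kern n c r x y = (\<Sum>j. c j * exp (- (freq n j)\<^sup>2 * r) * trial n j x * phi j (samp n y))"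

lemma kern_green: "green r x y = kern 0 (\<lambda>_. 1) r x y"
  and kern_lap_green: "lap_green r x y = kern 0 (\<lambda>j. - freq 0 j) r x y"
  by (simp_all add: green_def lap_green_def kern_def lam_def freq_def trial_def samp_def)

lemma
  assumes "0 < n"
  shows kern_green_n: "green_n n r x y = kern n (\<lambda>_. 1) r x y"
    and kern_lap_green_n: "lap_green_n n r x y = kern n (\<lambda>j. - freq n j) r x y"
proof -
  have "kern n c r x y = (\<Sum>j<n. c j * exp (- (freq n j)\<^sup>2 * r) * trial n j x * phi j (samp n y))" for c
    unfolding kern_def using assms by (intro suminf_finite) (auto simp: trial_def)
  then show "green_n n r x y = kern n (\<lambda>_. 1) r x y" "lap_green_n n r x y = kern n (\<lambda>j. - freq n j) r x y"
    using assms by (auto simp: green_n_def lap_green_n_def freq_def trial_def samp_def intro!: sum.cong)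
qed

text \<open>From \<open>a * exp (- a) \<le> 1\<close> with \<open>a = \<mu>\<^sup>2 * r\<close>;
  since \<open>1 \<le> 3 * \<mu>\<close> for \<open>j > 0\<close>, the constant is
  \<open>24 = 4 * 6\<close>. The bound is not integrable at \<open>r = 0\<close>: it only gives
  convergence of the kernel series for each fixed \<open>r > 0\<close>.\<close>

lemma exp_freq_le:
  assumes "0 < r" shows "(1 + freq n j) * exp (- (freq n j)\<^sup>2 * r) \<le> (1 + 24 / r) * wt 1 j"
proof (cases "j = 0")
  case False
  let ?m = "freq n j"
  have m: "0 < ?m" using False by (intro freq_pos) simp
  define a where "a = ?m\<^sup>2 * r"
  have e: "a * exp (- a) \<le> 1"
  proof -
    have "a \<le> exp a" using exp_ge_add_one_self[of a] by linarith
    then have "a * exp (- a) \<le> exp a * exp (- a)" by (intro mult_right_mono) auto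
    then show ?thesis by (simp flip: exp_add)
  qed
  have "?m\<^sup>2 * exp (- a) \<le> 1 / r" using e assms by (simp add: a_def field_simps)
  then have "(?m * exp (- a)) * ?m \<le> 1 / r" by (simp add: power2_eq_square mult_ac)
  then have "?m * exp (- a) \<le> 1 / r / ?m" using m by (simp only: pos_le_divide_eq)
  also have "\<dots> = 1 / r * (1 / ?m)" by simp
  also have "1 / r * (1 / ?m) \<le> 1 / r * (6 * wt 1 j)" using inverse_freq_le[of j n] False assms by (intro mult_left_mono) auto
  finally have 1: "?m * exp (- a) \<le> 6 / r * wt 1 j" by simp
  have "1 / 3 \<le> ?m"
  proof -
    have "(1::real) \<le> (real j)\<^sup>2" using False by simp
    then show ?thesis using freq_ge[of j n] by linarith
  qed
  then have "1 * exp (- a) \<le> (3 * ?m) * exp (- a)" by (intro mult_right_mono) auto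
  then have "(1 + ?m) * exp (- a) \<le> 4 * (?m * exp (- a))" by (simp add: algebra_simps)
  also have "\<dots> \<le> 4 * (6 / r * wt 1 j)" using 1 by simp
  also have "\<dots> \<le> (1 + 24 / r) * wt 1 j" using wt_nonneg[of 1 j] by (simp add: algebra_simps)
  finally show ?thesis by (simp add: a_def)
qed (use assms in simp)

lemma kern_term_le:
  assumes "0 < r" "\<bar>c j\<bar> \<le> 1 + freq n j" "x \<in> domO"
  shows "\<bar>c j * exp (- (freq n j)\<^sup>2 * r) * trial n j x * phi j y\<bar> \<le> (1 + 24 / r) * wt 1 j"
proof -
  have "\<bar>c j * exp (- (freq n j)\<^sup>2 * r) * trial n j x * phi j y\<bar>
      \<le> (1 + freq n j) * exp (- (freq n j)\<^sup>2 * r) * 1 * 1"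
    unfolding abs_mult using assms abs_trial_le[OF assms(3), of n j] abs_phi_le[of j y] freq_nonneg[of n j]
    by (intro mult_mono) auto
  then show ?thesis using exp_freq_le[OF assms(1), of n j] by simp
qed

text \<open>Sum and space-time integral are exchanged because the integrals of the absolute values
  are summable by \<open>slab_integral_bound\<close>; pointwise convergence holds off the slice
  \<open>s = t\<close>. The function \<open>h\<close> serves only as a majorant, so drift and
  diffusion are covered together.\<close>

lemma kern_integral:
  assumes h: "h \<in> L2_OT T" and t: "0 \<le> t" "t \<le> T" and x: "x \<in> domO"
    and c: "\<And>j. \<bar>c j\<bar> \<le> 1 + freq n j" and p: "set_integrable lborel (domOT T) p"
    and P: "0 \<le> P" "\<And>j z. z \<in> {0..t} \<times> domO \<Longrightarrow> \<bar>c j * p z\<bar> \<le> P * (freq n j + \<bar>h z\<bar>)"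
  shows "(LBINT s:{0..t}. LBINT y:domO. kern n c (t - s) x y * p (s, y)) = (\<Sum>j. trial n j x * mint n (\<lambda>z. c j * p z) j t)"
    and "summable (\<lambda>j. trial n j x * mint n (\<lambda>z. c j * p z) j t)"
proof -
  let ?S = "{0..t} \<times> domO"
  define G where "G z = kern n c (t - fst z) x (snd z) * p z" for z
  define g where "g j z = trial n j x * (exp (- (freq n j)\<^sup>2 * (t - fst z)) * phi j (samp n (snd z)) * (c j * p z))" for j z
  let ?ind = "\<lambda>z. indicator ?S z :: real"
  have gi: "set_integrable lborel ?S (g j)" for j
    unfolding g_def by (intro set_integrable_mult_right mint_integrable[OF set_integrable_mult_right[OF p] t(2)])
  have int: "integrable lborel (\<lambda>z. ?ind z *\<^sub>R g j z)" for j
    using gi[of j] unfolding set_integrable_def .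
  have gint: "(\<integral>z. ?ind z *\<^sub>R g j z \<partial>lborel) = trial n j x * mint n (\<lambda>z. c j * p z) j t" for j
  proof -
    have "(LBINT z:?S. g j z) = trial n j x * mint n (\<lambda>z. c j * p z) j t"
      unfolding g_def mint_def by (rule set_integral_mult_right)
    then show ?thesis unfolding set_lebesgue_integral_def .
  qed
  have nb: "\<bar>\<integral>z. norm (?ind z *\<^sub>R g j z) \<partial>lborel\<bar> \<le> P * exp (1 * t) * (5 + energy T h) * wt 1 j" for j
  proof -
    have "\<bar>LBINT z:?S. \<bar>g j z\<bar>\<bar> \<le> P * exp (1 * t) * ((5 + energy T h) * wt 1 j)"
    proof (rule slab_integral_bound[OF h order_refl t zero_less_one P(1)])
      fix z assume z: "z \<in> ?S"
      then have "1 \<le> exp (1 * fst z)" by auto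
      then have "P * 1 * (freq n j + \<bar>h z\<bar>) \<le> P * exp (1 * fst z) * (freq n j + \<bar>h z\<bar>)"
        using P(1) freq_nonneg[of n j] by (intro mult_right_mono mult_left_mono) auto
      then show "\<bar>c j * p z\<bar> \<le> P * exp (1 * fst z) * (freq n j + \<bar>h z\<bar>)" using P(2)[OF z, of j] by simp
      have "\<bar>trial n j x\<bar> * (exp (- (freq n j)\<^sup>2 * (t - fst z)) * \<bar>phi j (samp n (snd z))\<bar> * \<bar>c j * p z\<bar>)
        \<le> 1 * (exp (- (freq n j)\<^sup>2 * (t - fst z)) * 1 * \<bar>c j * p z\<bar>)"
        using abs_trial_le[OF x] abs_phi_le by (intro mult_mono) auto
      then show "\<bar>\<bar>g j z\<bar>\<bar> \<le> exp (- (freq n j)\<^sup>2 * (t - fst z)) * \<bar>c j * p z\<bar>"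
        by (simp add: g_def abs_mult)
    qed
    moreover have "(LBINT z:?S. \<bar>g j z\<bar>) = (\<integral>z. norm (?ind z *\<^sub>R g j z) \<partial>lborel)"
      unfolding set_lebesgue_integral_def by (simp add: abs_mult)
    ultimately show ?thesis by (simp add: mult.assoc)
  qed
  have ns: "summable (\<lambda>j. \<integral>z. norm (?ind z *\<^sub>R g j z) \<partial>lborel)"
    by (rule abs_suminf_le(1)[OF nb summable_wt_mult]) simp
  have ks: "summable (\<lambda>j. \<bar>c j * exp (- (freq n j)\<^sup>2 * (t - fst z)) * trial n j x * phi j (samp n (snd z))\<bar>)"
    if "z \<in> ?S" "fst z \<noteq> t" for z
  proof (rule abs_suminf_le(1)[OF _ summable_wt_mult])
    fix j
    show "\<bar>\<bar>c j * exp (- (freq n j)\<^sup>2 * (t - fst z)) * trial n j x * phi j (samp n (snd z))\<bar>\<bar> \<le> (1 + 24 / (t - fst z)) * wt 1 j"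
      using kern_term_le[OF _ c x, where r = "t - fst z" and j = j] that by auto
  qed simp
  have geq: "g j z = c j * exp (- (freq n j)\<^sup>2 * (t - fst z)) * trial n j x * phi j (samp n (snd z)) * p z" for j z
    by (simp add: g_def)
  have as: "AE z in lborel. summable (\<lambda>j. norm (?ind z *\<^sub>R g j z))"
    using AE_fst_neq[of t]
  proof eventually_elim
    fix z :: "real \<times> real" assume z: "fst z \<noteq> t"
    show "summable (\<lambda>j. norm (?ind z *\<^sub>R g j z))"
    proof (cases "z \<in> ?S")
      case True
      from summable_mult2[OF ks[OF True z], of "\<bar>p z\<bar>"] show ?thesis
        using True by (simp add: geq abs_mult)
    qed simp
  qed
  have ae: "AE z in lborel. (\<Sum>j. ?ind z *\<^sub>R g j z) = ?ind z *\<^sub>R G z"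
    using AE_fst_neq[of t]
  proof eventually_elim
    fix z :: "real \<times> real" assume z: "fst z \<noteq> t"
    show "(\<Sum>j. ?ind z *\<^sub>R g j z) = ?ind z *\<^sub>R G z"
    proof (cases "z \<in> ?S")
      case True
      have "(\<Sum>j. g j z) = G z"
        unfolding geq G_def kern_def by (rule suminf_mult2[OF summable_rabs_cancel[OF ks[OF True z]], symmetric])
      then show ?thesis using True by simp
    qed simp
  qed
  have km: "(\<lambda>z. kern n c (t - fst z) x (snd z)) \<in> borel_measurable borel"
    unfolding kern_def by measurable
  have pm: "(\<lambda>z. ?ind z *\<^sub>R p z) \<in> borel_measurable lborel"
    using set_integrable_subset[OF p _ slab_subset[OF t(2)]] unfolding set_integrable_def by auto
  have Gm: "(\<lambda>z. ?ind z *\<^sub>R G z) \<in> borel_measurable lborel"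
  proof -
    have "(\<lambda>z. kern n c (t - fst z) x (snd z) * (?ind z *\<^sub>R p z)) \<in> borel_measurable lborel"
      using km pm by measurable
    then show ?thesis by (simp add: G_def mult_ac)
  qed
  have si: "integrable lborel (\<lambda>z. \<Sum>j. ?ind z *\<^sub>R g j z)" by (rule integrable_suminf[OF int as ns])
  have Gi: "integrable lborel (\<lambda>z. ?ind z *\<^sub>R G z)"
    using integrable_cong_AE[THEN iffD1, OF borel_measurable_integrable[OF si] Gm ae si] .
  then have Gs: "set_integrable lborel ?S G" unfolding set_integrable_def .
  have "(LBINT s:{0..t}. LBINT y:domO. G (s, y)) = (LBINT z:?S. G z)" by (rule set_integral_Times[OF Gs, symmetric])
  also have "\<dots> = (\<integral>z. (\<Sum>j. ?ind z *\<^sub>R g j z) \<partial>lborel)"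
    unfolding set_lebesgue_integral_def
    by (rule integral_cong_AE[OF Gm borel_measurable_integrable[OF si]]) (use ae in \<open>auto elim: eventually_mono\<close>)
  also have "\<dots> = (\<Sum>j. \<integral>z. ?ind z *\<^sub>R g j z \<partial>lborel)" by (rule integral_suminf[OF int as ns])
  finally show "(LBINT s:{0..t}. LBINT y:domO. kern n c (t - s) x y * p (s, y)) = (\<Sum>j. trial n j x * mint n (\<lambda>z. c j * p z) j t)"
    unfolding gint by (simp add: G_def)
  show "summable (\<lambda>j. trial n j x * mint n (\<lambda>z. c j * p z) j t)"
    using summable_integral[OF int as ns] unfolding gint .
qed

lemma kern_initial:
  assumes u0: "continuous_on domO u0" and x: "x \<in> domO" and t: "0 < t \<or> (0 < n \<and> 0 \<le> t)"
  shows "(LBINT y:domO. kern n (\<lambda>_. 1) t x y * u0 (samp n y)) = (\<Sum>j. trial n j x * (exp (- (freq n j)\<^sup>2 * t) * icoef n u0 j))"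
    and "summable (\<lambda>j. trial n j x * (exp (- (freq n j)\<^sup>2 * t) * icoef n u0 j))"
proof -
  have "compact (u0 ` domO)" by (intro compact_continuous_image u0) simp
  then obtain U where "\<forall>y\<in>u0 ` domO. norm y \<le> U" by (meson compact_imp_bounded bounded_iff)
  then have U: "\<And>y. y \<in> domO \<Longrightarrow> \<bar>u0 y\<bar> \<le> U" by auto
  have U0: "0 \<le> U" using order.trans[OF abs_ge_zero U[of 0]] by simp
  define a where "a j = exp (- (freq n j)\<^sup>2 * t) * trial n j x" for j
  have a: "summable (\<lambda>j. \<bar>a j\<bar>)"
  proof (cases "0 < t")
    case True
    have "\<bar>\<bar>a j\<bar>\<bar> \<le> (1 + 24 / t) * wt 1 j" for j
    proof -
      have "exp (- (freq n j)\<^sup>2 * t) * \<bar>trial n j x\<bar> \<le> exp (- (freq n j)\<^sup>2 * t) * (1 + freq n j)"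
        using abs_trial_le[OF x, of n j] freq_nonneg[of n j] by (intro mult_left_mono) auto
      also have "\<dots> \<le> (1 + 24 / t) * wt 1 j"
        using exp_freq_le[OF True, of n j] by (simp only: mult.commute[of "exp _"])
      finally show ?thesis by (simp add: a_def abs_mult)
    qed
    then show ?thesis by (rule abs_suminf_le(1)[OF _ summable_wt_mult]) simp
  next
    case False
    then have "0 < n" using t by auto
    then show ?thesis by (intro summable_finite[of "{..<n}"]) (auto simp: a_def trial_def)
  qed
  define g where "g j y = a j * (phi j (samp n y) * u0 (samp n y))" for j y
  let ?ind = "\<lambda>y. indicator domO y :: real"
  have ui: "set_integrable lborel domO (\<lambda>y. u0 (samp n y))"
    using integrable_kappa[of n u0] set_integrable_continuous_compact[OF _ u0]
    by (cases "n = 0") (auto simp: samp_def)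
  have pui: "set_integrable lborel domO (\<lambda>y. phi j (samp n y) * u0 (samp n y))" for j
    by (rule set_integrable_mult_bounded[OF ui measurable_phi_samp abs_phi_le]) simp
  have int: "integrable lborel (\<lambda>y. ?ind y *\<^sub>R g j y)" for j
    using set_integrable_mult_right[OF pui, of "a j" j] unfolding g_def set_integrable_def by simp
  have gb: "\<bar>g j y\<bar> \<le> \<bar>a j\<bar> * U" if "y \<in> domO" for j y
  proof -
    have "\<bar>phi j (samp n y)\<bar> * \<bar>u0 (samp n y)\<bar> \<le> 1 * U"
      using U[OF samp_in_domO[OF that]] by (intro mult_mono abs_phi_le) auto
    then show ?thesis unfolding g_def abs_mult by (intro mult_left_mono) auto
  qed
  have as: "AE y in lborel. summable (\<lambda>j. norm (?ind y *\<^sub>R g j y))"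
  proof (intro AE_I2)
    fix y
    show "summable (\<lambda>j. norm (?ind y *\<^sub>R g j y))"
    proof (cases "y \<in> domO")
      case True
      then show ?thesis by (intro abs_suminf_le(1)[OF _ summable_mult2[OF a, of U]]) (use gb in auto)
    qed simp
  qed
  have ns: "summable (\<lambda>j. \<integral>y. norm (?ind y *\<^sub>R g j y) \<partial>lborel)"
  proof (rule abs_suminf_le(1)[OF _ summable_mult2[OF a, of "pi * U"]])
    fix j
    have "\<bar>LBINT y:domO. \<bar>g j y\<bar>\<bar> \<le> (LBINT y:domO. \<bar>a j\<bar> * U)"
      by (rule abs_set_integral_le) (use gb in \<open>auto intro!: set_integrable_continuous_compact\<close>)
    also have "\<dots> = \<bar>a j\<bar> * (pi * U)" by (simp add: set_integral_const domO_def)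
    finally show "\<bar>\<integral>y. norm (?ind y *\<^sub>R g j y) \<partial>lborel\<bar> \<le> \<bar>a j\<bar> * (pi * U)"
      unfolding set_lebesgue_integral_def by (simp add: abs_mult)
  qed
  have gint: "(\<integral>y. ?ind y *\<^sub>R g j y \<partial>lborel) = trial n j x * (exp (- (freq n j)\<^sup>2 * t) * icoef n u0 j)" for j
  proof -
    have "(LBINT y:domO. g j y) = a j * (LBINT y:domO. phi j (samp n y) * u0 (samp n y))"
      unfolding g_def by (rule set_integral_mult_right)
    also have "\<dots> = trial n j x * (exp (- (freq n j)\<^sup>2 * t) * icoef n u0 j)"
      by (auto simp: a_def icoef_def trial_def)
    finally show ?thesis unfolding set_lebesgue_integral_def .
  qed
  have eq: "(\<Sum>j. ?ind y *\<^sub>R g j y) = ?ind y *\<^sub>R (kern n (\<lambda>_. 1) t x y * u0 (samp n y))" for y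
  proof (cases "y \<in> domO")
    case True
    have "summable (\<lambda>j. a j * phi j (samp n y))"
      by (rule abs_suminf_le(1)[OF _ a]) (simp add: abs_mult abs_phi_le mult_left_le)
    from suminf_mult2[OF this, of "u0 (samp n y)"] show ?thesis
      using True by (simp add: g_def kern_def a_def mult.assoc)
  qed simp
  show "(LBINT y:domO. kern n (\<lambda>_. 1) t x y * u0 (samp n y)) = (\<Sum>j. trial n j x * (exp (- (freq n j)\<^sup>2 * t) * icoef n u0 j))"
    using integral_suminf[OF int as ns] unfolding gint eq set_lebesgue_integral_def .
  show "summable (\<lambda>j. trial n j x * (exp (- (freq n j)\<^sup>2 * t) * icoef n u0 j))"
    using summable_integral[OF int as ns] unfolding gint .
qed

lemma mild_eq_kern:
  assumes h: "h \<in> L2_OT T" and f: "continuous_on (domOT T) f" and \<sigma>: "continuous_on UNIV \<sigma>"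
    and u0: "continuous_on domO u0" and x: "x \<in> domO" and t: "t \<le> T" "0 < t \<or> (0 < n \<and> 0 \<le> t)"
  shows "mild n bfun \<sigma> u0 h f t x =
      (LBINT y:domO. kern n (\<lambda>_. 1) t x y * u0 (samp n y))
    + (LBINT s:{0..t}. LBINT y:domO. kern n (\<lambda>j. - freq n j) (t - s) x y * bfun (f (s, samp n y)))
    + (LBINT s:{0..t}. LBINT y:domO. kern n (\<lambda>_. 1) (t - s) x y * (\<sigma> (f (s, samp n y)) * h (s, y)))"
proof -
  have t0: "0 \<le> t" and T0: "0 \<le> T" using t by auto
  obtain B where B: "\<And>z. z \<in> domOT T \<Longrightarrow> \<bar>bfun (f z)\<bar> \<le> B" using compose_bounded[OF f continuous_on_bfun] by blast
  obtain S where S: "\<And>z. z \<in> domOT T \<Longrightarrow> \<bar>\<sigma> (f z)\<bar> \<le> S" using compose_bounded[OF f \<sigma>] by blast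
  have "(0, 0) \<in> domOT T" using T0 by (simp add: domOT_def)
  then have BS: "0 \<le> B" "0 \<le> S" using order.trans[OF abs_ge_zero B] order.trans[OF abs_ge_zero S] by blast+
  let ?w = "\<lambda>z. (fst z, samp n (snd z))"
  let ?p = "\<lambda>z. bfun (f (?w z))" and ?q = "\<lambda>z. \<sigma> (f (?w z)) * h z"
  have sub: "z \<in> domOT T" "?w z \<in> domOT T" if "z \<in> {0..t} \<times> domO" for z
    using slab_subset[OF t(1)] that samp_pair_in_domOT by blast+
  have qi: "set_integrable lborel (domOT T) ?q"
    using source_integrable[OF f continuous_on_const \<sigma> h T0, of n 0 0] by (simp add: source_def[abs_def])
  have pi: "set_integrable lborel (domOT T) ?p"
  proof -
    have i: "set_integrable lborel (domOT T) (\<lambda>_. B)" by (intro set_integrable_continuous_compact) auto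
    show ?thesis
      by (rule set_integrable_bound[OF i measurable_compose_samp[OF f continuous_on_bfun T0]])
        (use B[OF samp_pair_in_domOT] BS in \<open>auto intro!: AE_I2\<close>)
  qed
  have 1: "\<bar>- freq n j * ?p z\<bar> \<le> B * (freq n j + \<bar>h z\<bar>)" if "z \<in> {0..t} \<times> domO" for j z
  proof -
    have "freq n j * \<bar>?p z\<bar> \<le> freq n j * B" using B[OF sub(2)[OF that]] freq_nonneg by (intro mult_left_mono) auto
    moreover have "0 \<le> B * \<bar>h z\<bar>" using BS by simp
    ultimately show ?thesis using freq_nonneg[of n j] by (simp add: abs_mult algebra_simps)
  qed
  have 2: "\<bar>1 * ?q z\<bar> \<le> S * (freq n j + \<bar>h z\<bar>)" if "z \<in> {0..t} \<times> domO" for j z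
  proof -
    have "\<bar>\<sigma> (f (?w z))\<bar> * \<bar>h z\<bar> \<le> S * \<bar>h z\<bar>" using S[OF sub(2)[OF that]] by (intro mult_right_mono) auto
    moreover have "0 \<le> S * freq n j" using BS freq_nonneg by simp
    ultimately show ?thesis by (simp add: abs_mult algebra_simps)
  qed
  note K1 = kern_integral[OF h t0 t(1) x _ pi BS(1) 1] and K2 = kern_integral[OF h t0 t(1) x _ qi BS(2) 2]
  have c1: "\<bar>- freq n j\<bar> \<le> 1 + freq n j" "\<bar>1\<bar> \<le> 1 + freq n j" for j using freq_nonneg[of n j] by auto
  note I = kern_initial[OF u0 x t(2)]
  have eq: "trial n j x * modec n bfun \<sigma> u0 h f j t = trial n j x * (exp (- (freq n j)\<^sup>2 * t) * icoef n u0 j)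
     + trial n j x * mint n (\<lambda>z. - freq n j * ?p z) j t + trial n j x * mint n (\<lambda>z. 1 * ?q z) j t" for j
  proof -
    have "source n bfun \<sigma> h f j = (\<lambda>z. 1 * (- freq n j * ?p z) + 1 * (1 * ?q z))"
      by (auto simp: source_def fun_eq_iff)
    then have "mint n (source n bfun \<sigma> h f j) j t = mint n (\<lambda>z. - freq n j * ?p z) j t + mint n (\<lambda>z. 1 * ?q z) j t"
      using mint_linear[OF set_integrable_mult_right[OF pi, of "- freq n j"] set_integrable_mult_right[OF qi, of 1] t(1), of n 1 1 j]
      by (simp only: mult_1)
    then show ?thesis unfolding modec_def by (simp only: distrib_left add.assoc)
  qed
  have "mild n bfun \<sigma> u0 h f t x = (\<Sum>j. trial n j x * (exp (- (freq n j)\<^sup>2 * t) * icoef n u0 j))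
     + (\<Sum>j. trial n j x * mint n (\<lambda>z. - freq n j * ?p z) j t) + (\<Sum>j. trial n j x * mint n (\<lambda>z. 1 * ?q z) j t)"
    unfolding mild_def eq
    using suminf_add[OF summable_add[OF I(2) K1(2)[OF c1(1)]] K2(2)[OF c1(2)]] suminf_add[OF I(2) K1(2)[OF c1(1)]] by simp
  then show ?thesis unfolding I(1) using K1(1)[OF c1(1)] K2(1)[OF c1(2)] by simp
qed

section \<open>Equivalence of the stated equations with their mode form\<close>

lemma mint_0: "mint n p j 0 = 0"
proof -
  have "AE z in lborel. indicator ({0..0::real} \<times> domO) z *\<^sub>R (exp (- (freq n j)\<^sup>2 * (0 - fst z)) * phi j (samp n (snd z)) * p z) = 0"
    using AE_fst_neq[of 0] by eventually_elim auto
  then show ?thesis unfolding mint_def set_lebesgue_integral_def by (rule integral_eq_zero_AE)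
qed

text \<open>For positive times the kernels are expanded in modes. At time zero the mode form gives
  the cosine series of \<open>u0\<close>, whose pointwise convergence yields the prescribed initial
  condition.\<close>

lemma solves_skeleton_iff_sol:
  assumes h: "h \<in> L2_OT T" and \<sigma>: "continuous_on UNIV \<sigma>" and T: "0 < T" and u0: "continuous_on domO u0"
    and series: "\<And>x. x \<in> domO \<Longrightarrow> (\<Sum>j. phi j x * icoef 0 u0 j) = u0 x"
  shows "solves_skeleton T \<sigma> u0 h f \<longleftrightarrow> sol T 0 bfun \<sigma> u0 h f"
proof (cases "continuous_on (domOT T) f")
  case f: True
  have "mild 0 bfun \<sigma> u0 h f 0 x = u0 x" if "x \<in> domO" for x
    using series[OF that] by (simp add: mild_def modec_def mint_0 trial_def)
  moreover have "mild 0 bfun \<sigma> u0 h f t x = (LBINT z:domO. green t x z * u0 z)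
        + (LBINT s:{0..t}. (LBINT z:domO. lap_green (t - s) x z * bfun (f (s, z))))
        + (LBINT s:{0..t}. (LBINT z:domO. green (t - s) x z * \<sigma> (f (s, z)) * h (s, z)))"
    if "t \<in> {0<..T}" "x \<in> domO" for t x
    using mild_eq_kern[OF h f \<sigma> u0 that(2), of t 0] that
    by (simp add: kern_green kern_lap_green samp_def mult.assoc)
  moreover have "{0..T} = insert 0 {0<..T}" using T by auto
  ultimately show ?thesis using f unfolding solves_skeleton_def sol_def by simp
qed (simp add: solves_skeleton_def sol_def)

lemma solves_skeleton_n_iff_sol:
  assumes h: "h \<in> L2_OT T" and \<sigma>: "continuous_on UNIV \<sigma>" and n: "0 < n" and u0: "continuous_on domO u0"
  shows "solves_skeleton_n n T \<sigma> u0 h f \<longleftrightarrow> sol T n bfun \<sigma> u0 h f"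
proof (cases "continuous_on (domOT T) f")
  case f: True
  have "mild n bfun \<sigma> u0 h f t x = (LBINT y:domO. green_n n t x y * u0 (kappa n y))
        + (LBINT s:{0..t}. (LBINT y:domO. lap_green_n n (t - s) x y * bfun (f (s, kappa n y))))
        + (LBINT s:{0..t}. (LBINT y:domO. green_n n (t - s) x y * \<sigma> (f (s, kappa n y)) * h (s, y)))"
    if "t \<in> {0..T}" "x \<in> domO" for t x
    using mild_eq_kern[OF h f \<sigma> u0 that(2), of t n] that n
    by (simp add: kern_green_n[OF n] kern_lap_green_n[OF n] samp_def mult.assoc)
  then show ?thesis using f unfolding solves_skeleton_n_def sol_def by simp
qed (simp add: solves_skeleton_n_def sol_def)

section \<open>Rate functions and the transfer of controls\<close>

definition level_rate :: "real \<Rightarrow> nat \<Rightarrow> (real \<Rightarrow> real) \<Rightarrow> (real \<Rightarrow> real) \<Rightarrow> real \<Rightarrow> real \<Rightarrow> ereal" where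
  "level_rate T n \<sigma> u0 x y = Inf {ereal (1 / 2 * energy T h) | h. h \<in> L2_OT T \<and> (\<exists>f. sol T n bfun \<sigma> u0 h f \<and> f (T, x) = y)}"

text \<open>Replaces the definite description by an existential statement, so that the choice of
  representative off the domain disappears from the rate functions.\<close>

lemma the_extensional_value:
  assumes P: "\<And>f g. (\<And>z. z \<in> D \<Longrightarrow> f z = g z) \<Longrightarrow> P f \<longleftrightarrow> P g"
    and ex: "\<exists>f. P f" and unique: "\<And>f g z. P f \<Longrightarrow> P g \<Longrightarrow> z \<in> D \<Longrightarrow> f z = g z" and z: "z \<in> D"
  shows "(THE f. f \<in> extensional D \<and> P f) z = y \<longleftrightarrow> (\<exists>f. P f \<and> f z = y)"
proof -
  obtain f where f: "P f" using ex by blast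
  have "P (restrict f D)" using P[of "restrict f D" f] f by simp
  moreover have "g = restrict f D" if "g \<in> extensional D \<and> P g" for g
    using that unique[OF _ f] by (auto simp: restrict_def extensional_def fun_eq_iff)
  ultimately have "(THE f. f \<in> extensional D \<and> P f) = restrict f D" by (intro the_equality) auto
  then have eq: "(THE f. f \<in> extensional D \<and> P f) z = f z" using z by simp
  show ?thesis
    unfolding eq
  proof
    assume "f z = y" then show "\<exists>f. P f \<and> f z = y" by (intro exI[of _ f] conjI f)
  next
    assume "\<exists>f. P f \<and> f z = y"
    then obtain g where g: "P g" "g z = y" by (elim exE conjE)
    show "f z = y" using unique[OF f g(1) z] g(2) by simp
  qed
qed

text \<open>Both inequalities follow the same pattern: take a nearly optimal control of one
  equation, solve the other with it, and correct the small terminal error at small extra energy. For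
  the lower bound the control varies with \<open>n\<close>, which is where uniformity over the
  energy ball is needed.\<close>

lemma level_rate_convergence:
  assumes T: "0 < T" and \<sigma>: "coefficient \<sigma> K L" "\<And>x. \<sigma> x \<noteq> 0" and u0: "initial_datum u0 V" and x: "x \<in> domO"
  shows "(\<lambda>n. level_rate T n \<sigma> u0 x y) \<longlonglongrightarrow> level_rate T 0 \<sigma> u0 x y"
proof (rule order_tendstoI)
  have T0: "0 \<le> T" using T by simp
  have Tx: "(T, x) \<in> domOT T" using T x by (simp add: domOT_def)
  have rate_le: "level_rate T n \<sigma> u0 x y \<le> ereal (1 / 2 * energy T h)"
    if "h \<in> L2_OT T" "sol T n bfun \<sigma> u0 h f" "f (T, x) = y" for n h f
    unfolding level_rate_def by (rule Inf_lower) (use that in blast)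
  {
    fix a assume "level_rate T 0 \<sigma> u0 x y < a"
    then obtain h f where h: "h \<in> L2_OT T" and f: "sol T 0 bfun \<sigma> u0 h f" "f (T, x) = y" and a: "ereal (1 / 2 * energy T h) < a"
      unfolding level_rate_def by (auto simp: Inf_less_iff)
    obtain b where b: "ereal (1 / 2 * energy T h) < ereal b" "ereal b < a" using ereal_dense2[OF a] by blast
    \<comment> \<open>The rate is half the energy, so this increment lifts the cost exactly to
      \<open>b\<close>.\<close>
    define \<epsilon> where "\<epsilon> = 2 * b - energy T h"
    have \<epsilon>: "0 < \<epsilon>" using b by (simp add: \<epsilon>_def)
    from control[OF T \<sigma> u0 energy_nonneg[of T h] \<epsilon> x] obtain \<delta>0 where \<delta>0: "0 < \<delta>0"
      and ctrl: "\<forall>n h' g \<delta>. h' \<in> L2_OT T \<longrightarrow> energy T h' \<le> energy T h \<longrightarrow> sol T n bfun \<sigma> u0 h' g \<longrightarrow> \<bar>\<delta>\<bar> \<le> \<delta>0 \<longrightarrow>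
        (\<exists>k f. k \<in> L2_OT T \<and> energy T k \<le> energy T h' + \<epsilon> \<and> sol T n bfun \<sigma> u0 k f \<and> f (T, x) = g (T, x) + \<delta>)"
      by blast
    from sol_convergence[OF T0 \<sigma>(1) u0 energy_nonneg[of T h] \<delta>0] obtain N where
      N: "\<forall>n\<ge>N. \<forall>h' f g. h' \<in> L2_OT T \<longrightarrow> energy T h' \<le> energy T h \<longrightarrow> sol T 0 bfun \<sigma> u0 h' f \<longrightarrow> sol T n bfun \<sigma> u0 h' g \<longrightarrow>
        (\<forall>z\<in>domOT T. \<bar>g z - f z\<bar> \<le> \<delta>0)" by blast
    have "level_rate T n \<sigma> u0 x y < a" if "N \<le> n" for n
    proof -
      obtain g where g: "sol T n bfun \<sigma> u0 h g" using wellposed(1)[OF T0 \<sigma>(1) u0 h order_refl] by blast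
      have "\<bar>g (T, x) - y\<bar> \<le> \<delta>0" using N[rule_format, OF that h order_refl f(1) g Tx] f(2) by simp
      then have "\<bar>y - g (T, x)\<bar> \<le> \<delta>0" by (simp add: abs_minus_commute)
      from ctrl[rule_format, OF h order_refl g this] obtain k f' where
        k: "k \<in> L2_OT T" "energy T k \<le> energy T h + \<epsilon>" "sol T n bfun \<sigma> u0 k f'" "f' (T, x) = y" by auto
      have "level_rate T n \<sigma> u0 x y \<le> ereal (1 / 2 * energy T k)" by (rule rate_le[OF k(1,3,4)])
      also have "\<dots> \<le> ereal b" using k(2) by (simp add: \<epsilon>_def)
      also have "\<dots> < a" by (rule b)
      finally show ?thesis .
    qed
    then show "\<forall>\<^sub>F n in sequentially. level_rate T n \<sigma> u0 x y < a" unfolding eventually_sequentially by blast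
  next
    fix a assume "a < level_rate T 0 \<sigma> u0 x y"
    then obtain r where r: "a < ereal r" "ereal r < level_rate T 0 \<sigma> u0 x y" using ereal_dense2 by blast
    then obtain b where b: "ereal r < ereal b" "ereal b < level_rate T 0 \<sigma> u0 x y" using ereal_dense2 by blast
    define \<epsilon> where "\<epsilon> = 2 * (b - r)"
    \<comment> \<open>A discrete rate below \<open>r\<close> is witnessed by a control of energy
      below \<open>2 * r\<close>; all these controls lie in one ball, whatever \<open>n\<close>
      is.\<close>
    define M where "M = max 0 (2 * r)"
    have \<epsilon>: "0 < \<epsilon>" and M: "0 \<le> M" using b by (auto simp: \<epsilon>_def M_def)
    from control[OF T \<sigma> u0 M \<epsilon> x] obtain \<delta>0 where \<delta>0: "0 < \<delta>0"
      and ctrl: "\<forall>n h g \<delta>. h \<in> L2_OT T \<longrightarrow> energy T h \<le> M \<longrightarrow> sol T n bfun \<sigma> u0 h g \<longrightarrow> \<bar>\<delta>\<bar> \<le> \<delta>0 \<longrightarrow>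
        (\<exists>k f. k \<in> L2_OT T \<and> energy T k \<le> energy T h + \<epsilon> \<and> sol T n bfun \<sigma> u0 k f \<and> f (T, x) = g (T, x) + \<delta>)"
      by blast
    from sol_convergence[OF T0 \<sigma>(1) u0 M \<delta>0] obtain N where
      N: "\<forall>n\<ge>N. \<forall>h f g. h \<in> L2_OT T \<longrightarrow> energy T h \<le> M \<longrightarrow> sol T 0 bfun \<sigma> u0 h f \<longrightarrow> sol T n bfun \<sigma> u0 h g \<longrightarrow>
        (\<forall>z\<in>domOT T. \<bar>g z - f z\<bar> \<le> \<delta>0)" by blast
    have "a < level_rate T n \<sigma> u0 x y" if "N \<le> n" for n
    proof (rule ccontr)
      assume "\<not> a < level_rate T n \<sigma> u0 x y"
      then have "level_rate T n \<sigma> u0 x y < ereal r" using r(1) by (simp add: not_less order.strict_trans1)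
      then obtain h g where h: "h \<in> L2_OT T" and g: "sol T n bfun \<sigma> u0 h g" "g (T, x) = y" and hr: "1 / 2 * energy T h < r"
        unfolding level_rate_def by (auto simp: Inf_less_iff)
      have hM: "energy T h \<le> M" using hr by (simp add: M_def)
      obtain f where f: "sol T 0 bfun \<sigma> u0 h f" using wellposed(1)[OF T0 \<sigma>(1) u0 h order_refl] by blast
      have "\<bar>y - f (T, x)\<bar> \<le> \<delta>0" using N[rule_format, OF that h hM f g(1) Tx] g(2) by simp
      from ctrl[rule_format, OF h hM f this] obtain k f' where
        k: "k \<in> L2_OT T" "energy T k \<le> energy T h + \<epsilon>" "sol T 0 bfun \<sigma> u0 k f'" "f' (T, x) = y" by auto
      have "level_rate T 0 \<sigma> u0 x y \<le> ereal (1 / 2 * energy T k)" by (rule rate_le[OF k(1,3,4)])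
      also have "\<dots> \<le> ereal b" using k(2) hr by (simp add: \<epsilon>_def)
      finally show False using b(2) by simp
    qed
    then show "\<forall>\<^sub>F n in sequentially. a < level_rate T n \<sigma> u0 x y" unfolding eventually_sequentially by blast
  }
qed

theorem theorem4p14:
  fixes T xbar :: real and \<sigma> u0 :: "real \<Rightarrow> real"
  assumes "0 < T"
    and "bounded (range \<sigma>)"
    and "\<exists>L. L-lipschitz_on UNIV \<sigma>"
    and "\<forall>x. \<sigma> x \<noteq> 0"
    and "Ck_on 3 domO u0"
    and "(u0 has_real_derivative 0) (at 0 within domO)"
    and "(u0 has_real_derivative 0) (at pi within domO)"
    and "xbar \<in> domO"
  shows "\<forall>y::real. (\<lambda>n. rate_n n T \<sigma> u0 xbar y) \<longlonglongrightarrow> rate T \<sigma> u0 xbar y"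
proof
  fix y
  obtain K where K: "\<And>x. \<bar>\<sigma> x\<bar> \<le> K" using assms(2) by (auto simp: bounded_iff)
  obtain L where L: "L-lipschitz_on UNIV \<sigma>" using assms(3) by blast
  have \<sigma>: "coefficient \<sigma> K L"
    using K lipschitz_onD[OF L] lipschitz_on_nonneg[OF L] by (auto simp: coefficient_def dist_real_def)
  note \<sigma>c = coefficient_continuous[OF \<sigma>]
  have T0: "0 \<le> T" using assms(1) by simp
  note datum = datum_of_hypotheses[OF assms(5-7)]
  obtain V where V: "initial_datum u0 V" using datum(1) by blast
  then have d: "decaying u0 V" by (simp add: initial_datum_def)
  have Tx: "(T, xbar) \<in> domOT T" using assms by (simp add: domOT_def)
  have attained: "(THE f. f \<in> extensional (domOT T) \<and> sol T n bfun \<sigma> u0 h f) (T, xbar) = y \<longleftrightarrow> (\<exists>f. sol T n bfun \<sigma> u0 h f \<and> f (T, xbar) = y)"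
    if h: "h \<in> L2_OT T" for n h
  proof (rule the_extensional_value[where P = "sol T n bfun \<sigma> u0 h" and D = "domOT T"])
    fix f g :: "real \<times> real \<Rightarrow> real" assume "\<And>z. z \<in> domOT T \<Longrightarrow> f z = g z"
    then show "sol T n bfun \<sigma> u0 h f \<longleftrightarrow> sol T n bfun \<sigma> u0 h g" by (intro sol_cong) auto
  next
    show "\<exists>f. sol T n bfun \<sigma> u0 h f" by (rule wellposed(1)[OF T0 \<sigma> V h order_refl])
  next
    fix f g z assume "sol T n bfun \<sigma> u0 h f" "sol T n bfun \<sigma> u0 h g" "z \<in> domOT T"
    then show "f z = g z" by (rule sol_unique[OF T0 \<sigma> d h])
  qed (rule Tx)
  have "rate T \<sigma> u0 xbar y = level_rate T 0 \<sigma> u0 xbar y"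
    unfolding rate_def level_rate_def L2_norm_OT_power2 Upsilon_def
    using attained[of _ 0] solves_skeleton_iff_sol[OF _ \<sigma>c assms(1) datum(3) datum(2)]
    by (intro arg_cong[where f = Inf] Collect_cong ex_cong1 conj_cong refl) (simp cong: conj_cong)
  moreover have "rate_n n T \<sigma> u0 xbar y = level_rate T n \<sigma> u0 xbar y" if n: "0 < n" for n
    unfolding rate_n_def level_rate_def L2_norm_OT_power2 Upsilon_n_def
    using attained[of _ n] solves_skeleton_n_iff_sol[OF _ \<sigma>c n datum(3)]
    by (intro arg_cong[where f = Inf] Collect_cong ex_cong1 conj_cong refl) (simp cong: conj_cong)
  \<comment> \<open>Only eventual equality can be claimed: index \<open>0\<close> of
    \<open>level_rate\<close> denotes the continuum equation.\<close>
  then have "\<forall>\<^sub>F n in sequentially. level_rate T n \<sigma> u0 xbar y = rate_n n T \<sigma> u0 xbar y"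
    by (auto intro!: eventually_mono[OF eventually_gt_at_top[of 0]])
  ultimately show "(\<lambda>n. rate_n n T \<sigma> u0 xbar y) \<longlonglongrightarrow> rate T \<sigma> u0 xbar y"
    using Lim_transform_eventually[OF level_rate_convergence[OF assms(1) \<sigma> _ V assms(8)]] assms(4) by simp
qed

end
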